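(* Let $X$ be a Riemann surface, $\mathcal{E}$ a holomorphic vector bundle of rank $r$ on $X$ with trivialized determinant, $\varphi$ a trace-zero Higgs field on $\mathcal{E}$ with reduced spectral curve and multivalued form $\phi=(\phi_1,\dots,\phi_r)$, $\nabla_0$ a connection on $\mathcal{E}$ with trivial determinant, and consider the complex WKB problem $\nabla_t=\nabla_0+t\varphi$, $t\to\infty$. Let $\omega$ be an ultrafilter and $h_\omega:\widetilde X\to\mathrm{Cone}_\omega$ the limiting map. If $\gamma:[0,1]\to\widetilde X^{*}$ is any noncritical path, numbered so that $\gamma^*\mathrm{Re}\,\phi_1>\dots>\gamma^*\mathrm{Re}\,\phi_r$, then $h_\omega\circ\gamma$ maps $[0,1]$ into a single apartment of $\mathrm{Cone}_\omega$, and the vector distance which determines the location in this apartment is given by the integrals $$\vec d_{\mathrm{Cone}_\omega}\big(h_\omega(\gamma(0)),h_\omega(\gamma(1))\big)=(\alpha_1,\dots,\alpha_r),\qquad \alpha_i=\int_0^1\gamma^*\mathrm{Re}\,\phi_i .$$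
   Context: $\phi_1,\dots,\phi_r$ are the locally defined eigen-$1$-forms of $\varphi$; $\widetilde X^*$ is the preimage in the universal cover $\widetilde X$ of the complement of the branch points of the spectral curve. A path $\gamma$ is noncritical if the real forms $\gamma^*\mathrm{Re}\,\phi_i$ are pairwise distinct at every point of $[0,1]$. Fix a Hermitian metric $h$ on $\mathcal{E}$ inducing the standard metric on the determinant and a base point $x_0\in\widetilde X$. $SL_r(\mathbb{C})/SU_r$ is identified with the space $\mathrm{Met}$ of Hermitian metrics on $\mathcal{E}_{x_0}$ inducing the standard metric on the determinant; $h_t(Q)\in\mathrm{Met}$ is the pullback of $h_Q$ by the transport $T_{x_0Q}(t):\mathcal{E}_{x_0}\to\mathcal{E}_Q$ of $\nabla_t$ (sign convention: transported sections satisfy $\nabla_0s=t\varphi s$). $\omega$ is a non-principal ultrafilter on the set of parameters $t$ (with countable support) converging to infinity, i.e. containing $(T,\infty)$ for every $T$. $\mathrm{Cone}_\omega$ is the asymptotic cone of the symmetric space $\mathrm{Met}$ with its metric $d$, base point $h_{x_0}$ and scale factors $t$: the set of families $(y_t)$ with $\frac1td(y_t,h_{x_0})$ bounded, with distance $\lim_\omega\frac1td(y_t,z_t)$, modulo distance zero. By Kleiner–Leeb it is an affine building with apartments modelled on $\mathbb{A}=\{x\in\mathbb{R}^r:\sum x_i=0\}$, $W=S_r$, $W_{\mathrm{aff}}=W\ltimes\mathbb{A}$; apartments arise as limits of maximal flats. $h_\omega(Q)$ is the class of $(h_t(Q))_t$. The vector distance between two points $a,b$ of a building is $b-a\in\mathbb{A}$,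 computed in any apartment containing both, with coordinates rearranged in decreasing order. In $\mathrm{Cone}_\omega$ it equals $\lim_\omega\frac1t\vec d(y_t,z_t)$, where on $\mathrm{Met}$, $\vec d(h,k)$ is the decreasingly ordered vector of $a_i$ with $\|e_i\|_k=e^{a_i}\|e_i\|_h$ for a basis $(e_i)$ orthogonal for both $h$ and $k$. *)

theory Defs
  imports "HOL-Analysis.Analysis"
begin

section \<open>Riemann surfaces\<close>

text \<open>A chart is a pair \<open>(U, z)\<close>: a domain and a coordinate, which is only meaningful on \<open>U\<close>.\<close>

type_synonym 'x chart = "'x set \<times> ('x \<Rightarrow> complex)"

definition holo_fun :: "'x chart set \<Rightarrow> 'x set \<Rightarrow> ('x \<Rightarrow> complex) \<Rightarrow> bool" where
  "holo_fun C W f \<longleftrightarrow> (\<forall>(U, z)\<in>C. (f \<circ> inv_into U z) holomorphic_on z ` (U \<inter> W))"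

definition riemann_surface :: "('x::t2_space) chart set \<Rightarrow> bool" where
  "riemann_surface C \<longleftrightarrow>
     connected (UNIV :: 'x set) \<and> \<Union> (fst ` C) = UNIV \<and>
     (\<forall>(U, z)\<in>C. open U \<and> open (z ` U) \<and> (\<exists>q. homeomorphism U (z ` U) z q)) \<and>
     (\<forall>(U, z)\<in>C. holo_fun C U z)"

text \<open>\<open>cderiv (U, z) f x\<close> is $\partial f/\partial z$ at \<open>x\<close>.\<close>

definition cderiv :: "'x chart \<Rightarrow> ('x \<Rightarrow> complex) \<Rightarrow> 'x \<Rightarrow> complex" where
  "cderiv c f x = deriv (f \<circ> inv_into (fst c) (snd c)) (snd c x)"

text \<open>A 1-form is given by its coefficient \<open>\<alpha> (U, z)\<close> with respect to $dz$ in every chart.\<close>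

definition holo_form :: "'x chart set \<Rightarrow> 'x set \<Rightarrow> ('x chart \<Rightarrow> 'x \<Rightarrow> complex) \<Rightarrow> bool" where
  "holo_form C W \<alpha> \<longleftrightarrow>
     (\<forall>c\<in>C. holo_fun C (W \<inter> fst c) (\<alpha> c)) \<and>
     (\<forall>c\<in>C. \<forall>c'\<in>C. \<forall>x\<in>W \<inter> fst c \<inter> fst c'. \<alpha> c' x = cderiv c' (snd c) x * \<alpha> c x)"

definition universal_cover :: "('u::topological_space \<Rightarrow> 'x::topological_space) \<Rightarrow> bool" where
  "universal_cover p \<longleftrightarrow> covering_space UNIV p UNIV \<and> simply_connected (UNIV :: 'u set)"

section \<open>Holomorphic vector bundles with trivialized determinant\<close>

text \<open>The type \<open>'e\<close> is the total space. A local trivialization \<open>(V, \<psi>)\<close> restricts to a bijection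
  from each fibre over \<open>V\<close> onto $\mathbb{C}^r$; the linear structure of the fibres is the one
  transported along these bijections. The isomorphism $\det\mathcal{E}\cong\mathcal{O}$ is given by
  its value \<open>vol e\<close> on $e_1\wedge\dots\wedge e_r$.\<close>

type_synonym ('x, 'e, 'r) triv = "'x set \<times> ('e \<Rightarrow> complex ^ 'r)"

record ('x, 'e, 'r::finite) vbundle =
  charts :: "'x chart set"
  proj :: "'e \<Rightarrow> 'x"
  trivs :: "('x, 'e, 'r) triv set"
  vol :: "('r \<Rightarrow> 'e) \<Rightarrow> complex"

definition fibre :: "('x, 'e, 'r::finite) vbundle \<Rightarrow> 'x \<Rightarrow> 'e set" where
  "fibre E x = {e. proj E e = x}"

definition trans_fun ::
  "('x, 'e, 'r::finite) vbundle \<Rightarrow> ('x, 'e, 'r) triv \<Rightarrow> ('x, 'e, 'r) triv \<Rightarrow> 'x \<Rightarrow> complex ^ 'r ^ 'r" where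
  "trans_fun E \<tau> \<tau>' x = matrix (\<lambda>v. snd \<tau>' (inv_into (fibre E x) (snd \<tau>) v))"

definition frame ::
  "('x, 'e, 'r::finite) vbundle \<Rightarrow> ('x, 'e, 'r) triv \<Rightarrow> 'x \<Rightarrow> 'r \<Rightarrow> 'e" where
  "frame E \<tau> x i = inv_into (fibre E x) (snd \<tau>) (axis i 1)"

definition holomorphic_bundle :: "('x::t2_space, 'e, 'r::finite) vbundle \<Rightarrow> bool" where
  "holomorphic_bundle E \<longleftrightarrow>
     riemann_surface (charts E) \<and>
     \<Union> (fst ` trivs E) = UNIV \<and>
     (\<forall>(V, \<psi>)\<in>trivs E. open V \<and> (\<forall>x\<in>V. bij_betw \<psi> (fibre E x) UNIV)) \<and>
     (\<forall>\<tau>\<in>trivs E. \<forall>\<tau>'\<in>trivs E.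
        (\<forall>x\<in>fst \<tau> \<inter> fst \<tau>'. \<forall>e\<in>fibre E x. snd \<tau>' e = trans_fun E \<tau> \<tau>' x *v snd \<tau> e) \<and>
        (\<forall>i j. holo_fun (charts E) (fst \<tau> \<inter> fst \<tau>') (\<lambda>x. trans_fun E \<tau> \<tau>' x $ i $ j)))"

definition det_trivialized :: "('x::t2_space, 'e, 'r::finite) vbundle \<Rightarrow> bool" where
  "det_trivialized E \<longleftrightarrow>
     (\<forall>(V, \<psi>)\<in>trivs E. \<exists>\<delta>. holo_fun (charts E) V \<delta> \<and>
        (\<forall>x\<in>V. \<delta> x \<noteq> 0 \<and>
           (\<forall>e. range e \<subseteq> fibre E x \<longrightarrow> vol E e = \<delta> x * det (\<chi> i j. \<psi> (e j) $ i))))"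

section \<open>Higgs fields, spectral curves, connections\<close>

text \<open>In the chart \<open>c = (U, z)\<close> and the trivialization \<open>\<tau>\<close>, the Higgs field is
  \<open>\<Phi> c \<tau>\<close>$\,dz$ and the connection $\nabla_0$ is $d + {}$\<open>B c \<tau>\<close>$\,dz$.\<close>

type_synonym ('x, 'e, 'r) local_form =
  "'x chart \<Rightarrow> ('x, 'e, 'r) triv \<Rightarrow> 'x \<Rightarrow> complex ^ 'r ^ 'r"

definition holo_coeffs :: "('x, 'e, 'r::finite) vbundle \<Rightarrow> ('x, 'e, 'r) local_form \<Rightarrow> bool" where
  "holo_coeffs E A \<longleftrightarrow>
     (\<forall>c\<in>charts E. \<forall>\<tau>\<in>trivs E. \<forall>i j.
        holo_fun (charts E) (fst c \<inter> fst \<tau>) (\<lambda>x. A c \<tau> x $ i $ j))"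

definition higgs_field :: "('x, 'e, 'r::finite) vbundle \<Rightarrow> ('x, 'e, 'r) local_form \<Rightarrow> bool" where
  "higgs_field E \<Phi> \<longleftrightarrow> holo_coeffs E \<Phi> \<and>
     (\<forall>c\<in>charts E. \<forall>c'\<in>charts E. \<forall>\<tau>\<in>trivs E. \<forall>\<tau>'\<in>trivs E.
        \<forall>x\<in>fst c \<inter> fst c' \<inter> fst \<tau> \<inter> fst \<tau>'. \<forall>i j.
          (\<Phi> c' \<tau>' x ** trans_fun E \<tau> \<tau>' x) $ i $ j
            = cderiv c' (snd c) x * (trans_fun E \<tau> \<tau>' x ** \<Phi> c \<tau> x) $ i $ j)"

definition trace_zero :: "('x, 'e, 'r::finite) vbundle \<Rightarrow> ('x, 'e, 'r) local_form \<Rightarrow> bool" where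
  "trace_zero E \<Phi> \<longleftrightarrow>
     (\<forall>c\<in>charts E. \<forall>\<tau>\<in>trivs E. \<forall>x\<in>fst c \<inter> fst \<tau>. trace (\<Phi> c \<tau> x) = 0)"

text \<open>The gauge transformation law
  $B' = (g B g^{-1} - (\partial_z g)\, g^{-1})\, dz/dz'$, multiplied by $g$ on the right.\<close>

definition holo_connection :: "('x, 'e, 'r::finite) vbundle \<Rightarrow> ('x, 'e, 'r) local_form \<Rightarrow> bool" where
  "holo_connection E B \<longleftrightarrow> holo_coeffs E B \<and>
     (\<forall>c\<in>charts E. \<forall>c'\<in>charts E. \<forall>\<tau>\<in>trivs E. \<forall>\<tau>'\<in>trivs E.
        \<forall>x\<in>fst c \<inter> fst c' \<inter> fst \<tau> \<inter> fst \<tau>'. \<forall>i j.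
          (B c' \<tau>' x ** trans_fun E \<tau> \<tau>' x) $ i $ j
            = cderiv c' (snd c) x *
              ((trans_fun E \<tau> \<tau>' x ** B c \<tau> x) $ i $ j
                - cderiv c (\<lambda>y. trans_fun E \<tau> \<tau>' y $ i $ j) x))"

text \<open>The induced connection on $\det\mathcal{E}$ sends $f_1\wedge\dots\wedge f_r$ (for the frame $f$
  of \<open>\<tau>\<close>) to $\mathrm{tr}(B)\,dz\otimes f_1\wedge\dots\wedge f_r$; \<open>vol\<close> has to carry it to $d$.\<close>

definition trivial_det_connection ::
  "('x, 'e, 'r::finite) vbundle \<Rightarrow> ('x, 'e, 'r) local_form \<Rightarrow> bool" where
  "trivial_det_connection E B \<longleftrightarrow>
     (\<forall>c\<in>charts E. \<forall>\<tau>\<in>trivs E. \<forall>x\<in>fst c \<inter> fst \<tau>.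
        cderiv c (\<lambda>y. vol E (frame E \<tau> y)) x = trace (B c \<tau> x) * vol E (frame E \<tau> x))"

definition charpoly_fun :: "complex ^ 'r ^ 'r::finite \<Rightarrow> complex \<Rightarrow> complex" where
  "charpoly_fun A l = det (mat l - A)"

definition holo2 :: "(complex \<times> complex) set \<Rightarrow> (complex \<times> complex \<Rightarrow> complex) \<Rightarrow> bool" where
  "holo2 W f \<longleftrightarrow> open W \<and>
     (\<forall>q\<in>W. \<exists>D1 D2. (f has_derivative (\<lambda>v. D1 * fst v + D2 * snd v)) (at q))"

text \<open>In the coordinates $(w, \lambda)$ of $T^*U$ given by a chart, the spectral curve is the analytic
  space cut out by \<open>spectral_eq\<close>; it is reduced if its local rings $\mathcal{O}_q/(P)$ have no
  nilpotents.\<close>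

definition spectral_eq ::
  "('x, 'e, 'r::finite) local_form \<Rightarrow> 'x chart \<Rightarrow> ('x, 'e, 'r) triv \<Rightarrow> complex \<times> complex \<Rightarrow> complex" where
  "spectral_eq \<Phi> c \<tau> q = charpoly_fun (\<Phi> c \<tau> (inv_into (fst c) (snd c) (fst q))) (snd q)"

definition in_ideal_at ::
  "complex \<times> complex \<Rightarrow> (complex \<times> complex \<Rightarrow> complex) \<Rightarrow> (complex \<times> complex \<Rightarrow> complex) \<Rightarrow> bool" where
  "in_ideal_at q P f \<longleftrightarrow> (\<exists>W g. q \<in> W \<and> holo2 W g \<and> (\<forall>y\<in>W. f y = P y * g y))"

definition reduced_spectral_curve ::
  "('x, 'e, 'r::finite) vbundle \<Rightarrow> ('x, 'e, 'r) local_form \<Rightarrow> bool" where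
  "reduced_spectral_curve E \<Phi> \<longleftrightarrow>
     (\<forall>c\<in>charts E. \<forall>\<tau>\<in>trivs E. \<forall>x\<in>fst c \<inter> fst \<tau>. \<forall>l. \<forall>W f n.
        (snd c x, l) \<in> W \<and> holo2 W f \<and>
        in_ideal_at (snd c x, l) (spectral_eq \<Phi> c \<tau>) (\<lambda>y. f y ^ n)
          \<longrightarrow> in_ideal_at (snd c x, l) (spectral_eq \<Phi> c \<tau>) f)"

text \<open>Branch points: the points over which the spectral curve has fewer than $r$ points.\<close>

definition branch_points ::
  "('x, 'e, 'r::finite) vbundle \<Rightarrow> ('x, 'e, 'r) local_form \<Rightarrow> 'x set" where
  "branch_points E \<Phi> =
     {x. \<exists>c\<in>charts E. \<exists>\<tau>\<in>trivs E. x \<in> fst c \<inter> fst \<tau> \<and>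
           card {l. charpoly_fun (\<Phi> c \<tau> x) l = 0} < CARD('r)}"

definition cover_star ::
  "('x, 'e, 'r::finite) vbundle \<Rightarrow> ('x, 'e, 'r) local_form \<Rightarrow> ('u \<Rightarrow> 'x) \<Rightarrow> 'u set" where
  "cover_star E \<Phi> p = p -` (- branch_points E \<Phi>)"

definition eigenforms ::
  "('x, 'e, 'r::finite) vbundle \<Rightarrow> ('x, 'e, 'r) local_form \<Rightarrow> 'x set \<Rightarrow>
   ('r \<Rightarrow> 'x chart \<Rightarrow> 'x \<Rightarrow> complex) \<Rightarrow> bool" where
  "eigenforms E \<Phi> W \<phi> \<longleftrightarrow>
     (\<forall>i. holo_form (charts E) W (\<phi> i)) \<and>
     (\<forall>c\<in>charts E. \<forall>\<tau>\<in>trivs E. \<forall>x\<in>W \<inter> fst c \<inter> fst \<tau>.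
        \<forall>l. charpoly_fun (\<Phi> c \<tau> x) l = (\<Prod>i\<in>UNIV. l - \<phi> i c x))"

section \<open>Noncritical paths\<close>

definition velocity :: "'x chart \<Rightarrow> (real \<Rightarrow> 'x) \<Rightarrow> real \<Rightarrow> complex" where
  "velocity c \<eta> s = vector_derivative (\<lambda>s. snd c (\<eta> s)) (at s within {0..1})"

text \<open>A $C^1$ path in the cover: \<open>p\<close> is a local isomorphism, so it suffices to look in the
  coordinates of the charts of \<open>X\<close>.\<close>

definition C1_path ::
  "'x chart set \<Rightarrow> ('u::topological_space \<Rightarrow> 'x) \<Rightarrow> (real \<Rightarrow> 'u) \<Rightarrow> bool" where
  "C1_path C p \<gamma> \<longleftrightarrow> path \<gamma> \<and>
     (\<forall>c\<in>C. let S = {s\<in>{0..1}. p (\<gamma> s) \<in> fst c} in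
        (\<forall>s\<in>S. (\<lambda>s. snd c (p (\<gamma> s))) differentiable (at s within {0..1})) \<and>
        continuous_on S (velocity c (p \<circ> \<gamma>)))"

text \<open>\<open>a i\<close> is the coefficient of $\gamma^*\phi_i$: near every parameter there are local
  eigenforms $\phi_i$ on \<open>X\<close> with $\gamma^*\phi_i = {}$\<open>a i\<close>$\,ds$.\<close>

definition pullback_eigenforms ::
  "('x::topological_space, 'e, 'r::finite) vbundle \<Rightarrow> ('x, 'e, 'r) local_form \<Rightarrow> ('u \<Rightarrow> 'x) \<Rightarrow>
   (real \<Rightarrow> 'u) \<Rightarrow> ('r \<Rightarrow> real \<Rightarrow> complex) \<Rightarrow> bool" where
  "pullback_eigenforms E \<Phi> p \<gamma> a \<longleftrightarrow>
     (\<forall>s0\<in>{0..1}. \<exists>W \<phi> d. open W \<and> p (\<gamma> s0) \<in> W \<and> eigenforms E \<Phi> W \<phi> \<and> d > 0 \<and>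
        (\<forall>s\<in>{0..1}. \<bar>s - s0\<bar> < d \<longrightarrow> p (\<gamma> s) \<in> W \<and>
           (\<forall>c\<in>charts E. p (\<gamma> s) \<in> fst c \<longrightarrow>
              (\<forall>i. a i s = \<phi> i c (p (\<gamma> s)) * velocity c (p \<circ> \<gamma>) s))))"

definition noncritical :: "('r \<Rightarrow> real \<Rightarrow> complex) \<Rightarrow> bool" where
  "noncritical a \<longleftrightarrow> (\<forall>s\<in>{0..1}. \<forall>i j. i \<noteq> j \<longrightarrow> Re (a i s) \<noteq> Re (a j s))"

section \<open>Hermitian metrics\<close>

definition sesq :: "complex ^ 'r ^ 'r::finite \<Rightarrow> complex ^ 'r \<Rightarrow> complex ^ 'r \<Rightarrow> complex" where
  "sesq H v w = (\<Sum>i\<in>UNIV. \<Sum>j\<in>UNIV. H $ i $ j * v $ i * cnj (w $ j))"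

definition herm_inner_on :: "('x, 'e, 'r::finite) vbundle \<Rightarrow> 'x \<Rightarrow> ('e \<Rightarrow> 'e \<Rightarrow> complex) \<Rightarrow> bool" where
  "herm_inner_on E x k \<longleftrightarrow>
     (\<forall>(V, \<psi>)\<in>trivs E. x \<in> V \<longrightarrow>
        (\<exists>H. (\<forall>i j. H $ j $ i = cnj (H $ i $ j)) \<and> (\<forall>v. v \<noteq> 0 \<longrightarrow> Re (sesq H v v) > 0) \<and>
             (\<forall>e\<in>fibre E x. \<forall>e'\<in>fibre E x. k e e' = sesq H (\<psi> e) (\<psi> e'))))"

text \<open>The metric induced on $\det\mathcal{E}_x$, whose value on $e_1\wedge\dots\wedge e_r$ is the Gram
  determinant, is the standard metric of $\mathbb{C}$.\<close>

definition standard_det_on :: "('x, 'e, 'r::finite) vbundle \<Rightarrow> 'x \<Rightarrow> ('e \<Rightarrow> 'e \<Rightarrow> complex) \<Rightarrow> bool" where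
  "standard_det_on E x k \<longleftrightarrow>
     (\<forall>e. range e \<subseteq> fibre E x \<longrightarrow>
        det (\<chi> i j. k (e i) (e j)) = of_real ((cmod (vol E e))\<^sup>2))"

primrec C_k :: "nat \<Rightarrow> complex set \<Rightarrow> (complex \<Rightarrow> complex) \<Rightarrow> bool" where
  "C_k 0 W f \<longleftrightarrow> continuous_on W f"
| "C_k (Suc k) W f \<longleftrightarrow>
     (\<exists>fx fy. (\<forall>w\<in>W. (f has_derivative (\<lambda>v. Re v *\<^sub>R fx w + Im v *\<^sub>R fy w)) (at w)) \<and>
              C_k k W fx \<and> C_k k W fy)"

definition hermitian_metric :: "('x, 'e, 'r::finite) vbundle \<Rightarrow> ('e \<Rightarrow> 'e \<Rightarrow> complex) \<Rightarrow> bool" where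
  "hermitian_metric E h \<longleftrightarrow>
     (\<forall>x. herm_inner_on E x h) \<and>
     (\<forall>(U, z)\<in>charts E. \<forall>\<tau>\<in>trivs E. \<forall>i j k.
        C_k k (z ` (U \<inter> fst \<tau>))
          ((\<lambda>x. h (frame E \<tau> x i) (frame E \<tau> x j)) \<circ> inv_into U z))"

definition restrict_form :: "'e set \<Rightarrow> ('e \<Rightarrow> 'e \<Rightarrow> complex) \<Rightarrow> 'e \<Rightarrow> 'e \<Rightarrow> complex" where
  "restrict_form F k e e' = (if e \<in> F \<and> e' \<in> F then k e e' else 0)"

text \<open>Elements of \<open>Met E x\<close> are made to vanish off the fibre, so that equality of metrics is
  equality of functions.\<close>

definition Met :: "('x, 'e, 'r::finite) vbundle \<Rightarrow> 'x \<Rightarrow> ('e \<Rightarrow> 'e \<Rightarrow> complex) set" where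
  "Met E x = {k. herm_inner_on E x k \<and> standard_det_on E x k \<and> restrict_form (fibre E x) k = k}"

definition decreasing :: "real ^ 'r::{finite,linorder} \<Rightarrow> bool" where
  "decreasing a \<longleftrightarrow> (\<forall>i j. i \<le> j \<longrightarrow> a $ j \<le> a $ i)"

definition sort_desc :: "real ^ 'r::{finite,linorder} \<Rightarrow> real ^ 'r::{finite,linorder}" where
  "sort_desc v = (THE w. decreasing w \<and> (\<exists>\<sigma>. bij \<sigma> \<and> w = (\<chi> i. v $ \<sigma> i)))"

definition fibre_basis :: "('x, 'e, 'r::finite) vbundle \<Rightarrow> 'x \<Rightarrow> ('r \<Rightarrow> 'e) \<Rightarrow> bool" where
  "fibre_basis E x e \<longleftrightarrow> range e \<subseteq> fibre E x \<and>
     (\<forall>(V, \<psi>)\<in>trivs E. x \<in> V \<longrightarrow> vec.span (range (\<lambda>i. \<psi> (e i))) = UNIV)"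

definition form_norm :: "('e \<Rightarrow> 'e \<Rightarrow> complex) \<Rightarrow> 'e \<Rightarrow> real" where
  "form_norm k e = sqrt (Re (k e e))"

definition met_vdist ::
  "('x, 'e, 'r::{finite,linorder}) vbundle \<Rightarrow> 'x \<Rightarrow> ('e \<Rightarrow> 'e \<Rightarrow> complex) \<Rightarrow> ('e \<Rightarrow> 'e \<Rightarrow> complex) \<Rightarrow>
   real ^ 'r::{finite,linorder}" where
  "met_vdist E x h k = (THE a. decreasing a \<and>
     (\<exists>e. fibre_basis E x e \<and> (\<forall>i j. i \<noteq> j \<longrightarrow> h (e i) (e j) = 0 \<and> k (e i) (e j) = 0) \<and>
          (\<forall>i. form_norm k (e i) = exp (a $ i) * form_norm h (e i))))"

text \<open>The distance of the symmetric space, normalized by the standard Euclidean metric on its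
  flats.\<close>

definition met_dist ::
  "('x, 'e, 'r::{finite,linorder}) vbundle \<Rightarrow> 'x \<Rightarrow> ('e \<Rightarrow> 'e \<Rightarrow> complex) \<Rightarrow> ('e \<Rightarrow> 'e \<Rightarrow> complex) \<Rightarrow> real"
  where "met_dist E x h k = norm (met_vdist E x h k)"

section \<open>The asymptotic cone\<close>

definition cone_ultrafilter :: "real filter \<Rightarrow> bool" where
  "cone_ultrafilter \<omega> \<longleftrightarrow> \<omega> \<noteq> bot \<and>
     (\<forall>P. eventually P \<omega> \<or> eventually (\<lambda>t. \<not> P t) \<omega>) \<and>
     (\<forall>t0. \<not> eventually (\<lambda>t. t = t0) \<omega>) \<and>
     (\<forall>T. eventually (\<lambda>t. t \<in> {T<..}) \<omega>) \<and>
     (\<exists>S. countable S \<and> eventually (\<lambda>t. t \<in> S) \<omega>)"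

text \<open>Boundedness is imposed for \<open>\<omega>\<close>-almost all $t$: only these matter in the limit, and the quotient
  $d(h_t(Q), h_{x_0})/t$ is in general unbounded as $t\to 0$.\<close>

definition cone_families ::
  "('x, 'e, 'r::{finite,linorder}) vbundle \<Rightarrow> 'x \<Rightarrow> ('e \<Rightarrow> 'e \<Rightarrow> complex) \<Rightarrow> real filter \<Rightarrow>
   (real \<Rightarrow> 'e \<Rightarrow> 'e \<Rightarrow> complex) set" where
  "cone_families E x h \<omega> =
     {y. (\<forall>t. y t \<in> Met E x) \<and>
         (\<exists>C. eventually (\<lambda>t. met_dist E x (y t) (restrict_form (fibre E x) h) / t \<le> C) \<omega>)}"

definition cone_class ::
  "('x, 'e, 'r::{finite,linorder}) vbundle \<Rightarrow> 'x \<Rightarrow> ('e \<Rightarrow> 'e \<Rightarrow> complex) \<Rightarrow> real filter \<Rightarrow>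
   (real \<Rightarrow> 'e \<Rightarrow> 'e \<Rightarrow> complex) \<Rightarrow> (real \<Rightarrow> 'e \<Rightarrow> 'e \<Rightarrow> complex) set" where
  "cone_class E x h \<omega> y =
     {z \<in> cone_families E x h \<omega>. ((\<lambda>t. met_dist E x (y t) (z t) / t) \<longlongrightarrow> 0) \<omega>}"

text \<open>The maximal flats of \<open>Met\<close> are the sets of metrics for which a given basis is orthogonal.
  For a basis \<open>e\<close> of unit volume, \<open>flat_chart E x e\<close> parametrizes such a flat by the model space.\<close>

definition model_apartment :: "(real ^ 'r::finite) set" where
  "model_apartment = {v. (\<Sum>i\<in>UNIV. v $ i) = 0}"

definition unimodular_basis :: "('x, 'e, 'r::finite) vbundle \<Rightarrow> 'x \<Rightarrow> ('r \<Rightarrow> 'e) \<Rightarrow> bool" where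
  "unimodular_basis E x e \<longleftrightarrow> fibre_basis E x e \<and> cmod (vol E e) = 1"

definition flat_chart ::
  "('x, 'e, 'r::finite) vbundle \<Rightarrow> 'x \<Rightarrow> ('r \<Rightarrow> 'e) \<Rightarrow> real ^ 'r \<Rightarrow> 'e \<Rightarrow> 'e \<Rightarrow> complex" where
  "flat_chart E x e v = (THE k. k \<in> Met E x \<and>
     (\<forall>i j. k (e i) (e j) = (if i = j then of_real (exp (2 * v $ i)) else 0)))"

text \<open>Charts of apartments are the limits, rescaled by $t$, of charts of maximal flats whose origins
  stay at rescaled bounded distance from the base point.\<close>

definition apartment_chart ::
  "('x, 'e, 'r::{finite,linorder}) vbundle \<Rightarrow> 'x \<Rightarrow> ('e \<Rightarrow> 'e \<Rightarrow> complex) \<Rightarrow> real filter \<Rightarrow>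
   (real ^ 'r::{finite,linorder} \<Rightarrow> (real \<Rightarrow> 'e \<Rightarrow> 'e \<Rightarrow> complex) set) \<Rightarrow> bool" where
  "apartment_chart E x h \<omega> f \<longleftrightarrow>
     (\<exists>e. (\<forall>t. unimodular_basis E x (e t)) \<and>
          (\<lambda>t. flat_chart E x (e t) 0) \<in> cone_families E x h \<omega> \<and>
          f = (\<lambda>v. cone_class E x h \<omega> (\<lambda>t. flat_chart E x (e t) (t *\<^sub>R v))))"

definition apartments ::
  "('x, 'e, 'r::{finite,linorder}) vbundle \<Rightarrow> 'x \<Rightarrow> ('e \<Rightarrow> 'e \<Rightarrow> complex) \<Rightarrow> real filter \<Rightarrow>
   (real \<Rightarrow> 'e \<Rightarrow> 'e \<Rightarrow> complex) set set set" where
  "apartments E x h \<omega> = {f ` model_apartment | f. apartment_chart E x h \<omega> f}"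

definition cone_vdist ::
  "('x, 'e, 'r::{finite,linorder}) vbundle \<Rightarrow> 'x \<Rightarrow> ('e \<Rightarrow> 'e \<Rightarrow> complex) \<Rightarrow> real filter \<Rightarrow>
   (real \<Rightarrow> 'e \<Rightarrow> 'e \<Rightarrow> complex) set \<Rightarrow> (real \<Rightarrow> 'e \<Rightarrow> 'e \<Rightarrow> complex) set \<Rightarrow> real ^ 'r::{finite,linorder}" where
  "cone_vdist E x h \<omega> P Q = (THE v. \<exists>f. apartment_chart E x h \<omega> f \<and>
     (\<exists>a\<in>model_apartment. \<exists>b\<in>model_apartment. f a = P \<and> f b = Q \<and> v = sort_desc (b - a)))"

section \<open>Transport and the limiting map\<close>

text \<open>Flat sections of the pullback of $\mathcal{E}$ to the universal cover, with the sign
  convention $\nabla_0 s = t\varphi s$. If \<open>p\<close> is injective on the open set \<open>N\<close> and maps it into the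
  domain of \<open>z\<close>, then $z\circ p$ is a coordinate on \<open>N\<close>.\<close>

definition flat_section ::
  "('x, 'e, 'r::finite) vbundle \<Rightarrow> ('x, 'e, 'r) local_form \<Rightarrow> ('x, 'e, 'r) local_form \<Rightarrow>
   ('u::topological_space \<Rightarrow> 'x) \<Rightarrow> real \<Rightarrow> ('u \<Rightarrow> 'e) \<Rightarrow> bool" where
  "flat_section E \<Phi> B p t s \<longleftrightarrow>
     (\<forall>u. s u \<in> fibre E (p u)) \<and>
     (\<forall>c\<in>charts E. \<forall>\<tau>\<in>trivs E. \<forall>N. open N \<and> inj_on p N \<and> p ` N \<subseteq> fst c \<inter> fst \<tau> \<longrightarrow>
        (\<forall>u\<in>N. \<forall>i.
           ((\<lambda>w. snd \<tau> (s (inv_into N (snd c \<circ> p) w)) $ i) has_field_derivative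
              ((t *\<^sub>R \<Phi> c \<tau> (p u) - B c \<tau> (p u)) *v snd \<tau> (s u)) $ i)
           (at (snd c (p u)))))"

definition transport ::
  "('x, 'e, 'r::finite) vbundle \<Rightarrow> ('x, 'e, 'r) local_form \<Rightarrow> ('x, 'e, 'r) local_form \<Rightarrow>
   ('u::topological_space \<Rightarrow> 'x) \<Rightarrow> 'u \<Rightarrow> real \<Rightarrow> 'u \<Rightarrow> 'e \<Rightarrow> 'e" where
  "transport E \<Phi> B p x0 t Q e =
     (THE e'. \<exists>s. flat_section E \<Phi> B p t s \<and> s x0 = e \<and> s Q = e')"

definition h_pull ::
  "('x, 'e, 'r::finite) vbundle \<Rightarrow> ('x, 'e, 'r) local_form \<Rightarrow> ('x, 'e, 'r) local_form \<Rightarrow>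
   ('u::topological_space \<Rightarrow> 'x) \<Rightarrow> 'u \<Rightarrow> ('e \<Rightarrow> 'e \<Rightarrow> complex) \<Rightarrow> real \<Rightarrow> 'u \<Rightarrow>
   'e \<Rightarrow> 'e \<Rightarrow> complex" where
  "h_pull E \<Phi> B p x0 h t Q =
     restrict_form (fibre E (p x0))
       (\<lambda>e e'. h (transport E \<Phi> B p x0 t Q e) (transport E \<Phi> B p x0 t Q e'))"

definition h_lim ::
  "('x, 'e, 'r::{finite,linorder}) vbundle \<Rightarrow> ('x, 'e, 'r) local_form \<Rightarrow> ('x, 'e, 'r) local_form \<Rightarrow>
   ('u::topological_space \<Rightarrow> 'x) \<Rightarrow> 'u \<Rightarrow> ('e \<Rightarrow> 'e \<Rightarrow> complex) \<Rightarrow> real filter \<Rightarrow> 'u \<Rightarrow>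
   (real \<Rightarrow> 'e \<Rightarrow> 'e \<Rightarrow> complex) set" where
  "h_lim E \<Phi> B p x0 h \<omega> Q = cone_class E (p x0) h \<omega> (\<lambda>t. h_pull E \<Phi> B p x0 h t Q)"

end

(* In a local frame the flat sections along the path solve y' = (t N - b) y, where N has the simple
   eigenvalues a_i. Splitting y by the spectral projections of N gives components whose squared norms
   grow at the rates 2 t Re a_i, up to an error bounded by a constant times the total norm. Since the rates
   are separated, for large t the i-th component dominates all the others along the whole path as
   soon as the components j > i vanish at s = 0 and the components j < i vanish at s = 1, and dimension
   counting yields a flat section satisfying these boundary conditions. The resulting basis of flat
   sections is uniformly almost orthogonal and its i-th member has norm exp (t alpha_i(s)) up to bounded
   factors. Hence the pulled back metrics stay at bounded distance, uniformly in t and s, from the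
   maximal flat of this basis. After rescaling by t this flat becomes an apartment that contains the path,
   with coordinates alpha(s); vector distances in the cone do not depend on the apartment by the
   minimax principle. *)

theory Submission
  imports Defs "HOL-Complex_Analysis.Cauchy_Integral_Formula"
begin

section \<open>Hermitian forms on complex vectors\<close>

text \<open>The coefficient \<open>vel c s * \<Phi>\<close> of the pulled back Higgs field is merely
  continuous, because the path is only C^1. Its spectral projections are nevertheless
  differentiable: they are unchanged by nonzero scaling, hence are those of the holomorphic matrix
  \<open>\<Phi>\<close>. The growth estimates therefore concern squared norms of spectral
  components, with no choice of eigenvectors. \<open>transport\<close> is a definite description
  over global flat sections, so these must exist and be unique on the universal cover; vanishing
  trace and the trivial determinant connection then conserve volume, which places the pulled back
  metrics in \<open>Met\<close>. Distances on \<open>Met\<close> are handled only up to factors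
  depending on the rank, which suffices because the cone sees limits after division by t. The vector
  distance, by contrast, needs sharp additive errors. The base point may lie off the path, so an
  exponential bound on transport is needed to keep the flats at rescaled bounded distance from
  it.\<close>

definition hform :: "(complex ^ 'n \<Rightarrow> complex ^ 'n \<Rightarrow> complex) \<Rightarrow> bool" where
  "hform K \<longleftrightarrow> (\<forall>u v w. K (u + v) w = K u w + K v w) \<and> (\<forall>c v w. K (c *s v) w = c * K v w) \<and>
     (\<forall>v w. K w v = cnj (K v w)) \<and> (\<forall>v. v \<noteq> 0 \<longrightarrow> Re (K v v) > 0)"

definition qf :: "('a \<Rightarrow> 'a \<Rightarrow> complex) \<Rightarrow> 'a \<Rightarrow> real" where
  "qf K v = Re (K v v)"

lemma hformD:
  assumes "hform K"
  shows hform_add_left: "K (u + v) w = K u w + K v w"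
    and hform_scale_left: "K (c *s v) w = c * K v w"
    and hform_cnj: "K w v = cnj (K v w)"
    and hform_pos: "v \<noteq> 0 \<Longrightarrow> qf K v > 0"
  using assms unfolding hform_def qf_def by blast+

lemma hform_add_right:
  assumes "hform K" shows "K w (u + v) = K w u + K w v"
proof -
  have "K w (u + v) = cnj (K u w + K v w)"
    by (subst hform_cnj[OF assms]) (simp add: hform_add_left[OF assms])
  also have "\<dots> = K w u + K w v"
    by (simp flip: hform_cnj[OF assms])
  finally show ?thesis .
qed

lemma hform_scale_right:
  assumes "hform K" shows "K w (c *s v) = cnj c * K w v"
proof -
  have "K w (c *s v) = cnj (c * K v w)"
    by (subst hform_cnj[OF assms]) (simp add: hform_scale_left[OF assms])
  also have "\<dots> = cnj c * K w v"
    by (simp flip: hform_cnj[OF assms])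
  finally show ?thesis .
qed

lemma hform_zero_left [simp]: "hform K \<Longrightarrow> K 0 w = 0"
  using hform_scale_left[of K 0 0 w] by simp

lemma hform_zero_right [simp]: "hform K \<Longrightarrow> K w 0 = 0"
  using hform_scale_right[of K w 0 0] by simp

lemma hform_sum_left:
  assumes "hform K" shows "K (\<Sum>i\<in>A. f i) w = (\<Sum>i\<in>A. K (f i) w)"
  by (induction A rule: infinite_finite_induct) (simp_all add: assms hform_add_left)

lemma hform_sum_right:
  assumes "hform K" shows "K w (\<Sum>i\<in>A. f i) = (\<Sum>i\<in>A. K w (f i))"
  by (induction A rule: infinite_finite_induct) (simp_all add: assms hform_add_right)

lemma hform_diag:
  assumes "hform K" shows "K v v = of_real (qf K v)"
proof -
  have "Im (K v v) = 0"
    using arg_cong[OF hform_cnj[OF assms, of v v], of Im] by simp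
  then show ?thesis by (simp add: qf_def complex_eq_iff)
qed

lemma qf_nonneg: "hform K \<Longrightarrow> qf K v \<ge> 0"
  using hform_pos[of K v] by (cases "v = 0") (auto simp: qf_def)

lemma qf_eq_0_iff: "hform K \<Longrightarrow> qf K v = 0 \<longleftrightarrow> v = 0"
  using hform_pos[of K v] by (cases "v = 0") (auto simp: qf_def)

lemma qf_scale: "hform K \<Longrightarrow> qf K (c *s v) = (cmod c)\<^sup>2 * qf K v"
  using hform_diag[of K v]
  by (simp add: qf_def hform_scale_left hform_scale_right complex_mult_cnj cmod_power2 flip: mult.assoc)

lemma qf_add:
  assumes "hform K"
  shows "qf K (v + w) = qf K v + 2 * Re (K v w) + qf K w"
  using hform_cnj[OF assms, of v w] by (simp add: qf_def hform_add_left hform_add_right assms)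

lemma smult_of_real: "x *\<^sub>R v = complex_of_real x *s v"
  unfolding vec_eq_iff vector_scaleR_component vector_smult_component
  by (intro allI scaleR_conv_of_real)

lemma sesq_add_left: "sesq H (u + v) w = sesq H u w + sesq H v w"
  by (simp add: sesq_def algebra_simps sum.distrib)

lemma sesq_scale_left: "sesq H (c *s v) w = c * sesq H v w"
  by (simp add: sesq_def algebra_simps sum_distrib_left)

lemma sesq_cnj:
  assumes "\<forall>i j. H $ j $ i = cnj (H $ i $ j)"
  shows "sesq H w v = cnj (sesq H v w)"
proof -
  have *: "cnj (H $ i $ j) = H $ j $ i" for i j using assms by metis
  have "cnj (sesq H v w) = (\<Sum>i\<in>UNIV. \<Sum>j\<in>UNIV. H $ j $ i * cnj (v $ i) * w $ j)"
    by (simp add: sesq_def *)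
  also have "\<dots> = sesq H w v"
    unfolding sesq_def by (subst sum.swap) (simp add: mult_ac)
  finally show ?thesis ..
qed

lemma hform_sesq:
  assumes "\<forall>i j. H $ j $ i = cnj (H $ i $ j)" "\<forall>v. v \<noteq> 0 \<longrightarrow> Re (sesq H v v) > 0"
  shows "hform (sesq H)"
  unfolding hform_def
  by (intro conjI allI impI sesq_add_left sesq_scale_left sesq_cnj[OF assms(1)] assms(2)[rule_format])

lemma hform_eq_sesq:
  fixes K :: "complex ^ 'n::finite \<Rightarrow> complex ^ 'n \<Rightarrow> complex"
  assumes "hform K"
  shows "K = sesq (\<chi> i j. K (axis i 1) (axis j 1))"
proof (intro ext)
  fix v w
  have "K v w = K (\<Sum>i\<in>UNIV. v $ i *s axis i 1) (\<Sum>i\<in>UNIV. w $ i *s axis i 1)"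
    by (simp add: basis_expansion)
  also have "\<dots> = sesq (\<chi> i j. K (axis i 1) (axis j 1)) v w"
    by (simp add: hform_sum_left hform_sum_right hform_scale_left hform_scale_right assms sesq_def
        sum_distrib_left mult_ac)
  finally show "K v w = sesq (\<chi> i j. K (axis i 1) (axis j 1)) v w" .
qed

lemma continuous_on_hform:
  fixes K :: "complex ^ 'n::finite \<Rightarrow> complex ^ 'n \<Rightarrow> complex"
  assumes "hform K" "continuous_on S f" "continuous_on S g"
  shows "continuous_on S (\<lambda>x. K (f x) (g x))"
  by (subst hform_eq_sesq[OF assms(1)]) (auto simp: sesq_def intro!: continuous_intros assms)

lemma hform_compose:
  fixes G :: "complex ^ 'm::finite ^ 'n::finite"
  assumes "hform K" "\<And>v. v \<noteq> 0 \<Longrightarrow> G *v v \<noteq> 0"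
  shows "hform (\<lambda>v w. K (G *v v) (G *v w))"
  unfolding hform_def
proof (intro conjI allI impI)
  show "K (G *v w) (G *v v) = cnj (K (G *v v) (G *v w))" for v w by (rule hform_cnj[OF assms(1)])
  show "Re (K (G *v v) (G *v v)) > 0" if "v \<noteq> 0" for v
    using hform_pos[OF assms(1) assms(2)[OF that]] by (simp add: qf_def)
qed (simp_all add: matrix_vector_right_distrib vector_scalar_commute hform_add_left hform_scale_left assms(1))

section \<open>Bases as matrix columns, and solvability of linear systems\<close>

definition cmat :: "('n \<Rightarrow> complex ^ 'n) \<Rightarrow> complex ^ 'n ^ 'n" where
  "cmat b = (\<chi> i j. b j $ i)"

lemma cmat_mult: "cmat b *v x = (\<Sum>j\<in>UNIV. x $ j *s b j)"
  by (simp add: vec_eq_iff cmat_def matrix_vector_mult_def mult.commute)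

lemma columns_cmat: "columns (cmat b) = range b"
  by (auto simp: columns_def column_def cmat_def)

lemma det_cmat_nz_iff_span: "det (cmat b) \<noteq> 0 \<longleftrightarrow> vec.span (range b) = UNIV"
  using matrix_right_invertible_span_columns[of "cmat b"] invertible_det_nz[of "cmat b"]
    invertible_right_inverse[of "cmat b"]
  by (simp add: columns_cmat)

lemma det_nzI:
  fixes A :: "complex ^ 'n ^ 'n"
  assumes "\<And>x. A *v x = 0 \<Longrightarrow> x = 0" shows "det A \<noteq> 0"
  using assms matrix_left_invertible_ker[of A] invertible_det_nz[of A] invertible_left_inverse[of A]
  by blast

lemma det_nz_ker:
  fixes A :: "complex ^ 'n ^ 'n"
  assumes "det A \<noteq> 0" "A *v x = 0" shows "x = 0"
  using assms matrix_left_invertible_ker[of A] invertible_det_nz[of A] invertible_left_inverse[of A]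
  by blast

lemma det_nz_solve:
  fixes A :: "complex ^ 'n ^ 'n"
  assumes "det A \<noteq> 0" obtains x where "A *v x = y"
  using assms matrix_right_invertible_surjective[of A] invertible_det_nz[of A] invertible_right_inverse[of A]
  by (metis surjD)

text \<open>A square matrix with a zero row at an index outside \<open>J\<close> is singular. This
  is the dimension count behind the orthogonal complements of the diagonalization, the minimax
  principle and the two-point boundary conditions.\<close>

lemma underdetermined_solution:
  fixes L :: "'n::finite \<Rightarrow> complex ^ 'n" and J :: "'n set"
  assumes "J \<noteq> UNIV"
  obtains w where "w \<noteq> 0" "\<And>j. j \<in> J \<Longrightarrow> (\<Sum>k\<in>UNIV. L j $ k * w $ k) = 0"
proof -
  define A :: "complex ^ 'n ^ 'n" where "A = (\<chi> j k. if j \<in> J then L j $ k else 0)"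
  obtain i where "i \<notin> J" using assms by blast
  then have "row i A = 0" by (simp add: row_def A_def vec_eq_iff)
  then have "det A = 0" by (rule det_zero_row)
  then obtain w where w: "A *v w = 0" "w \<noteq> 0" using det_nzI by blast
  have "(\<Sum>k\<in>UNIV. L j $ k * w $ k) = (A *v w) $ j" if "j \<in> J" for j
    using that by (simp add: A_def matrix_vector_mult_def)
  then show thesis using that[of w] w by simp
qed

lemma qf_orthogonal_sum:
  fixes b :: "'n::finite \<Rightarrow> complex ^ 'n"
  assumes "hform K" "\<And>i j. i \<noteq> j \<Longrightarrow> K (b i) (b j) = 0"
  shows "qf K (cmat b *v x) = (\<Sum>j\<in>UNIV. (cmod (x $ j))\<^sup>2 * qf K (b j))"
    and "K (cmat b *v x) (b i) = x $ i * K (b i) (b i)"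
proof -
  have *: "(\<Sum>j\<in>UNIV. f j * K (b j) (b i)) = f i * K (b i) (b i)" for f :: "'n \<Rightarrow> complex" and i
    using assms(2)[of _ i] by (subst sum.remove[of _ i]) auto
  show 1: "K (cmat b *v x) (b i) = x $ i * K (b i) (b i)" for i
    by (simp add: cmat_mult hform_sum_left hform_scale_left assms(1) *)
  have "K (cmat b *v x) (cmat b *v x) = (\<Sum>j\<in>UNIV. cnj (x $ j) * (x $ j * K (b j) (b j)))"
    by (subst (2) cmat_mult) (simp add: hform_sum_right hform_scale_right assms(1) 1)
  also have "\<dots> = of_real (\<Sum>j\<in>UNIV. (cmod (x $ j))\<^sup>2 * qf K (b j))"
    by (simp add: hform_diag[OF assms(1)] mult_ac complex_norm_square del: of_real_power)
  finally show "qf K (cmat b *v x) = (\<Sum>j\<in>UNIV. (cmod (x $ j))\<^sup>2 * qf K (b j))"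
    by (simp add: qf_def)
qed

lemma orthogonal_det_nz:
  fixes b :: "'n::finite \<Rightarrow> complex ^ 'n"
  assumes "hform K" "\<And>i j. i \<noteq> j \<Longrightarrow> K (b i) (b j) = 0" "\<And>i. b i \<noteq> 0"
  shows "det (cmat b) \<noteq> 0"
proof (rule det_nzI)
  fix x assume "cmat b *v x = 0"
  then have *: "x $ i * K (b i) (b i) = 0" for i
    using qf_orthogonal_sum(2)[of K b x i, OF assms(1,2)] assms(1) by simp
  then show "x = 0"
    using hform_pos[OF assms(1) assms(3)] unfolding vec_eq_iff qf_def
    by (metis * less_irrefl mult_eq_0_iff zero_complex.sel(1) zero_index)
qed

section \<open>Simultaneous diagonalization of two Hermitian forms\<close>

lemma psd_form_null:
  assumes h: "hform H" and k: "hform K" and S: "\<And>c w. w \<in> S \<Longrightarrow> v + c *s w \<in> S"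
    and le: "\<And>w. w \<in> S \<Longrightarrow> qf K w \<le> l * qf H w" and eq: "qf K v = l * qf H v" and w: "w \<in> S"
  shows "K v w = of_real l * H v w"
proof (rule ccontr)
  define g where "g = of_real l * H v w - K v w"
  assume "K v w \<noteq> of_real l * H v w"
  then have g: "g \<noteq> 0" by (simp add: g_def)
  define G where "G = l * qf H w - qf K w"
  have G: "G \<ge> 0" using le[OF w] by (simp add: G_def)
  \<comment> \<open>The form \<open>l * H - K\<close> is nonnegative on \<open>S\<close> and
    vanishes at \<open>v\<close>. If its pairing \<open>g\<close> with \<open>w\<close> were
    nonzero, a step along \<open>w\<close> against \<open>g\<close> would decrease it to first
    order; \<open>e\<close> is so small that the second order term, with \<open>e * G < 1\<close>,
    cannot compensate.\<close>
  define e where "e = 1 / (G + 1)"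
  have e: "e > 0" "e * (G + 1) = 1" using G by (auto simp: e_def)
  define c where "c = - (of_real e * g)"
  have "qf K (v + c *s w) \<le> l * qf H (v + c *s w)" by (intro le S w)
  then have "0 \<le> 2 * Re (cnj c * g) + (cmod c)\<^sup>2 * G"
    using eq by (simp add: qf_add qf_scale hform_scale_right h k G_def g_def algebra_simps)
  also have "Re (cnj c * g) = - e * (cmod g)\<^sup>2"
    unfolding cmod_power2 by (simp add: c_def power2_eq_square algebra_simps)
  also have "(cmod c)\<^sup>2 = e\<^sup>2 * (cmod g)\<^sup>2" by (simp add: c_def norm_mult power_mult_distrib)
  finally have "0 \<le> (cmod g)\<^sup>2 * e * (e * G - 2)" by (simp add: algebra_simps power2_eq_square)
  moreover have "e * G - 2 < 0" using e by (simp add: algebra_simps)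
  moreover have "(cmod g)\<^sup>2 * e > 0" using g e by simp
  ultimately show False by (metis mult_pos_neg not_le)
qed

text \<open>The next vector maximizes the Rayleigh quotient of \<open>K\<close> by \<open>H\<close>
  on the \<open>H\<close>-orthogonal complement of the previous ones. The induction carries the full
  eigenvector equation against every \<open>w\<close>, stronger than mutual orthogonality: it makes
  a vector of the complement \<open>K\<close>-orthogonal to the previous vectors as well.\<close>

lemma simultaneous_diagonalization_aux:
  fixes H K :: "complex ^ 'n::finite \<Rightarrow> complex ^ 'n \<Rightarrow> complex"
  assumes h: "hform H" and k: "hform K" and "finite (J :: 'n set)"
  shows "\<exists>b l. \<forall>j\<in>J. b j \<noteq> 0 \<and> (\<forall>w. K (b j) w = of_real (l j) * H (b j) w) \<and>
           (\<forall>i\<in>J. i \<noteq> j \<longrightarrow> H (b i) (b j) = 0)"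
  using \<open>finite J\<close>
proof (induction J rule: finite_induct)
  case empty then show ?case by simp
next
  case (insert i J)
  then obtain b l where b: "\<And>j. j \<in> J \<Longrightarrow> b j \<noteq> 0"
    and kb: "\<And>j w. j \<in> J \<Longrightarrow> K (b j) w = of_real (l j) * H (b j) w"
    and ob: "\<And>i j. i \<in> J \<Longrightarrow> j \<in> J \<Longrightarrow> i \<noteq> j \<Longrightarrow> H (b i) (b j) = 0" by blast
  define S where "S = {w. \<forall>j\<in>J. H w (b j) = 0}"
  \<comment> \<open>Fewer vectors than the dimension have been chosen, so the complement is
    nonzero.\<close>
  have "J \<noteq> UNIV" using insert by auto
  from underdetermined_solution[OF this, of "\<lambda>j. \<chi> k. H (axis k 1) (b j)"]
  obtain w0 where w0: "w0 \<noteq> 0"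
    and w0J: "\<And>j. j \<in> J \<Longrightarrow> (\<Sum>k\<in>UNIV. H (axis k 1) (b j) * w0 $ k) = 0" by auto
  have "H w0 (b j) = (\<Sum>k\<in>UNIV. H (axis k 1) (b j) * w0 $ k)" for j
    by (subst basis_expansion[of w0, symmetric])
      (simp add: hform_sum_left hform_scale_left h mult.commute del: basis_expansion)
  then have w0S: "w0 \<in> S" using w0J by (simp add: S_def)
  have Ssc: "c *s v \<in> S" if "v \<in> S" for c v
    using that by (simp add: S_def hform_scale_left h)
  have Sadd: "v + w \<in> S" if "v \<in> S" "w \<in> S" for v w
    using that by (simp add: S_def hform_add_left h)
  have "S = (\<Inter>j\<in>J. {w. H w (b j) = 0})" by (auto simp: S_def)
  moreover have "closed {w. H w (b j) = 0}" for j
    by (intro closed_Collect_eq continuous_on_hform[OF h] continuous_intros)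
  ultimately have "closed S" by auto
  then have comp: "compact (sphere 0 1 \<inter> S)" by (auto intro: compact_Int_closed)
  have "(1 / norm w0) *\<^sub>R w0 \<in> S" unfolding smult_of_real by (rule Ssc[OF w0S])
  moreover have "(1 / norm w0) *\<^sub>R w0 \<in> sphere 0 1" using w0 by simp
  ultimately have "sphere 0 1 \<inter> S \<noteq> {}" by blast
  moreover have "continuous_on (sphere 0 1 \<inter> S) (\<lambda>v. qf K v / qf H v)"
  proof (rule continuous_on_divide)
    show "continuous_on (sphere 0 1 \<inter> S) (qf K)" "continuous_on (sphere 0 1 \<inter> S) (qf H)"
      unfolding qf_def
      by (rule continuous_on_Re continuous_on_hform h k continuous_on_id)+
    show "\<forall>v\<in>sphere 0 1 \<inter> S. qf H v \<noteq> 0" by (auto simp: qf_eq_0_iff[OF h])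
  qed
  ultimately obtain v where v: "v \<in> sphere 0 1 \<inter> S"
    and vmax: "\<And>w. w \<in> sphere 0 1 \<inter> S \<Longrightarrow> qf K w / qf H w \<le> qf K v / qf H v"
    using continuous_attains_sup[OF comp] by meson
  define m where "m = qf K v / qf H v"
  have v0: "v \<noteq> 0" and vS: "v \<in> S" using v by auto
  have eq: "qf K v = m * qf H v" using v0 qf_eq_0_iff[OF h, of v] by (simp add: m_def)
  have le: "qf K w \<le> m * qf H w" if "w \<in> S" for w
  proof (cases "w = 0")
    case False
    define w' where "w' = (1 / norm w) *\<^sub>R w"
    have "w' \<in> S" unfolding w'_def smult_of_real by (rule Ssc[OF that])
    moreover have "w' \<in> sphere 0 1" using False by (simp add: w'_def)
    ultimately have "w' \<in> sphere 0 1 \<inter> S" by blast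
    from vmax[OF this] have "qf K w' / qf H w' \<le> m" by (simp add: m_def)
    moreover have "qf K w' / qf H w' = qf K w / qf H w"
      using False unfolding w'_def smult_of_real by (simp add: qf_scale h k del: of_real_divide)
    moreover have "qf H w > 0" using hform_pos[OF h False] .
    ultimately show ?thesis by (simp add: field_simps)
  qed (simp add: qf_def h k)
  have vb: "H v (b j) = 0" if "j \<in> J" for j using vS that by (simp add: S_def)
  have vb': "H (b j) v = 0" if "j \<in> J" for j using vb[OF that] by (metis complex_cnj_zero hform_cnj[OF h])
  have vK: "K v (b j) = 0" if "j \<in> J" for j
    using kb[OF that, of v] vb'[OF that] by (metis complex_cnj_zero hform_cnj[OF k] mult_zero_right)
  \<comment> \<open>Maximality yields the equation only against vectors of \<open>S\<close>. An
    arbitrary \<open>u\<close> is the sum of a vector of \<open>S\<close> and a combination of the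
    earlier \<open>b j\<close>, and both forms vanish between these and \<open>v\<close>.\<close>
  have kv: "K v u = of_real m * H v u" for u
  proof -
    define x where "x j = H u (b j) / H (b j) (b j)" for j
    define w where "w = u - (\<Sum>j\<in>J. x j *s b j)"
    have u: "u = w + (\<Sum>j\<in>J. x j *s b j)" by (simp add: w_def)
    have "H (\<Sum>j\<in>J. x j *s b j) (b i) = H u (b i)" if "i \<in> J" for i
    proof -
      have "H (\<Sum>j\<in>J. x j *s b j) (b i) = (\<Sum>j\<in>J. x j * H (b j) (b i))"
        by (simp add: hform_sum_left hform_scale_left h)
      also have "\<dots> = x i * H (b i) (b i)"
        using that insert.hyps ob by (subst sum.remove[of _ i]) auto
      also have "\<dots> = H u (b i)"
        using b[OF that] hform_pos[OF h b[OF that]] by (auto simp: x_def qf_def)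
      finally show ?thesis .
    qed
    then have "w \<in> S"
      unfolding S_def using hform_add_left[OF h, of w "\<Sum>j\<in>J. x j *s b j", folded u] by simp
    then have "K v w = of_real m * H v w"
      by (intro psd_form_null[OF h k _ le eq]) (auto intro: Sadd Ssc vS)
    then show ?thesis
      unfolding u by (simp add: hform_add_right hform_sum_right hform_scale_right h k vb vK distrib_left)
  qed
  let ?b = "b(i := v)" and ?l = "l(i := m)"
  have "\<forall>j\<in>insert i J. ?b j \<noteq> 0 \<and> (\<forall>w. K (?b j) w = of_real (?l j) * H (?b j) w) \<and>
           (\<forall>i'\<in>insert i J. i' \<noteq> j \<longrightarrow> H (?b i') (?b j) = 0)"
    using insert.hyps b v0 kb kv ob vb vb' by auto
  then show ?case by blast
qed

lemma simultaneous_diagonalization: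
  fixes H K :: "complex ^ 'n::finite \<Rightarrow> complex ^ 'n \<Rightarrow> complex"
  assumes "hform H" "hform K"
  obtains b :: "'n \<Rightarrow> complex ^ 'n" where "\<And>i. b i \<noteq> 0" "\<And>i j. i \<noteq> j \<Longrightarrow> H (b i) (b j) = 0" "\<And>i j. i \<noteq> j \<Longrightarrow> K (b i) (b j) = 0"
proof -
  obtain b :: "'n \<Rightarrow> complex ^ 'n" and l where *: "\<forall>j\<in>UNIV. b j \<noteq> 0 \<and> (\<forall>w. K (b j) w = of_real (l j) * H (b j) w) \<and>
           (\<forall>i\<in>UNIV. i \<noteq> j \<longrightarrow> H (b i) (b j) = 0)"
    using simultaneous_diagonalization_aux[OF assms finite_class.finite_UNIV] by blast
  then have nz: "b i \<noteq> 0" and H: "i \<noteq> j \<Longrightarrow> H (b i) (b j) = 0" for i j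
    by simp_all
  have K: "K (b j) w = of_real (l j) * H (b j) w" for j w using * by simp
  have "K (b i) (b j) = 0" if "i \<noteq> j" for i j using H[OF that] K[of i "b j"] by simp
  then show thesis using that nz H by blast
qed

text \<open>The minimax principle: the span of the first \<open>i\<close> vectors of one basis meets the span of the
  last ones, from \<open>i\<close> on, of the other.\<close>

lemma minimax_comparison:
  fixes H K H' K' :: "complex ^ 'n::{finite,linorder} \<Rightarrow> complex ^ 'n::{finite,linorder} \<Rightarrow> complex"
    and b b' :: "'n \<Rightarrow> complex ^ 'n::{finite,linorder}" and i :: 'n
  assumes forms: "hform H" "hform K" "hform H'" "hform K'"
    and orth: "\<And>i j. i \<noteq> j \<Longrightarrow> H (b i) (b j) = 0" "\<And>i j. i \<noteq> j \<Longrightarrow> K (b i) (b j) = 0"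
      "\<And>i j. i \<noteq> j \<Longrightarrow> H' (b' i) (b' j) = 0" "\<And>i j. i \<noteq> j \<Longrightarrow> K' (b' i) (b' j) = 0"
    and nz: "\<And>i. b i \<noteq> 0" "\<And>i. b' i \<noteq> 0"
    and ratio: "\<And>i. qf K (b i) = l i * qf H (b i)" "\<And>i. qf K' (b' i) = l' i * qf H' (b' i)"
    and dec: "\<And>i j. i \<le> j \<Longrightarrow> l j \<le> l i" "\<And>i j. i \<le> j \<Longrightarrow> l' j \<le> l' i"
    and comp: "\<And>v. qf K v \<le> c * qf K' v" "\<And>v. qf H' v \<le> d * qf H v" and "c > 0"
  shows "l i \<le> c * d * l' i"
proof -
  \<comment> \<open>One equation for each index other than \<open>i\<close>: orthogonality to the
    later \<open>b j\<close> leaves \<open>v\<close> in the span of the first vectors of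
    \<open>b\<close>, orthogonality to the earlier \<open>b' j\<close> leaves it in the span of the
    last vectors of \<open>b'\<close>, index \<open>i\<close> included in both.\<close>
  define L where "L j = (\<chi> k. if j > i then H (axis k 1) (b j) else H' (axis k 1) (b' j))" for j
  have "- {i} \<noteq> UNIV" by auto
  from underdetermined_solution[OF this, of L]
  obtain v where v: "v \<noteq> 0" "\<And>j. j \<noteq> i \<Longrightarrow> (\<Sum>k\<in>UNIV. L j $ k * v $ k) = 0"
    by auto
  have exp: "M v w = (\<Sum>k\<in>UNIV. M (axis k 1) w * v $ k)" if "hform M" for M w
    by (subst basis_expansion[of v, symmetric])
      (simp add: hform_sum_left hform_scale_left that mult.commute del: basis_expansion)
  have vH: "H v (b j) = 0" if "j > i" for j
    using v(2)[of j] that by (simp add: exp[OF forms(1)] L_def)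
  have vH': "H' v (b' j) = 0" if "j < i" for j
    using v(2)[of j] that less_not_sym[OF that] by (simp add: exp[OF forms(3)] L_def)
  obtain x where x: "cmat b *v x = v" using det_nz_solve orthogonal_det_nz[of H b, OF forms(1) orth(1) nz(1)] .
  obtain y where y: "cmat b' *v y = v" using det_nz_solve orthogonal_det_nz[of H' b', OF forms(3) orth(3) nz(2)] .
  have x0: "x $ j = 0" if "j > i" for j
    using vH[OF that] qf_orthogonal_sum(2)[of H b x j, OF forms(1) orth(1)] hform_pos[OF forms(1) nz(1)[of j]]
    by (auto simp: x qf_def)
  have y0: "y $ j = 0" if "j < i" for j
    using vH'[OF that] qf_orthogonal_sum(2)[of H' b' y j, OF forms(3) orth(3)] hform_pos[OF forms(3) nz(2)[of j]]
    by (auto simp: y qf_def)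
  have "l i * qf H v = (\<Sum>j\<in>UNIV. (cmod (x $ j))\<^sup>2 * (l i * qf H (b j)))"
    using qf_orthogonal_sum(1)[of H b x, OF forms(1) orth(1)]
    by (simp add: x sum_distrib_left mult_ac)
  also have "\<dots> \<le> (\<Sum>j\<in>UNIV. (cmod (x $ j))\<^sup>2 * qf K (b j))"
  proof (intro sum_mono)
    fix j show "(cmod (x $ j))\<^sup>2 * (l i * qf H (b j)) \<le> (cmod (x $ j))\<^sup>2 * qf K (b j)"
      using x0[of j] dec(1)[of j i] qf_nonneg[OF forms(1), of "b j"] unfolding ratio
      by (cases "j \<le> i") (auto intro!: mult_left_mono mult_right_mono)
  qed
  also have "\<dots> = qf K v" using qf_orthogonal_sum(1)[of K b x, OF forms(2) orth(2)] by (simp add: x)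
  also have "\<dots> \<le> c * qf K' v" by (rule comp)
  also have "qf K' v = (\<Sum>j\<in>UNIV. (cmod (y $ j))\<^sup>2 * qf K' (b' j))"
    using qf_orthogonal_sum(1)[of K' b' y, OF forms(4) orth(4)] by (simp add: y)
  also have "\<dots> \<le> (\<Sum>j\<in>UNIV. (cmod (y $ j))\<^sup>2 * (l' i * qf H' (b' j)))"
  proof (intro sum_mono)
    fix j show "(cmod (y $ j))\<^sup>2 * qf K' (b' j) \<le> (cmod (y $ j))\<^sup>2 * (l' i * qf H' (b' j))"
      using y0[of j] dec(2)[of i j] qf_nonneg[OF forms(3), of "b' j"] unfolding ratio
      by (cases "i \<le> j") (auto intro!: mult_left_mono mult_right_mono)
  qed
  also have "\<dots> = l' i * qf H' v"
    using qf_orthogonal_sum(1)[of H' b' y, OF forms(3) orth(3)]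
    by (simp add: y sum_distrib_left mult_ac)
  finally have 1: "l i * qf H v \<le> c * (l' i * qf H' v)" using \<open>c > 0\<close> by simp
  have "l' i \<ge> 0"
    using ratio(2)[of i] hform_pos[OF forms(3) nz(2)[of i]] hform_pos[OF forms(4) nz(2)[of i]]
    by (smt (verit) mult_nonneg_nonneg mult_neg_pos)
  then have "c * (l' i * qf H' v) \<le> c * (l' i * (d * qf H v))"
    using \<open>c > 0\<close> comp(2)[of v] by (intro mult_left_mono) auto
  with 1 have "l i * qf H v \<le> (c * d * l' i) * qf H v" by (simp add: mult_ac)
  then show ?thesis using hform_pos[OF forms(1) v(1)] by simp
qed

section \<open>Linear differential equations in the complex domain\<close>

lemma norm_smult: "norm (c *s v) = cmod c * norm (v :: complex ^ 'n::finite)"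
  by (simp add: norm_vec_def norm_mult L2_set_right_distrib)

lemma norm_vec_mult_le:
  fixes A :: "complex ^ 'n::finite ^ 'm::finite"
    and m c :: real
  assumes "\<And>i j. cmod (A $ i $ j) \<le> m" "\<And>j. cmod (y $ j) \<le> c"
  shows "cmod ((A *v y) $ i) \<le> CARD('n) * m * c"
proof -
  have m: "m \<ge> 0" using assms(1) norm_ge_zero order_trans by blast
  have "cmod ((A *v y) $ i) \<le> (\<Sum>j\<in>UNIV. cmod (A $ i $ j * y $ j))"
    unfolding matrix_vector_mult_def by (simp add: norm_sum)
  also have "\<dots> \<le> (\<Sum>j\<in>(UNIV::'n set). m * c)"
    by (intro sum_mono) (simp add: norm_mult mult_mono assms m)
  finally show ?thesis by simp
qed

text \<open>Picard iteration. The ball has diameter \<open>2 * \<rho>\<close>, so by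
  \<open>small\<close> integration against \<open>A\<close> at least halves an entrywise bound, and
  the iterates converge uniformly. The initial point \<open>w1\<close> is arbitrary in the ball,
  because a section has to be prescribed at any point of a coordinate ball.\<close>

lemma linear_ode_solution:
  fixes A :: "complex \<Rightarrow> complex ^ 'n::finite ^ 'n" and v :: "complex ^ 'n" and \<rho> m :: real
  assumes hol: "\<And>i j. (\<lambda>w. A w $ i $ j) holomorphic_on ball w0 \<rho>"
    and bound: "\<And>w i j. w \<in> ball w0 \<rho> \<Longrightarrow> cmod (A w $ i $ j) \<le> m"
    and small: "2 * \<rho> * (CARD('n) * m) \<le> 1 / 2" and w1: "w1 \<in> ball w0 \<rho>"
  obtains y where "y w1 = v"
    "\<And>w i. w \<in> ball w0 \<rho> \<Longrightarrow> ((\<lambda>w. y w $ i) has_field_derivative (A w *v y w) $ i) (at w)"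
proof -
  let ?B = "ball w0 \<rho>"
  \<comment> \<open>\<open>P y g\<close> says that \<open>g\<close> is the Picard iterate of
    \<open>y\<close>. It exists because holomorphic functions have primitives on the convex
    ball.\<close>
  define P where "P y g \<longleftrightarrow> (\<forall>i. \<forall>w\<in>?B. ((\<lambda>w. g w $ i) has_field_derivative (A w *v y w) $ i) (at w)) \<and> g w1 = v"
    for y g :: "complex \<Rightarrow> complex ^ 'n"
  have ex: "\<exists>g. P y g" if y: "\<And>i. (\<lambda>w. y w $ i) holomorphic_on ?B" for y
  proof -
    have "\<exists>g. \<forall>w\<in>?B. (g has_field_derivative (A w *v y w) $ i) (at w)" for i
    proof -
      have "(\<lambda>w. (A w *v y w) $ i) holomorphic_on ?B"
        unfolding matrix_vector_mult_def by (simp, intro holomorphic_intros hol y)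
      from holomorphic_convex_primitive'[OF _ _ this]
      obtain g where "\<And>w. w \<in> ?B \<Longrightarrow> (g has_field_derivative (A w *v y w) $ i) (at w within ?B)"
        by auto
      then show ?thesis by (metis at_within_open open_ball)
    qed
    then obtain g where g: "\<And>i w. w \<in> ?B \<Longrightarrow> (g i has_field_derivative (A w *v y w) $ i) (at w)"
      by metis
    have "((\<lambda>w. g i w - g i w1 + v $ i) has_field_derivative (A w *v y w) $ i) (at w)" if "w \<in> ?B" for i w
      by (rule derivative_eq_intros g that refl | simp)+
    then have "P y (\<lambda>w. \<chi> i. g i w - g i w1 + v $ i)"
      unfolding P_def by (simp add: vec_eq_iff)
    then show ?thesis by blast
  qed
  define Y where "Y = rec_nat (\<lambda>_. v) (\<lambda>_ y. SOME g. P y g)"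
  have Y0: "Y 0 = (\<lambda>_. v)" and YS: "Y (Suc k) = (SOME g. P (Y k) g)" for k
    by (simp_all add: Y_def)
  have holY: "(\<lambda>w. Y k w $ i) holomorphic_on ?B" and PY: "P (Y k) (Y (Suc k))" for k i
  proof (induction k arbitrary: i)
    case 0
    { case 1 show ?case by (simp add: Y0) next
      case 2 show ?case unfolding YS by (rule someI_ex[OF ex]) (simp add: Y0) }
  next
    case (Suc k)
    have *: "(\<lambda>w. Y (Suc k) w $ i) holomorphic_on ?B" for i
      using Suc(2) unfolding P_def
      by (auto simp: holomorphic_on_def field_differentiable_def intro: has_field_derivative_at_within)
    { case 1 show ?case by (rule *) next
      case 2 show ?case by (subst YS) (rule someI_ex[OF ex[OF *]]) }
  qed
  have der: "((\<lambda>w. Y (Suc k) w $ i) has_field_derivative (A w *v Y k w) $ i) (at w)"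
    if "w \<in> ?B" for k i w using PY[of k] that by (simp add: P_def)
  have Yw1: "Y k w1 = v" for k using PY by (cases k) (auto simp: Y0 P_def)
  define c where "c = norm v"
  have dist: "norm (w - w1) \<le> 2 * \<rho>" if "w \<in> ?B" for w
    using that w1 dist_triangle2[of w w1 w0] by (simp add: dist_norm norm_minus_commute)
  have \<rho>: "\<rho> > 0" using w1 by (metis ball_empty empty_iff not_less)
  have m: "m \<ge> 0" using bound[OF w1] norm_ge_zero order_trans by blast
  \<comment> \<open>Integration from \<open>w1\<close> over a segment of length at most
    \<open>2 * \<rho>\<close> turns a bound \<open>d\<close> into \<open>d / 2\<close>; this is
    applied to the increments of the iteration.\<close>
  have step: "cmod (f w) \<le> d / 2"
    if f: "\<And>w. w \<in> ?B \<Longrightarrow> (f has_field_derivative (A w *v z w) $ i) (at w)" and "f w1 = 0"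
      and z: "\<And>w j. w \<in> ?B \<Longrightarrow> cmod (z w $ j) \<le> d" and "w \<in> ?B" for f z d i w
  proof -
    have d: "d \<ge> 0" using z[OF w1] norm_ge_zero order_trans by blast
    have "cmod (f w - f w1) \<le> CARD('n) * m * d * norm (w - w1)"
    proof (rule field_differentiable_bound[of ?B])
      show "(f has_field_derivative (A x *v z x) $ i) (at x within ?B)" if "x \<in> ?B" for x
        using f[OF that] by (rule has_field_derivative_at_within)
      show "cmod ((A x *v z x) $ i) \<le> CARD('n) * m * d" if "x \<in> ?B" for x
        using norm_vec_mult_le bound z that by blast
    qed (use w1 \<open>w \<in> ?B\<close> in auto)
    also have "\<dots> \<le> CARD('n) * m * d * (2 * \<rho>)"
      using dist[OF \<open>w \<in> ?B\<close>] m d by (intro mult_left_mono) auto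
    also have "\<dots> = d * (2 * \<rho> * (CARD('n) * m))" by simp
    also have "\<dots> \<le> d * (1 / 2)" using small d by (intro mult_left_mono) auto
    finally show ?thesis using \<open>f w1 = 0\<close> by simp
  qed
  have diff: "cmod (Y (Suc k) w $ i - Y k w $ i) \<le> c * (1/2) ^ Suc k" if "w \<in> ?B" for k w i
    using that
  proof (induction k arbitrary: w i)
    case 0
    have "cmod ((\<lambda>w. Y 1 w $ i - v $ i) w) \<le> c / 2"
    proof (rule step[OF _ _ _ 0])
      show "((\<lambda>w. Y 1 w $ i - v $ i) has_field_derivative (A w *v Y 0 w) $ i) (at w)" if "w \<in> ?B" for w
        using der[OF that, of 0] by (auto intro!: derivative_eq_intros)
      show "Y 1 w1 $ i - v $ i = 0" by (simp add: Yw1)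
      show "cmod (Y 0 w $ j) \<le> c" for w j
        using Finite_Cartesian_Product.norm_nth_le[of v j] by (simp add: Y0 c_def)
    qed
    then show ?case by (simp add: Y0)
  next
    case (Suc k)
    have "cmod ((\<lambda>w. Y (Suc (Suc k)) w $ i - Y (Suc k) w $ i) w) \<le> c * (1/2) ^ Suc k / 2"
    proof (rule step[OF _ _ _ Suc.prems])
      show "((\<lambda>w. Y (Suc (Suc k)) w $ i - Y (Suc k) w $ i) has_field_derivative
          (A w *v (Y (Suc k) w - Y k w)) $ i) (at w)" if "w \<in> ?B" for w
        using DERIV_diff[OF der[OF that, of "Suc k" i] der[OF that, of k i]]
        by (simp add: matrix_vector_mult_diff_distrib)
      show "Y (Suc (Suc k)) w1 $ i - Y (Suc k) w1 $ i = 0" by (simp add: Yw1)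
      show "cmod ((Y (Suc k) w - Y k w) $ j) \<le> c * (1/2) ^ Suc k" if "w \<in> ?B" for w j
        using Suc.IH[OF that] by simp
    qed
    then show ?case by simp
  qed
  have "\<exists>l. uniform_limit ?B (\<lambda>k w. Y k w $ i) l sequentially" for i
  proof -
    have sm: "summable (\<lambda>k. c * (1/2::real) ^ Suc k)"
      by (intro summable_mult) (simp add: summable_Suc_iff)
    have "uniform_limit ?B (\<lambda>n w. \<Sum>k<n. Y (Suc k) w $ i - Y k w $ i)
        (\<lambda>w. \<Sum>k. Y (Suc k) w $ i - Y k w $ i) sequentially"
      by (rule Weierstrass_m_test[OF diff sm])
    moreover have "(\<Sum>k<n. Y (Suc k) w $ i - Y k w $ i) = Y n w $ i - v $ i" for n w
      using sum_lessThan_telescope[of "\<lambda>k. Y k w $ i" n] by (simp add: Y0)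
    ultimately have "uniform_limit ?B (\<lambda>n w. Y n w $ i - v $ i) (\<lambda>w. \<Sum>k. Y (Suc k) w $ i - Y k w $ i) sequentially"
      by simp
    then have "uniform_limit ?B (\<lambda>n w. (Y n w $ i - v $ i) + v $ i)
        (\<lambda>w. (\<Sum>k. Y (Suc k) w $ i - Y k w $ i) + v $ i) sequentially"
      by (intro uniform_limit_intros)
    then show ?thesis by (auto simp only: diff_add_cancel)
  qed
  then obtain l where l: "\<And>i. uniform_limit ?B (\<lambda>k w. Y k w $ i) (l i) sequentially" by metis
  define y where "y w = (\<chi> i. l i w)" for w
  have lim: "(\<lambda>k. Y k w $ i) \<longlonglongrightarrow> y w $ i" if "w \<in> ?B" for w i
    using tendsto_uniform_limitI[OF l that] by (simp add: y_def)
  show thesis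
  proof
    have "v $ i = y w1 $ i" for i using lim[OF w1, of i] by (intro LIMSEQ_unique[OF _ lim[OF w1, of i]]) (simp add: Yw1)
    then show "y w1 = v" by (simp add: vec_eq_iff)
    fix w i assume w: "w \<in> ?B"
    \<comment> \<open>Locally uniform limits of holomorphic functions may be differentiated
      termwise. The index is shifted by one so that the derivatives are \<open>A x *v Y k x\<close>,
      whose limit is then computed a second time from that of \<open>Y k x\<close>.\<close>
    have "\<exists>g'. \<forall>x\<in>?B. ((\<lambda>w. y w $ i) has_field_derivative g' x) (at x) \<and> (\<lambda>k. (A x *v Y k x) $ i) \<longlonglongrightarrow> g' x"
    proof (rule has_complex_derivative_uniform_sequence[of ?B "\<lambda>k w. Y (Suc k) w $ i"])
      fix x assume "x \<in> ?B"
      then obtain d where d: "d > 0" "cball x d \<subseteq> ?B"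
        using open_contains_cball[of ?B] open_ball by blast
      have "uniform_limit ?B (\<lambda>k w. Y (Suc k) w $ i) (l i) sequentially"
        using l[of i] by (simp add: filterlim_sequentially_Suc uniform_limit_sequentially_iff) (meson le_SucI)
      from uniform_limit_on_subset[OF this d(2)]
      have "uniform_limit (cball x d) (\<lambda>k w. Y (Suc k) w $ i) (\<lambda>w. y w $ i) sequentially"
        by (simp add: y_def)
      with d show "\<exists>d>0. cball x d \<subseteq> ?B \<and> uniform_limit (cball x d) (\<lambda>k w. Y (Suc k) w $ i) (\<lambda>w. y w $ i) sequentially"
        by blast
    qed (use der in auto)
    then obtain d where "((\<lambda>w. y w $ i) has_field_derivative d) (at w)" "(\<lambda>k. (A w *v Y k w) $ i) \<longlonglongrightarrow> d"
      using w by blast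
    moreover have "(\<lambda>k. (A w *v Y k w) $ i) \<longlonglongrightarrow> (A w *v y w) $ i"
      unfolding matrix_vector_mult_def by (simp, intro tendsto_intros lim w)
    ultimately show "((\<lambda>w. y w $ i) has_field_derivative (A w *v y w) $ i) (at w)"
      using LIMSEQ_unique by metis
  qed
qed

section \<open>Differential inequalities on the unit interval\<close>

lemma nonincreasing_within:
  fixes f :: "real \<Rightarrow> real"
  assumes "x \<in> {0..1}" "y \<in> {0..1}" "x \<le> y"
    and der: "\<And>s. s \<in> {0..1} \<Longrightarrow> \<exists>D. (f has_real_derivative D) (at s within {0..1}) \<and> D \<le> 0"
  shows "f y \<le> f x"
proof (cases "x = y")
  case False
  show ?thesis
  proof (rule DERIV_nonpos_imp_decreasing_open[of x y f])
    show "x \<le> y" by fact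
    show "\<exists>D. DERIV f s :> D \<and> D \<le> 0" if "x < s" "s < y" for s
    proof -
      \<comment> \<open>Derivatives along the path are one-sided at 0 and 1; in the interior they
        are genuine, and continuity carries monotonicity to the endpoints.\<close>
      have "at s within {0..1} = at s" using that assms by (intro at_within_interior) auto
      then show ?thesis using der[of s] that assms by auto
    qed
    have "continuous_on {0..1} f"
      using der unfolding continuous_on_eq_continuous_within by (meson DERIV_continuous)
    then show "continuous_on {x..y} f" using assms by (elim continuous_on_subset) auto
  qed
qed simp

lemma has_real_derivative_inner_self:
  fixes y :: "real \<Rightarrow> 'a::real_inner"
  assumes "(y has_vector_derivative d) (at s within S)"
  shows "((\<lambda>s. y s \<bullet> y s) has_real_derivative 2 * (y s \<bullet> d)) (at s within S)"
  using assms unfolding has_vector_derivative_def has_field_derivative_def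
  by (auto intro!: derivative_eq_intros simp: inner_commute fun_eq_iff)

text \<open>The squared norm times \<open>exp (- 2 * L * s)\<close> has nonpositive derivative by
  Cauchy-Schwarz. The square avoids differentiating the norm at zeros of \<open>y\<close>.\<close>

lemma gronwall_norm:
  fixes y y' :: "real \<Rightarrow> 'a::real_inner" and L :: real
  assumes der: "\<And>s. s \<in> {0..1} \<Longrightarrow> (y has_vector_derivative y' s) (at s within {0..1})"
    and bound: "\<And>s. s \<in> {0..1} \<Longrightarrow> norm (y' s) \<le> L * norm (y s)"
  shows "norm (y 1) \<le> exp L * norm (y 0)"
proof -
  define f where "f s = (y s \<bullet> y s) * exp (- 2 * L * s)" for s
  have "f 1 \<le> f 0"
  proof (rule nonincreasing_within[of 0 1 f])
    fix s :: real assume s: "s \<in> {0..1}"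
    have 1: "(f has_real_derivative (2 * (y s \<bullet> y' s)) * exp (- 2 * L * s) +
        (y s \<bullet> y s) * (exp (- 2 * L * s) * (- 2 * L))) (at s within {0..1})"
      unfolding f_def
      by (rule derivative_eq_intros has_real_derivative_inner_self der s refl | simp)+
    have "y s \<bullet> y' s \<le> norm (y s) * norm (y' s)" by (rule norm_cauchy_schwarz)
    also have "\<dots> \<le> norm (y s) * (L * norm (y s))" by (intro mult_left_mono bound s) simp
    also have "\<dots> = L * (y s \<bullet> y s)" by (simp add: dot_square_norm power2_eq_square)
    finally have "(y s \<bullet> y' s - L * (y s \<bullet> y s)) * (2 * exp (- 2 * L * s)) \<le> 0"
      by (intro mult_nonpos_nonneg) auto
    then have "(2 * (y s \<bullet> y' s)) * exp (- 2 * L * s) +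
        (y s \<bullet> y s) * (exp (- 2 * L * s) * (- 2 * L)) \<le> 0" by (simp add: algebra_simps)
    with 1 show "\<exists>D. (f has_real_derivative D) (at s within {0..1}) \<and> D \<le> 0" by blast
  qed simp_all
  then have "(norm (y 1))\<^sup>2 \<le> (norm (y 0))\<^sup>2 * exp (2 * L)"
    by (simp add: f_def dot_square_norm exp_minus field_simps)
  also have "\<dots> = (exp L * norm (y 0))\<^sup>2"
    by (simp add: power_mult_distrib exp_double)
  finally show ?thesis by (rule power2_le_imp_le) simp
qed

lemma norm_vec_le_cmod_sum:
  fixes y :: "complex ^ 'n::finite" and c :: real
  assumes "\<And>j. cmod (y $ j) \<le> c"
  shows "norm y \<le> CARD('n) * c"
proof -
  have "norm y \<le> (\<Sum>j\<in>UNIV. cmod (y $ j))"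
    by (simp add: norm_vec_def L2_set_le_sum)
  also have "\<dots> \<le> (\<Sum>j\<in>(UNIV :: 'n set). c)" by (intro sum_mono assms)
  finally show ?thesis by simp
qed

lemma norm_matrix_vector_le:
  fixes A :: "complex ^ 'n::finite ^ 'm::finite" and m :: real
  assumes "\<And>i j. cmod (A $ i $ j) \<le> m"
  shows "norm (A *v y) \<le> CARD('m) * (CARD('n) * m) * norm y"
  using norm_vec_le_cmod_sum[of "A *v y" "CARD('n) * m * norm y"]
    norm_vec_mult_le[of A m y "norm y"] assms Finite_Cartesian_Product.norm_nth_le[of y]
  by (simp add: mult_ac)

lemma has_vector_derivative_vec:
  fixes y :: "real \<Rightarrow> complex ^ 'n::finite"
  assumes "\<And>i. ((\<lambda>s. y s $ i) has_vector_derivative d $ i) (at s within S)"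
  shows "(y has_vector_derivative d) (at s within S)"
  unfolding has_vector_derivative_def
proof (subst has_derivative_componentwise_within, intro ballI)
  fix b :: "complex ^ 'n" assume "b \<in> Basis"
  then obtain i u where b: "b = axis i u" "u \<in> Basis" by (auto simp: Basis_vec_def)
  have "((\<lambda>s. y s $ i \<bullet> u) has_derivative (\<lambda>x. (x *\<^sub>R d $ i) \<bullet> u)) (at s within S)"
    using assms[of i] unfolding has_vector_derivative_def by (rule has_derivative_inner_left)
  then show "((\<lambda>s. y s \<bullet> b) has_derivative (\<lambda>x. x *\<^sub>R d \<bullet> b)) (at s within S)"
    by (simp add: b inner_axis)
qed

text \<open>Restriction of the equation to the segment from \<open>w0\<close> to \<open>w1\<close>,
  followed by \<open>gronwall_norm\<close>. Applied to a difference of two solutions it gives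
  uniqueness; its rate, linear in the coefficient bound, gives bounds exponential in t.\<close>

lemma linear_ode_growth:
  fixes A :: "complex \<Rightarrow> complex ^ 'n::finite ^ 'n" and y :: "complex \<Rightarrow> complex ^ 'n" and m :: real
  assumes "convex S" and w: "w0 \<in> S" "w1 \<in> S"
    and bound: "\<And>w i j. w \<in> S \<Longrightarrow> cmod (A w $ i $ j) \<le> m"
    and der: "\<And>w i. w \<in> S \<Longrightarrow> ((\<lambda>w. y w $ i) has_field_derivative (A w *v y w) $ i) (at w)"
  shows "norm (y w1) \<le> exp (norm (w1 - w0) * (CARD('n) * (CARD('n) * m))) * norm (y w0)"
proof -
  define l where "l s = w0 + of_real s * (w1 - w0)" for s :: real
  have l: "l s \<in> S" if "s \<in> {0..1}" for s
    using convexD_alt[OF \<open>convex S\<close> w, of s] that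
    by (simp add: l_def algebra_simps scaleR_conv_of_real)
  have dl: "(l has_vector_derivative (w1 - w0)) (at s within {0..1})" for s
    unfolding l_def by (auto intro!: derivative_eq_intros simp: has_vector_derivative_def scaleR_conv_of_real)
  have "norm (y (l 1)) \<le> exp (norm (w1 - w0) * (CARD('n) * (CARD('n) * m))) * norm (y (l 0))"
  proof (rule gronwall_norm[where y = "\<lambda>s. y (l s)" and y' = "\<lambda>s. (w1 - w0) *s (A (l s) *v y (l s))"])
    fix s :: real assume s: "s \<in> {0..1}"
    show "((\<lambda>s. y (l s)) has_vector_derivative (w1 - w0) *s (A (l s) *v y (l s))) (at s within {0..1})"
      using field_vector_diff_chain_within[OF dl has_field_derivative_at_within[OF der[OF l[OF s]]]]
      by (intro has_vector_derivative_vec) (simp only: o_def vector_smult_component)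
    have "norm ((w1 - w0) *s (A (l s) *v y (l s))) = norm (w1 - w0) * norm (A (l s) *v y (l s))"
      by (rule norm_smult)
    also have "\<dots> \<le> norm (w1 - w0) * (CARD('n) * (CARD('n) * m) * norm (y (l s)))"
      by (intro mult_left_mono norm_matrix_vector_le bound l s) simp
    finally show "norm ((w1 - w0) *s (A (l s) *v y (l s))) \<le>
        norm (w1 - w0) * (CARD('n) * (CARD('n) * m)) * norm (y (l s))"
      by (simp add: mult_ac)
  qed
  then show ?thesis by (simp add: l_def)
qed

section \<open>Coordinates on the covering\<close>

lemma matrix_uminus_mult:
  fixes A B :: "complex ^ 'n::finite ^ 'n"
  shows "(- A) ** B = - (A ** B)" "A ** (- B) = - (A ** B)"
  by (simp_all add: matrix_matrix_mult_def vec_eq_iff sum_negf)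

locale covered_bundle =
  fixes E :: "('x::t2_space, 'e, 'r::finite) vbundle" and p :: "'u::t2_space \<Rightarrow> 'x"
  assumes holB: "holomorphic_bundle E" and cover: "universal_cover p"
begin

lemma chart:
  assumes "c \<in> charts E"
  shows chart_open: "open (fst c)" and chart_image_open: "open (snd c ` fst c)"
    and chart_inj: "inj_on (snd c) (fst c)" and chart_cont: "continuous_on (fst c) (snd c)"
    and chart_inv_cont: "continuous_on (snd c ` fst c) (inv_into (fst c) (snd c))"
proof -
  have "riemann_surface (charts E)" using holB by (simp add: holomorphic_bundle_def)
  then have "case c of (U, z) \<Rightarrow> open U \<and> open (z ` U) \<and> (\<exists>q. homeomorphism U (z ` U) z q)"
    using assms unfolding riemann_surface_def by blast
  then obtain q where o: "open (fst c)" "open (snd c ` fst c)" and q: "homeomorphism (fst c) (snd c ` fst c) (snd c) q"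
    by (cases c) auto
  show "open (fst c)" "open (snd c ` fst c)" by (fact o)+
  have qz: "q (snd c x) = x" if "x \<in> fst c" for x using homeomorphism_apply1[OF q that] .
  show i: "inj_on (snd c) (fst c)" by (metis qz inj_onI)
  show "continuous_on (fst c) (snd c)" using q by (simp add: homeomorphism_def)
  have "inv_into (fst c) (snd c) w = q w" if "w \<in> snd c ` fst c" for w
    using that by (auto simp: qz i)
  then show "continuous_on (snd c ` fst c) (inv_into (fst c) (snd c))"
    using homeomorphism_cont2[OF q] by (simp cong: continuous_on_cong)
qed

lemma chart_inv: "c \<in> charts E \<Longrightarrow> x \<in> fst c \<Longrightarrow> inv_into (fst c) (snd c) (snd c x) = x"
  by (simp add: chart_inj)

lemma chart_image_Int_open:
  assumes "c \<in> charts E" "open W" shows "open (snd c ` (fst c \<inter> W))"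
proof -
  have "snd c ` (fst c \<inter> W) = (snd c ` fst c) \<inter> inv_into (fst c) (snd c) -` W"
    using assms(1) by (auto simp: chart_inv image_iff)
  then show ?thesis
    using chart_inv_cont[OF assms(1)] chart_image_open[OF assms(1)] assms(2)
    by (simp add: continuous_open_preimage)
qed

lemma chart_at: obtains c where "c \<in> charts E" "x \<in> fst c"
proof -
  have "x \<in> \<Union> (fst ` charts E)" using holB by (simp add: holomorphic_bundle_def riemann_surface_def)
  then show thesis using that by auto
qed

lemma triv_at: obtains \<tau> where "\<tau> \<in> trivs E" "x \<in> fst \<tau>"
proof -
  have "x \<in> \<Union> (fst ` trivs E)" using holB by (simp add: holomorphic_bundle_def)
  then show thesis using that by auto
qed

lemma triv:
  assumes "\<tau> \<in> trivs E"
  shows triv_open: "open (fst \<tau>)" and triv_bij: "x \<in> fst \<tau> \<Longrightarrow> bij_betw (snd \<tau>) (fibre E x) UNIV"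
  using holB assms unfolding holomorphic_bundle_def by (auto simp: case_prod_unfold)

lemma trans:
  assumes "\<tau> \<in> trivs E" "\<tau>' \<in> trivs E"
  shows trans_apply: "x \<in> fst \<tau> \<inter> fst \<tau>' \<Longrightarrow> e \<in> fibre E x \<Longrightarrow> snd \<tau>' e = trans_fun E \<tau> \<tau>' x *v snd \<tau> e"
    and trans_holo: "holo_fun (charts E) (fst \<tau> \<inter> fst \<tau>') (\<lambda>x. trans_fun E \<tau> \<tau>' x $ i $ j)"
  using holB assms unfolding holomorphic_bundle_def by blast+

definition vec_of :: "('x, 'e, 'r) triv \<Rightarrow> 'x \<Rightarrow> complex ^ 'r \<Rightarrow> 'e" where
  "vec_of \<tau> x v = inv_into (fibre E x) (snd \<tau>) v"

lemma vec_of: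
  assumes "\<tau> \<in> trivs E" "x \<in> fst \<tau>"
  shows vec_of_fibre: "vec_of \<tau> x v \<in> fibre E x" and triv_vec_of: "snd \<tau> (vec_of \<tau> x v) = v"
    and vec_of_triv: "e \<in> fibre E x \<Longrightarrow> vec_of \<tau> x (snd \<tau> e) = e"
proof -
  note b = triv_bij[OF assms]
  show "vec_of \<tau> x v \<in> fibre E x" "snd \<tau> (vec_of \<tau> x v) = v"
    using b unfolding vec_of_def bij_betw_def by (metis UNIV_I inv_into_into, metis UNIV_I f_inv_into_f)
  show "e \<in> fibre E x \<Longrightarrow> vec_of \<tau> x (snd \<tau> e) = e"
    using b by (simp add: vec_of_def bij_betw_def)
qed

lemma triv_eq:
  assumes "\<tau> \<in> trivs E" "x \<in> fst \<tau>" "e \<in> fibre E x" "e' \<in> fibre E x" "snd \<tau> e = snd \<tau> e'"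
  shows "e = e'"
  using assms vec_of_triv by metis

lemma holo_fun_chart:
  assumes "holo_fun (charts E) W f" "c \<in> charts E"
  shows "(f \<circ> inv_into (fst c) (snd c)) holomorphic_on snd c ` (fst c \<inter> W)"
  using assms by (auto simp: holo_fun_def case_prod_unfold)

lemma holo_fun_derivative:
  assumes "holo_fun (charts E) W f" "c \<in> charts E" "open W" "x \<in> fst c" "x \<in> W"
  shows "((f \<circ> inv_into (fst c) (snd c)) has_field_derivative cderiv c f x) (at (snd c x))"
  unfolding cderiv_def using assms
  by (intro holomorphic_derivI[OF holo_fun_chart]) (auto intro: chart_image_Int_open)

lemma chart_holo:
  assumes "c \<in> charts E" shows "holo_fun (charts E) (fst c) (snd c)"
  using holB assms by (auto simp: holomorphic_bundle_def riemann_surface_def)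

lemma p_cont: "continuous_on S p"
  using cover by (auto simp: universal_cover_def covering_space_def intro: continuous_on_subset)

lemma p_open: assumes "open N" shows "open (p ` N)"
proof (subst open_subopen, intro ballI)
  fix y assume "y \<in> p ` N"
  then obtain u where u: "u \<in> N" "y = p u" by auto
  have "covering_space UNIV p UNIV" using cover by (simp add: universal_cover_def)
  from covering_space_local_homeomorphism[OF this UNIV_I[of u]]
  obtain T V q where T: "u \<in> T" "open T" "open V" and h: "homeomorphism T V p q"
    by (metis open_openin subtopology_UNIV)
  have "p ` (N \<inter> T) = V \<inter> q -` N"
    using h by (auto simp: homeomorphism_def image_iff)
  moreover have "continuous_on V q" using h by (simp add: homeomorphism_def)
  ultimately have "open (p ` (N \<inter> T))"
    using T assms by (simp add: continuous_open_preimage)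
  then show "\<exists>T. open T \<and> y \<in> T \<and> T \<subseteq> p ` N" using u T by blast
qed

lemma local_coordinate:
  assumes c: "c \<in> charts E" and N: "open N" "inj_on p N" "p ` N \<subseteq> fst c"
  shows coord_inj: "inj_on (snd c \<circ> p) N"
    and coord_open: "O' \<subseteq> N \<Longrightarrow> open O' \<Longrightarrow> open ((snd c \<circ> p) ` O')"
    and coord_cont: "continuous_on N (snd c \<circ> p)"
    and coord_inv_cont: "continuous_on ((snd c \<circ> p) ` N) (inv_into N (snd c \<circ> p))"
proof -
  show i: "inj_on (snd c \<circ> p) N"
    using N chart_inj[OF c] by (intro comp_inj_on) (auto elim: inj_on_subset)
  show o: "open ((snd c \<circ> p) ` O')" if "O' \<subseteq> N" "open O'" for O'
  proof -
    have "(snd c \<circ> p) ` O' = snd c ` (fst c \<inter> p ` O')" using that N(3) by auto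
    then show ?thesis using chart_image_Int_open[OF c p_open[OF that(2)]] by simp
  qed
  show co: "continuous_on N (snd c \<circ> p)"
    using N(3) by (intro continuous_on_compose p_cont continuous_on_subset[OF chart_cont[OF c]])
  show "continuous_on ((snd c \<circ> p) ` N) (inv_into N (snd c \<circ> p))"
  proof (rule continuous_on_inverse_open_map[OF co refl])
    show "inv_into N (snd c \<circ> p) ((snd c \<circ> p) x) = x" if "x \<in> N" for x
      using i that by (rule inv_into_f_f)
    show "openin (top_of_set ((snd c \<circ> p) ` N)) ((snd c \<circ> p) ` U)" if "openin (top_of_set N) U" for U
      using that o[of U] N(1) by (intro openin_subset_trans[of UNIV _ UNIV] open_subset)
        (auto simp: openin_open_eq)
  qed
qed

text \<open>Local coordinates on the cover are prepared with a ball as image, the shape on which the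
  differential equation is solved. The radius is not prescribed; where its size matters it is
  controlled through the choice of \<open>O'\<close>.\<close>

lemma coordinate_ball:
  assumes c: "c \<in> charts E" and "open O'" "u0 \<in> O'" "p u0 \<in> fst c" "open V" "p u0 \<in> V"
  obtains N \<rho> where "\<rho> > 0" "open N" "u0 \<in> N" "N \<subseteq> O'" "inj_on p N" "p ` N \<subseteq> fst c \<inter> V"
    "(snd c \<circ> p) ` N = ball (snd c (p u0)) \<rho>"
proof -
  have "covering_space UNIV p UNIV" using cover by (simp add: universal_cover_def)
  from covering_space_local_homeomorphism[OF this UNIV_I[of u0]]
  obtain T W q where T: "u0 \<in> T" "open T" and h: "homeomorphism T W p q"
    by (metis open_openin subtopology_UNIV)
  have ip: "inj_on p T" by (rule inj_onI) (metis homeomorphism_apply1[OF h])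
  define N1 where "N1 = T \<inter> O' \<inter> p -` (fst c \<inter> V)"
  have N1: "open N1" unfolding N1_def
    using T assms chart_open[OF c] by (intro open_Int open_vimage p_cont) auto
  have i1: "inj_on p N1" using ip by (rule inj_on_subset) (auto simp: N1_def)
  have s1: "p ` N1 \<subseteq> fst c \<inter> V" by (auto simp: N1_def)
  then have s1': "p ` N1 \<subseteq> fst c" by auto
  have u1: "u0 \<in> N1" using T assms by (auto simp: N1_def)
  let ?Z = "snd c \<circ> p"
  note lc = local_coordinate[OF c N1 i1 s1']
  have "open (?Z ` N1)" using lc(2) N1 by auto
  then obtain \<rho> where \<rho>: "\<rho> > 0" "ball (?Z u0) \<rho> \<subseteq> ?Z ` N1"
    using u1 open_contains_ball by (metis imageI)
  define N where "N = N1 \<inter> ?Z -` ball (?Z u0) \<rho>"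
  have "open N" unfolding N_def by (rule continuous_open_preimage[OF lc(3) N1 open_ball])
  moreover have "?Z ` N = ball (?Z u0) \<rho>" using \<rho>(2) by (auto simp: N_def)
  ultimately show thesis
    using that[of \<rho> N] \<rho>(1) u1 s1 inj_on_subset[OF i1, of N] by (auto simp: N_def N1_def)
qed

end

section \<open>Flat sections on the covering\<close>

text \<open>The connection is $d - A$, so that flat sections solve $s' = A s$.\<close>

locale flat_bundle = covered_bundle E p
  for E :: "('x::t2_space, 'e, 'r::finite) vbundle" and p :: "'u::t2_space \<Rightarrow> 'x" +
  fixes A :: "('x, 'e, 'r) local_form"
  assumes conn: "holo_connection E (\<lambda>c \<tau> x. - A c \<tau> x)"
begin

definition flat_deriv where
  "flat_deriv c \<tau> N s u \<longleftrightarrow> (\<forall>i. ((\<lambda>w. snd \<tau> (s (inv_into N (snd c \<circ> p) w)) $ i) has_field_derivative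
     (A c \<tau> (p u) *v snd \<tau> (s u)) $ i) (at (snd c (p u))))"

text \<open>Quantification over every chart, trivialization and coordinate domain makes this
  literally \<open>flat_section\<close> when \<open>\<Omega>\<close> is everything;
  \<open>flat_deriv_change\<close> reduces the check to one choice around each point.\<close>

definition flat_on where
  "flat_on \<Omega> s \<longleftrightarrow> (\<forall>u\<in>\<Omega>. s u \<in> fibre E (p u)) \<and>
     (\<forall>c\<in>charts E. \<forall>\<tau>\<in>trivs E. \<forall>N. open N \<and> inj_on p N \<and> p ` N \<subseteq> fst c \<inter> fst \<tau> \<and> N \<subseteq> \<Omega> \<longrightarrow>
        (\<forall>u\<in>N. flat_deriv c \<tau> N s u))"

lemma flat_on_subset: "flat_on \<Omega> s \<Longrightarrow> \<Omega>' \<subseteq> \<Omega> \<Longrightarrow> flat_on \<Omega>' s"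
  unfolding flat_on_def by (meson order_trans subsetD)

lemma flat_onD:
  assumes "flat_on \<Omega> s" "u \<in> \<Omega>" shows "s u \<in> fibre E (p u)"
  using assms by (simp add: flat_on_def)

lemma A_holo:
  assumes "c \<in> charts E" "\<tau> \<in> trivs E"
  shows "(\<lambda>w. A c \<tau> (inv_into (fst c) (snd c) w) $ i $ j) holomorphic_on snd c ` (fst c \<inter> fst \<tau>)"
proof -
  have "holo_fun (charts E) (fst c \<inter> fst \<tau>) (\<lambda>x. (- A c \<tau> x) $ i $ j)"
    using conn assms by (simp add: holo_connection_def holo_coeffs_def)
  from holomorphic_on_minus[OF holo_fun_chart[OF this assms(1)]]
  show ?thesis by (simp add: o_def)
qed

text \<open>In the new trivialization the section is \<open>g\<close> times the old one, composed
  with the change of coordinate. The product and chain rules produce a term with the derivative of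
  \<open>g\<close>, which is absorbed by the inhomogeneous term in the transformation law of a
  connection.\<close>

lemma flat_deriv_change:
  assumes d: "flat_deriv c \<tau> N s u"
    and c: "c \<in> charts E" "\<tau> \<in> trivs E" "open N" "inj_on p N" "p ` N \<subseteq> fst c \<inter> fst \<tau>"
    and c': "c' \<in> charts E" "\<tau>' \<in> trivs E" "open N'" "inj_on p N'" "p ` N' \<subseteq> fst c' \<inter> fst \<tau>'"
    and u: "u \<in> N" "u \<in> N'" and s: "\<And>u. u \<in> N \<Longrightarrow> u \<in> N' \<Longrightarrow> s u \<in> fibre E (p u)"
  shows "flat_deriv c' \<tau>' N' s u"
  unfolding flat_deriv_def
proof
  fix i
  let ?x = "p u"
  define g where "g = trans_fun E \<tau> \<tau>'"
  define \<theta> where "\<theta> = snd c \<circ> inv_into (fst c') (snd c')"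
  define q q' where "q = inv_into N (snd c \<circ> p)" and "q' = inv_into N' (snd c' \<circ> p)"
  define G where "G j k = (\<lambda>x. g x $ j $ k) \<circ> inv_into (fst c) (snd c)" for j k
  define f where "f k = (\<lambda>w. snd \<tau> (s (q w)) $ k)" for k
  define J where "J = cderiv c' (snd c) ?x"
  have x: "?x \<in> fst c" "?x \<in> fst c'" "?x \<in> fst \<tau>" "?x \<in> fst \<tau>'" using c c' u by auto
  have pN: "p ` N \<subseteq> fst c" "p ` N' \<subseteq> fst c'" using c c' by auto
  have d\<theta>: "(\<theta> has_field_derivative J) (at (snd c' ?x))"
    unfolding \<theta>_def J_def using holo_fun_derivative[OF chart_holo[OF c(1)] c'(1) chart_open[OF c(1)]] x by simp
  have \<theta>x: "\<theta> (snd c' ?x) = snd c ?x" using x by (simp add: \<theta>_def chart_inv[OF c'(1)])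
  have dG: "(G j k has_field_derivative cderiv c (\<lambda>y. g y $ j $ k) ?x) (at (snd c ?x))" for j k
    unfolding G_def g_def using x
    by (intro holo_fun_derivative[OF trans_holo[OF c(2) c'(2)] c(1)] open_Int triv_open c c') auto
  have Gx: "G j k (snd c ?x) = g ?x $ j $ k" for j k using x by (simp add: G_def chart_inv[OF c(1)])
  have df: "(f k has_field_derivative (A c \<tau> ?x *v snd \<tau> (s u)) $ k) (at (snd c ?x))" for k
    using d by (simp add: flat_deriv_def f_def q_def)
  have qx: "q (snd c ?x) = u"
    using inv_into_f_f[OF coord_inj[OF c(1,3,4) pN(1)] u(1)] by (simp add: q_def)
  have fx: "f k (snd c ?x) = snd \<tau> (s u) $ k" for k by (simp add: f_def qx)
  \<comment> \<open>The connection matrix is \<open>- A\<close>, so the derivative of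
    \<open>g\<close> enters with a plus sign.\<close>
  have law: "(A c' \<tau>' ?x ** g ?x) $ i $ k = J * ((g ?x ** A c \<tau> ?x) $ i $ k + cderiv c (\<lambda>y. g y $ i $ k) ?x)" for k
  proof -
    have "((- A c' \<tau>' ?x) ** g ?x) $ i $ k
        = J * ((g ?x ** (- A c \<tau> ?x)) $ i $ k - cderiv c (\<lambda>y. g y $ i $ k) ?x)"
      using conn c c' x unfolding holo_connection_def g_def J_def by blast
    then show ?thesis unfolding matrix_uminus_mult by (simp add: algebra_simps)
  qed
  have "((\<lambda>w. \<Sum>k\<in>UNIV. G i k (\<theta> w) * f k (\<theta> w)) has_field_derivative
     (\<Sum>k\<in>UNIV. cderiv c (\<lambda>y. g y $ i $ k) ?x * snd \<tau> (s u) $ k + (A c \<tau> ?x *v snd \<tau> (s u)) $ k * g ?x $ i $ k) * J)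
     (at (snd c' ?x))"
  proof (rule DERIV_chain2[of "\<lambda>w. \<Sum>k\<in>UNIV. G i k w * f k w" _ \<theta>, OF _ d\<theta>], unfold \<theta>x)
    have "((\<lambda>w. G i k w * f k w) has_field_derivative
      cderiv c (\<lambda>y. g y $ i $ k) ?x * snd \<tau> (s u) $ k + (A c \<tau> ?x *v snd \<tau> (s u)) $ k * g ?x $ i $ k) (at (snd c ?x))" for k
      using DERIV_mult'[OF dG[of i k] df[of k]] by (simp add: Gx fx algebra_simps)
    then show "((\<lambda>w. \<Sum>k\<in>UNIV. G i k w * f k w) has_field_derivative
      (\<Sum>k\<in>UNIV. cderiv c (\<lambda>y. g y $ i $ k) ?x * snd \<tau> (s u) $ k + (A c \<tau> ?x *v snd \<tau> (s u)) $ k * g ?x $ i $ k)) (at (snd c ?x))"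
      by (rule DERIV_sum)
  qed
  also have "(\<Sum>k\<in>UNIV. cderiv c (\<lambda>y. g y $ i $ k) ?x * snd \<tau> (s u) $ k + (A c \<tau> ?x *v snd \<tau> (s u)) $ k * g ?x $ i $ k) * J
     = (\<Sum>k\<in>UNIV. J * cderiv c (\<lambda>y. g y $ i $ k) ?x * snd \<tau> (s u) $ k) + J * (g ?x *v (A c \<tau> ?x *v snd \<tau> (s u))) $ i"
    by (simp add: sum.distrib algebra_simps sum_distrib_left matrix_vector_mult_def[of "g ?x"])
  also have "\<dots> = (\<Sum>k\<in>UNIV. J * cderiv c (\<lambda>y. g y $ i $ k) ?x * snd \<tau> (s u) $ k) +
      (\<Sum>k\<in>UNIV. J * (g ?x ** A c \<tau> ?x) $ i $ k * snd \<tau> (s u) $ k)"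
    by (simp add: matrix_vector_mul_assoc) (simp add: matrix_vector_mult_def sum_distrib_left mult.assoc)
  also have "\<dots> = (\<Sum>k\<in>UNIV. (A c' \<tau>' ?x ** g ?x) $ i $ k * snd \<tau> (s u) $ k)"
    by (simp add: law algebra_simps flip: sum.distrib)
  also have "\<dots> = (A c' \<tau>' ?x *v (g ?x *v snd \<tau> (s u))) $ i"
    by (simp add: matrix_vector_mul_assoc) (simp add: matrix_vector_mult_def)
  also have "g ?x *v snd \<tau> (s u) = snd \<tau>' (s u)"
    using trans_apply[OF c(2) c'(2), of ?x "s u"] x s[OF u] by (simp add: g_def)
  finally have D: "((\<lambda>w. \<Sum>k\<in>UNIV. G i k (\<theta> w) * f k (\<theta> w)) has_field_derivative
    (A c' \<tau>' ?x *v snd \<tau>' (s u)) $ i) (at (snd c' ?x))" .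
  show "((\<lambda>w. snd \<tau>' (s (inv_into N' (snd c' \<circ> p) w)) $ i) has_field_derivative
         (A c' \<tau>' ?x *v snd \<tau>' (s u)) $ i) (at (snd c' ?x))"
  \<comment> \<open>The product formula describes the section only where the two coordinate domains
    overlap, which is an open neighbourhood of the point by \<open>coord_open\<close>.\<close>
  proof (rule has_field_derivative_transform_within_open[OF D])
    show "open ((snd c' \<circ> p) ` (N \<inter> N'))"
      using c c' by (intro coord_open[OF c'(1,3,4) pN(2)]) auto
    show "snd c' ?x \<in> (snd c' \<circ> p) ` (N \<inter> N')" using u by auto
    fix w assume "w \<in> (snd c' \<circ> p) ` (N \<inter> N')"
    then obtain u' where u': "u' \<in> N" "u' \<in> N'" and w: "w = snd c' (p u')" by auto
    have x': "p u' \<in> fst c" "p u' \<in> fst c'" "p u' \<in> fst \<tau>" "p u' \<in> fst \<tau>'" using c c' u' by auto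
    have "q' w = u'" using inv_into_f_f[OF coord_inj[OF c'(1,3,4) pN(2)] u'(2)] by (simp add: q'_def w)
    moreover have \<theta>w: "\<theta> w = snd c (p u')" using x' by (simp add: \<theta>_def w chart_inv[OF c'(1)])
    moreover have "q (\<theta> w) = u'"
      using inv_into_f_f[OF coord_inj[OF c(1,3,4) pN(1)] u'(1)] by (simp add: q_def \<theta>w)
    moreover have "snd \<tau>' (s u') = g (p u') *v snd \<tau> (s u')"
      using trans_apply[OF c(2) c'(2), of "p u'" "s u'"] x' s[OF u'] by (simp add: g_def)
    ultimately show "(\<Sum>k\<in>UNIV. G i k (\<theta> w) * f k (\<theta> w)) = snd \<tau>' (s (inv_into N' (snd c' \<circ> p) w)) $ i"
      unfolding q'_def[symmetric] using x'
      by (simp add: G_def f_def chart_inv[OF c(1)] matrix_vector_mult_def)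
  qed
qed

end

section \<open>Parallel transport on small sets and along continuous maps\<close>

context flat_bundle
begin

text \<open>A good set is one on which parallel transport is path independent.\<close>

definition good where
  "good N \<longleftrightarrow> open N \<and> (\<forall>u\<in>N. \<forall>u'\<in>N. \<exists>g. path g \<and> path_image g \<subseteq> N \<and> g 0 = u \<and> g 1 = u') \<and>
     (\<forall>u\<in>N. \<forall>e\<in>fibre E (p u). \<exists>s. flat_on N s \<and> s u = e) \<and>
     (\<forall>s s'. \<forall>u\<in>N. \<forall>u'\<in>N. flat_on N s \<longrightarrow> flat_on N s' \<longrightarrow> s u = s' u \<longrightarrow> s u' = s' u')"

lemma good_unique:
  "good N \<Longrightarrow> u \<in> N \<Longrightarrow> u' \<in> N \<Longrightarrow> flat_on N s \<Longrightarrow> flat_on N s' \<Longrightarrow> s u = s' u \<Longrightarrow> s u' = s' u'"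
  unfolding good_def by blast

lemma flat_on_ode:
  assumes s: "flat_on N s" and c: "c \<in> charts E" "\<tau> \<in> trivs E" "open N" "inj_on p N" "p ` N \<subseteq> fst c \<inter> fst \<tau>"
    and w: "w \<in> (snd c \<circ> p) ` N"
  shows "((\<lambda>w. snd \<tau> (s (inv_into N (snd c \<circ> p) w)) $ i) has_field_derivative
     (A c \<tau> (inv_into (fst c) (snd c) w) *v snd \<tau> (s (inv_into N (snd c \<circ> p) w))) $ i) (at w)"
proof -
  obtain u where u: "u \<in> N" "w = snd c (p u)" using w by auto
  have "inv_into N (snd c \<circ> p) w = u"
    using inv_into_f_f[OF coord_inj[OF c(1,3,4)] u(1)] c(5) u by auto
  moreover have "inv_into (fst c) (snd c) w = p u" using u c(5) by (auto simp: chart_inv[OF c(1)])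
  moreover have "flat_deriv c \<tau> N s u" using s c u unfolding flat_on_def by blast
  ultimately show ?thesis by (simp add: flat_deriv_def u(2))
qed

text \<open>The exponent is the coordinate distance times the coefficient bound \<open>m\<close>;
  with \<open>m\<close> proportional to t this becomes the a priori bound on transport.\<close>

lemma ball_growth:
  fixes \<rho> m :: real
  assumes c: "c \<in> charts E" "\<tau> \<in> trivs E" "open N" "inj_on p N" "p ` N \<subseteq> fst c \<inter> fst \<tau>"
    and im: "(snd c \<circ> p) ` N = ball w0 \<rho>"
    and m: "\<And>w i j. w \<in> ball w0 \<rho> \<Longrightarrow> cmod (A c \<tau> (inv_into (fst c) (snd c) w) $ i $ j) \<le> m"
    and s: "flat_on N s" and u: "u \<in> N" "u' \<in> N"
  shows "norm (snd \<tau> (s u')) \<le> exp (norm (snd c (p u') - snd c (p u)) * (CARD('r) * (CARD('r) * m))) * norm (snd \<tau> (s u))"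
proof -
  let ?q = "inv_into N (snd c \<circ> p)"
  have pN: "p ` N \<subseteq> fst c" using c by auto
  have q: "?q (snd c (p u)) = u" if "u \<in> N" for u
    using inv_into_f_f[OF coord_inj[OF c(1,3,4) pN] that] by simp
  have Zb: "snd c (p u) \<in> ball w0 \<rho>" if "u \<in> N" for u using im that by auto
  have "norm (snd \<tau> (s (?q (snd c (p u'))))) \<le>
      exp (norm (snd c (p u') - snd c (p u)) * (CARD('r) * (CARD('r) * m))) * norm (snd \<tau> (s (?q (snd c (p u)))))"
    by (rule linear_ode_growth[OF convex_ball Zb[OF u(1)] Zb[OF u(2)] m]) (use flat_on_ode[OF s c] im in blast)+
  then show ?thesis using q u by simp
qed

text \<open>Existence is Picard iteration in the coordinate ball, uniqueness is the growth estimate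
  applied to a difference of sections, and paths are segments of the ball carried back to
  \<open>N\<close>.\<close>

lemma good_ball:
  fixes \<rho> m :: real
  assumes c: "c \<in> charts E" "\<tau> \<in> trivs E" "open N" "inj_on p N" "p ` N \<subseteq> fst c \<inter> fst \<tau>"
    and im: "(snd c \<circ> p) ` N = ball w0 \<rho>"
    and m: "\<And>w i j. w \<in> ball w0 \<rho> \<Longrightarrow> cmod (A c \<tau> (inv_into (fst c) (snd c) w) $ i $ j) \<le> m"
    and small: "2 * \<rho> * (CARD('r) * m) \<le> 1 / 2"
  shows "good N"
proof -
  let ?Z = "snd c \<circ> p" and ?q = "inv_into N (snd c \<circ> p)"
  have pN: "p ` N \<subseteq> fst c" using c by auto
  have qZ: "?q (?Z u) = u" if "u \<in> N" for u
    using inv_into_f_f[OF coord_inj[OF c(1,3,4) pN] that] .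
  have Zb: "snd c (p u) \<in> ball w0 \<rho>" if "u \<in> N" for u using im that by auto
  have ode: "((\<lambda>w. snd \<tau> (s (?q w)) $ i) has_field_derivative
     (A c \<tau> (inv_into (fst c) (snd c) w) *v snd \<tau> (s (?q w))) $ i) (at w)"
    if "flat_on N s" "w \<in> ball w0 \<rho>" for s w i
    using flat_on_ode[OF that(1) c] that(2) im by blast
  have ex: "\<exists>s. flat_on N s \<and> s u = e" if u: "u \<in> N" and e: "e \<in> fibre E (p u)" for u e
  proof -
    have pNt: "p u \<in> fst \<tau>" if "u \<in> N" for u using c(5) that by auto
    have "(\<lambda>w. A c \<tau> (inv_into (fst c) (snd c) w) $ i $ j) holomorphic_on ball w0 \<rho>" for i j
      using A_holo[OF c(1,2)] by (rule holomorphic_on_subset) (unfold im[symmetric] image_comp[symmetric], intro image_mono c(5))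
    from linear_ode_solution[OF this m small Zb[OF u], of "snd \<tau> e"]
    obtain y where y1: "y (snd c (p u)) = snd \<tau> e"
      and y: "\<And>w i. w \<in> ball w0 \<rho> \<Longrightarrow> ((\<lambda>w. y w $ i) has_field_derivative (A c \<tau> (inv_into (fst c) (snd c) w) *v y w) $ i) (at w)"
      by blast
    define s where "s u = vec_of \<tau> (p u) (y (?Z u))" for u
    have sf: "s u \<in> fibre E (p u)" if "u \<in> N" for u
      unfolding s_def by (rule vec_of_fibre[OF c(2) pNt[OF that]])
    have st: "snd \<tau> (s u) = y (?Z u)" if "u \<in> N" for u
      unfolding s_def by (rule triv_vec_of[OF c(2) pNt[OF that]])
    have d: "flat_deriv c \<tau> N s u" if "u \<in> N" for u
      unfolding flat_deriv_def
    proof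
      fix i
      have "inv_into (fst c) (snd c) (snd c (p u)) = p u" using that pN by (auto simp: chart_inv[OF c(1)])
      then have "((\<lambda>w. y w $ i) has_field_derivative (A c \<tau> (p u) *v snd \<tau> (s u)) $ i) (at (snd c (p u)))"
        using y[OF Zb[OF that], of i] st[OF that] by simp
      then show "((\<lambda>w. snd \<tau> (s (?q w)) $ i) has_field_derivative (A c \<tau> (p u) *v snd \<tau> (s u)) $ i) (at (snd c (p u)))"
      proof (rule has_field_derivative_transform_within_open[OF _ open_ball Zb[OF that]])
        fix w assume "w \<in> ball w0 \<rho>"
        then obtain u' where "u' \<in> N" "w = ?Z u'" using im by blast
        then show "y w $ i = snd \<tau> (s (?q w)) $ i" using qZ[of u'] st[of u'] by simp
      qed
    qed
    have "flat_on N s"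
      unfolding flat_on_def
    proof (intro conjI ballI allI impI)
      fix c' \<tau>' N' u
      assume c': "c' \<in> charts E" "\<tau>' \<in> trivs E" and "open N' \<and> inj_on p N' \<and> p ` N' \<subseteq> fst c' \<inter> fst \<tau>' \<and> N' \<subseteq> N"
        and u: "u \<in> N'"
      then have N': "open N'" "inj_on p N'" "p ` N' \<subseteq> fst c' \<inter> fst \<tau>'" "N' \<subseteq> N" by blast+
      then have "u \<in> N" using u by blast
      show "flat_deriv c' \<tau>' N' s u"
        by (rule flat_deriv_change[OF d[OF \<open>u \<in> N\<close>] c c' N'(1-3) \<open>u \<in> N\<close> u sf])
    qed (rule sf)
    moreover have "s u = e"
      unfolding s_def by (simp add: y1 vec_of_triv[OF c(2) pNt[OF u] e])
    ultimately show ?thesis by blast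
  qed
  have uniq: "s u' = s' u'" if f: "flat_on N s" "flat_on N s'" and u: "u \<in> N" "u' \<in> N" "s u = s' u" for s s' u u'
  proof -
    have "norm ((\<lambda>w. snd \<tau> (s (?q w)) - snd \<tau> (s' (?q w))) (snd c (p u')))
      \<le> exp (norm (snd c (p u') - snd c (p u)) * (CARD('r) * (CARD('r) * m))) *
        norm ((\<lambda>w. snd \<tau> (s (?q w)) - snd \<tau> (s' (?q w))) (snd c (p u)))"
    proof (rule linear_ode_growth[OF convex_ball Zb[OF u(1)] Zb[OF u(2)] m])
      fix w i assume w: "w \<in> ball w0 \<rho>"
      show "((\<lambda>w. (snd \<tau> (s (?q w)) - snd \<tau> (s' (?q w))) $ i) has_field_derivative
        (A c \<tau> (inv_into (fst c) (snd c) w) *v (snd \<tau> (s (?q w)) - snd \<tau> (s' (?q w)))) $ i) (at w)"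
        using DERIV_diff[OF ode[OF f(1) w, of i] ode[OF f(2) w, of i]]
        by (simp add: matrix_vector_mult_diff_distrib)
    qed
    then have "snd \<tau> (s u') = snd \<tau> (s' u')" using qZ[OF u(1)] qZ[OF u(2)] u(3) by simp
    moreover have "p u' \<in> fst \<tau>" using c(5) u by auto
    ultimately show ?thesis
      using triv_eq[OF c(2), of "p u'"] flat_onD[OF f(1) u(2)] flat_onD[OF f(2) u(2)] by blast
  qed
  have pc: "\<exists>g. path g \<and> path_image g \<subseteq> N \<and> g 0 = u \<and> g 1 = u'" if u: "u \<in> N" "u' \<in> N" for u u'
  proof -
    let ?l = "linepath (?Z u) (?Z u')"
    have sub: "path_image ?l \<subseteq> ball w0 \<rho>"
      using Zb u by (simp add: closed_segment_subset)
    have "path (?q \<circ> ?l)"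
      using sub im by (intro path_continuous_image continuous_on_subset[OF coord_inv_cont[OF c(1,3,4) pN]]) auto
    moreover have "path_image (?q \<circ> ?l) \<subseteq> N"
      using sub unfolding path_image_compose im[symmetric] by (auto intro!: inv_into_into)
    ultimately show ?thesis
      using qZ u by (intro exI[of _ "?q \<circ> ?l"]) (auto simp: linepath_def)
  qed
  show "good N" unfolding good_def
    by (intro conjI ballI allI impI) (fact c(3), erule (1) pc, erule (1) ex, erule (4) uniq)
qed

lemma coefficient_bound:
  assumes "c \<in> charts E" "\<tau> \<in> trivs E" "x \<in> fst c" "x \<in> fst \<tau>"
  obtains R m where "R > 0" "\<And>w i j. w \<in> ball (snd c x) R \<Longrightarrow> cmod (A c \<tau> (inv_into (fst c) (snd c) w) $ i $ j) \<le> m"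
proof -
  let ?S = "snd c ` (fst c \<inter> fst \<tau>)"
  have "open ?S" by (intro chart_image_Int_open triv_open assms)
  then obtain R where R: "R > 0" "cball (snd c x) R \<subseteq> ?S"
    using assms open_contains_cball by (metis IntI imageI)
  define f where "f w = (\<Sum>i\<in>UNIV. \<Sum>j\<in>UNIV. cmod (A c \<tau> (inv_into (fst c) (snd c) w) $ i $ j))" for w
  have "continuous_on (cball (snd c x) R) f" unfolding f_def
    by (intro continuous_on_sum continuous_on_norm
        continuous_on_subset[OF holomorphic_on_imp_continuous_on[OF A_holo[OF assms(1,2)]] R(2)])
  then have "compact (f ` cball (snd c x) R)" by (intro compact_continuous_image) auto
  from compact_imp_bounded[OF this]
  obtain m where "\<forall>y\<in>f ` cball (snd c x) R. norm y \<le> m" unfolding bounded_iff by blast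
  then have m: "\<And>w. w \<in> cball (snd c x) R \<Longrightarrow> norm (f w) \<le> m" by blast
  have "cmod (A c \<tau> (inv_into (fst c) (snd c) w) $ i $ j) \<le> f w" for w i j
    unfolding f_def
    by (rule order_trans[OF member_le_sum[of j UNIV] member_le_sum[of i UNIV]]) (auto intro: sum_nonneg)
  then have "cmod (A c \<tau> (inv_into (fst c) (snd c) w) $ i $ j) \<le> m" if "w \<in> ball (snd c x) R" for w i j
    using m[of w] that by (intro order_trans[OF _ order_trans[OF abs_ge_self m[of w, unfolded real_norm_def]]]) auto
  then show thesis using that R(1) by blast
qed

lemma good_neighbourhood:
  assumes "open \<Omega>" "u0 \<in> \<Omega>"
  obtains N where "good N" "u0 \<in> N" "N \<subseteq> \<Omega>"
proof -
  obtain c where c: "c \<in> charts E" "p u0 \<in> fst c" by (rule chart_at)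
  obtain \<tau> where t: "\<tau> \<in> trivs E" "p u0 \<in> fst \<tau>" by (rule triv_at)
  obtain R m where R: "R > 0"
    and m: "\<And>w i j. w \<in> ball (snd c (p u0)) R \<Longrightarrow> cmod (A c \<tau> (inv_into (fst c) (snd c) w) $ i $ j) \<le> m"
    using coefficient_bound[OF c(1) t(1) c(2) t(2)] by metis
  have m0: "m \<ge> 0" using m[of "snd c (p u0)"] R by (meson centre_in_ball norm_ge_zero order_trans)
  \<comment> \<open>With \<open>k = CARD('r) * m\<close> this gives
    \<open>2 * \<rho>1 * k \<le> 2 * k / (4 * k + 1) \<le> 1 / 2\<close>, the smallness asked by
    \<open>good_ball\<close>; the summand 1 keeps the denominator positive when
    \<open>m = 0\<close>.\<close>
  define \<rho>1 where "\<rho>1 = min R (1 / (4 * (CARD('r) * m) + 1))"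
  have "4 * (CARD('r) * m) + 1 > 0" using m0 by (simp add: add_nonneg_pos)
  then have \<rho>1: "\<rho>1 > 0" using R by (simp add: \<rho>1_def)
  define \<Omega>' where "\<Omega>' = \<Omega> \<inter> {u \<in> p -` fst c. snd c (p u) \<in> ball (snd c (p u0)) \<rho>1}"
  have "open (p -` fst c \<inter> (snd c \<circ> p) -` ball (snd c (p u0)) \<rho>1)"
    by (intro continuous_open_preimage continuous_on_compose p_cont open_vimage chart_open c open_ball
        continuous_on_subset[OF chart_cont[OF c(1)]]) auto
  then have "open \<Omega>'" using assms(1) unfolding \<Omega>'_def
    by (intro open_Int) (auto simp: vimage_def Int_def)
  moreover have "u0 \<in> \<Omega>'" using assms c \<rho>1 by (simp add: \<Omega>'_def)
  ultimately obtain N \<rho> where N: "\<rho> > 0" "open N" "u0 \<in> N" "N \<subseteq> \<Omega>'" "inj_on p N" "p ` N \<subseteq> fst c \<inter> fst \<tau>"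
    and im: "(snd c \<circ> p) ` N = ball (snd c (p u0)) \<rho>"
    using coordinate_ball[OF c(1) _ _ c(2) triv_open[OF t(1)] t(2)] by metis
  have sub: "ball (snd c (p u0)) \<rho> \<subseteq> ball (snd c (p u0)) \<rho>1"
    unfolding im[symmetric] using N(4) by (auto simp: \<Omega>'_def)
  then have le: "\<rho> \<le> \<rho>1" using N(1) by (simp add: ball_subset_ball_iff)
  have "2 * \<rho> * (CARD('r) * m) \<le> 2 * \<rho>1 * (CARD('r) * m)"
    using le m0 by (intro mult_right_mono) auto
  also have "\<dots> \<le> 2 * (1 / (4 * (CARD('r) * m) + 1)) * (CARD('r) * m)"
    using m0 by (intro mult_right_mono mult_left_mono) (auto simp: \<rho>1_def)
  also have "\<dots> \<le> 1 / 2"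
  proof -
    have "2 * (1 / (4 * k + 1)) * k \<le> 1 / 2" if "k \<ge> 0" for k :: real using that by (simp add: divide_simps)
    then show ?thesis by this (simp add: m0)
  qed
  finally have "2 * \<rho> * (CARD('r) * m) \<le> 1 / 2" .
  then have "good N"
    using sub by (intro good_ball[OF c(1) t(1) N(2,5,6) im m]) (auto simp: \<rho>1_def)
  then show thesis using that N by (auto simp: \<Omega>'_def)
qed

text \<open>A parallel family of vectors along \<open>H\<close>, expressed through local flat
  sections on the cover. Thus \<open>H\<close> only has to be continuous, and homotopies can be
  treated without differentiating them.\<close>

definition flat_lift :: "('k::topological_space \<Rightarrow> 'u) \<Rightarrow> 'k set \<Rightarrow> ('k \<Rightarrow> 'e) \<Rightarrow> bool" where
  "flat_lift H K \<sigma> \<longleftrightarrow> (\<forall>q\<in>K. \<exists>D \<Omega> s. open D \<and> q \<in> D \<and> open \<Omega> \<and> flat_on \<Omega> s \<and>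
     (\<forall>q'\<in>D \<inter> K. H q' \<in> \<Omega> \<and> \<sigma> q' = s (H q')))"

lemma flat_lift_fibre: "flat_lift H K \<sigma> \<Longrightarrow> q \<in> K \<Longrightarrow> \<sigma> q \<in> fibre E (p (H q))"
proof -
  assume "flat_lift H K \<sigma>" and q: "q \<in> K"
  then obtain D \<Omega> s where "q \<in> D" "flat_on \<Omega> s" "\<forall>q'\<in>D \<inter> K. H q' \<in> \<Omega> \<and> \<sigma> q' = s (H q')"
    unfolding flat_lift_def by blast
  then show ?thesis using q flat_onD[of \<Omega> s "H q"] by auto
qed

lemma flat_lift_section:
  assumes "flat_on \<Omega> s" "open \<Omega>" "H ` K \<subseteq> \<Omega>" shows "flat_lift H K (s \<circ> H)"
  unfolding flat_lift_def using assms
  by (intro ballI exI[of _ UNIV] exI[of _ \<Omega>] exI[of _ s]) auto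

lemma flat_lift_compose:
  assumes "flat_lift H K \<sigma>" "continuous_on K' \<iota>" "\<iota> ` K' \<subseteq> K"
    and "\<And>q. q \<in> K' \<Longrightarrow> H' q = H (\<iota> q)" "\<And>q. q \<in> K' \<Longrightarrow> \<sigma>' q = \<sigma> (\<iota> q)"
  shows "flat_lift H' K' \<sigma>'"
  unfolding flat_lift_def
proof
  fix q assume q: "q \<in> K'"
  then have "\<iota> q \<in> K" using assms(3) by auto
  from assms(1)[unfolded flat_lift_def, rule_format, OF this]
  obtain D \<Omega> s where D: "open D" "\<iota> q \<in> D" and s: "open \<Omega>" "flat_on \<Omega> s" "\<forall>q'\<in>D \<inter> K. H q' \<in> \<Omega> \<and> \<sigma> q' = s (H q')"
    by blast
  from assms(2)[unfolded continuous_on_open_invariant, rule_format, OF D(1)]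
  obtain D' where D': "open D'" "D' \<inter> K' = \<iota> -` D \<inter> K'" by blast
  show "\<exists>D \<Omega> s. open D \<and> q \<in> D \<and> open \<Omega> \<and> flat_on \<Omega> s \<and> (\<forall>q'\<in>D \<inter> K'. H' q' \<in> \<Omega> \<and> \<sigma>' q' = s (H' q'))"
  proof (intro exI[of _ D'] exI[of _ \<Omega>] exI[of _ s] conjI D' s ballI)
    show "q \<in> D'" using D' D q by auto
    fix q' assume "q' \<in> D' \<inter> K'"
    then have "q' \<in> K'" "\<iota> q' \<in> D \<inter> K" using D' assms(3) by auto
    then show "H' q' \<in> \<Omega>" "\<sigma>' q' = s (H' q')" using s assms(4,5) by auto
  qed
qed

text \<open>On a good neighbourhood two flat sections that agree at one point agree everywhere, so
  the truth value of the equation between the two lifts is locally constant on the connected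
  domain.\<close>

lemma flat_lift_unique:
  assumes "connected K" "continuous_on K H" "flat_lift H K \<sigma>" "flat_lift H K \<sigma>'"
    and q: "q0 \<in> K" "q1 \<in> K" "\<sigma> q0 = \<sigma>' q0"
  shows "\<sigma> q1 = \<sigma>' q1"
proof -
  have "\<sigma> q0 = \<sigma>' q0 \<longleftrightarrow> \<sigma> q1 = \<sigma>' q1"
  proof (rule connected_equivalence_relation[OF assms(1) q(1,2), of "\<lambda>x y. \<sigma> x = \<sigma>' x \<longleftrightarrow> \<sigma> y = \<sigma>' y"])
    fix a assume a: "a \<in> K"
    obtain D \<Omega> s where D: "open D" "a \<in> D" "open \<Omega>" "flat_on \<Omega> s" and s: "\<And>q'. q' \<in> D \<inter> K \<Longrightarrow> H q' \<in> \<Omega> \<and> \<sigma> q' = s (H q')"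
      using assms(3)[unfolded flat_lift_def, rule_format, OF a] by blast
    obtain D' \<Omega>' s' where D': "open D'" "a \<in> D'" "open \<Omega>'" "flat_on \<Omega>' s'" and s': "\<And>q'. q' \<in> D' \<inter> K \<Longrightarrow> H q' \<in> \<Omega>' \<and> \<sigma>' q' = s' (H q')"
      using assms(4)[unfolded flat_lift_def, rule_format, OF a] by blast
    have "open (\<Omega> \<inter> \<Omega>')" "H a \<in> \<Omega> \<inter> \<Omega>'" using D D' s[of a] s'[of a] a by auto
    then obtain N where N: "good N" "H a \<in> N" "N \<subseteq> \<Omega> \<inter> \<Omega>'" by (rule good_neighbourhood)
    then have f: "flat_on N s" "flat_on N s'" using D D' flat_on_subset by auto
    have "open N" using N(1) by (simp add: good_def)
    with assms(2)[unfolded continuous_on_open_invariant, rule_format, of N]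
    obtain T where T: "open T" "T \<inter> K = H -` N \<inter> K" by blast
    show "\<exists>T. openin (top_of_set K) T \<and> a \<in> T \<and> (\<forall>x\<in>T. \<sigma> a = \<sigma>' a \<longleftrightarrow> \<sigma> x = \<sigma>' x)"
    proof (intro exI[of _ "K \<inter> (T \<inter> D \<inter> D')"] conjI ballI)
      show "openin (top_of_set K) (K \<inter> (T \<inter> D \<inter> D'))" using T D D' by (intro openin_open_Int open_Int)
      show "a \<in> K \<inter> (T \<inter> D \<inter> D')" using a T D D' N by auto
      fix x assume x: "x \<in> K \<inter> (T \<inter> D \<inter> D')"
      then have "H x \<in> N" using T by auto
      then have "s (H a) = s' (H a) \<longleftrightarrow> s (H x) = s' (H x)"
        using good_unique[OF N(1) N(2) _ f] good_unique[OF N(1) _ N(2) f] by blast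
      then show "\<sigma> a = \<sigma>' a \<longleftrightarrow> \<sigma> x = \<sigma>' x" using s[of a] s[of x] s'[of a] s'[of x] a D D' x by auto
    qed
  qed auto
  then show ?thesis using q by simp
qed

lemma flat_lift_merge:
  assumes "closed K1" "closed K2" "continuous_on (K1 \<union> K2) H" "flat_lift H K1 \<sigma>1" "flat_lift H K2 \<sigma>2"
    and eq: "\<And>q. q \<in> K1 \<inter> K2 \<Longrightarrow> \<sigma>1 q = \<sigma>2 q"
  shows "flat_lift H (K1 \<union> K2) (\<lambda>q. if q \<in> K1 then \<sigma>1 q else \<sigma>2 q)"
  unfolding flat_lift_def
proof
  let ?P = "\<lambda>q D \<Omega> s. open D \<and> q \<in> D \<and> open \<Omega> \<and> flat_on \<Omega> s \<and>
    (\<forall>q'\<in>D \<inter> (K1 \<union> K2). H q' \<in> \<Omega> \<and> (if q' \<in> K1 then \<sigma>1 q' else \<sigma>2 q') = s (H q'))"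
  fix q assume q: "q \<in> K1 \<union> K2"
  have 1: "\<exists>D \<Omega> s. open D \<and> q \<in> D \<and> open \<Omega> \<and> flat_on \<Omega> s \<and> (\<forall>q'\<in>D \<inter> K1. H q' \<in> \<Omega> \<and> \<sigma>1 q' = s (H q'))" if "q \<in> K1"
    using assms(4)[unfolded flat_lift_def, rule_format, OF that] .
  have 2: "\<exists>D \<Omega> s. open D \<and> q \<in> D \<and> open \<Omega> \<and> flat_on \<Omega> s \<and> (\<forall>q'\<in>D \<inter> K2. H q' \<in> \<Omega> \<and> \<sigma>2 q' = s (H q'))" if "q \<in> K2"
    using assms(5)[unfolded flat_lift_def, rule_format, OF that] .
  consider "q \<in> K1" "q \<notin> K2" | "q \<in> K2" "q \<notin> K1" | "q \<in> K1" "q \<in> K2" using q by blast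
  then show "\<exists>D \<Omega> s. ?P q D \<Omega> s"
  proof cases
    case i: 1
    from 1[OF i(1)] obtain D \<Omega> s where D: "open D" "q \<in> D" "open \<Omega>" "flat_on \<Omega> s"
      and s: "\<And>q'. q' \<in> D \<inter> K1 \<Longrightarrow> H q' \<in> \<Omega> \<and> \<sigma>1 q' = s (H q')" by blast
    \<comment> \<open>Away from the overlap the other piece, being closed, can be removed from the
      neighbourhood.\<close>
    have "?P q (D \<inter> - K2) \<Omega> s" using D s i assms(2) by auto
    then show ?thesis by blast
  next
    case i: 2
    from 2[OF i(1)] obtain D \<Omega> s where D: "open D" "q \<in> D" "open \<Omega>" "flat_on \<Omega> s"
      and s: "\<And>q'. q' \<in> D \<inter> K2 \<Longrightarrow> H q' \<in> \<Omega> \<and> \<sigma>2 q' = s (H q')" by blast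
    have "?P q (D \<inter> - K1) \<Omega> s" using D s i assms(1) by auto
    then show ?thesis by blast
  next
    case 3
    obtain D \<Omega> s where D: "open D" "q \<in> D" "open \<Omega>" "flat_on \<Omega> s"
      and s: "\<And>q'. q' \<in> D \<inter> K1 \<Longrightarrow> H q' \<in> \<Omega> \<and> \<sigma>1 q' = s (H q')" using 1[OF 3(1)] by blast
    obtain D' \<Omega>' s' where D': "open D'" "q \<in> D'" "open \<Omega>'" "flat_on \<Omega>' s'"
      and s': "\<And>q'. q' \<in> D' \<inter> K2 \<Longrightarrow> H q' \<in> \<Omega>' \<and> \<sigma>2 q' = s' (H q')" using 2[OF 3(2)] by blast
    have "open (\<Omega> \<inter> \<Omega>')" "H q \<in> \<Omega> \<inter> \<Omega>'" using D D' s[of q] s'[of q] 3 by auto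
    then obtain N where N: "good N" "H q \<in> N" "N \<subseteq> \<Omega> \<inter> \<Omega>'" by (rule good_neighbourhood)
    then have f: "flat_on N s" "flat_on N s'" using D D' flat_on_subset by auto
    have "open N" using N(1) by (simp add: good_def)
    with assms(3)[unfolded continuous_on_open_invariant, rule_format, of N]
    obtain T where T: "open T" "T \<inter> (K1 \<union> K2) = H -` N \<inter> (K1 \<union> K2)" by blast
    \<comment> \<open>At a common point the two local sections agree at \<open>H q\<close>, hence on
      the good set \<open>N\<close>, so that \<open>s\<close> alone describes both pieces
      nearby.\<close>
    have "s (H q) = s' (H q)" using s[of q] s'[of q] eq[of q] 3 D D' by auto
    then have ss: "s x = s' x" if "x \<in> N" for x using good_unique[OF N(1) N(2) that f] by blast
    have "?P q (D \<inter> D' \<inter> T) N s"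
    proof (intro conjI ballI)
      show "open (D \<inter> D' \<inter> T)" using D D' T by auto
      show "q \<in> D \<inter> D' \<inter> T" using D D' T N q by blast
      fix q' assume q': "q' \<in> D \<inter> D' \<inter> T \<inter> (K1 \<union> K2)"
      then show HN: "H q' \<in> N" using T by blast
      show "(if q' \<in> K1 then \<sigma>1 q' else \<sigma>2 q') = s (H q')"
        using q' s[of q'] s'[of q'] ss[OF HN] by auto
    qed (fact f \<open>open N\<close>)+
    then show ?thesis by blast
  qed
qed

end

section \<open>Trivial monodromy and global flat sections\<close>

context flat_bundle
begin

definition liftable where
  "liftable H K \<longleftrightarrow> (\<forall>q\<in>K. \<forall>e\<in>fibre E (p (H q)). \<exists>\<sigma>. flat_lift H K \<sigma> \<and> \<sigma> q = e)"

lemma flat_lift_subset: "flat_lift H K \<sigma> \<Longrightarrow> K' \<subseteq> K \<Longrightarrow> flat_lift H K' \<sigma>"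
  by (rule flat_lift_compose[where \<iota> = id]) (auto simp: id_def)

text \<open>When the second lift is chosen, agreement can be arranged at one common point only;
  connectedness of the overlap spreads it to all of \<open>K1 \<inter> K2\<close>.\<close>

lemma liftable_merge:
  assumes K: "closed K1" "closed K2" "connected (K1 \<inter> K2)" "K1 \<inter> K2 \<noteq> {}" and H: "continuous_on (K1 \<union> K2) H"
    and l: "liftable H K1" "liftable H K2"
  shows "liftable H (K1 \<union> K2)"
proof -
  obtain q' where q': "q' \<in> K1" "q' \<in> K2" using K(4) by blast
  have HI: "continuous_on (K1 \<inter> K2) H" using H by (rule continuous_on_subset) auto
  have glue: "flat_lift H (K1 \<union> K2) (\<lambda>q. if q \<in> K1 then \<sigma>1 q else \<sigma>2 q)"
    and agree: "\<And>q. q \<in> K1 \<inter> K2 \<Longrightarrow> \<sigma>1 q = \<sigma>2 q"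
    if s: "flat_lift H K1 \<sigma>1" "flat_lift H K2 \<sigma>2" "\<sigma>1 q' = \<sigma>2 q'" for \<sigma>1 \<sigma>2
  proof -
    have eq: "\<sigma>1 q = \<sigma>2 q" if "q \<in> K1 \<inter> K2" for q
    proof (rule flat_lift_unique[OF K(3) HI, of \<sigma>1 \<sigma>2 q' q])
      show "flat_lift H (K1 \<inter> K2) \<sigma>1" "flat_lift H (K1 \<inter> K2) \<sigma>2"
        using s by (auto intro: flat_lift_subset)
    qed (use q' that s in auto)
    show "flat_lift H (K1 \<union> K2) (\<lambda>q. if q \<in> K1 then \<sigma>1 q else \<sigma>2 q)"
      using flat_lift_merge[OF K(1,2) H s(1,2) eq] .
    show "\<And>q. q \<in> K1 \<inter> K2 \<Longrightarrow> \<sigma>1 q = \<sigma>2 q" by (rule eq)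
  qed
  show ?thesis
    unfolding liftable_def
  proof (intro ballI)
    fix q e assume q: "q \<in> K1 \<union> K2" and e: "e \<in> fibre E (p (H q))"
    show "\<exists>\<sigma>. flat_lift H (K1 \<union> K2) \<sigma> \<and> \<sigma> q = e"
    proof (cases "q \<in> K1")
      case True
      from l(1)[unfolded liftable_def, rule_format, OF True e]
      obtain \<sigma>1 where s1: "flat_lift H K1 \<sigma>1" "\<sigma>1 q = e" by blast
      from l(2)[unfolded liftable_def, rule_format, OF q'(2) flat_lift_fibre[OF s1(1) q'(1)]]
      obtain \<sigma>2 where s2: "flat_lift H K2 \<sigma>2" "\<sigma>2 q' = \<sigma>1 q'" by blast
      show ?thesis using glue[OF s1(1) s2(1) s2(2)[symmetric]] True s1(2)
        by (intro exI[of _ "\<lambda>q. if q \<in> K1 then \<sigma>1 q else \<sigma>2 q"]) auto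
    next
      case False
      then have qK: "q \<in> K2" using q by blast
      from l(2)[unfolded liftable_def, rule_format, OF qK e]
      obtain \<sigma>2 where s2: "flat_lift H K2 \<sigma>2" "\<sigma>2 q = e" by blast
      from l(1)[unfolded liftable_def, rule_format, OF q'(1) flat_lift_fibre[OF s2(1) q'(2)]]
      obtain \<sigma>1 where s1: "flat_lift H K1 \<sigma>1" "\<sigma>1 q' = \<sigma>2 q'" by blast
      show ?thesis using glue[OF s1(1) s2(1) s1(2)] False s2(2)
        by (intro exI[of _ "\<lambda>q. if q \<in> K1 then \<sigma>1 q else \<sigma>2 q"]) auto
    qed
  qed
qed

lemma liftable_good:
  assumes "good N" "H ` K \<subseteq> N" shows "liftable H K"
  unfolding liftable_def
proof (intro ballI)
  fix q e assume q: "q \<in> K" and e: "e \<in> fibre E (p (H q))"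
  have "H q \<in> N" using assms q by blast
  with assms(1) e obtain s where "flat_on N s" "s (H q) = e" unfolding good_def by blast
  then show "\<exists>\<sigma>. flat_lift H K \<sigma> \<and> \<sigma> q = e"
    using flat_lift_section[of N s H K] assms by (intro exI[of _ "s \<circ> H"]) (auto simp: good_def)
qed

text \<open>Two nested bisections: around each \<open>x\<close> a thin vertical strip is liftable,
  by stacking small rectangles, and then strips are joined side by side. Neighbouring pieces meet in
  a segment, which is connected.\<close>

lemma liftable_rectangle:
  fixes H :: "real \<times> real \<Rightarrow> 'u"
  assumes H: "continuous_on UNIV H" and ab: "a \<le> b" "c \<le> d"
  shows "liftable H ({a..b} \<times> {c..d})"
proof -
  have join: "liftable H (A \<times> B \<union> A' \<times> B')"
    if "liftable H (A \<times> B)" "liftable H (A' \<times> B')" "closed A" "closed B" "closed A'" "closed B'"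
      "connected (A \<inter> A')" "connected (B \<inter> B')" "A \<inter> A' \<noteq> {}" "B \<inter> B' \<noteq> {}" for A B A' B'
    using that
    by (intro liftable_merge continuous_on_subset[OF H])
       (auto simp: Times_Int_Times closed_Times connected_Times)
  \<comment> \<open>The width \<open>\<delta>\<close> depends on \<open>x\<close> and serves the
    whole height; when two heights are joined the smaller of their widths is taken.\<close>
  have strip: "\<exists>\<delta>>0. \<forall>a b. a \<le> x \<and> x \<le> b \<and> b - a < \<delta> \<longrightarrow> liftable H ({a..b} \<times> {c..d})" for x
    using ab(2)
  proof (induction c d rule: Bolzano)
    case (trans c d e)
    obtain \<delta>1 \<delta>2 where 1: "\<delta>1 > 0" "\<And>a b. a \<le> x \<and> x \<le> b \<and> b - a < \<delta>1 \<Longrightarrow> liftable H ({a..b} \<times> {c..d})"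
      and 2: "\<delta>2 > 0" "\<And>a b. a \<le> x \<and> x \<le> b \<and> b - a < \<delta>2 \<Longrightarrow> liftable H ({a..b} \<times> {d..e})"
      using trans(1,2) by blast
    have "liftable H ({a..b} \<times> {c..e})" if "a \<le> x" "x \<le> b" "b - a < min \<delta>1 \<delta>2" for a b
    proof -
      have "{a..b} \<times> {c..e} = {a..b} \<times> {c..d} \<union> {a..b} \<times> {d..e}" using trans by auto
      moreover have "{c..d} \<inter> {d..e} = {d}" using trans by auto
      ultimately show ?thesis using join[OF 1(2) 2(2), of a b a b] that by auto
    qed
    then show ?case using 1(1) 2(1) by (intro exI[of _ "min \<delta>1 \<delta>2"]) auto
  next
    case (local y)
    obtain N where N: "good N" "H (x, y) \<in> N" by (rule good_neighbourhood[OF open_UNIV UNIV_I])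
    then have "open (H -` N)" using H by (auto simp: good_def intro: open_vimage)
    then obtain A B where AB: "open A" "open B" "(x, y) \<in> A \<times> B" "A \<times> B \<subseteq> H -` N"
      using N(2) by (metis open_prod_elim vimageI)
    obtain \<delta>1 where 1: "\<delta>1 > 0" "ball x \<delta>1 \<subseteq> A" using AB(1,3) unfolding open_contains_ball by auto
    obtain \<delta>2 where 2: "\<delta>2 > 0" "ball y \<delta>2 \<subseteq> B" using AB(2,3) unfolding open_contains_ball by auto
    have "liftable H ({a..b} \<times> {c..d})" if "c \<le> y" "y \<le> d" "d - c < \<delta>2" "a \<le> x" "x \<le> b" "b - a < \<delta>1" for a b c d
    proof (rule liftable_good[OF N(1)])
      have "{a..b} \<subseteq> ball x \<delta>1" "{c..d} \<subseteq> ball y \<delta>2" using that by (auto simp: dist_real_def)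
      then show "H ` ({a..b} \<times> {c..d}) \<subseteq> N" using 1 2 AB(4) by blast
    qed
    then show ?case using 1(1) 2(1)
      by (intro exI[of _ \<delta>2] conjI allI impI exI[of _ \<delta>1]) auto
  qed
  show ?thesis using ab(1)
  proof (induction a b rule: Bolzano)
    case (trans a b e)
    have "{a..e} \<times> {c..d} = {a..b} \<times> {c..d} \<union> {b..e} \<times> {c..d}" using trans by auto
    moreover have "{a..b} \<inter> {b..e} = {b}" using trans by auto
    ultimately show ?case using join[OF trans(1,2)] ab by auto
  next
    case (local x) then show ?case using strip[of x] by blast
  qed
qed

text \<open>Retraction of the line onto the unit interval: it extends paths and homotopies to the
  plane, where \<open>liftable_rectangle\<close> asks for continuity.\<close>

definition clamp01 :: "real \<Rightarrow> real" where "clamp01 x = max 0 (min 1 x)"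

lemma clamp01: "clamp01 x \<in> {0..1}" "x \<in> {0..1} \<Longrightarrow> clamp01 x = x" "continuous_on S clamp01"
  unfolding clamp01_def by (auto intro!: continuous_intros)

text \<open>A path is treated as a homotopy that is constant in the first variable.\<close>

lemma liftable_path:
  assumes "path g" "e \<in> fibre E (p (g 0))"
  obtains \<sigma> where "flat_lift g {0..1} \<sigma>" "\<sigma> 0 = e"
proof -
  define H where "H = (\<lambda>q :: real \<times> real. g (clamp01 (snd q)))"
  have "continuous_on UNIV H"
    unfolding H_def
    by (rule continuous_on_compose2[OF assms(1)[unfolded path_def] continuous_on_compose2[OF clamp01(3) continuous_on_snd[OF continuous_on_id]]])
       (use clamp01(1) in auto)
  then have "liftable H ({0..1} \<times> {0..1})" by (intro liftable_rectangle) auto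
  moreover have "e \<in> fibre E (p (H (0, 0)))" using assms(2) by (simp add: H_def clamp01(2))
  ultimately obtain \<sigma> where s: "flat_lift H ({0..1} \<times> {0..1}) \<sigma>" "\<sigma> (0, 0) = e"
    unfolding liftable_def by (metis atLeastAtMost_iff mem_Sigma_iff order_refl zero_le_one)
  have "flat_lift g {0..1} (\<lambda>t. \<sigma> (0, t))"
    by (rule flat_lift_compose[OF s(1), of _ "\<lambda>t. (0, t)"])
       (auto simp: H_def clamp01(2) intro!: continuous_intros)
  then show thesis using that s(2) by blast
qed

lemma UNIV_simply_connected: "simply_connected (UNIV :: 'u set)"
  using cover by (simp add: universal_cover_def)

lemma const_path: "path (\<lambda>_. u)"
  by (simp add: path_def)

text \<open>In \<open>simply_connected\<close> any two loops are freely homotopic, even constant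
  loops at different points; path connectedness is therefore included.\<close>

lemma loop_homotopy:
  fixes g g' :: "real \<Rightarrow> 'u"
  assumes "path g" "path g'" "g 0 = g 1" "g' 0 = g' 1"
  shows "\<exists>h :: real \<times> real \<Rightarrow> 'u. continuous_on ({0..1} \<times> {0..1}) h \<and> (\<forall>x\<in>{0..1}. h (0, x) = g x) \<and>
    (\<forall>x\<in>{0..1}. h (1, x) = g' x) \<and> (\<forall>t\<in>{0..1}. h (t, 1) = h (t, 0))"
proof -
  have "homotopic_loops UNIV g g'"
    using UNIV_simply_connected[unfolded simply_connected_def, rule_format, of g g'] assms
    by (simp add: pathstart_def pathfinish_def)
  then show ?thesis
    unfolding homotopic_loops by (simp add: pathstart_def pathfinish_def)
qed

text \<open>The track of the base point during a free homotopy between two constant loops.\<close>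

lemma path_between: obtains g where "path g" "g 0 = u" "g 1 = (u' :: 'u)"
proof -
  obtain h :: "real \<times> real \<Rightarrow> 'u" where h: "continuous_on ({0..1} \<times> {0..1}) h"
    "\<forall>x\<in>{0..1}. h (0, x) = u" "\<forall>x\<in>{0..1}. h (1, x) = u'"
    using loop_homotopy[OF const_path[of u] const_path[of u'] refl refl] by blast
  have "path (\<lambda>t. h (t, 0))"
    unfolding path_def by (rule continuous_on_compose2[OF h(1)]) (auto intro!: continuous_intros)
  then show thesis using that[of "\<lambda>t. h (t, 0)"] h(2,3) by simp
qed

text \<open>Along a free homotopy to a constant loop, the lifts over the two vertical sides of the square
  agree at the bottom, hence at the top.\<close>

lemma trivial_monodromy:
  assumes "path g" "g 0 = g 1" "flat_lift g {0..1} \<sigma>"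
  shows "\<sigma> 0 = \<sigma> 1"
proof -
  obtain h :: "real \<times> real \<Rightarrow> 'u" where h: "continuous_on ({0..1} \<times> {0..1}) h" "\<forall>x\<in>{0..1}. h (0, x) = g 0"
    "\<forall>x\<in>{0..1}. h (1, x) = g x" "\<forall>t\<in>{0..1}. h (t, 1) = h (t, 0)"
    using loop_homotopy[OF const_path[of "g 0"] assms(1) refl assms(2)] by blast
  define H where "H = (\<lambda>q :: real \<times> real. h (clamp01 (fst q), clamp01 (snd q)))"
  have "continuous_on UNIV H"
    unfolding H_def
    by (rule continuous_on_compose2[OF h(1)])
       (use clamp01(1) in \<open>auto intro!: continuous_on_Pair continuous_on_compose2[OF clamp01(3)] continuous_intros\<close>)
  then have l: "liftable H ({0..1} \<times> {0..1})" by (intro liftable_rectangle) auto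
  have "\<sigma> 0 \<in> fibre E (p (H (1, 0)))"
    using flat_lift_fibre[OF assms(3), of 0] h(3) by (simp add: H_def clamp01(2))
  with l obtain \<tau> where t: "flat_lift H ({0..1} \<times> {0..1}) \<tau>" "\<tau> (1, 0) = \<sigma> 0"
    unfolding liftable_def by (metis atLeastAtMost_iff mem_Sigma_iff order_refl zero_le_one)
  have side: "flat_lift H' {0..1} (\<lambda>t. \<tau> (\<iota> t))"
    if "continuous_on {0..1} \<iota>" "\<iota> ` {0..1} \<subseteq> {0..1} \<times> {0..1}" "\<And>t. t \<in> {0..1} \<Longrightarrow> H' t = H (\<iota> t)"
    for H' and \<iota> :: "real \<Rightarrow> real \<times> real"
    by (rule flat_lift_compose[OF t(1) that(1,2)]) (use that(3) in auto)
  have conn: "connected {0..1::real}" by simp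
  have "flat_lift (\<lambda>_. g 0) {0..1} (\<lambda>x. \<tau> (0, x))"
    by (rule side) (auto simp: H_def clamp01(2) h intro!: continuous_intros)
  \<comment> \<open>Over a constant map the constant family is a lift too, being the previous lift
    composed with a constant parameter.\<close>
  moreover have "flat_lift (\<lambda>_. g 0) {0..1} (\<lambda>x. \<tau> (0, 0))"
    by (rule flat_lift_compose[OF calculation, of _ "\<lambda>_. 0"]) auto
  ultimately have bottom: "\<tau> (0, 1) = \<tau> (0, 0)"
    by (intro flat_lift_unique[OF conn continuous_on_const, of _ "\<lambda>x. \<tau> (0, x)" "\<lambda>x. \<tau> (0, 0)" 0 1]) auto
  have cH: "continuous_on {0..1} (\<lambda>t. h (t, 0))"
    by (rule continuous_on_compose2[OF h(1)]) (auto intro!: continuous_intros)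
  have "flat_lift (\<lambda>t. h (t, 0)) {0..1} (\<lambda>t. \<tau> (t, 0))"
    by (rule side) (auto simp: H_def clamp01(2) h intro!: continuous_intros)
  moreover have "flat_lift (\<lambda>t. h (t, 0)) {0..1} (\<lambda>t. \<tau> (t, 1))"
    by (rule side) (auto simp: H_def clamp01(2) h intro!: continuous_intros)
  ultimately have sides: "\<tau> (1, 0) = \<tau> (1, 1)"
    using bottom by (intro flat_lift_unique[OF conn cH, of "\<lambda>t. \<tau> (t, 0)" "\<lambda>t. \<tau> (t, 1)" 0 1]) auto
  have "flat_lift g {0..1} (\<lambda>x. \<tau> (1, x))"
    by (rule side) (auto simp: H_def clamp01(2) h intro!: continuous_intros)
  then have "\<tau> (1, 1) = \<sigma> 1"
    using assms(3) t(2)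
    by (intro flat_lift_unique[OF conn assms(1)[unfolded path_def], of "\<lambda>x. \<tau> (1, x)" \<sigma> 0 1]) auto
  then show ?thesis using sides t(2) by simp
qed

text \<open>Trivial monodromy for the loop \<open>g\<close> followed by the reverse of
  \<open>g'\<close>: its lift starts and ends at \<open>\<sigma> 0\<close>, and its value at the
  midpoint is the endpoint of both given lifts.\<close>

lemma lift_endpoint_unique:
  assumes g: "path g" "path g'" "g 0 = g' 0" "g 1 = g' 1"
    and l: "flat_lift g {0..1} \<sigma>" "flat_lift g' {0..1} \<sigma>'" "\<sigma> 0 = \<sigma>' 0"
  shows "\<sigma> 1 = \<sigma>' 1"
proof -
  define L where "L = g +++ reversepath g'"
  have L: "path L" unfolding L_def
    using g by (intro path_join_imp path_reversepath[THEN iffD2]) (auto simp: pathstart_def pathfinish_def reversepath_def)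
  have L01: "L 0 = L 1" using g by (simp add: L_def joinpaths_def reversepath_def)
  have L1: "L t = g (2 * t)" if "t \<le> 1/2" for t using that by (simp add: L_def joinpaths_def)
  have L2: "L t = g' (2 - 2 * t)" if "t \<ge> 1/2" for t
  proof (cases "t = 1/2")
    case True show ?thesis using g(4) unfolding True L_def joinpaths_def by simp
  qed (use that in \<open>auto simp: L_def joinpaths_def reversepath_def\<close>)
  have "\<sigma> 0 \<in> fibre E (p (L 0))" using flat_lift_fibre[OF l(1), of 0] L1[of 0] by simp
  then obtain \<tau> where t: "flat_lift L {0..1} \<tau>" "\<tau> 0 = \<sigma> 0" using liftable_path[OF L] by blast
  have t1: "\<tau> 1 = \<sigma> 0" using trivial_monodromy[OF L L01 t(1)] t(2) by simp
  have "flat_lift L {0..1/2} (\<lambda>t. \<sigma> (2 * t))"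
    by (rule flat_lift_compose[OF l(1), of _ "\<lambda>t. 2 * t"]) (auto simp: L1 intro!: continuous_intros)
  moreover have "flat_lift L {0..1/2} \<tau>" by (rule flat_lift_subset[OF t(1)]) auto
  moreover have c: "continuous_on {0..1} L" using L by (simp add: path_def)
  moreover have "continuous_on {0..1/2} L" by (rule continuous_on_subset[OF c]) auto
  ultimately have 1: "\<tau> (1/2) = \<sigma> 1"
    using flat_lift_unique[of "{0..1/2}" L \<tau> "\<lambda>t. \<sigma> (2 * t)" 0 "1/2"] t(2) by simp
  have "flat_lift L {1/2..1} (\<lambda>t. \<sigma>' (2 - 2 * t))"
    by (rule flat_lift_compose[OF l(2), of _ "\<lambda>t. 2 - 2 * t"]) (auto simp: L2 intro!: continuous_intros)
  moreover have "flat_lift L {1/2..1} \<tau>" by (rule flat_lift_subset[OF t(1)]) auto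
  moreover have "continuous_on {1/2..1} L" by (rule continuous_on_subset[OF c]) auto
  ultimately have "\<tau> (1/2) = \<sigma>' 1"
    using flat_lift_unique[of "{1/2..1}" L \<tau> "\<lambda>t. \<sigma>' (2 - 2 * t)" 1 "1/2"] t1 l(3) by simp
  with 1 show ?thesis by simp
qed

text \<open>The value at \<open>u\<close> is the endpoint of the lift along any path from
  \<open>u0\<close>, well defined by \<open>lift_endpoint_unique\<close>. Flatness is checked
  locally by comparison with the flat section of a good neighbourhood.\<close>

theorem global_flat_section:
  assumes e: "e \<in> fibre E (p u0)"
  obtains s where "flat_on UNIV s" "s u0 = e"
proof -
  define R where "R u f \<longleftrightarrow> (\<exists>g \<sigma>. path g \<and> g 0 = u0 \<and> g 1 = u \<and> flat_lift g {0..1} \<sigma> \<and> \<sigma> 0 = e \<and> \<sigma> 1 = f)" for u f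
  have ex: "\<exists>f. R u f" for u
  proof -
    obtain g where g: "path g" "g 0 = u0" "g 1 = u" by (rule path_between)
    obtain \<sigma> where "flat_lift g {0..1} \<sigma>" "\<sigma> 0 = e" using liftable_path[OF g(1)] e g(2) by blast
    then show ?thesis using g unfolding R_def by blast
  qed
  have un: "f = f'" if "R u f" "R u f'" for u f f'
    using that lift_endpoint_unique unfolding R_def by metis
  define s where "s u = (SOME f. R u f)" for u
  have s: "R u (s u)" for u unfolding s_def using ex[of u] by (rule someI_ex)
  have sf: "s u \<in> fibre E (p u)" for u
    using s[of u] flat_lift_fibre[of _ "{0..1}" _ 1] unfolding R_def by fastforce
  \<comment> \<open>The path to \<open>u\<close> is prolonged inside \<open>N\<close>, and over the
    added piece the lift is given by \<open>sN\<close>.\<close>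
  have loc: "s u' = sN u'" if N: "good N" "u \<in> N" "u' \<in> N" and sN: "flat_on N sN" "sN u = s u" for N u u' sN
  proof -
    obtain g \<sigma> where g: "path g" "g 0 = u0" "g 1 = u" and l: "flat_lift g {0..1} \<sigma>" "\<sigma> 0 = e" "\<sigma> 1 = s u"
      using s[of u] unfolding R_def by blast
    obtain k where k: "path k" "path_image k \<subseteq> N" "k 0 = u" "k 1 = u'"
      using N unfolding good_def by blast
    define L where "L = g +++ k"
    have "path L" unfolding L_def using g k by (intro path_join_imp) (auto simp: pathstart_def pathfinish_def)
    then have L: "path L" "L 0 = u0" "L 1 = u'" using g k by (auto simp: L_def joinpaths_def)
    have L1: "L t = g (2 * t)" if "t \<le> 1/2" for t using that by (simp add: L_def joinpaths_def)
    have L2: "L t = k (2 * t - 1)" if "t \<ge> 1/2" for t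
    proof (cases "t = 1/2")
      case True show ?thesis using g k unfolding True L_def joinpaths_def by simp
    qed (use that in \<open>auto simp: L_def joinpaths_def\<close>)
    have "flat_lift L {0..1/2} (\<lambda>t. \<sigma> (2 * t))"
      by (rule flat_lift_compose[OF l(1), of _ "\<lambda>t. 2 * t"]) (auto simp: L1 intro!: continuous_intros)
    moreover have "flat_lift L {1/2..1} (\<lambda>t. sN (L t))"
      using flat_lift_section[of N sN L "{1/2..1}", OF sN(1)] N(1) k(2)
      by (auto simp: good_def o_def L2 path_image_def image_subset_iff)
    moreover have "{0..1/2} \<union> {1/2..1} = {0..1::real}" by auto
    moreover have "\<sigma> (2 * q) = sN (L q)" if "q \<in> {0..1/2} \<inter> {1/2..1}" for q
    proof -
      have "q = 1/2" using that by auto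
      then show ?thesis using l(3) sN(2) g(3) L1[of "1/2"] by (simp only: order_refl) simp
    qed
    ultimately have "flat_lift L {0..1} (\<lambda>t. if t \<in> {0..1/2} then \<sigma> (2 * t) else sN (L t))"
      using flat_lift_merge[of "{0..1/2}" "{1/2..1}" L "\<lambda>t. \<sigma> (2 * t)" "\<lambda>t. sN (L t)"] L(1)
      by (auto simp: path_def)
    then have "R u' (sN u')"
      unfolding R_def using L l(2)
      by (intro exI[of _ L] exI[of _ "\<lambda>t. if t \<in> {0..1/2} then \<sigma> (2 * t) else sN (L t)"]) auto
    then show ?thesis using un s by blast
  qed
  have "flat_on UNIV s"
    unfolding flat_on_def
  proof (intro conjI ballI allI impI)
    fix c \<tau> N u assume c: "c \<in> charts E" "\<tau> \<in> trivs E"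
      and "open N \<and> inj_on p N \<and> p ` N \<subseteq> fst c \<inter> fst \<tau> \<and> N \<subseteq> UNIV" and u: "u \<in> N"
    then have N: "open N" "inj_on p N" "p ` N \<subseteq> fst c \<inter> fst \<tau>" by blast+
    obtain M where M: "good M" "u \<in> M" "M \<subseteq> N" using good_neighbourhood[OF N(1) u] .
    obtain sM where sM: "flat_on M sM" "sM u = s u" using M sf[of u] unfolding good_def by blast
    have M': "open M" "inj_on p M" "p ` M \<subseteq> fst c \<inter> fst \<tau>" using M N by (auto simp: good_def intro: inj_on_subset)
    have "flat_deriv c \<tau> M sM u" using sM(1) c M' M(2) unfolding flat_on_def by blast
    moreover have eq: "s u' = sM u'" if "u' \<in> M" for u' using loc[OF M(1,2) that sM] .
    ultimately have "flat_deriv c \<tau> M s u"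
      unfolding flat_deriv_def sM(2)
    proof (intro allI)
      fix i
      assume a: "\<forall>i. ((\<lambda>w. snd \<tau> (sM (inv_into M (snd c \<circ> p) w)) $ i) has_field_derivative
              (A c \<tau> (p u) *v snd \<tau> (s u)) $ i) (at (snd c (p u)))"
      show "((\<lambda>w. snd \<tau> (s (inv_into M (snd c \<circ> p) w)) $ i) has_field_derivative
              (A c \<tau> (p u) *v snd \<tau> (s u)) $ i) (at (snd c (p u)))"
      proof (rule has_field_derivative_transform_within_open[OF a[rule_format]])
        show "open ((snd c \<circ> p) ` M)" using M' by (intro coord_open[OF c(1) M'(1,2)]) auto
        show "snd c (p u) \<in> (snd c \<circ> p) ` M" using M(2) by auto
        fix w assume "w \<in> (snd c \<circ> p) ` M"
        then have "inv_into M (snd c \<circ> p) w \<in> M" by (rule inv_into_into)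
        then show "snd \<tau> (sM (inv_into M (snd c \<circ> p) w)) $ i = snd \<tau> (s (inv_into M (snd c \<circ> p) w)) $ i"
          by (simp add: eq)
      qed
    qed
    then show "flat_deriv c \<tau> N s u"
      by (rule flat_deriv_change[OF _ c M' c N M(2) u sf])
  qed (rule sf)
  moreover have "s u0 = e"
  proof -
    have "flat_lift (\<lambda>_ :: real. u0) {0..1} (\<lambda>_. e)"
    proof -
      obtain \<sigma> where s: "flat_lift (\<lambda>_ :: real. u0) {0..1} \<sigma>" "\<sigma> 0 = e"
        by (rule liftable_path[OF const_path e])
      show ?thesis by (rule flat_lift_compose[OF s(1), of _ "\<lambda>_. 0"]) (auto simp: s(2))
    qed
    then have "R u0 e" unfolding R_def
      by (intro exI[of _ "\<lambda>_. u0"] exI[of _ "\<lambda>_. e"]) (auto simp: const_path)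
    then show ?thesis using un s by blast
  qed
  ultimately show thesis using that by blast
qed

lemma flat_section_unique:
  assumes "flat_on UNIV s" "flat_on UNIV s'" "s u = s' u"
  shows "s = s'"
proof
  fix u'
  obtain g where g: "path g" "g 0 = u" "g 1 = u'" by (rule path_between)
  have "flat_lift g {0..1} (s \<circ> g)" "flat_lift g {0..1} (s' \<circ> g)"
    using assms by (auto intro: flat_lift_section)
  from flat_lift_unique[OF _ _ this, of 0 1] g assms(3)
  show "s u' = s' u'" by (simp add: path_def)
qed

end

section \<open>Jacobi's formula, linearity of transport and conservation of volume\<close>

lemma det_has_field_derivative:
  fixes Y :: "complex \<Rightarrow> complex ^ 'n::finite ^ 'n" and M :: "complex ^ 'n ^ 'n"
  assumes "\<And>i j. ((\<lambda>w. Y w $ i $ j) has_field_derivative (M ** Y z) $ i $ j) (at z)"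
  shows "((\<lambda>w. det (Y w)) has_field_derivative trace M * det (Y z)) (at z)"
proof -
  \<comment> \<open>\<open>R k X\<close> is \<open>Y z\<close> with row \<open>k\<close> replaced by
    \<open>X\<close>; the derivative of the Leibniz expansion is the sum of such determinants, each
    with one differentiated row.\<close>
  define R where "R k X = (\<chi> i. if i = k then X else Y z $ i)" for k and X :: "complex ^ 'n"
  let ?D = "\<Sum>\<pi>\<in>{\<pi>. \<pi> permutes (UNIV :: 'n set)}. of_int (sign \<pi>) *
    (\<Sum>k\<in>UNIV. (M ** Y z) $ k $ \<pi> k * (\<Prod>i\<in>UNIV - {k}. Y z $ i $ \<pi> i))"
  have "((\<lambda>w. det (Y w)) has_field_derivative ?D) (at z)"
    unfolding det_def by (intro DERIV_sum DERIV_cmult has_field_derivative_prod assms)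
  moreover have "?D = (\<Sum>k\<in>UNIV. det (R k ((M ** Y z) $ k)))"
    unfolding det_def sum_distrib_left
  proof (subst sum.swap, intro sum.cong refl)
    fix k :: 'n and \<pi> :: "'n \<Rightarrow> 'n"
    have "(\<Prod>i\<in>UNIV. R k ((M ** Y z) $ k) $ i $ \<pi> i) = (M ** Y z) $ k $ \<pi> k * (\<Prod>i\<in>UNIV - {k}. Y z $ i $ \<pi> i)"
      by (subst prod.remove[of _ k]) (auto simp: R_def intro!: prod.cong)
    then show "of_int (sign \<pi>) * ((M ** Y z) $ k $ \<pi> k * (\<Prod>i\<in>UNIV - {k}. Y z $ i $ \<pi> i)) =
      of_int (sign \<pi>) * (\<Prod>i\<in>UNIV. R k ((M ** Y z) $ k) $ i $ \<pi> i)" by simp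
  qed
  \<comment> \<open>Row \<open>k\<close> of \<open>M ** Y z\<close> is a combination of the rows of
    \<open>Y z\<close>; every term except that of row \<open>k\<close> itself gives a matrix with
    two equal rows.\<close>
  moreover have "det (R k ((M ** Y z) $ k)) = M $ k $ k * det (Y z)" for k
  proof -
    have "(M ** Y z) $ k = (\<Sum>l\<in>UNIV. M $ k $ l *s Y z $ l)"
      by (simp add: vec_eq_iff matrix_matrix_mult_def)
    then have "det (R k ((M ** Y z) $ k)) = (\<Sum>l\<in>UNIV. det (R k (M $ k $ l *s Y z $ l)))"
      using det_linear_row_sum[of UNIV k "\<lambda>_ l. M $ k $ l *s Y z $ l" "\<lambda>i. Y z $ i"] by (simp add: R_def)
    also have "\<dots> = (\<Sum>l\<in>UNIV. M $ k $ l * det (R k (Y z $ l)))"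
    proof (intro sum.cong refl)
      fix l
      show "det (R k (M $ k $ l *s Y z $ l)) = M $ k $ l * det (R k (Y z $ l))"
        using det_row_mul[of k "M $ k $ l" "\<lambda>_. Y z $ l" "\<lambda>i. Y z $ i"] by (simp add: R_def)
    qed
    also have "\<dots> = (\<Sum>l\<in>UNIV. if l = k then M $ k $ k * det (Y z) else 0)"
    proof (intro sum.cong refl)
      fix l
      show "M $ k $ l * det (R k (Y z $ l)) = (if l = k then M $ k $ k * det (Y z) else 0)"
      proof (cases "l = k")
        case True
        have "R k (Y z $ k) = Y z" by (simp add: R_def vec_eq_iff)
        then show ?thesis using True by simp
      next
        case False
        have "row l (R k (Y z $ l)) = row k (R k (Y z $ l))"
          using False by (simp add: R_def row_def vec_eq_iff)
        then have "det (R k (Y z $ l)) = 0" by (rule det_identical_rows[OF False])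
        then show ?thesis using False by simp
      qed
    qed
    finally show ?thesis by simp
  qed
  ultimately show ?thesis by (simp add: trace_def sum_distrib_right)
qed

context flat_bundle
begin

definition some_triv where "some_triv x = (SOME \<tau>. \<tau> \<in> trivs E \<and> x \<in> fst \<tau>)"

lemma some_triv: "some_triv x \<in> trivs E" "x \<in> fst (some_triv x)"
proof -
  have "\<exists>\<tau>. \<tau> \<in> trivs E \<and> x \<in> fst \<tau>" using triv_at[of x] by blast
  from someI_ex[OF this] show "some_triv x \<in> trivs E" "x \<in> fst (some_triv x)"
    unfolding some_triv_def by blast+
qed

text \<open>The linear structure of a fibre exists only through the trivializations. The combination
  is formed in an arbitrarily chosen one, and linearity of the transition functions makes every
  other one compute the same result.\<close>

definition fibre_axpy where
  "fibre_axpy x a e e' = vec_of (some_triv x) x (a *s snd (some_triv x) e + snd (some_triv x) e')"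

lemma fibre_axpy:
  assumes "\<tau> \<in> trivs E" "x \<in> fst \<tau>" "e \<in> fibre E x" "e' \<in> fibre E x"
  shows "fibre_axpy x a e e' \<in> fibre E x" "snd \<tau> (fibre_axpy x a e e') = a *s snd \<tau> e + snd \<tau> e'"
proof -
  note st = some_triv[of x]
  show f: "fibre_axpy x a e e' \<in> fibre E x" unfolding fibre_axpy_def by (rule vec_of_fibre[OF st])
  have x: "x \<in> fst (some_triv x) \<inter> fst \<tau>" using st assms by blast
  note t = trans_apply[OF st(1) assms(1) x]
  have "snd (some_triv x) (fibre_axpy x a e e') = a *s snd (some_triv x) e + snd (some_triv x) e'"
    unfolding fibre_axpy_def by (rule triv_vec_of[OF st])
  then show "snd \<tau> (fibre_axpy x a e e') = a *s snd \<tau> e + snd \<tau> e'"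
    unfolding t[OF f] t[OF assms(3)] t[OF assms(4)]
    by (simp add: matrix_vector_right_distrib vector_scalar_commute)
qed

lemma flat_on_deriv:
  assumes "flat_on \<Omega> s" "c \<in> charts E" "\<tau> \<in> trivs E" "open N" "inj_on p N" "p ` N \<subseteq> fst c \<inter> fst \<tau>" "N \<subseteq> \<Omega>" "u \<in> N"
  shows "flat_deriv c \<tau> N s u"
proof -
  have "\<forall>c\<in>charts E. \<forall>\<tau>\<in>trivs E. \<forall>N. open N \<and> inj_on p N \<and> p ` N \<subseteq> fst c \<inter> fst \<tau> \<and> N \<subseteq> \<Omega> \<longrightarrow>
        (\<forall>u\<in>N. flat_deriv c \<tau> N s u)"
    using assms(1) unfolding flat_on_def by (rule conjunct2)
  with assms(2-8) show ?thesis by simp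
qed

lemma flat_axpy:
  assumes s: "flat_on UNIV s" "flat_on UNIV s'"
  shows "flat_on UNIV (\<lambda>u. fibre_axpy (p u) a (s u) (s' u))"
  unfolding flat_on_def
proof (intro conjI ballI allI impI)
  show "fibre_axpy (p u) a (s u) (s' u) \<in> fibre E (p u)" for u
    using fibre_axpy(1)[OF some_triv] flat_onD s by blast
  fix c \<tau> N u assume c: "c \<in> charts E" "\<tau> \<in> trivs E"
    and "open N \<and> inj_on p N \<and> p ` N \<subseteq> fst c \<inter> fst \<tau> \<and> N \<subseteq> UNIV" and u: "u \<in> N"
  then have N: "open N" "inj_on p N" "p ` N \<subseteq> fst c \<inter> fst \<tau>" by blast+
  let ?q = "inv_into N (snd c \<circ> p)"
  have e: "snd \<tau> (fibre_axpy (p u) a (s u) (s' u)) = a *s snd \<tau> (s u) + snd \<tau> (s' u)" if "u \<in> N" for u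
    using fibre_axpy(2)[OF c(2)] N(3) that s flat_onD by blast
  note d = flat_on_deriv[OF s(1) c N subset_UNIV u] flat_on_deriv[OF s(2) c N subset_UNIV u]
  show "flat_deriv c \<tau> N (\<lambda>u. fibre_axpy (p u) a (s u) (s' u)) u"
    unfolding flat_deriv_def
  proof
    fix i
    have "((\<lambda>w. a * snd \<tau> (s (?q w)) $ i + snd \<tau> (s' (?q w)) $ i) has_field_derivative
      a * (A c \<tau> (p u) *v snd \<tau> (s u)) $ i + (A c \<tau> (p u) *v snd \<tau> (s' u)) $ i) (at (snd c (p u)))"
      by (intro DERIV_add DERIV_cmult d[unfolded flat_deriv_def, rule_format])
    also have "a * (A c \<tau> (p u) *v snd \<tau> (s u)) $ i + (A c \<tau> (p u) *v snd \<tau> (s' u)) $ i =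
       (A c \<tau> (p u) *v snd \<tau> (fibre_axpy (p u) a (s u) (s' u))) $ i"
      by (simp add: e[OF u] matrix_vector_right_distrib vector_scalar_commute)
    finally show "((\<lambda>w. snd \<tau> (fibre_axpy (p (?q w)) a (s (?q w)) (s' (?q w))) $ i) has_field_derivative
       (A c \<tau> (p u) *v snd \<tau> (fibre_axpy (p u) a (s u) (s' u))) $ i) (at (snd c (p u)))"
    proof (rule has_field_derivative_transform_within_open)
      show "open ((snd c \<circ> p) ` N)" using N by (intro coord_open[OF c(1) N(1,2)]) auto
      show "snd c (p u) \<in> (snd c \<circ> p) ` N" using u by auto
      fix w assume "w \<in> (snd c \<circ> p) ` N"
      then have "?q w \<in> N" by (rule inv_into_into)
      then show "a * snd \<tau> (s (?q w)) $ i + snd \<tau> (s' (?q w)) $ i =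
          snd \<tau> (fibre_axpy (p (?q w)) a (s (?q w)) (s' (?q w))) $ i"
        by (simp add: e)
    qed
  qed
qed

text \<open>Flat sections are determined by their value at \<open>u0\<close>, so combinations of
  flat sections give linearity of the value at \<open>u\<close>; uniqueness started from
  \<open>u\<close> gives injectivity.\<close>

lemma transport_matrix:
  assumes t0: "\<tau>0 \<in> trivs E" "p u0 \<in> fst \<tau>0" and t: "\<tau> \<in> trivs E" "p u \<in> fst \<tau>"
  obtains G where "det G \<noteq> 0" "\<And>s. flat_on UNIV s \<Longrightarrow> snd \<tau> (s u) = G *v snd \<tau>0 (s u0)"
proof -
  have "\<exists>s. flat_on UNIV s \<and> s u0 = vec_of \<tau>0 (p u0) v" for v
    using global_flat_section[OF vec_of_fibre[OF t0]] by metis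
  then obtain S where S: "\<And>v. flat_on UNIV (S v)" "\<And>v. S v u0 = vec_of \<tau>0 (p u0) v" by metis
  have tS: "snd \<tau>0 (S v u0) = v" for v by (simp add: S(2) triv_vec_of[OF t0])
  have uniq: "s = S (snd \<tau>0 (s u0))" if "flat_on UNIV s" for s
    by (rule flat_section_unique[OF that S(1), of u0])
       (simp add: S(2) vec_of_triv[OF t0 flat_onD[OF that UNIV_I]])
  have lin: "snd \<tau> (S (a *s v + w) u) = a *s snd \<tau> (S v u) + snd \<tau> (S w u)" for a v w
  proof -
    let ?s = "\<lambda>u. fibre_axpy (p u) a (S v u) (S w u)"
    have "flat_on UNIV ?s" by (intro flat_axpy S)
    from uniq[OF this] have "?s = S (a *s v + w)"
      using fibre_axpy(2)[OF t0 flat_onD[OF S(1) UNIV_I] flat_onD[OF S(1) UNIV_I]] tS by simp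
    then have "S (a *s v + w) u = fibre_axpy (p u) a (S v u) (S w u)" by metis
    then show ?thesis
      using fibre_axpy(2)[OF t flat_onD[OF S(1) UNIV_I] flat_onD[OF S(1) UNIV_I]] by simp
  qed
  define G where "G = matrix (\<lambda>v. snd \<tau> (S v u))"
  have l0: "snd \<tau> (S 0 u) = 0" using lin[of 1 0 0] by simp
  have "Vector_Spaces.linear (*s) (*s) (\<lambda>v. snd \<tau> (S v u))"
    using lin[of 1] lin[of _ _ 0] l0 by unfold_locales (simp_all add: vector_add_ldistrib vector_sadd_rdistrib vector_smult_assoc)
  then have G: "G *v v = snd \<tau> (S v u)" for v unfolding G_def by (rule matrix_works)
  show thesis
  proof
    show "det G \<noteq> 0"
    proof (rule det_nzI)
      fix v assume "G *v v = 0"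
      then have "snd \<tau> (S v u) = snd \<tau> (S 0 u)" using G[of v] l0 by simp
      then have "S v u = S 0 u" by (rule triv_eq[OF t flat_onD[OF S(1) UNIV_I] flat_onD[OF S(1) UNIV_I]])
      then have "S v = S 0" by (rule flat_section_unique[OF S(1) S(1)])
      then show "v = 0" using tS by metis
    qed
    show "snd \<tau> (s u) = G *v snd \<tau>0 (s u0)" if "flat_on UNIV s" for s
      unfolding G using uniq[OF that] by metis
  qed
qed

lemma connected_cover: "connected (UNIV :: 'u set)"
proof -
  have "path_connected (UNIV :: 'u set)"
    unfolding path_connected_def pathstart_def pathfinish_def
    using path_between by (metis top_greatest)
  then show ?thesis by (rule path_connected_imp_connected)
qed

text \<open>In a frame the volume is \<open>\<delta> * det Y\<close>. By \<open>tr\<close> the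
  factor \<open>\<delta>\<close> has logarithmic derivative minus the trace of \<open>A\<close>, by
  Jacobi's formula \<open>det Y\<close> contributes plus this trace, so the product is locally
  constant on a connected space.\<close>

lemma volume_constant:
  assumes vol: "det_trivialized E"
    and tr: "\<And>c \<tau> x. c \<in> charts E \<Longrightarrow> \<tau> \<in> trivs E \<Longrightarrow> x \<in> fst c \<inter> fst \<tau> \<Longrightarrow>
      cderiv c (\<lambda>y. vol E (frame E \<tau> y)) x = - trace (A c \<tau> x) * vol E (frame E \<tau> x)"
    and S: "\<And>i. flat_on UNIV (S i)"
  shows "vol E (\<lambda>i. S i u) = vol E (\<lambda>i. S i u')"
proof (rule connected_equivalence_relation[OF connected_cover UNIV_I UNIV_I, of "\<lambda>u u'. vol E (\<lambda>i. S i u) = vol E (\<lambda>i. S i u')"])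
  fix u0
  obtain c where c: "c \<in> charts E" "p u0 \<in> fst c" by (rule chart_at)
  obtain \<tau> where t: "\<tau> \<in> trivs E" "p u0 \<in> fst \<tau>" by (rule triv_at)
  obtain N \<rho> where N: "\<rho> > 0" "open N" "u0 \<in> N" "N \<subseteq> UNIV" "inj_on p N" "p ` N \<subseteq> fst c \<inter> fst \<tau>"
    and im: "(snd c \<circ> p) ` N = ball (snd c (p u0)) \<rho>"
    using coordinate_ball[OF c(1) open_UNIV UNIV_I c(2) triv_open[OF t(1)] t(2)] by metis
  obtain \<delta> where \<delta>: "holo_fun (charts E) (fst \<tau>) \<delta>"
    and vol\<delta>: "\<And>x e. x \<in> fst \<tau> \<Longrightarrow> range e \<subseteq> fibre E x \<Longrightarrow> vol E e = \<delta> x * det (\<chi> i j. snd \<tau> (e j) $ i)"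
    using vol t(1) unfolding det_trivialized_def by (auto simp: case_prod_unfold)
  let ?q = "inv_into N (snd c \<circ> p)" and ?inv = "inv_into (fst c) (snd c)"
  define Y where "Y w = (\<chi> i j. snd \<tau> (S j (?q w)) $ i)" for w
  have frame: "vol E (frame E \<tau> x) = \<delta> x" if x: "x \<in> fst \<tau>" for x
  proof -
    have f: "frame E \<tau> x i = vec_of \<tau> x (axis i 1)" for i by (simp add: frame_def vec_of_def)
    have "range (frame E \<tau> x) \<subseteq> fibre E x" using vec_of_fibre[OF t(1) x] by (auto simp: f)
    from vol\<delta>[OF x this] have "vol E (frame E \<tau> x) = \<delta> x * det ((\<chi> i j. axis j 1 $ i) :: complex ^ 'r ^ 'r)"
      by (simp add: f triv_vec_of[OF t(1) x])
    also have "((\<chi> i j. axis j 1 $ i) :: complex ^ 'r ^ 'r) = (mat 1 :: complex ^ 'r ^ 'r)"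
      by (simp add: vec_eq_iff axis_def mat_def)
    finally show ?thesis by simp
  qed
  have d\<delta>: "((\<lambda>w. \<delta> (?inv w)) has_field_derivative - trace (A c \<tau> x) * \<delta> x) (at (snd c x))"
    if x: "x \<in> fst c" "x \<in> fst \<tau>" for x
  proof -
    have "((\<delta> \<circ> ?inv) has_field_derivative cderiv c \<delta> x) (at (snd c x))"
      by (rule holo_fun_derivative[OF \<delta> c(1) triv_open[OF t(1)] x])
    also have "cderiv c \<delta> x = cderiv c (\<lambda>y. vol E (frame E \<tau> y)) x"
      unfolding cderiv_def
    proof (rule deriv_cong_ev[OF _ refl])
      have "open (snd c ` (fst c \<inter> fst \<tau>))" by (intro chart_image_Int_open c triv_open t)
      moreover have "snd c x \<in> snd c ` (fst c \<inter> fst \<tau>)" using x by blast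
      ultimately have "\<forall>\<^sub>F w in nhds (snd c x). w \<in> snd c ` (fst c \<inter> fst \<tau>)"
        by (rule eventually_nhds_in_open)
      then show "\<forall>\<^sub>F w in nhds (snd c x). (\<delta> \<circ> ?inv) w = ((\<lambda>y. vol E (frame E \<tau> y)) \<circ> ?inv) w"
        by eventually_elim (auto simp: frame chart_inv[OF c(1)])
    qed
    also have "\<dots> = - trace (A c \<tau> x) * \<delta> x" using tr[OF c(1) t(1), of x] x by (simp add: frame)
    finally show ?thesis by (simp add: o_def)
  qed
  have V: "vol E (\<lambda>i. S i u) = \<delta> (?inv (snd c (p u))) * det (Y (snd c (p u)))" if "u \<in> N" for u
  proof -
    have x: "p u \<in> fst c" "p u \<in> fst \<tau>" using N that by auto
    have "p ` N \<subseteq> fst c" using N by auto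
    then have "?q (snd c (p u)) = u"
      using inv_into_f_f[OF coord_inj[OF c(1) N(2,5)] that] by simp
    then show ?thesis
      using vol\<delta>[OF x(2), of "\<lambda>i. S i u"] flat_onD[OF S UNIV_I] x
      by (auto simp: Y_def chart_inv[OF c(1)])
  qed
  have "((\<lambda>w. \<delta> (?inv w) * det (Y w)) has_field_derivative 0) (at w)" if w: "w \<in> ball (snd c (p u0)) \<rho>" for w
  proof -
    from w have "w \<in> (snd c \<circ> p) ` N" unfolding im .
    then obtain u where u: "u \<in> N" "w = snd c (p u)" by auto
    have x: "p u \<in> fst c" "p u \<in> fst \<tau>" using N u by auto
    have "((\<lambda>w. Y w $ i $ j) has_field_derivative (A c \<tau> (?inv w) ** Y w) $ i $ j) (at w)" for i j
      using flat_on_ode[OF flat_on_subset[OF S N(4)] c(1) t(1) N(2,5,6), of w j i] w im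
      by (simp add: Y_def matrix_matrix_mult_def matrix_vector_mult_def)
    from DERIV_mult'[OF d\<delta>[OF x] det_has_field_derivative[OF this, unfolded u(2)]]
    show ?thesis using x unfolding u(2) by (simp add: chart_inv[OF c(1)] algebra_simps)
  qed
  then have "\<exists>k. \<forall>w\<in>ball (snd c (p u0)) \<rho>. \<delta> (?inv w) * det (Y w) = k"
    by (intro has_field_derivative_zero_constant convex_ball) (auto intro: has_field_derivative_at_within)
  then obtain k where k: "\<And>w. w \<in> ball (snd c (p u0)) \<rho> \<Longrightarrow> \<delta> (?inv w) * det (Y w) = k" by blast
  have "vol E (\<lambda>i. S i u) = k" if "u \<in> N" for u
  proof -
    have "snd c (p u) \<in> ball (snd c (p u0)) \<rho>" unfolding im[symmetric] using that by auto
    then show ?thesis using V[OF that] k by simp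
  qed
  then show "\<exists>T. openin (top_of_set UNIV) T \<and> u0 \<in> T \<and> (\<forall>x\<in>T. vol E (\<lambda>i. S i u0) = vol E (\<lambda>i. S i x))"
    using N(2,3) by (intro exI[of _ N]) (simp add: open_openin[symmetric])
qed auto

end

section \<open>Dominated solutions\<close>

lemma qf_cauchy_schwarz:
  fixes K :: "complex ^ 'n::finite \<Rightarrow> complex ^ 'n \<Rightarrow> complex"
  assumes "hform K"
  shows "(cmod (K v w))\<^sup>2 \<le> qf K v * qf K w"
proof (cases "w = 0")
  case True then show ?thesis using assms by (simp add: qf_def)
next
  case False
  define q where "q = qf K w"
  have q: "q > 0" using hform_pos[OF assms False] by (simp add: q_def)
  \<comment> \<open>The minimizer of \<open>qf K (v + c *s w)\<close> over \<open>c\<close>.\<close>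
  define c where "c = - (K v w / of_real q)"
  have "0 \<le> qf K (v + c *s w)" by (rule qf_nonneg[OF assms])
  also have "\<dots> = qf K v + 2 * Re (cnj c * K v w) + (cmod c)\<^sup>2 * q"
    by (simp add: qf_add qf_scale hform_scale_right assms q_def)
  also have "Re (cnj c * K v w) = - ((cmod (K v w))\<^sup>2 / q)"
  proof -
    have "cnj c * K v w = - (K v w * cnj (K v w) / of_real q)" by (simp add: c_def)
    also have "\<dots> = of_real (- ((cmod (K v w))\<^sup>2 / q))"
      by (simp add: complex_norm_square[symmetric] del: of_real_power)
    finally show ?thesis by (simp only: Re_complex_of_real)
  qed
  also have "(cmod c)\<^sup>2 = (cmod (K v w))\<^sup>2 / q\<^sup>2"
    using q by (simp add: c_def norm_divide power_divide)
  finally show ?thesis using q by (simp add: field_simps power2_eq_square q_def[symmetric])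
qed

lemma sqrt_qf_triangle:
  fixes K :: "complex ^ 'n::finite \<Rightarrow> complex ^ 'n \<Rightarrow> complex"
  assumes "hform K"
  shows "sqrt (qf K (v + w)) \<le> sqrt (qf K v) + sqrt (qf K w)"
proof -
  have "Re (K v w) \<le> cmod (K v w)" by (rule complex_Re_le_cmod)
  also have "\<dots> \<le> sqrt (qf K v * qf K w)" by (rule real_le_rsqrt[OF qf_cauchy_schwarz[OF assms]])
  finally have "qf K (v + w) \<le> (sqrt (qf K v) + sqrt (qf K w))\<^sup>2"
    by (simp add: qf_add assms power2_sum real_sqrt_mult qf_nonneg)
  then show ?thesis by (rule real_le_lsqrt[rotated]) (simp add: qf_nonneg assms)
qed

text \<open>The integrating factor \<open>exp (- c * s)\<close> turns \<open>\<psi>\<close> into a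
  nonincreasing function, whatever the sign of \<open>c\<close>.\<close>

lemma nonpos_forward:
  fixes \<psi> :: "real \<Rightarrow> real"
  assumes der: "\<And>s. s \<in> {0..1} \<Longrightarrow> \<exists>D. (\<psi> has_real_derivative D) (at s within {0..1}) \<and> D \<le> c * \<psi> s"
    and "\<psi> 0 \<le> 0" "s \<in> {0..1}"
  shows "\<psi> s \<le> 0"
proof -
  define f where "f s = \<psi> s * exp (- c * s)" for s
  have "f s \<le> f 0"
  proof (rule nonincreasing_within[of 0 s f])
    fix s :: real assume s: "s \<in> {0..1}"
    obtain D where D: "(\<psi> has_real_derivative D) (at s within {0..1})" "D \<le> c * \<psi> s" using der[OF s] by blast
    have "(f has_real_derivative D * exp (- c * s) + \<psi> s * (exp (- c * s) * (- c))) (at s within {0..1})"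
      unfolding f_def by (rule derivative_eq_intros D refl | simp)+
    moreover have "D * exp (- c * s) + \<psi> s * (exp (- c * s) * (- c)) = (D - c * \<psi> s) * exp (- c * s)"
      by (simp add: algebra_simps)
    moreover have "\<dots> \<le> 0" using D(2) by (intro mult_nonpos_nonneg) auto
    ultimately show "\<exists>D. (f has_real_derivative D) (at s within {0..1}) \<and> D \<le> 0" by metis
  qed (use assms in auto)
  then have "f s \<le> 0" using assms(2) by (simp add: f_def)
  then show ?thesis by (simp add: f_def mult_le_0_iff)
qed

lemma nonpos_backward:
  fixes \<psi> :: "real \<Rightarrow> real"
  assumes der: "\<And>s. s \<in> {0..1} \<Longrightarrow> \<exists>D. (\<psi> has_real_derivative D) (at s within {0..1}) \<and> c * \<psi> s \<le> D"
    and "\<psi> 1 \<le> 0" "s \<in> {0..1}"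
  shows "\<psi> s \<le> 0"
proof -
  define f where "f s = - (\<psi> s * exp (- c * s))" for s
  have "f 1 \<le> f s"
  proof (rule nonincreasing_within[of s 1 f])
    fix s :: real assume s: "s \<in> {0..1}"
    obtain D where D: "(\<psi> has_real_derivative D) (at s within {0..1})" "c * \<psi> s \<le> D" using der[OF s] by blast
    have "(f has_real_derivative - (D * exp (- c * s) + \<psi> s * (exp (- c * s) * (- c)))) (at s within {0..1})"
      unfolding f_def by (rule derivative_eq_intros D refl | simp)+
    moreover have "- (D * exp (- c * s) + \<psi> s * (exp (- c * s) * (- c))) = (c * \<psi> s - D) * exp (- c * s)"
      by (simp add: algebra_simps)
    moreover have "\<dots> \<le> 0" using D(2) by (intro mult_nonpos_nonneg) auto
    ultimately show "\<exists>D. (f has_real_derivative D) (at s within {0..1}) \<and> D \<le> 0" by metis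
  qed (use assms in auto)
  moreover have "f 1 \<ge> 0" using assms(2) by (simp add: f_def mult_le_0_iff)
  ultimately have "f s \<ge> 0" by simp
  then show ?thesis by (simp add: f_def mult_le_0_iff)
qed

text \<open>Componentwise growth rates \<open>2 t a\<^sub>j\<close> up to a bounded error. Relative to the \<open>i\<close>-th rate, the
  components after \<open>i\<close> stay dominated going forward when they vanish at 0, and those before \<open>i\<close> going
  backward when they vanish at 1.\<close>

locale growth_system =
  fixes a \<alpha> :: "'r::{finite,linorder} \<Rightarrow> real \<Rightarrow> real" and t K \<delta> \<epsilon> :: real
  assumes \<alpha>: "\<And>i s. s \<in> {0..1} \<Longrightarrow> (\<alpha> i has_real_derivative a i s) (at s within {0..1})" "\<And>i. \<alpha> i 0 = 0"
    and gap: "\<And>i j s. s \<in> {0..1} \<Longrightarrow> i < j \<Longrightarrow> a j s + \<delta> \<le> a i s"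
    and pos: "t \<ge> 0" "\<delta> > 0" "K \<ge> 0" "0 < \<epsilon>" "\<epsilon> \<le> 1 / 4"
    and large: "K * CARD('r) * (1 + \<epsilon>)\<^sup>2 \<le> 2 * t * \<delta> * \<epsilon>"
begin

text \<open>An invariant region argument. After division by
  \<open>exp (2 * t * \<alpha> i s)\<close> the \<open>i\<close>-th component is neutral. The later
  components minus \<open>\<epsilon>\<close> times the rest then obey a linear differential
  inequality that preserves nonpositivity forward; the earlier ones do so backward. Once
  \<open>i\<close> dominates, the error \<open>K * T s\<close> is at most \<open>2 * K\<close> times
  the \<open>i\<close>-th component, which keeps its size within a factor \<open>exp (2 * K)\<close>
  of the initial one.\<close>

lemma dominated:
  fixes f :: "'r \<Rightarrow> real \<Rightarrow> real"
  assumes f: "\<And>j s. s \<in> {0..1} \<Longrightarrow> \<exists>D. (f j has_real_derivative D) (at s within {0..1}) \<and>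
      \<bar>D - 2 * t * a j s * f j s\<bar> \<le> K * (\<Sum>k\<in>UNIV. f k s)"
    and nonneg: "\<And>j s. s \<in> {0..1} \<Longrightarrow> f j s \<ge> 0"
    and total: "\<And>s. s \<in> {0..1} \<Longrightarrow> (\<Sum>k\<in>UNIV. f k s) > 0"
    and bc: "\<And>j. i < j \<Longrightarrow> f j 0 = 0" "\<And>j. j < i \<Longrightarrow> f j 1 = 0"
    and s: "s \<in> {0..1}"
  shows "(\<Sum>j\<in>-{i}. f j s) \<le> 4 * \<epsilon> * f i s" "f i s > 0"
    and "f i s \<le> f i 0 * exp (2 * t * \<alpha> i s + 2 * K)" "f i 0 * exp (2 * t * \<alpha> i s - 2 * K) \<le> f i s"
proof -
  define L where "L = K * CARD('r) * (1 + \<epsilon>)"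
  define c where "c = L - 2 * t * \<delta>"
  define F where "F j s = f j s * exp (- 2 * t * \<alpha> i s)" for j s
  define T where "T s = (\<Sum>k\<in>UNIV. F k s)" for s
  have L: "L \<ge> 0" using pos by (simp add: L_def)
  \<comment> \<open>This is the assumption \<open>large\<close> rewritten, and the reason for the
    square of \<open>1 + \<epsilon>\<close> there.\<close>
  have Lc: "L \<le> - c * \<epsilon>" using large by (simp add: c_def L_def power2_eq_square algebra_simps)
  have F0: "F j s \<ge> 0" if "s \<in> {0..1}" for j s using nonneg[OF that] by (simp add: F_def)
  have T0: "T s > 0" if "s \<in> {0..1}" for s
    using total[OF that] by (simp add: T_def F_def flip: sum_distrib_right)
  have "\<exists>D. \<forall>j. (F j has_real_derivative D j) (at s within {0..1}) \<and>
      \<bar>D j - 2 * t * (a j s - a i s) * F j s\<bar> \<le> K * T s" if s: "s \<in> {0..1}" for s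
  proof -
    have "\<exists>D. (F j has_real_derivative D) (at s within {0..1}) \<and>
      \<bar>D - 2 * t * (a j s - a i s) * F j s\<bar> \<le> K * T s" for j
    proof -
      obtain D where D: "(f j has_real_derivative D) (at s within {0..1})"
        "\<bar>D - 2 * t * a j s * f j s\<bar> \<le> K * (\<Sum>k\<in>UNIV. f k s)" using f[OF s] by blast
      let ?e = "exp (- 2 * t * \<alpha> i s)"
      have "(F j has_real_derivative D * ?e + f j s * (?e * (- 2 * t * a i s))) (at s within {0..1})"
        unfolding F_def by (rule derivative_eq_intros D \<alpha> s refl | simp)+
      moreover have "D * ?e + f j s * (?e * (- 2 * t * a i s)) - 2 * t * (a j s - a i s) * F j s =
          (D - 2 * t * a j s * f j s) * ?e" by (simp add: F_def algebra_simps)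
      moreover have "\<bar>(D - 2 * t * a j s * f j s) * ?e\<bar> \<le> K * (\<Sum>k\<in>UNIV. f k s) * ?e"
        unfolding abs_mult using D(2) by (intro mult_mono) auto
      moreover have "K * (\<Sum>k\<in>UNIV. f k s) * ?e = K * T s" by (simp add: T_def F_def sum_distrib_right mult.assoc)
      ultimately show ?thesis by metis
    qed
    then show ?thesis by metis
  qed
  then obtain D where D: "\<And>s j. s \<in> {0..1} \<Longrightarrow> (F j has_real_derivative D s j) (at s within {0..1})"
    and DF: "\<And>s j. s \<in> {0..1} \<Longrightarrow> \<bar>D s j - 2 * t * (a j s - a i s) * F j s\<bar> \<le> K * T s" by metis
  have sumD: "((\<lambda>s. \<Sum>j\<in>J. F j s) has_real_derivative (\<Sum>j\<in>J. D s j)) (at s within {0..1})" if "s \<in> {0..1}" for s J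
    by (intro DERIV_sum D that)
  have KT: "K * T s \<ge> 0" if "s \<in> {0..1}" for s using T0[OF that] pos by simp
  have sumK: "(\<Sum>j\<in>J. K * T s) \<le> CARD('r) * (K * T s)" if "s \<in> {0..1}" for s and J :: "'r set"
    using KT[OF that] card_mono[of UNIV J] by (simp add: mult_right_mono)
  have slow: "(\<Sum>j\<in>J. D s j) \<le> - 2 * t * \<delta> * (\<Sum>j\<in>J. F j s) + CARD('r) * (K * T s)"
    if "\<And>j. j \<in> J \<Longrightarrow> i < j" "s \<in> {0..1}" for s J
  proof -
    have "D s j \<le> - 2 * t * \<delta> * F j s + K * T s" if "j \<in> J" for j
    proof -
      have "2 * t * (a j s - a i s) * F j s \<le> 2 * t * (- \<delta>) * F j s"
        using gap[OF \<open>s \<in> {0..1}\<close>, of i j] \<open>\<And>j. j \<in> J \<Longrightarrow> i < j\<close>[OF that] pos F0[OF \<open>s \<in> {0..1}\<close>, of j]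
        by (intro mult_right_mono mult_left_mono) auto
      then have "2 * t * (a j s - a i s) * F j s \<le> - 2 * t * \<delta> * F j s"
        by (simp only: mult_minus_right mult_minus_left)
      then show ?thesis using DF[OF \<open>s \<in> {0..1}\<close>, of j] unfolding abs_le_iff by linarith
    qed
    then have "(\<Sum>j\<in>J. D s j) \<le> (\<Sum>j\<in>J. - 2 * t * \<delta> * F j s + K * T s)" by (rule sum_mono)
    also have "\<dots> = - 2 * t * \<delta> * (\<Sum>j\<in>J. F j s) + (\<Sum>j\<in>J. K * T s)"
      by (simp only: sum.distrib sum_distrib_left)
    finally show ?thesis using sumK[OF that(2), of J] by linarith
  qed
  have fast: "2 * t * \<delta> * (\<Sum>j\<in>J. F j s) - CARD('r) * (K * T s) \<le> (\<Sum>j\<in>J. D s j)"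
    if "\<And>j. j \<in> J \<Longrightarrow> j < i" "s \<in> {0..1}" for s J
  proof -
    have "2 * t * \<delta> * F j s - K * T s \<le> D s j" if "j \<in> J" for j
    proof -
      have "2 * t * \<delta> * F j s \<le> 2 * t * (a j s - a i s) * F j s"
        using gap[OF \<open>s \<in> {0..1}\<close>, of j i] \<open>\<And>j. j \<in> J \<Longrightarrow> j < i\<close>[OF that] pos F0[OF \<open>s \<in> {0..1}\<close>, of j]
        by (intro mult_right_mono mult_left_mono) auto
      then show ?thesis using DF[OF \<open>s \<in> {0..1}\<close>, of j] unfolding abs_le_iff by linarith
    qed
    then have "(\<Sum>j\<in>J. 2 * t * \<delta> * F j s - K * T s) \<le> (\<Sum>j\<in>J. D s j)" by (rule sum_mono)
    also have "(\<Sum>j\<in>J. 2 * t * \<delta> * F j s - K * T s) = 2 * t * \<delta> * (\<Sum>j\<in>J. F j s) - (\<Sum>j\<in>J. K * T s)"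
      by (simp only: sum_subtractf sum_distrib_left)
    finally show ?thesis using sumK[OF that(2), of J] by linarith
  qed
  have neut_low: "- (CARD('r) * (K * T s)) \<le> (\<Sum>j\<in>J. D s j)" if "\<And>j. j \<in> J \<Longrightarrow> j \<le> i" "s \<in> {0..1}" for s J
  proof -
    have "- (K * T s) \<le> D s j" if "j \<in> J" for j
    proof -
      have "0 \<le> 2 * t * (a j s - a i s) * F j s"
        using gap[OF \<open>s \<in> {0..1}\<close>, of j i] \<open>\<And>j. j \<in> J \<Longrightarrow> j \<le> i\<close>[OF that] pos F0[OF \<open>s \<in> {0..1}\<close>, of j]
        by (cases "j = i") (auto simp: order_le_less[of j i] intro!: mult_nonneg_nonneg)
      then show ?thesis using DF[OF \<open>s \<in> {0..1}\<close>, of j] unfolding abs_le_iff by linarith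
    qed
    then have "(\<Sum>j\<in>J. - (K * T s)) \<le> (\<Sum>j\<in>J. D s j)" by (rule sum_mono)
    then show ?thesis using sumK[OF that(2), of J] by (simp only: sum_negf)
  qed
  have neut_up: "(\<Sum>j\<in>J. D s j) \<le> CARD('r) * (K * T s)" if "\<And>j. j \<in> J \<Longrightarrow> i \<le> j" "s \<in> {0..1}" for s J
  proof -
    have "D s j \<le> K * T s" if "j \<in> J" for j
    proof -
      have "2 * t * (a j s - a i s) * F j s \<le> 0"
        using gap[OF \<open>s \<in> {0..1}\<close>, of i j] \<open>\<And>j. j \<in> J \<Longrightarrow> i \<le> j\<close>[OF that] pos F0[OF \<open>s \<in> {0..1}\<close>, of j]
        by (cases "j = i") (auto simp: order_le_less[of i j] intro!: mult_nonpos_nonneg mult_nonneg_nonpos)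
      then show ?thesis using DF[OF \<open>s \<in> {0..1}\<close>, of j] unfolding abs_le_iff by linarith
    qed
    then have "(\<Sum>j\<in>J. D s j) \<le> (\<Sum>j\<in>J. K * T s)" by (rule sum_mono)
    then show ?thesis using sumK[OF that(2), of J] by linarith
  qed
  \<comment> \<open>Here \<open>Q\<close> stands for the components to be suppressed and
    \<open>P\<close> for the rest. The left side equals \<open>L * P + c * Q\<close>, and
    \<open>Lc\<close> replaces \<open>L\<close> by \<open>- c * \<epsilon>\<close>.\<close>
  have key: "CARD('r) * (K * (P + Q)) * (1 + \<epsilon>) - 2 * t * \<delta> * Q \<le> c * (Q - \<epsilon> * P)" if "P \<ge> 0" for P Q
  proof -
    have "L * P \<le> - c * \<epsilon> * P" using Lc that by (rule mult_right_mono)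
    then show ?thesis by (simp add: L_def c_def algebra_simps)
  qed
  have split: "T s = (\<Sum>j\<in>{..i}. F j s) + (\<Sum>j\<in>{i<..}. F j s)" "T s = (\<Sum>j\<in>{..<i}. F j s) + (\<Sum>j\<in>{i..}. F j s)" for s
    unfolding T_def by (subst sum.union_disjoint[symmetric]; force intro: sum.cong)+
  have fw: "(\<Sum>j\<in>{i<..}. F j s) - \<epsilon> * (\<Sum>j\<in>{..i}. F j s) \<le> 0" if "s \<in> {0..1}" for s
  proof (rule nonpos_forward[OF _ _ that, of "\<lambda>s. (\<Sum>j\<in>{i<..}. F j s) - \<epsilon> * (\<Sum>j\<in>{..i}. F j s)" c])
    fix s :: real assume s: "s \<in> {0..1}"
    have "((\<lambda>s. (\<Sum>j\<in>{i<..}. F j s) - \<epsilon> * (\<Sum>j\<in>{..i}. F j s)) has_real_derivative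
        (\<Sum>j\<in>{i<..}. D s j) - \<epsilon> * (\<Sum>j\<in>{..i}. D s j)) (at s within {0..1})"
      by (intro DERIV_diff DERIV_cmult sumD s)
    moreover have "(\<Sum>j\<in>{i<..}. D s j) - \<epsilon> * (\<Sum>j\<in>{..i}. D s j) \<le> c * ((\<Sum>j\<in>{i<..}. F j s) - \<epsilon> * (\<Sum>j\<in>{..i}. F j s))"
    proof -
      have "- (\<epsilon> * (\<Sum>j\<in>{..i}. D s j)) \<le> \<epsilon> * (CARD('r) * (K * T s))"
        using mult_left_mono[OF neut_low[of "{..i}" s], of \<epsilon>] s pos by simp
      moreover have "(\<Sum>j\<in>{i<..}. D s j) \<le> - 2 * t * \<delta> * (\<Sum>j\<in>{i<..}. F j s) + CARD('r) * (K * T s)"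
        by (rule slow) (use s in auto)
      moreover have "CARD('r) * (K * T s) * (1 + \<epsilon>) - 2 * t * \<delta> * (\<Sum>j\<in>{i<..}. F j s) \<le>
          c * ((\<Sum>j\<in>{i<..}. F j s) - \<epsilon> * (\<Sum>j\<in>{..i}. F j s))"
        unfolding split(1) by (rule key) (intro sum_nonneg F0 s)
      moreover have "CARD('r) * (K * T s) * (1 + \<epsilon>) = CARD('r) * (K * T s) + \<epsilon> * (CARD('r) * (K * T s))"
        by (simp add: algebra_simps)
      ultimately show ?thesis by linarith
    qed
    ultimately show "\<exists>D. ((\<lambda>s. (\<Sum>j\<in>{i<..}. F j s) - \<epsilon> * (\<Sum>j\<in>{..i}. F j s)) has_real_derivative D) (at s within {0..1}) \<and>
       D \<le> c * ((\<Sum>j\<in>{i<..}. F j s) - \<epsilon> * (\<Sum>j\<in>{..i}. F j s))" by blast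
  next
    have "F j 0 = 0" if "j \<in> {i<..}" for j using bc(1) that by (simp add: F_def)
    then have "(\<Sum>j\<in>{i<..}. F j 0) = 0" by (intro sum.neutral) blast
    moreover have "\<epsilon> * (\<Sum>j\<in>{..i}. F j 0) \<ge> 0" using F0[of 0] pos by (intro mult_nonneg_nonneg sum_nonneg) auto
    ultimately show "(\<Sum>j\<in>{i<..}. F j 0) - \<epsilon> * (\<Sum>j\<in>{..i}. F j 0) \<le> 0" by linarith
  qed
  have bw: "(\<Sum>j\<in>{..<i}. F j s) - \<epsilon> * (\<Sum>j\<in>{i..}. F j s) \<le> 0" if "s \<in> {0..1}" for s
  proof (rule nonpos_backward[OF _ _ that, of "\<lambda>s. (\<Sum>j\<in>{..<i}. F j s) - \<epsilon> * (\<Sum>j\<in>{i..}. F j s)" "- c"])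
    fix s :: real assume s: "s \<in> {0..1}"
    have "((\<lambda>s. (\<Sum>j\<in>{..<i}. F j s) - \<epsilon> * (\<Sum>j\<in>{i..}. F j s)) has_real_derivative
        (\<Sum>j\<in>{..<i}. D s j) - \<epsilon> * (\<Sum>j\<in>{i..}. D s j)) (at s within {0..1})"
      by (intro DERIV_diff DERIV_cmult sumD s)
    moreover have "- c * ((\<Sum>j\<in>{..<i}. F j s) - \<epsilon> * (\<Sum>j\<in>{i..}. F j s)) \<le> (\<Sum>j\<in>{..<i}. D s j) - \<epsilon> * (\<Sum>j\<in>{i..}. D s j)"
    proof -
      have "\<epsilon> * (\<Sum>j\<in>{i..}. D s j) \<le> \<epsilon> * (CARD('r) * (K * T s))"
        using neut_up[of "{i..}" s] s pos by (intro mult_left_mono) auto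
      moreover have "2 * t * \<delta> * (\<Sum>j\<in>{..<i}. F j s) - CARD('r) * (K * T s) \<le> (\<Sum>j\<in>{..<i}. D s j)"
        by (rule fast) (use s in auto)
      moreover have "CARD('r) * (K * ((\<Sum>j\<in>{i..}. F j s) + (\<Sum>j\<in>{..<i}. F j s))) * (1 + \<epsilon>) - 2 * t * \<delta> * (\<Sum>j\<in>{..<i}. F j s) \<le>
          c * ((\<Sum>j\<in>{..<i}. F j s) - \<epsilon> * (\<Sum>j\<in>{i..}. F j s))"
        by (rule key) (intro sum_nonneg F0 s)
      moreover have "(\<Sum>j\<in>{i..}. F j s) + (\<Sum>j\<in>{..<i}. F j s) = T s" using split(2)[of s] by simp
      moreover have "CARD('r) * (K * T s) * (1 + \<epsilon>) = CARD('r) * (K * T s) + \<epsilon> * (CARD('r) * (K * T s))"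
        by (simp add: algebra_simps)
      ultimately show ?thesis by (simp only: mult_minus_left)
    qed
    ultimately show "\<exists>D. ((\<lambda>s. (\<Sum>j\<in>{..<i}. F j s) - \<epsilon> * (\<Sum>j\<in>{i..}. F j s)) has_real_derivative D) (at s within {0..1}) \<and>
       - c * ((\<Sum>j\<in>{..<i}. F j s) - \<epsilon> * (\<Sum>j\<in>{i..}. F j s)) \<le> D" by blast
  next
    have "F j 1 = 0" if "j \<in> {..<i}" for j using bc(2) that by (simp add: F_def)
    then have "(\<Sum>j\<in>{..<i}. F j 1) = 0" by (intro sum.neutral) blast
    moreover have "\<epsilon> * (\<Sum>j\<in>{i..}. F j 1) \<ge> 0" using F0[of 1] pos by (intro mult_nonneg_nonneg sum_nonneg) auto
    ultimately show "(\<Sum>j\<in>{..<i}. F j 1) - \<epsilon> * (\<Sum>j\<in>{i..}. F j 1) \<le> 0" by linarith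
  qed
  have dom: "(\<Sum>j\<in>-{i}. F j s) \<le> 4 * \<epsilon> * F i s" and T2: "T s \<le> 2 * F i s" if s: "s \<in> {0..1}" for s
  proof -
    define P Q where "P = (\<Sum>j\<in>{..<i}. F j s)" and "Q = (\<Sum>j\<in>{i<..}. F j s)"
    have PQ: "P \<ge> 0" "Q \<ge> 0" unfolding P_def Q_def by (intro sum_nonneg F0 s)+
    have "{..i} = insert i {..<i}" "{i..} = insert i {i<..}" by auto
    then have 1: "(\<Sum>j\<in>{..i}. F j s) = F i s + P" "(\<Sum>j\<in>{i..}. F j s) = F i s + Q" by (simp_all add: P_def Q_def)
    have c: "- {i} = {..<i} \<union> {i<..}" by auto
    have "{..<i} \<inter> {i<..} = {}" by auto
    then have 2: "(\<Sum>j\<in>-{i}. F j s) = P + Q" unfolding P_def Q_def c by (intro sum.union_disjoint finite)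
    \<comment> \<open>The sum of the forward bound \<open>Q \<le> \<epsilon> * (F i s + P)\<close>
      and the backward bound \<open>P \<le> \<epsilon> * (F i s + Q)\<close>;
      \<open>\<epsilon> \<le> 1 / 4\<close> then absorbs the term \<open>P + Q\<close> on the
      right.\<close>
    have "P + Q \<le> \<epsilon> * (P + Q) + 2 * (\<epsilon> * F i s)"
      using fw[OF s] bw[OF s] unfolding 1 P_def[symmetric] Q_def[symmetric] by (simp add: algebra_simps)
    moreover have "\<epsilon> * (P + Q) \<le> (1/4) * (P + Q)" using pos PQ by (intro mult_right_mono) auto
    moreover have "\<epsilon> * F i s \<ge> 0" using pos F0[OF s] by simp
    moreover have "x \<le> 4 * y" if "x \<le> z + 2 * y" "z \<le> (1/4) * x" "y \<ge> 0" for x y z :: real using that by simp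
    ultimately have 3: "P + Q \<le> 4 * (\<epsilon> * F i s)" by blast
    then show "(\<Sum>j\<in>-{i}. F j s) \<le> 4 * \<epsilon> * F i s" by (simp add: 2)
    have "\<epsilon> * F i s \<le> 1/4 * F i s" using pos F0[OF s] by (intro mult_right_mono) auto
    then show "T s \<le> 2 * F i s" using 3 split(1)[of s] unfolding 1 Q_def[symmetric] by linarith
  qed
  have Fpos: "F i s > 0" if "s \<in> {0..1}" for s using T0[OF that] T2[OF that] by linarith
  have DK: "\<bar>D s i\<bar> \<le> 2 * K * F i s" if s: "s \<in> {0..1}" for s
  proof -
    have "\<bar>D s i\<bar> \<le> K * T s" using DF[OF s, of i] by simp
    also have "\<dots> \<le> K * (2 * F i s)" using T2[OF s] pos by (intro mult_left_mono) auto
    finally show ?thesis by simp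
  qed
  have up: "F i s \<le> F i 0 * exp (2 * K)"
  proof -
    have "F i s - F i 0 * exp (2 * K * s) \<le> 0"
    proof (rule nonpos_forward[OF _ _ s, of "\<lambda>s. F i s - F i 0 * exp (2 * K * s)" "2 * K"])
      fix s :: real assume s: "s \<in> {0..1}"
      have "((\<lambda>s. F i s - F i 0 * exp (2 * K * s)) has_real_derivative D s i - F i 0 * (exp (2 * K * s) * (2 * K))) (at s within {0..1})"
        by (rule derivative_eq_intros D s refl | simp)+
      moreover have "D s i - F i 0 * (exp (2 * K * s) * (2 * K)) \<le> 2 * K * (F i s - F i 0 * exp (2 * K * s))"
        using DK[OF s] by (simp add: algebra_simps abs_le_iff)
      ultimately show "\<exists>D. ((\<lambda>s. F i s - F i 0 * exp (2 * K * s)) has_real_derivative D) (at s within {0..1}) \<and>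
        D \<le> 2 * K * (F i s - F i 0 * exp (2 * K * s))" by blast
    qed simp
    moreover have "F i 0 * exp (2 * K * s) \<le> F i 0 * exp (2 * K)"
      using s pos F0[of 0 i] by (intro mult_left_mono) (auto simp: mult_left_le)
    ultimately show ?thesis by linarith
  qed
  have low: "F i 0 * exp (- 2 * K) \<le> F i s"
  proof -
    have "F i 0 * exp (- 2 * K * s) - F i s \<le> 0"
    proof (rule nonpos_forward[OF _ _ s, of "\<lambda>s. F i 0 * exp (- 2 * K * s) - F i s" "- 2 * K"])
      fix s :: real assume s: "s \<in> {0..1}"
      have "((\<lambda>s. F i 0 * exp (- 2 * K * s) - F i s) has_real_derivative F i 0 * (exp (- 2 * K * s) * (- 2 * K)) - D s i) (at s within {0..1})"
        by (rule derivative_eq_intros D s refl | simp)+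
      moreover have "F i 0 * (exp (- 2 * K * s) * (- 2 * K)) - D s i \<le> - 2 * K * (F i 0 * exp (- 2 * K * s) - F i s)"
        using DK[OF s] by (simp add: algebra_simps abs_le_iff)
      ultimately show "\<exists>D. ((\<lambda>s. F i 0 * exp (- 2 * K * s) - F i s) has_real_derivative D) (at s within {0..1}) \<and>
        D \<le> - 2 * K * (F i 0 * exp (- 2 * K * s) - F i s)" by blast
    qed simp
    moreover have "F i 0 * exp (- 2 * K) \<le> F i 0 * exp (- 2 * K * s)"
      using s pos F0[of 0 i] by (intro mult_left_mono) (auto simp: mult_left_le)
    ultimately show ?thesis by linarith
  qed
  have Fi0: "F i 0 = f i 0" using \<alpha>(2) by (simp add: F_def)
  show "(\<Sum>j\<in>-{i}. f j s) \<le> 4 * \<epsilon> * f i s"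
  proof -
    have "(\<Sum>j\<in>-{i}. f j s) * exp (- 2 * t * \<alpha> i s) \<le> (4 * \<epsilon> * f i s) * exp (- 2 * t * \<alpha> i s)"
      using dom[OF s] by (simp add: F_def sum_distrib_right mult_ac)
    then show ?thesis by simp
  qed
  show "f i s > 0" using Fpos[OF s] by (simp add: F_def zero_less_mult_iff)
  have fF: "f i s = F i s * exp (2 * t * \<alpha> i s)" by (simp add: F_def mult.assoc flip: exp_add)
  show "f i s \<le> f i 0 * exp (2 * t * \<alpha> i s + 2 * K)"
    using mult_right_mono[OF up, of "exp (2 * t * \<alpha> i s)"] unfolding fF Fi0 by (simp add: exp_add mult_ac)
  show "f i 0 * exp (2 * t * \<alpha> i s - 2 * K) \<le> f i s"
    using mult_right_mono[OF low, of "exp (2 * t * \<alpha> i s)"] unfolding fF Fi0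
    by (simp add: mult.assoc flip: exp_add)
qed

text \<open>\<open>n s j\<close> stands for the seminorm given by the norm of the
  \<open>j\<close>-th spectral component at \<open>s\<close>. By \<open>ker\<close> each boundary
  condition at 0 or 1 follows from one linear equation, so the conditions for a fixed
  \<open>i\<close> are one fewer than the dimension.\<close>

lemma adapted_basis:
  fixes n :: "real \<Rightarrow> 'r \<Rightarrow> (complex, 'r) vec \<Rightarrow> real"
  assumes n: "\<And>s j v. n s j v \<ge> 0" "\<And>s j c v. n s j (c *s v) = cmod c * n s j v"
    and der: "\<And>s j v. s \<in> {0..1} \<Longrightarrow> \<exists>D. ((\<lambda>s. (n s j v)\<^sup>2) has_real_derivative D) (at s within {0..1}) \<and>
      \<bar>D - 2 * t * a j s * (n s j v)\<^sup>2\<bar> \<le> K * (\<Sum>k\<in>UNIV. (n s k v)\<^sup>2)"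
    and nondeg: "\<And>s v. s \<in> {0..1} \<Longrightarrow> v \<noteq> 0 \<Longrightarrow> (\<Sum>k\<in>UNIV. (n s k v)\<^sup>2) > 0"
    and ker: "\<And>s j. s \<in> {0, 1} \<Longrightarrow> \<exists>l :: (complex, 'r) vec. \<forall>v. (\<Sum>k\<in>UNIV. l $ k * v $ k) = 0 \<longrightarrow> n s j v = 0"
  obtains b where "\<And>i. n 0 i (b i) = 1"
    "\<And>i j s. s \<in> {0..1} \<Longrightarrow> j \<noteq> i \<Longrightarrow> n s j (b i) \<le> 2 * sqrt \<epsilon> * n s i (b i)"
    "\<And>i s. s \<in> {0..1} \<Longrightarrow> n s i (b i) \<le> exp (t * \<alpha> i s + K)"
    "\<And>i s. s \<in> {0..1} \<Longrightarrow> exp (t * \<alpha> i s - K) \<le> n s i (b i)"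
proof -
  have "\<exists>v. n 0 i v = 1 \<and> (\<forall>s\<in>{0..1}. (\<forall>j. j \<noteq> i \<longrightarrow> n s j v \<le> 2 * sqrt \<epsilon> * n s i v) \<and>
      n s i v \<le> exp (t * \<alpha> i s + K) \<and> exp (t * \<alpha> i s - K) \<le> n s i v)" for i
  proof -
    \<comment> \<open>Components after \<open>i\<close> are made to vanish at 0 and those before
      \<open>i\<close> at 1, the ends from which \<open>dominated\<close> controls them.\<close>
    have "\<forall>j. \<exists>l :: (complex, 'r) vec. \<forall>v. (\<Sum>k\<in>UNIV. l $ k * v $ k) = 0 \<longrightarrow> n (if i < j then 0 else 1) j v = 0"
      using ker by auto
    then obtain L :: "'r \<Rightarrow> (complex, 'r) vec"
      where L: "\<And>j v. (\<Sum>k\<in>UNIV. L j $ k * v $ k) = 0 \<Longrightarrow> n (if i < j then 0 else 1) j v = 0" by metis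
    have "- {i} \<noteq> UNIV" by auto
    from underdetermined_solution[OF this, of L]
    obtain w where w: "w \<noteq> 0" and w0: "\<And>j. j \<noteq> i \<Longrightarrow> (\<Sum>k\<in>UNIV. L j $ k * w $ k) = 0"
      by (metis ComplI singletonD)
    have bc: "n 0 j w = 0" if "i < j" for j using L[OF w0[of j]] that by auto
    have bc': "n 1 j w = 0" if "j < i" for j using L[OF w0[of j]] that less_not_sym[OF that] by auto
    have F: "(\<Sum>j\<in>-{i}. (n s j w)\<^sup>2) \<le> 4 * \<epsilon> * (n s i w)\<^sup>2" "(n s i w)\<^sup>2 > 0"
      "(n s i w)\<^sup>2 \<le> (n 0 i w)\<^sup>2 * exp (2 * t * \<alpha> i s + 2 * K)"
      "(n 0 i w)\<^sup>2 * exp (2 * t * \<alpha> i s - 2 * K) \<le> (n s i w)\<^sup>2" if s: "s \<in> {0..1}" for s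
      using dominated[of "\<lambda>j s. (n s j w)\<^sup>2" i s, OF der _ nondeg[OF _ w] _ _ s] bc bc' by simp_all
    have n0: "n 0 i w > 0" using F(2)[of 0] n(1)[of 0 i w] by (simp add: zero_less_power2 le_less)
    \<comment> \<open>Domination at \<open>s = 0\<close> makes \<open>n 0 i w\<close> positive, so
      the vector can be normalized there.\<close>
    define v where "v = of_real (1 / n 0 i w) *s w"
    have nv: "n s j v = n s j w / n 0 i w" for s j using n0 by (simp add: v_def n(2) norm_divide)
    have "n s j v \<le> 2 * sqrt \<epsilon> * n s i v" if s: "s \<in> {0..1}" and j: "j \<noteq> i" for s j
    proof -
      have "(n s j w)\<^sup>2 \<le> (\<Sum>j\<in>-{i}. (n s j w)\<^sup>2)" using j by (intro member_le_sum) auto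
      also have "\<dots> \<le> (2 * sqrt \<epsilon> * n s i w)\<^sup>2"
        using F(1)[OF s] pos by (simp add: power_mult_distrib)
      finally have "n s j w \<le> 2 * sqrt \<epsilon> * n s i w"
        by (rule power2_le_imp_le) (use pos n(1)[of s i w] in simp)
      then show ?thesis using n0 by (simp add: nv divide_right_mono)
    qed
    moreover have "n s i v \<le> exp (t * \<alpha> i s + K)" if s: "s \<in> {0..1}" for s
    proof -
      have "(n s i w)\<^sup>2 \<le> (n 0 i w * exp (t * \<alpha> i s + K))\<^sup>2"
        using F(3)[OF s] by (simp add: power_mult_distrib flip: exp_double) (simp add: algebra_simps)
      then have "n s i w \<le> n 0 i w * exp (t * \<alpha> i s + K)"
        by (rule power2_le_imp_le) (use n0 in simp)
      then show ?thesis using n0 by (simp add: nv field_simps)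
    qed
    moreover have "exp (t * \<alpha> i s - K) \<le> n s i v" if s: "s \<in> {0..1}" for s
    proof -
      have "(n 0 i w * exp (t * \<alpha> i s - K))\<^sup>2 \<le> (n s i w)\<^sup>2"
        using F(4)[OF s] by (simp add: power_mult_distrib flip: exp_double) (simp add: algebra_simps)
      then have "n 0 i w * exp (t * \<alpha> i s - K) \<le> n s i w"
        by (rule power2_le_imp_le) (rule n)
      then show ?thesis using n0 by (simp add: nv field_simps)
    qed
    moreover have "n 0 i v = 1" using n0 by (simp add: nv)
    ultimately show ?thesis by (intro exI[of _ v]) simp
  qed
  then obtain b where b: "\<forall>i. n 0 i (b i) = 1 \<and> (\<forall>s\<in>{0..1}. (\<forall>j. j \<noteq> i \<longrightarrow> n s j (b i) \<le> 2 * sqrt \<epsilon> * n s i (b i)) \<and>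
      n s i (b i) \<le> exp (t * \<alpha> i s + K) \<and> exp (t * \<alpha> i s - K) \<le> n s i (b i))"
    by metis
  show thesis by (rule that[of b]) (simp_all add: b)
qed

text \<open>Diagonal dominance. Both sides are compared with the square of \<open>S\<close>, the sum
  of the terms \<open>cmod (x $ i) * n i (b i)\<close>: off-diagonal contributions to each
  \<open>n j\<close> are at most \<open>2 * sqrt \<epsilon> * S\<close>, and \<open>small\<close>
  keeps their total over \<open>j\<close> below \<open>S / 2\<close>. The factor
  \<open>exp (2 * K)\<close> comes from \<open>ub\<close> and \<open>lb\<close>, the powers of the
  rank from passing between sums and sums of squares.\<close>

lemma adapted_basis_comparison:
  fixes n :: "'r \<Rightarrow> (complex, 'r) vec \<Rightarrow> real"
  assumes n: "\<And>j v. n j v \<ge> 0" "\<And>j c v. n j (c *s v) = cmod c * n j v" "\<And>j v w. n j (v + w) \<le> n j v + n j w"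
    and off: "\<And>i j. j \<noteq> i \<Longrightarrow> n j (b i) \<le> 2 * sqrt \<epsilon> * n i (b i)"
    and ub: "\<And>i. n i (b i) \<le> exp (t * \<alpha> i s + K)" and lb: "\<And>i. exp (t * \<alpha> i s - K) \<le> n i (b i)"
    and small: "2 * sqrt \<epsilon> * CARD('r) \<le> 1 / 2"
  shows "(\<Sum>j\<in>UNIV. (n j (cmat b *v x))\<^sup>2) \<le> 4 * (real CARD('r))\<^sup>2 * exp (2 * K) * (\<Sum>i\<in>UNIV. (cmod (x $ i))\<^sup>2 * exp (2 * t * \<alpha> i s))"
    and "(\<Sum>i\<in>UNIV. (cmod (x $ i))\<^sup>2 * exp (2 * t * \<alpha> i s)) \<le> 4 * (real CARD('r))\<^sup>2 * exp (2 * K) * (\<Sum>j\<in>UNIV. (n j (cmat b *v x))\<^sup>2)"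
proof -
  let ?r = "real CARD('r)"
  define y where "y i = cmod (x $ i) * n i (b i)" for i
  define S where "S = (\<Sum>i\<in>UNIV. y i)"
  define W where "W = (\<Sum>i\<in>UNIV. (cmod (x $ i))\<^sup>2 * exp (2 * t * \<alpha> i s))"
  define N where "N = (\<Sum>j\<in>UNIV. (n j (cmat b *v x))\<^sup>2)"
  have r: "?r \<ge> 1" using zero_less_card_finite[where 'a = 'r] by linarith
  have y: "y i \<ge> 0" for i using n by (simp add: y_def)
  have e: "2 * sqrt \<epsilon> \<le> 1"
  proof -
    have "2 * sqrt \<epsilon> * 1 \<le> 2 * sqrt \<epsilon> * ?r" using r pos by (intro mult_left_mono) auto
    then show ?thesis using small by linarith
  qed
  have n0: "n j 0 = 0" for j using n(2)[of j 0 0] by simp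
  have nsum: "n j (\<Sum>i\<in>I. f i) \<le> (\<Sum>i\<in>I. n j (f i))" for j I and f :: "'r \<Rightarrow> (complex, 'r) vec"
    by (induction I rule: infinite_finite_induct) (auto simp: n0 intro: order_trans[OF n(3)])
  have W0: "W \<ge> 0" unfolding W_def by (intro sum_nonneg) simp
  have N0: "N \<ge> 0" unfolding N_def by (intro sum_nonneg) simp
  have ysq: "(y i)\<^sup>2 \<le> exp (2 * K) * ((cmod (x $ i))\<^sup>2 * exp (2 * t * \<alpha> i s))" for i
  proof -
    have "(n i (b i))\<^sup>2 \<le> (exp (t * \<alpha> i s + K))\<^sup>2" by (intro power_mono ub n)
    also have "\<dots> = exp (2 * K) * exp (2 * t * \<alpha> i s)" by (simp flip: exp_double exp_add add: algebra_simps)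
    finally have "(n i (b i))\<^sup>2 \<le> exp (2 * K) * exp (2 * t * \<alpha> i s)" .
    from mult_left_mono[OF this, of "(cmod (x $ i))\<^sup>2"] show ?thesis
      unfolding y_def power_mult_distrib by (simp only: mult.left_commute zero_le_power2)
  qed
  have ysq': "(cmod (x $ i))\<^sup>2 * exp (2 * t * \<alpha> i s) \<le> exp (2 * K) * (y i)\<^sup>2" for i
  proof -
    have "exp (2 * t * \<alpha> i s) = exp (2 * K) * (exp (t * \<alpha> i s - K))\<^sup>2"
      by (simp flip: exp_double exp_add add: algebra_simps)
    also have "\<dots> \<le> exp (2 * K) * (n i (b i))\<^sup>2" by (intro mult_left_mono power_mono lb) auto
    finally have "exp (2 * t * \<alpha> i s) \<le> exp (2 * K) * (n i (b i))\<^sup>2" .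
    from mult_left_mono[OF this, of "(cmod (x $ i))\<^sup>2"] show ?thesis
      unfolding y_def power_mult_distrib by (simp only: mult.left_commute zero_le_power2)
  qed
  have S2: "S\<^sup>2 \<le> ?r * (exp (2 * K) * W)"
  proof -
    have "S\<^sup>2 \<le> ?r * (\<Sum>i\<in>UNIV. (y i)\<^sup>2)"
      using sum_squared_le_sum_of_squares[of y UNIV] by (simp add: S_def mult.commute)
    also have "\<dots> \<le> ?r * (exp (2 * K) * W)"
      unfolding W_def sum_distrib_left[of "exp (2 * K)"] by (intro mult_left_mono sum_mono ysq) auto
    finally show ?thesis .
  qed
  have nj: "n j (cmat b *v x) \<le> S" for j
  proof -
    have "n j (cmat b *v x) \<le> (\<Sum>i\<in>UNIV. n j (x $ i *s b i))" unfolding cmat_mult by (rule nsum)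
    also have "\<dots> \<le> S" unfolding S_def
    proof (intro sum_mono)
      fix i
      have "n j (b i) \<le> n i (b i)"
        using off[of j i] mult_right_mono[OF e n(1)[of i "b i"]] by (cases "j = i") auto
      then show "n j (x $ i *s b i) \<le> y i" by (simp add: n(2) y_def mult_left_mono)
    qed
    finally show ?thesis .
  qed
  have "N \<le> (\<Sum>j\<in>(UNIV :: 'r set). S\<^sup>2)" unfolding N_def by (intro sum_mono power_mono nj n)
  then have "N \<le> ?r * S\<^sup>2" by simp
  also have "\<dots> \<le> ?r * (?r * (exp (2 * K) * W))" using S2 by (intro mult_left_mono) auto
  also have "\<dots> = 1 * (?r\<^sup>2 * exp (2 * K) * W)" by (simp add: power2_eq_square)
  also have "\<dots> \<le> 4 * (?r\<^sup>2 * exp (2 * K) * W)" using W0 by (intro mult_right_mono) auto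
  also have "\<dots> = 4 * ?r\<^sup>2 * exp (2 * K) * W" by simp
  finally show "(\<Sum>j\<in>UNIV. (n j (cmat b *v x))\<^sup>2) \<le> 4 * ?r\<^sup>2 * exp (2 * K) * (\<Sum>i\<in>UNIV. (cmod (x $ i))\<^sup>2 * exp (2 * t * \<alpha> i s))"
    unfolding W_def N_def .
  \<comment> \<open>Reverse triangle inequality: the term of index \<open>j\<close> is the whole
    vector minus the other terms.\<close>
  have low: "y j - 2 * sqrt \<epsilon> * S \<le> n j (cmat b *v x)" for j
  proof -
    define z where "z = (\<Sum>i\<in>-{j}. x $ i *s b i)"
    have v: "cmat b *v x = x $ j *s b j + z"
      unfolding cmat_mult z_def by (subst sum.remove[of _ j]) (auto simp: Compl_eq_Diff_UNIV)
    have "y j = n j ((x $ j *s b j + z) + (- 1) *s z)" by (simp add: n(2) y_def)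
    also have "\<dots> \<le> n j (cmat b *v x) + n j ((-1) *s z)" unfolding v by (rule n)
    also have "n j ((-1) *s z) = n j z" unfolding n(2) by simp
    also have "n j z \<le> (\<Sum>i\<in>-{j}. n j (x $ i *s b i))" unfolding z_def by (rule nsum)
    also have "\<dots> \<le> (\<Sum>i\<in>-{j}. 2 * sqrt \<epsilon> * y i)"
    proof (intro sum_mono)
      fix i assume "i \<in> - {j}"
      then have "n j (b i) \<le> 2 * sqrt \<epsilon> * n i (b i)" using off[of j i] by auto
      from mult_left_mono[OF this, of "cmod (x $ i)"]
      show "n j (x $ i *s b i) \<le> 2 * sqrt \<epsilon> * y i" by (simp add: n(2) y_def mult_ac)
    qed
    also have "\<dots> \<le> (\<Sum>i\<in>UNIV. 2 * sqrt \<epsilon> * y i)" using y pos by (intro sum_mono2) auto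
    also have "\<dots> = 2 * sqrt \<epsilon> * S" by (simp add: S_def sum_distrib_left)
    finally show ?thesis by simp
  qed
  have S0: "S \<ge> 0" unfolding S_def by (intro sum_nonneg y)
  have "S - ?r * (2 * sqrt \<epsilon> * S) = (\<Sum>j\<in>UNIV. y j - 2 * sqrt \<epsilon> * S)" by (simp add: sum_subtractf S_def)
  also have "\<dots> \<le> (\<Sum>j\<in>UNIV. n j (cmat b *v x))" by (intro sum_mono low)
  finally have "S - ?r * (2 * sqrt \<epsilon> * S) \<le> (\<Sum>j\<in>UNIV. n j (cmat b *v x))" .
  moreover have "?r * (2 * sqrt \<epsilon> * S) \<le> 1/2 * S" using mult_right_mono[OF small S0] by (simp add: mult_ac)
  ultimately have "S \<le> 2 * (\<Sum>j\<in>UNIV. n j (cmat b *v x))" by linarith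
  then have "S\<^sup>2 \<le> (2 * (\<Sum>j\<in>UNIV. n j (cmat b *v x)))\<^sup>2" using S0 by (rule power_mono)
  also have "\<dots> = 4 * (\<Sum>j\<in>UNIV. n j (cmat b *v x))\<^sup>2" by (simp add: power_mult_distrib)
  also have "\<dots> \<le> 4 * (?r * N)"
    using sum_squared_le_sum_of_squares[of "\<lambda>j. n j (cmat b *v x)" UNIV] by (simp add: N_def mult.commute)
  finally have S3: "S\<^sup>2 \<le> 4 * (?r * N)" .
  have "(\<Sum>i\<in>UNIV. (y i)\<^sup>2) \<le> (\<Sum>i\<in>UNIV. y i * S)"
    unfolding power2_eq_square S_def by (intro sum_mono mult_left_mono y member_le_sum) (auto simp: y)
  then have "(\<Sum>i\<in>UNIV. (y i)\<^sup>2) \<le> S\<^sup>2" by (simp add: S_def power2_eq_square flip: sum_distrib_right)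
  also note S3
  also have "4 * (?r * N) \<le> 4 * (?r * ?r * N)"
    using r N0 by (intro mult_left_mono mult_right_mono) auto
  finally have y2: "(\<Sum>i\<in>UNIV. (y i)\<^sup>2) \<le> 4 * (?r * ?r * N)" .
  have "W \<le> exp (2 * K) * (\<Sum>i\<in>UNIV. (y i)\<^sup>2)" unfolding W_def sum_distrib_left by (intro sum_mono ysq')
  also have "\<dots> \<le> exp (2 * K) * (4 * (?r * ?r * N))" using y2 by (intro mult_left_mono) auto
  also have "\<dots> = 4 * ?r\<^sup>2 * exp (2 * K) * N" by (simp add: power2_eq_square)
  finally show "(\<Sum>i\<in>UNIV. (cmod (x $ i))\<^sup>2 * exp (2 * t * \<alpha> i s)) \<le> 4 * ?r\<^sup>2 * exp (2 * K) * (\<Sum>j\<in>UNIV. (n j (cmat b *v x))\<^sup>2)"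
    unfolding W_def N_def .
qed

end

section \<open>Spectral projections\<close>

definition spectral_factor :: "complex ^ 'n::finite ^ 'n \<Rightarrow> ('n \<Rightarrow> complex) \<Rightarrow> 'n \<Rightarrow> 'n \<Rightarrow> complex ^ 'n ^ 'n" where
  "spectral_factor A l i k = (\<chi> a b. (A $ a $ b - (if a = b then l k else 0)) / (l i - l k))"

text \<open>Lagrange interpolation: the product of \<open>(A - l k) / (l i - l k)\<close> over all
  \<open>k\<close> other than \<open>i\<close>, which for simple eigenvalues is the projection to
  the \<open>i\<close>-th eigenline. Being rational in \<open>A\<close> and \<open>l\<close>, it
  inherits their differentiability without any choice of eigenvectors. The sorted list merely fixes
  an order of the factors.\<close>

definition spectral_proj :: "complex ^ 'n::{finite,linorder} ^ 'n::{finite,linorder} \<Rightarrow> ('n \<Rightarrow> complex) \<Rightarrow> 'n \<Rightarrow>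
    complex ^ 'n::{finite,linorder} ^ 'n::{finite,linorder}" where
  "spectral_proj A l i = foldr (\<lambda>k M. spectral_factor A l i k ** M) (sorted_list_of_set (UNIV - {i})) (mat 1)"

lemma spectral_factor_mult: "spectral_factor A l i k *v v = (1 / (l i - l k)) *s (A *v v - l k *s v)"
proof -
  have "(\<Sum>b\<in>UNIV. (if a = b then l k else 0) / (l i - l k) * v $ b) = l k / (l i - l k) * v $ a" for a
    by (subst sum.remove[of _ a]) auto
  moreover have "(\<Sum>b\<in>UNIV. (A $ a $ b - (if a = b then l k else 0)) / (l i - l k) * v $ b) =
      (\<Sum>b\<in>UNIV. A $ a $ b * v $ b) / (l i - l k) - (\<Sum>b\<in>UNIV. (if a = b then l k else 0) / (l i - l k) * v $ b)" for a
    by (simp add: diff_divide_distrib left_diff_distrib sum_subtractf sum_divide_distrib)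
  ultimately show ?thesis
    by (simp add: spectral_factor_def matrix_vector_mult_def vec_eq_iff diff_divide_distrib)
qed

lemma spectral_factor_scale: "c \<noteq> 0 \<Longrightarrow> spectral_factor (\<chi> a b. c * A $ a $ b) (\<lambda>i. c * l i) i k = spectral_factor A l i k"
proof -
  assume c: "c \<noteq> 0"
  have "(c * x - (if q then c * y else 0)) / (c * z - c * w) = (x - (if q then y else 0)) / (z - w)" for x y z w :: complex and q
    using mult_divide_mult_cancel_left[OF c, of "x - (if q then y else 0)" "z - w"]
    by (cases q) (simp_all add: right_diff_distrib)
  then show ?thesis by (simp add: spectral_factor_def vec_eq_iff)
qed

text \<open>Lets the projections of the pulled back form be computed from the Higgs field itself,
  without the velocity factor, which is only continuous.\<close>

lemma spectral_proj_scale: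
  assumes "c \<noteq> 0" shows "spectral_proj (\<chi> a b. c * A $ a $ b) (\<lambda>i. c * l i) i = spectral_proj A l i"
  by (simp add: spectral_proj_def spectral_factor_scale[OF assms])

lemma spectral_factor_intertwine:
  assumes "A' ** g = g ** A" shows "spectral_factor A' l i k ** g = g ** spectral_factor A l i k"
proof -
  have "A' *v (g *v v) = g *v (A *v v)" for v using assms by (simp add: matrix_vector_mul_assoc)
  then have "(spectral_factor A' l i k ** g) *v v = (g ** spectral_factor A l i k) *v v" for v
    by (simp add: spectral_factor_mult matrix_vector_mult_diff_distrib vector_scalar_commute
        flip: matrix_vector_mul_assoc)
  then show ?thesis by (simp add: matrix_eq)
qed

text \<open>A polynomial in the matrix intertwines whenever the matrix does; this makes the spectral
  components independent of the trivialization.\<close>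

lemma spectral_proj_intertwine:
  assumes "A' ** g = g ** A" shows "spectral_proj A' l i ** g = g ** spectral_proj A l i"
proof -
  have "foldr (\<lambda>k M. spectral_factor A' l i k ** M) ks (mat 1) ** g =
      g ** foldr (\<lambda>k M. spectral_factor A l i k ** M) ks (mat 1)" for ks
  proof (induction ks)
    case (Cons k ks)
    then show ?case
      using spectral_factor_intertwine[OF assms, of l i k] by (simp flip: matrix_mul_assoc) (simp add: matrix_mul_assoc)
  qed simp
  then show ?thesis by (simp add: spectral_proj_def)
qed

lemma spectral_proj_eigenvector:
  assumes l: "inj l" and w: "A *v w = l m *s w"
  shows "spectral_proj A l i *v w = (if m = i then w else 0)"
proof -
  have f: "foldr (\<lambda>k M. spectral_factor A l i k ** M) ks (mat 1) *v w = (\<Prod>k\<leftarrow>ks. (l m - l k) / (l i - l k)) *s w" for ks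
  proof (induction ks)
    case (Cons k ks)
    have "spectral_factor A l i k *v w = ((l m - l k) / (l i - l k)) *s w"
      unfolding spectral_factor_mult w by (simp add: vec_eq_iff left_diff_distrib diff_divide_distrib)
    then show ?case by (simp add: Cons vector_scalar_commute vector_smult_assoc mult.commute flip: matrix_vector_mul_assoc)
  qed simp
  have "(\<Prod>k\<leftarrow>sorted_list_of_set (UNIV - {i}). (l m - l k) / (l i - l k)) = (\<Prod>k\<in>UNIV - {i}. (l m - l k) / (l i - l k))"
    by (subst prod.distinct_set_conv_list[symmetric]) auto
  also have "\<dots> = (if m = i then 1 else 0)"
  proof (cases "m = i")
    case True
    have "(\<Prod>k\<in>UNIV - {i}. (l i - l k) / (l i - l k)) = 1"
      using l by (intro prod.neutral) (auto simp: inj_eq)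
    then show ?thesis using True by simp
  qed (auto intro!: prod_zero bexI[of _ m])
  finally show ?thesis unfolding spectral_proj_def f by simp
qed

text \<open>Every root of the characteristic polynomial has an eigenvector; applying the spectral
  projections to a vanishing combination isolates its terms.\<close>

lemma eigenbasis:
  fixes A :: "complex ^ 'n::{finite,linorder} ^ 'n::{finite,linorder}"
  assumes l: "inj l" and char: "\<And>z. charpoly_fun A z = (\<Prod>i\<in>UNIV. z - l i)"
  obtains W where "det (cmat W) \<noteq> 0" "\<And>i. A *v W i = l i *s W i"
proof -
  have "\<exists>w. w \<noteq> 0 \<and> A *v w = l i *s w" for i
  proof -
    have "det (mat (l i) - A) = 0"
      using char[of "l i"] by (simp add: charpoly_fun_def) (metis finite_UNIV UNIV_I diff_self prod_zero)
    then obtain w where w: "(mat (l i) - A) *v w = 0" "w \<noteq> 0" using det_nzI by metis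
    have "mat (l i) *v w = l i *s w"
      by (simp add: mat_def matrix_vector_mult_def vec_eq_iff if_distrib[of "\<lambda>x. x * _"] cong: if_cong)
    then show ?thesis using w by (intro exI[of _ w]) (simp add: matrix_vector_mult_diff_rdistrib)
  qed
  then obtain W where W: "\<And>i. W i \<noteq> 0" "\<And>i. A *v W i = l i *s W i" by metis
  have "det (cmat W) \<noteq> 0"
  proof (rule det_nzI)
    fix x assume x: "cmat W *v x = 0"
    have "x $ i *s W i = 0" for i
    proof -
      have "spectral_proj A l i *v (cmat W *v x) = (\<Sum>j\<in>UNIV. x $ j *s (spectral_proj A l i *v W j))"
        unfolding cmat_mult by (simp add: vec.sum vector_scalar_commute)
      also have "\<dots> = (\<Sum>j\<in>UNIV. if j = i then x $ i *s W i else 0)"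
        by (intro sum.cong) (auto simp: spectral_proj_eigenvector[OF l W(2)])
      finally show ?thesis by (simp add: x)
    qed
    then show "x = 0" using W(1) by (simp add: vec_eq_iff) (metis vec_eq_iff zero_index)
  qed
  then show thesis using that W by blast
qed

text \<open>All three claims are read off in an eigenbasis \<open>W\<close>. The last one records
  that the projection has rank at most one: it vanishes on the kernel of the \<open>i\<close>-th
  coordinate functional, a row of the inverse of \<open>cmat W\<close>.\<close>

lemma spectral_resolution:
  fixes A :: "complex ^ 'n::{finite,linorder} ^ 'n::{finite,linorder}"
  assumes l: "inj l" and char: "\<And>z. charpoly_fun A z = (\<Prod>i\<in>UNIV. z - l i)"
  shows "(\<Sum>i\<in>UNIV. spectral_proj A l i *v v) = v"
    and "spectral_proj A l i *v (A *v v) = l i *s (spectral_proj A l i *v v)"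
    and "\<exists>L. \<forall>v. (\<Sum>k\<in>UNIV. L $ k * v $ k) = 0 \<longrightarrow> spectral_proj A l i *v v = 0"
proof -
  obtain W where W: "det (cmat W) \<noteq> 0" "\<And>i. A *v W i = l i *s W i" by (rule eigenbasis[OF assms]) blast
  have P: "spectral_proj A l i *v (cmat W *v x) = x $ i *s W i" for x i
  proof -
    have "spectral_proj A l i *v (cmat W *v x) = (\<Sum>j\<in>UNIV. x $ j *s (spectral_proj A l i *v W j))"
      unfolding cmat_mult by (simp add: vec.sum vector_scalar_commute)
    also have "\<dots> = (\<Sum>j\<in>UNIV. if j = i then x $ i *s W i else 0)"
      by (intro sum.cong) (auto simp: spectral_proj_eigenvector[OF l W(2)])
    finally show ?thesis by simp
  qed
  have AW: "A *v (cmat W *v x) = cmat W *v (\<chi> j. l j * x $ j)" for x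
    unfolding cmat_mult
    by (simp add: vec.sum vector_scalar_commute W(2) vector_smult_assoc mult.commute)
  obtain x where x: "cmat W *v x = v" using det_nz_solve[OF W(1)] .
  show "(\<Sum>i\<in>UNIV. spectral_proj A l i *v v) = v"
    unfolding x[symmetric] P by (simp add: cmat_mult)
  show "spectral_proj A l i *v (A *v v) = l i *s (spectral_proj A l i *v v)"
    unfolding x[symmetric] AW P by (simp add: vector_smult_assoc)
  have "invertible (cmat W)" using W(1) invertible_det_nz by blast
  then obtain V where V: "cmat W ** V = mat 1" unfolding invertible_def by blast
  have "spectral_proj A l i *v v = (V *v v) $ i *s W i" for v
    using P[of i "V *v v"] V by (simp add: matrix_vector_mul_assoc)
  then show "\<exists>L. \<forall>v. (\<Sum>k\<in>UNIV. L $ k * v $ k) = 0 \<longrightarrow> spectral_proj A l i *v v = 0"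
    by (intro exI[of _ "V $ i"]) (simp add: matrix_vector_mult_def)
qed

section \<open>Continuously differentiable coefficients\<close>

text \<open>Derivatives are taken within \<open>{0..1}\<close> even at the ends of a smaller
  \<open>I\<close>, so statements proved on overlapping pieces concern the same derivatives.\<close>

definition C1_on :: "real set \<Rightarrow> (real \<Rightarrow> complex) \<Rightarrow> bool" where
  "C1_on I f \<longleftrightarrow> (\<exists>f'. continuous_on I f' \<and> (\<forall>s\<in>I. (f has_vector_derivative f' s) (at s within {0..1})))"

lemma C1_on_continuous:
  assumes "C1_on I f" "I \<subseteq> {0..1}" shows "continuous_on I f"
proof -
  have "continuous (at s within {0..1}) f" if "s \<in> I" for s
    using assms that has_vector_derivative_continuous unfolding C1_on_def by blast
  then show ?thesis using assms(2) continuous_within_subset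
    unfolding continuous_on_eq_continuous_within by blast
qed

lemma C1_on_const: "C1_on I (\<lambda>_. c)"
  unfolding C1_on_def by (intro exI[of _ "\<lambda>_. 0"]) auto

lemma C1_on_add:
  assumes "C1_on I f" "C1_on I g" shows "C1_on I (\<lambda>s. f s + g s)"
proof -
  obtain f' g' where "continuous_on I f'" "\<forall>s\<in>I. (f has_vector_derivative f' s) (at s within {0..1})"
    "continuous_on I g'" "\<forall>s\<in>I. (g has_vector_derivative g' s) (at s within {0..1})"
    using assms unfolding C1_on_def by blast
  then show ?thesis unfolding C1_on_def
    by (intro exI[of _ "\<lambda>s. f' s + g' s"]) (auto intro!: continuous_intros has_vector_derivative_add)
qed

lemma C1_on_mult:
  assumes "C1_on I f" "C1_on I g" "I \<subseteq> {0..1}" shows "C1_on I (\<lambda>s. f s * g s)"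
proof -
  obtain f' g' where "continuous_on I f'" "\<forall>s\<in>I. (f has_vector_derivative f' s) (at s within {0..1})"
    "continuous_on I g'" "\<forall>s\<in>I. (g has_vector_derivative g' s) (at s within {0..1})"
    using assms unfolding C1_on_def by blast
  then show ?thesis unfolding C1_on_def
    using C1_on_continuous[OF assms(1,3)] C1_on_continuous[OF assms(2,3)]
    by (intro exI[of _ "\<lambda>s. f s * g' s + f' s * g s"])
       (auto intro!: continuous_intros has_vector_derivative_mult)
qed

lemma C1_on_sum:
  assumes "\<And>i. i \<in> J \<Longrightarrow> C1_on I (f i)" shows "C1_on I (\<lambda>s. \<Sum>i\<in>J. f i s)"
  using assms by (induction J rule: infinite_finite_induct) (auto intro: C1_on_const C1_on_add)

lemma C1_on_holomorphic:
  assumes f: "f holomorphic_on S" "open S" and z: "C1_on I \<zeta>" "\<zeta> ` I \<subseteq> S" "I \<subseteq> {0..1}"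
  shows "C1_on I (\<lambda>s. f (\<zeta> s))"
proof -
  obtain \<zeta>' where \<zeta>': "continuous_on I \<zeta>'" "\<And>s. s \<in> I \<Longrightarrow> (\<zeta> has_vector_derivative \<zeta>' s) (at s within {0..1})"
    using z(1) unfolding C1_on_def by blast
  have "(\<lambda>s. f (\<zeta> s)) = f \<circ> \<zeta>" by auto
  then have "((\<lambda>s. f (\<zeta> s)) has_vector_derivative \<zeta>' s * deriv f (\<zeta> s)) (at s within {0..1})" if "s \<in> I" for s
    using field_vector_diff_chain_within[OF \<zeta>'(2)[OF that] has_field_derivative_at_within[OF holomorphic_derivI[OF f, of "\<zeta> s"]]] that z(2)
    by auto
  moreover have "continuous_on I (\<lambda>s. \<zeta>' s * deriv f (\<zeta> s))"
    using z(2) f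
    by (intro continuous_intros \<zeta>' continuous_on_compose2[OF holomorphic_on_imp_continuous_on[OF holomorphic_deriv] C1_on_continuous[OF z(1,3)]])
  ultimately show ?thesis unfolding C1_on_def by blast
qed

lemma C1_on_matrix_mult:
  fixes M M' :: "real \<Rightarrow> complex ^ 'n::finite ^ 'n"
  assumes "\<And>a b. C1_on I (\<lambda>s. M s $ a $ b)" "\<And>a b. C1_on I (\<lambda>s. M' s $ a $ b)" "I \<subseteq> {0..1}"
  shows "C1_on I (\<lambda>s. (M s ** M' s) $ a $ b)"
  unfolding matrix_matrix_mult_def by (simp, intro C1_on_sum C1_on_mult assms)

lemma C1_on_spectral_proj:
  fixes A :: "real \<Rightarrow> complex ^ 'n::{finite,linorder} ^ 'n::{finite,linorder}"
  assumes A: "\<And>a b. C1_on I (\<lambda>s. A s $ a $ b)" and l: "\<And>i. C1_on I (\<lambda>s. l s i)"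
    and I: "I \<subseteq> {0..1}" and inj: "\<And>s. s \<in> I \<Longrightarrow> inj (l s)"
  shows "C1_on I (\<lambda>s. spectral_proj (A s) (l s) i $ a $ b)"
proof -
  have minus: "C1_on I (\<lambda>s. - f s)" if "C1_on I f" for f
    using C1_on_mult[OF C1_on_const[of I "- 1"] that I] by simp
  have inv: "C1_on I (\<lambda>s. 1 / (l s i - l s k))" if "k \<noteq> i" for k
  proof -
    have "C1_on I (\<lambda>s. (\<lambda>z. 1 / z) (l s i - l s k))"
    proof (rule C1_on_holomorphic[of "\<lambda>z. 1 / z" "- {0}" I "\<lambda>s. l s i - l s k"])
      show "(\<lambda>z. 1 / z) holomorphic_on - {0}" by (intro holomorphic_intros) auto
      show "C1_on I (\<lambda>s. l s i - l s k)" using C1_on_add[OF l[of i] minus[OF l[of k]]] by simp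
      show "(\<lambda>s. l s i - l s k) ` I \<subseteq> - {0}" using inj that by (auto simp: inj_eq)
    qed (use I in auto)
    then show ?thesis by simp
  qed
  have fac: "C1_on I (\<lambda>s. spectral_factor (A s) (l s) i k $ a $ b)" if "k \<noteq> i" for k a b
  proof -
    have "C1_on I (\<lambda>s. (A s $ a $ b + - (if a = b then l s k else 0)) * (1 / (l s i - l s k)))"
      by (intro C1_on_mult C1_on_add A minus inv that I) (cases "a = b"; simp add: l C1_on_const)
    then show ?thesis by (simp add: spectral_factor_def)
  qed
  have "C1_on I (\<lambda>s. foldr (\<lambda>k M. spectral_factor (A s) (l s) i k ** M) ks (mat 1) $ a $ b)" if "i \<notin> set ks" for ks a b
    using that
  proof (induction ks arbitrary: a b)
    case Nil then show ?case by (simp add: C1_on_const)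
  next
    case (Cons k ks)
    then show ?case by (simp, intro C1_on_matrix_mult fac I) auto
  qed
  then show ?thesis unfolding spectral_proj_def by simp
qed

section \<open>The local estimate\<close>

lemma continuous_entries_bounded:
  fixes M :: "'a::topological_space \<Rightarrow> complex ^ 'n::finite ^ 'm::finite"
  assumes "compact I" "\<And>a b. continuous_on I (\<lambda>s. M s $ a $ b)"
  obtains m :: real where "m \<ge> 0" "\<And>s a b. s \<in> I \<Longrightarrow> cmod (M s $ a $ b) \<le> m"
proof -
  define f where "f s = (\<Sum>a\<in>UNIV. \<Sum>b\<in>UNIV. cmod (M s $ a $ b))" for s
  have "continuous_on I f" unfolding f_def by (intro continuous_on_sum continuous_on_norm assms)
  then have "compact (f ` I)" using assms(1) by (intro compact_continuous_image)
  from compact_imp_bounded[OF this] obtain m where "\<forall>y\<in>f ` I. norm y \<le> m" unfolding bounded_iff by blast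
  then have m: "f s \<le> m" if "s \<in> I" for s using that by fastforce
  have "cmod (M s $ a $ b) \<le> f s" for s a b
    unfolding f_def
    by (rule order_trans[OF member_le_sum[of b UNIV] member_le_sum[of a UNIV]]) (auto intro: sum_nonneg)
  then have "cmod (M s $ a $ b) \<le> max 0 m" if "s \<in> I" for s a b
    using m[OF that] by (meson max.coboundedI2 order_trans)
  then show thesis using that[of "max 0 m"] by simp
qed

lemma cmod_sesq_le:
  fixes H :: "complex ^ 'n::finite ^ 'n"
  assumes "\<And>a b. cmod (H $ a $ b) \<le> m"
  shows "cmod (sesq H v w) \<le> (real CARD('n))\<^sup>2 * m * (norm v * norm w)"
proof -
  have m: "m \<ge> 0" using assms norm_ge_zero order_trans by blast
  have "cmod (sesq H v w) \<le> (\<Sum>i\<in>UNIV. \<Sum>j\<in>UNIV. cmod (H $ i $ j * v $ i * cnj (w $ j)))"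
    unfolding sesq_def by (intro order_trans[OF norm_sum] sum_mono norm_sum)
  also have "\<dots> \<le> (\<Sum>i\<in>(UNIV :: 'n set). \<Sum>j\<in>(UNIV :: 'n set). m * (norm v * norm w))"
  proof (intro sum_mono)
    fix i j
    have "cmod (H $ i $ j) * (cmod (v $ i) * cmod (w $ j)) \<le> m * (norm v * norm w)"
      by (intro mult_mono assms m Finite_Cartesian_Product.norm_nth_le) auto
    then show "cmod (H $ i $ j * v $ i * cnj (w $ j)) \<le> m * (norm v * norm w)"
      by (simp add: norm_mult mult.assoc)
  qed
  also have "\<dots> = (real CARD('n))\<^sup>2 * m * (norm v * norm w)" by (simp add: power2_eq_square)
  finally show ?thesis .
qed

lemma sesq_has_vector_derivative:
  fixes H :: "real \<Rightarrow> complex ^ 'n::finite ^ 'n"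
  assumes "\<And>a b. ((\<lambda>s. H s $ a $ b) has_vector_derivative H' $ a $ b) (at s within S)"
    "\<And>a. ((\<lambda>s. v s $ a) has_vector_derivative v' $ a) (at s within S)"
    "\<And>a. ((\<lambda>s. w s $ a) has_vector_derivative w' $ a) (at s within S)"
  shows "((\<lambda>s. sesq (H s) (v s) (w s)) has_vector_derivative
    sesq H' (v s) (w s) + sesq (H s) v' (w s) + sesq (H s) (v s) w') (at s within S)"
proof -
  have "((\<lambda>s. H s $ a $ b * v s $ a * cnj (w s $ b)) has_vector_derivative
    (H s $ a $ b * v s $ a) * cnj (w' $ b) + (H s $ a $ b * v' $ a + H' $ a $ b * v s $ a) * cnj (w s $ b)) (at s within S)" for a b
    by (intro has_vector_derivative_mult has_vector_derivative_cnj assms)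
  then have "((\<lambda>s. sesq (H s) (v s) (w s)) has_vector_derivative
    (\<Sum>a\<in>UNIV. \<Sum>b\<in>UNIV. (H s $ a $ b * v s $ a) * cnj (w' $ b) + (H s $ a $ b * v' $ a + H' $ a $ b * v s $ a) * cnj (w s $ b))) (at s within S)"
    unfolding sesq_def by (intro has_vector_derivative_sum)
  then show ?thesis by (simp add: sesq_def sum.distrib algebra_simps)
qed

lemma matrix_vector_has_vector_derivative:
  fixes M :: "real \<Rightarrow> complex ^ 'n::finite ^ 'm::finite"
  assumes "\<And>a b. ((\<lambda>s. M s $ a $ b) has_vector_derivative M' $ a $ b) (at s within S)"
    "\<And>a. ((\<lambda>s. v s $ a) has_vector_derivative v' $ a) (at s within S)"
  shows "((\<lambda>s. (M s *v v s) $ a) has_vector_derivative (M' *v v s + M s *v v') $ a) (at s within S)"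
proof -
  have "((\<lambda>s. \<Sum>b\<in>UNIV. M s $ a $ b * v s $ b) has_vector_derivative
    (\<Sum>b\<in>UNIV. M s $ a $ b * v' $ b + M' $ a $ b * v s $ b)) (at s within S)"
    by (intro has_vector_derivative_sum has_vector_derivative_mult assms)
  then show ?thesis by (simp add: matrix_vector_mult_def sum.distrib add.commute)
qed

lemma scaleR_matrix_vector: "(t *\<^sub>R N) *v v = complex_of_real t *s (N *v v)" for N :: "complex ^ 'n::finite ^ 'm::finite"
  by (simp add: matrix_vector_mult_def vec_eq_iff sum_distrib_left mult.assoc scaleR_conv_of_real[where 'a = complex])

text \<open>The derivative of \<open>Pm j s *v y s\<close> is \<open>t * al j s\<close> times itself
  plus \<open>(P' j s - Pm j s ** Bm s) *v y s\<close>. The large parameter multiplies only a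
  scalar, so the error in the growth of the squared norm is bounded independently of t by the
  squared norm of \<open>y s\<close>, and by \<open>res\<close> by the sum over all
  components.\<close>

lemma wkb_local_estimate:
  fixes H N Bm :: "real \<Rightarrow> complex ^ 'n::finite ^ 'n" and Pm :: "'n \<Rightarrow> real \<Rightarrow> complex ^ 'n ^ 'n"
    and al :: "'n \<Rightarrow> real \<Rightarrow> complex"
  defines "k \<equiv> \<lambda>s. qf (sesq (H s))"
  assumes I: "compact I" "I \<subseteq> {0..1}"
    and H: "\<And>a b. C1_on I (\<lambda>s. H s $ a $ b)" "\<And>s. s \<in> I \<Longrightarrow> hform (sesq (H s))"
    and P: "\<And>j a b. C1_on I (\<lambda>s. Pm j s $ a $ b)"
    and Bm: "\<And>a b. continuous_on I (\<lambda>s. Bm s $ a $ b)"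
    and comm: "\<And>s j v. s \<in> I \<Longrightarrow> Pm j s *v (N s *v v) = al j s *s (Pm j s *v v)"
    and res: "\<And>s v. s \<in> I \<Longrightarrow> (\<Sum>j\<in>UNIV. Pm j s *v v) = v"
  obtains M where "\<And>s v. s \<in> I \<Longrightarrow> (\<Sum>j\<in>UNIV. k s (Pm j s *v v)) \<le> M * k s v"
    "\<And>s v. s \<in> I \<Longrightarrow> k s v \<le> M * (\<Sum>j\<in>UNIV. k s (Pm j s *v v))"
    "\<And>s t y j. s \<in> I \<Longrightarrow> (\<And>i. ((\<lambda>s. y s $ i) has_vector_derivative ((t *\<^sub>R N s - Bm s) *v y s) $ i) (at s within {0..1})) \<Longrightarrow>
      \<exists>D. ((\<lambda>s. k s (Pm j s *v y s)) has_real_derivative D) (at s within {0..1}) \<and>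
        \<bar>D - 2 * t * Re (al j s) * k s (Pm j s *v y s)\<bar> \<le> M * (\<Sum>j\<in>UNIV. k s (Pm j s *v y s))"
proof -
  let ?r = "real CARD('n)"
  have "\<exists>H'. \<forall>a b. continuous_on I (H' a b) \<and> (\<forall>s\<in>I. ((\<lambda>s. H s $ a $ b) has_vector_derivative H' a b s) (at s within {0..1}))"
    using H(1) unfolding C1_on_def by metis
  then obtain H0 where H0: "\<And>a b. continuous_on I (H0 a b)"
    "\<And>a b s. s \<in> I \<Longrightarrow> ((\<lambda>s. H s $ a $ b) has_vector_derivative H0 a b s) (at s within {0..1})" by blast
  define H' where "H' s = (\<chi> a b. H0 a b s)" for s
  have "\<exists>P'. \<forall>j a b. continuous_on I (P' j a b) \<and> (\<forall>s\<in>I. ((\<lambda>s. Pm j s $ a $ b) has_vector_derivative P' j a b s) (at s within {0..1}))"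
    using P unfolding C1_on_def by metis
  then obtain P0 where P0: "\<And>j a b. continuous_on I (P0 j a b)"
    "\<And>j a b s. s \<in> I \<Longrightarrow> ((\<lambda>s. Pm j s $ a $ b) has_vector_derivative P0 j a b s) (at s within {0..1})" by blast
  define P' where "P' j s = (\<chi> a b. P0 j a b s)" for j s
  note Hc = C1_on_continuous[OF H(1) I(2)] and Pc = C1_on_continuous[OF P I(2)]
  obtain m1 where m1: "m1 \<ge> 0" "\<And>s a b. s \<in> I \<Longrightarrow> cmod (H s $ a $ b) \<le> m1"
    by (rule continuous_entries_bounded[OF I(1) Hc]) blast
  obtain m2 where m2: "m2 \<ge> 0" "\<And>s a b. s \<in> I \<Longrightarrow> cmod (H' s $ a $ b) \<le> m2"
    by (rule continuous_entries_bounded[OF I(1), of H']) (auto simp: H'_def H0)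
  have "\<exists>m\<ge>0. \<forall>s\<in>I. \<forall>a b. cmod (Pm j s $ a $ b) \<le> m" for j
    by (rule continuous_entries_bounded[OF I(1) Pc[of j]]) blast
  then obtain n1 where n1: "\<And>j. n1 j \<ge> 0" "\<And>j s a b. s \<in> I \<Longrightarrow> cmod (Pm j s $ a $ b) \<le> n1 j" by metis
  have "\<exists>m\<ge>0. \<forall>s\<in>I. \<forall>a b. cmod ((P' j s - Pm j s ** Bm s) $ a $ b) \<le> m" for j
  proof -
    have "continuous_on I (\<lambda>s. (P' j s - Pm j s ** Bm s) $ a $ b)" for a b
      unfolding matrix_matrix_mult_def by (simp add: P'_def, intro continuous_intros P0 Pc Bm)
    from continuous_entries_bounded[OF I(1) this] show ?thesis by metis
  qed
  then obtain n2 where n2: "\<And>j. n2 j \<ge> 0" "\<And>j s a b. s \<in> I \<Longrightarrow> cmod ((P' j s - Pm j s ** Bm s) $ a $ b) \<le> n2 j" by metis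
  define p1 where "p1 = (\<Sum>j\<in>UNIV. ?r * (?r * n1 j))"
  define p2 where "p2 = (\<Sum>j\<in>UNIV. ?r * (?r * n2 j))"
  have p0: "p1 \<ge> 0" "p2 \<ge> 0" unfolding p1_def p2_def by (intro sum_nonneg mult_nonneg_nonneg n1 n2; simp)+
  have Pb: "norm (Pm j s *v v) \<le> p1 * norm v" if "s \<in> I" for j s v
  proof -
    have "norm (Pm j s *v v) \<le> ?r * (?r * n1 j) * norm v" by (intro norm_matrix_vector_le n1 that)
    also have "\<dots> \<le> p1 * norm v" unfolding p1_def
      by (intro mult_right_mono member_le_sum[of j UNIV "\<lambda>j. ?r * (?r * n1 j)"]) (auto simp: n1)
    finally show ?thesis .
  qed
  have Rb: "norm ((P' j s - Pm j s ** Bm s) *v v) \<le> p2 * norm v" if "s \<in> I" for j s v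
  proof -
    have "norm ((P' j s - Pm j s ** Bm s) *v v) \<le> ?r * (?r * n2 j) * norm v" by (intro norm_matrix_vector_le n2 that)
    also have "\<dots> \<le> p2 * norm v" unfolding p2_def
      by (intro mult_right_mono member_le_sum[of j UNIV "\<lambda>j. ?r * (?r * n2 j)"]) (auto simp: n2)
    finally show ?thesis .
  qed
  have kub: "k s v \<le> ?r\<^sup>2 * m1 * (norm v)\<^sup>2" if "s \<in> I" for s v
    using order_trans[OF complex_Re_le_cmod cmod_sesq_le[of "H s" m1 v v]] m1 that
    by (simp add: k_def qf_def power2_eq_square)
  have k0: "k s v \<ge> 0" if "s \<in> I" for s v unfolding k_def by (rule qf_nonneg[OF H(2)[OF that]])
  \<comment> \<open>A uniform lower bound for the forms, by compactness of \<open>I\<close> times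
    the unit sphere; for empty \<open>I\<close> any positive value does.\<close>
  obtain \<kappa> where \<kappa>: "\<kappa> > 0" "\<And>s v. s \<in> I \<Longrightarrow> \<kappa> * (norm v)\<^sup>2 \<le> k s v"
  proof (cases "I = {}")
    case False
    let ?S = "I \<times> sphere (0 :: complex ^ 'n) 1"
    have cs: "compact ?S" by (intro compact_Times I compact_sphere)
    have "axis undefined 1 \<in> sphere (0 :: complex ^ 'n) 1" by (simp add: norm_axis_1)
    then have ne: "?S \<noteq> {}" using False by blast
    have "continuous_on ?S (\<lambda>q. k (fst q) (snd q))"
      unfolding k_def qf_def sesq_def
      by (intro continuous_on_Re continuous_on_sum continuous_on_mult continuous_on_cnj continuous_intros
          continuous_on_compose2[OF Hc continuous_on_fst[OF continuous_on_id]]) auto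
    from continuous_attains_inf[OF cs ne this] obtain q where q: "q \<in> ?S" "\<And>q'. q' \<in> ?S \<Longrightarrow> k (fst q) (snd q) \<le> k (fst q') (snd q')"
      by meson
    define \<kappa> where "\<kappa> = k (fst q) (snd q)"
    have "fst q \<in> I" "snd q \<noteq> 0" using q(1) by auto
    then have \<kappa>0: "\<kappa> > 0" unfolding \<kappa>_def k_def by (intro hform_pos H(2))
    have "\<kappa> * (norm v)\<^sup>2 \<le> k s v" if s: "s \<in> I" for s v
    proof (cases "v = 0")
      case True then show ?thesis using k0[OF s, of v] by simp
    next
      case False
      have "(s, (1 / norm v) *\<^sub>R v) \<in> ?S" using s False by simp
      from q(2)[OF this] have "\<kappa> \<le> k s ((1 / norm v) *\<^sub>R v)" by (simp add: \<kappa>_def)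
      also have "\<dots> = (1 / norm v)\<^sup>2 * k s v"
        unfolding k_def smult_of_real qf_scale[OF H(2)[OF s]] by (simp add: norm_divide power_divide)
      finally show ?thesis using False by (simp add: field_simps)
    qed
    then show thesis using that \<kappa>0 by blast
  qed (use that[of 1] in auto)
  have sumlow: "(norm v)\<^sup>2 \<le> ?r / \<kappa> * (\<Sum>j\<in>UNIV. k s (Pm j s *v v))" if s: "s \<in> I" for s v
  proof -
    have "norm v \<le> (\<Sum>j\<in>UNIV. norm (Pm j s *v v))"
      using norm_sum[of "\<lambda>j. Pm j s *v v" UNIV] by (simp add: res[OF s])
    then have "(norm v)\<^sup>2 \<le> (\<Sum>j\<in>UNIV. norm (Pm j s *v v))\<^sup>2" by (intro power_mono) auto
    also have "\<dots> \<le> (\<Sum>j\<in>UNIV. (norm (Pm j s *v v))\<^sup>2) * ?r"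
      using sum_squared_le_sum_of_squares[of "\<lambda>j. norm (Pm j s *v v)" UNIV] by simp
    also have "\<dots> \<le> (\<Sum>j\<in>UNIV. k s (Pm j s *v v) / \<kappa>) * ?r"
      using \<kappa> s by (intro mult_right_mono sum_mono) (auto simp: field_simps)
    finally show ?thesis by (simp add: sum_divide_distrib[symmetric] mult.commute)
  qed
  have sumub: "(\<Sum>j\<in>UNIV. k s (Pm j s *v v)) \<le> ?r * (?r\<^sup>2 * m1 * p1\<^sup>2) * (norm v)\<^sup>2" if s: "s \<in> I" for s v
  proof -
    have "(\<Sum>j\<in>UNIV. k s (Pm j s *v v)) \<le> (\<Sum>j\<in>(UNIV :: 'n set). ?r\<^sup>2 * m1 * (p1 * norm v)\<^sup>2)"
      by (intro sum_mono order_trans[OF kub[OF s]] mult_left_mono power_mono Pb s) (auto simp: m1)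
    then show ?thesis by (simp add: power_mult_distrib mult_ac)
  qed
  \<comment> \<open>\<open>M1\<close> and \<open>M2\<close> serve the two comparisons of the form
    with its components, \<open>M3\<close> the derivative estimate; their sum serves all
    three.\<close>
  define M1 where "M1 = ?r * (?r\<^sup>2 * m1 * p1\<^sup>2) / \<kappa>"
  define M2 where "M2 = ?r\<^sup>2 * m1 * (?r / \<kappa>)"
  define q3 where "q3 = ?r\<^sup>2 * m2 * p1\<^sup>2 + 2 * (?r\<^sup>2 * m1 * (p2 * p1))"
  define M3 where "M3 = q3 * (?r / \<kappa>)"
  have M0: "M1 \<ge> 0" "M2 \<ge> 0" "q3 \<ge> 0" "M3 \<ge> 0" using m1 m2 p0 \<kappa>(1) by (auto simp: M1_def M2_def M3_def q3_def)
  show thesis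
  proof (rule that[of "M1 + M2 + M3"])
    fix s v assume s: "s \<in> I"
    have "(\<Sum>j\<in>UNIV. k s (Pm j s *v v)) \<le> ?r * (?r\<^sup>2 * m1 * p1\<^sup>2) * (norm v)\<^sup>2" by (rule sumub[OF s])
    also have "\<dots> \<le> ?r * (?r\<^sup>2 * m1 * p1\<^sup>2) * (k s v / \<kappa>)"
      using \<kappa>(2)[OF s, of v] \<kappa>(1) m1 by (intro mult_left_mono) (auto simp: field_simps)
    also have "\<dots> = M1 * k s v" by (simp add: M1_def)
    also have "\<dots> \<le> (M1 + M2 + M3) * k s v" using M0 k0[OF s] by (intro mult_right_mono) auto
    finally show "(\<Sum>j\<in>UNIV. k s (Pm j s *v v)) \<le> (M1 + M2 + M3) * k s v" .
    have S0: "(\<Sum>j\<in>UNIV. k s (Pm j s *v v)) \<ge> 0" by (intro sum_nonneg k0 s)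
    have "k s v \<le> ?r\<^sup>2 * m1 * (norm v)\<^sup>2" by (rule kub[OF s])
    also have "\<dots> \<le> ?r\<^sup>2 * m1 * (?r / \<kappa> * (\<Sum>j\<in>UNIV. k s (Pm j s *v v)))" using m1 by (intro mult_left_mono sumlow s) auto
    also have "\<dots> = M2 * (\<Sum>j\<in>UNIV. k s (Pm j s *v v))" by (simp add: M2_def)
    also have "\<dots> \<le> (M1 + M2 + M3) * (\<Sum>j\<in>UNIV. k s (Pm j s *v v))" using M0 S0 by (intro mult_right_mono) auto
    finally show "k s v \<le> (M1 + M2 + M3) * (\<Sum>j\<in>UNIV. k s (Pm j s *v v))" .
  next
    fix s t y j assume s: "s \<in> I" and y: "\<And>i. ((\<lambda>s. y s $ i) has_vector_derivative ((t *\<^sub>R N s - Bm s) *v y s) $ i) (at s within {0..1})"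
    define u where "u = Pm j s *v y s"
    define R where "R = (P' j s - Pm j s ** Bm s) *v y s"
    \<comment> \<open>Here \<open>comm\<close> turns the term with \<open>N\<close> into a scalar
      multiple of the component.\<close>
    define u' where "u' = (of_real t * al j s) *s u + R"
    have "P' j s *v y s + Pm j s *v ((t *\<^sub>R N s - Bm s) *v y s) = u'"
      by (simp add: u'_def R_def u_def matrix_vector_mult_diff_rdistrib matrix_vector_mult_diff_distrib scaleR_matrix_vector
          vector_scalar_commute comm[OF s] vector_smult_assoc matrix_vector_mul_assoc[symmetric])
    then have du: "((\<lambda>s. (Pm j s *v y s) $ a) has_vector_derivative u' $ a) (at s within {0..1})" for a
      using matrix_vector_has_vector_derivative[of "Pm j" "P' j s" s "{0..1}" y, OF _ y] P0(2)[OF s] by (simp add: P'_def)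
    define Dc where "Dc = sesq (H' s) u u + sesq (H s) u' u + sesq (H s) u u'"
    have "((\<lambda>s. sesq (H s) (Pm j s *v y s) (Pm j s *v y s)) has_vector_derivative Dc) (at s within {0..1})"
      unfolding Dc_def u_def by (rule sesq_has_vector_derivative[OF _ du du]) (simp add: H'_def H0(2)[OF s])
    from bounded_linear.has_vector_derivative[OF bounded_linear_Re this]
    have D: "((\<lambda>s. k s (Pm j s *v y s)) has_real_derivative Re Dc) (at s within {0..1})"
      by (simp add: k_def qf_def has_real_derivative_iff_has_vector_derivative)
    have h: "hform (sesq (H s))" by (rule H(2)[OF s])
    have "Re (sesq (H s) u u') = Re (sesq (H s) u' u)" using hform_cnj[OF h, of u u'] by simp
    moreover have "sesq (H s) u' u = of_real t * al j s * of_real (k s u) + sesq (H s) R u"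
      unfolding u'_def by (simp add: hform_add_left[OF h] hform_scale_left[OF h] hform_diag[OF h, of u] k_def)
    ultimately have "Re Dc - 2 * t * Re (al j s) * k s u = Re (sesq (H' s) u u) + 2 * Re (sesq (H s) R u)"
      by (simp add: Dc_def algebra_simps)
    also have "\<bar>\<dots>\<bar> \<le> \<bar>Re (sesq (H' s) u u)\<bar> + 2 * \<bar>Re (sesq (H s) R u)\<bar>" by linarith
    also have "\<dots> \<le> cmod (sesq (H' s) u u) + 2 * cmod (sesq (H s) R u)"
      using abs_Re_le_cmod[of "sesq (H' s) u u"] abs_Re_le_cmod[of "sesq (H s) R u"] by linarith
    also have "\<dots> \<le> ?r\<^sup>2 * m2 * (norm u * norm u) + 2 * (?r\<^sup>2 * m1 * (norm R * norm u))"
      by (intro add_mono mult_left_mono cmod_sesq_le m1 m2 s) auto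
    also have "\<dots> \<le> ?r\<^sup>2 * m2 * ((p1 * norm (y s)) * (p1 * norm (y s))) + 2 * (?r\<^sup>2 * m1 * ((p2 * norm (y s)) * (p1 * norm (y s))))"
      unfolding u_def R_def using p0 m1 m2
      by (intro add_mono mult_left_mono mult_mono Pb Rb s) auto
    also have "\<dots> = q3 * (norm (y s))\<^sup>2" by (simp add: q3_def power2_eq_square algebra_simps)
    also have "\<dots> \<le> q3 * (?r / \<kappa> * (\<Sum>j\<in>UNIV. k s (Pm j s *v y s)))" using M0 by (intro mult_left_mono sumlow s) auto
    also have "\<dots> = M3 * (\<Sum>j\<in>UNIV. k s (Pm j s *v y s))" by (simp add: M3_def)
    also have "\<dots> \<le> (M1 + M2 + M3) * (\<Sum>j\<in>UNIV. k s (Pm j s *v y s))"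
      using M0 by (intro mult_right_mono sum_nonneg k0 s) auto
    finally show "\<exists>D. ((\<lambda>s. k s (Pm j s *v y s)) has_real_derivative D) (at s within {0..1}) \<and>
        \<bar>D - 2 * t * Re (al j s) * k s (Pm j s *v y s)\<bar> \<le> (M1 + M2 + M3) * (\<Sum>j\<in>UNIV. k s (Pm j s *v y s))"
      using D unfolding u_def by blast
  qed
qed

text \<open>Compactness of the interval in the form of bisection; \<open>mono\<close> allows the
  larger of two constants on adjacent pieces.\<close>

lemma uniform_constant:
  fixes Q :: "real \<Rightarrow> real \<Rightarrow> bool"
  assumes mono: "\<And>K K' s. Q K s \<Longrightarrow> K \<le> K' \<Longrightarrow> Q K' s"
    and local: "\<And>x. x \<in> {0..1} \<Longrightarrow> \<exists>d>0. \<exists>K. \<forall>s\<in>{0..1}. \<bar>s - x\<bar> < d \<longrightarrow> Q K s"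
  obtains K where "\<And>s. s \<in> {0..1} \<Longrightarrow> Q K s"
proof -
  define P where "P a b \<longleftrightarrow> (\<exists>K. \<forall>s\<in>{a..b} \<inter> {0..1}. Q K s)" for a b
  have "P 0 1" using zero_le_one
  proof (induction rule: Bolzano)
    case (trans a b c)
    from trans(1) obtain K where K: "\<forall>s\<in>{a..b} \<inter> {0..1}. Q K s" unfolding P_def ..
    from trans(2) obtain K' where K': "\<forall>s\<in>{b..c} \<inter> {0..1}. Q K' s" unfolding P_def ..
    have "Q (max K K') s" if "s \<in> {a..c} \<inter> {0..1}" for s
    proof (cases "s \<le> b")
      case True
      then have "Q K s" using K that by auto
      then show ?thesis by (rule mono) simp
    next
      case False
      then have "Q K' s" using K' that by auto
      then show ?thesis by (rule mono) simp
    qed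
    then show ?case unfolding P_def by (intro exI[of _ "max K K'"] ballI)
  next
    case (local x)
    then obtain d K where d: "d > 0" "\<forall>s\<in>{0..1}. \<bar>s - x\<bar> < d \<longrightarrow> Q K s" using assms(2)[of x] by auto
    have "P a b" if "a \<le> x" "x \<le> b" "b - a < d" for a b
      unfolding P_def using d(2) that by (intro exI[of _ K]) auto
    then show ?case using d(1) by blast
  qed
  then obtain K where "\<forall>s\<in>{0..1} \<inter> {0..1}. Q K s" unfolding P_def ..
  then show thesis by (intro that[of K]) simp
qed

section \<open>Flat sections along a noncritical path\<close>

lemma det_scale: "det (\<chi> a b. c * A $ a $ b) = c ^ CARD('n) * det (A :: complex ^ 'n::finite ^ 'n)"
proof -
  have "(\<chi> a b. c * A $ a $ b) = (\<chi> i. c *s A $ i)" by (simp add: vec_eq_iff)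
  then show ?thesis using det_rows_mul[of "\<lambda>_. c" "\<lambda>i. A $ i"] by simp
qed

lemma charpoly_scale:
  fixes A :: "complex ^ 'n::finite ^ 'n" and \<phi> :: "'n \<Rightarrow> complex"
  assumes "\<And>l. charpoly_fun A l = (\<Prod>i\<in>UNIV. l - \<phi> i)"
  shows "charpoly_fun (\<chi> a b. c * A $ a $ b) l = (\<Prod>i\<in>UNIV. l - c * \<phi> i)"
\<comment> \<open>The scaling argument divides by \<open>c\<close>; the case of zero covers a
  vanishing velocity.\<close>
proof (cases "c = 0")
  case True
  have "(\<chi> a b. c * A $ a $ b) = 0" by (simp add: True vec_eq_iff)
  moreover have "mat l = (\<chi> a b. l * (mat 1 :: complex ^ 'n ^ 'n) $ a $ b)" by (simp add: mat_def vec_eq_iff)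
  ultimately show ?thesis using det_scale[of l "mat 1 :: complex ^ 'n ^ 'n"]
    by (simp add: charpoly_fun_def True)
next
  case False
  have "mat l - (\<chi> a b. c * A $ a $ b) = (\<chi> a b. c * (mat (l / c) - A) $ a $ b)"
    using False by (simp add: vec_eq_iff mat_def algebra_simps)
  then have "charpoly_fun (\<chi> a b. c * A $ a $ b) l = c ^ CARD('n) * charpoly_fun A (l / c)"
    unfolding charpoly_fun_def by (simp only: det_scale)
  also have "\<dots> = (\<Prod>i\<in>(UNIV :: 'n set). c) * (\<Prod>i\<in>UNIV. l / c - \<phi> i)" by (simp add: assms)
  also have "\<dots> = (\<Prod>i\<in>UNIV. c * (l / c - \<phi> i))" by (rule prod.distrib[symmetric])
  finally show ?thesis using False by (simp add: right_diff_distrib)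
qed

lemma C1_on_C_k:
  assumes f: "C_k (Suc 0) S f" and z: "C1_on I \<zeta>" "\<zeta> ` I \<subseteq> S" "I \<subseteq> {0..1}"
  shows "C1_on I (\<lambda>s. f (\<zeta> s))"
proof -
  obtain fx fy where d: "\<And>w. w \<in> S \<Longrightarrow> (f has_derivative (\<lambda>v. Re v *\<^sub>R fx w + Im v *\<^sub>R fy w)) (at w)"
    and c: "continuous_on S fx" "continuous_on S fy"
    using f by auto
  obtain \<zeta>' where \<zeta>': "continuous_on I \<zeta>'" "\<And>s. s \<in> I \<Longrightarrow> (\<zeta> has_vector_derivative \<zeta>' s) (at s within {0..1})"
    using z(1) unfolding C1_on_def by blast
  have "((\<lambda>s. f (\<zeta> s)) has_vector_derivative Re (\<zeta>' s) *\<^sub>R fx (\<zeta> s) + Im (\<zeta>' s) *\<^sub>R fy (\<zeta> s)) (at s within {0..1})"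
    if s: "s \<in> I" for s
  proof -
    have "\<zeta> s \<in> S" using s z(2) by blast
    from has_derivative_compose[OF \<zeta>'(2)[OF s, unfolded has_vector_derivative_def] d[OF this]]
    show ?thesis unfolding has_vector_derivative_def by (simp add: scaleR_add_right)
  qed
  moreover have "continuous_on I (\<lambda>s. Re (\<zeta>' s) *\<^sub>R fx (\<zeta> s) + Im (\<zeta>' s) *\<^sub>R fy (\<zeta> s))"
    using z(2) by (intro continuous_intros \<zeta>'(1) continuous_on_compose2[OF c(1) C1_on_continuous[OF z(1,3)]]
        continuous_on_compose2[OF c(2) C1_on_continuous[OF z(1,3)]])
  ultimately show ?thesis unfolding C1_on_def by blast
qed

locale wkb_path = covered_bundle E p
  for E :: "('x::t2_space, 'e, 'r::{finite,linorder}) vbundle" and p :: "'u::t2_space \<Rightarrow> 'x" +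
  fixes \<Phi> B :: "('x, 'e, 'r) local_form" and h :: "'e \<Rightarrow> 'e \<Rightarrow> complex" and \<gamma> :: "real \<Rightarrow> 'u" and a :: "'r \<Rightarrow> real \<Rightarrow> complex"
  assumes higgs: "higgs_field E \<Phi>" and connB: "holo_connection E B" and herm: "hermitian_metric E h"
    and C1: "C1_path (charts E) p \<gamma>" and pull: "pullback_eigenforms E \<Phi> p \<gamma> a"
    and order: "\<forall>s\<in>{0..1}. \<forall>i j. i < j \<longrightarrow> Re (a i s) > Re (a j s)"
begin

definition A :: "real \<Rightarrow> ('x, 'e, 'r) local_form" where
  "A t = (\<lambda>c \<tau> x. t *\<^sub>R \<Phi> c \<tau> x - B c \<tau> x)"

lemma holo_entries:
  assumes "c \<in> charts E" "\<tau> \<in> trivs E"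
  shows "holo_fun (charts E) (fst c \<inter> fst \<tau>) (\<lambda>x. \<Phi> c \<tau> x $ i $ j)"
    "holo_fun (charts E) (fst c \<inter> fst \<tau>) (\<lambda>x. B c \<tau> x $ i $ j)"
  using higgs connB assms by (auto simp: higgs_field_def holo_connection_def holo_coeffs_def)

text \<open>The Higgs field transforms homogeneously, so subtracting a multiple of it from the
  connection leaves the inhomogeneous part of the gauge law unchanged.\<close>

sublocale flat: flat_bundle E p "A t" for t
proof
  show "holo_connection E (\<lambda>c \<tau> x. - A t c \<tau> x)"
    unfolding holo_connection_def
  proof (intro conjI ballI allI)
    show "holo_coeffs E (\<lambda>c \<tau> x. - A t c \<tau> x)"
      unfolding holo_coeffs_def
    proof (intro ballI allI)
      fix c \<tau> i j assume c: "c \<in> charts E" "\<tau> \<in> trivs E"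
      have "holo_fun (charts E) (fst c \<inter> fst \<tau>) (\<lambda>x. B c \<tau> x $ i $ j - of_real t * \<Phi> c \<tau> x $ i $ j)"
        using holo_entries[OF c, of i j] unfolding holo_fun_def o_def
        by (auto simp: case_prod_unfold intro!: holomorphic_intros)
      then show "holo_fun (charts E) (fst c \<inter> fst \<tau>) (\<lambda>x. (- A t c \<tau> x) $ i $ j)"
        by (simp add: A_def scaleR_conv_of_real[where 'a = complex])
    qed
    fix c c' \<tau> \<tau>' x i j assume c: "c \<in> charts E" "c' \<in> charts E" "\<tau> \<in> trivs E" "\<tau>' \<in> trivs E"
      and x: "x \<in> fst c \<inter> fst c' \<inter> fst \<tau> \<inter> fst \<tau>'"
    define g where "g = trans_fun E \<tau> \<tau>'"
    have 1: "(\<Phi> c' \<tau>' x ** g x) $ i $ j = cderiv c' (snd c) x * (g x ** \<Phi> c \<tau> x) $ i $ j"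
      using higgs c x unfolding higgs_field_def g_def by blast
    have 2: "(B c' \<tau>' x ** g x) $ i $ j = cderiv c' (snd c) x * ((g x ** B c \<tau> x) $ i $ j - cderiv c (\<lambda>y. g y $ i $ j) x)"
      using connB c x unfolding holo_connection_def g_def by blast
    have e: "((- A t c \<tau> x) ** M) $ i $ j = (B c \<tau> x ** M) $ i $ j - of_real t * (\<Phi> c \<tau> x ** M) $ i $ j"
      "(M ** (- A t c \<tau> x)) $ i $ j = (M ** B c \<tau> x) $ i $ j - of_real t * (M ** \<Phi> c \<tau> x) $ i $ j" for c \<tau> M
      by (simp_all add: A_def matrix_matrix_mult_def sum_subtractf sum_distrib_left scaleR_conv_of_real[where 'a = complex]
          algebra_simps)
    show "(- A t c' \<tau>' x ** trans_fun E \<tau> \<tau>' x) $ i $ j =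
       cderiv c' (snd c) x * ((trans_fun E \<tau> \<tau>' x ** - A t c \<tau> x) $ i $ j - cderiv c (\<lambda>y. trans_fun E \<tau> \<tau>' y $ i $ j) x)"
      unfolding e g_def[symmetric] 1 2 by (simp add: algebra_simps)
  qed
qed

lemma flat_section_iff: "flat_section E \<Phi> B p t s \<longleftrightarrow> flat.flat_on t UNIV s"
  unfolding flat_section_def flat.flat_on_def flat.flat_deriv_def
  by (simp add: A_def)

text \<open>Positivity is given for some matrix, smoothness for the one in the frame; the values on
  the frame identify the two.\<close>

lemma metric_matrix:
  assumes "\<tau> \<in> trivs E" "x \<in> fst \<tau>"
  defines "H \<equiv> (\<chi> i j. h (frame E \<tau> x i) (frame E \<tau> x j))"
  shows "hform (sesq H)" "e \<in> fibre E x \<Longrightarrow> e' \<in> fibre E x \<Longrightarrow> h e e' = sesq H (snd \<tau> e) (snd \<tau> e')"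
proof -
  have "herm_inner_on E x h" using herm by (simp add: hermitian_metric_def)
  then have "\<exists>H. (\<forall>i j. H $ j $ i = cnj (H $ i $ j)) \<and> (\<forall>v. v \<noteq> 0 \<longrightarrow> Re (sesq H v v) > 0) \<and>
             (\<forall>e\<in>fibre E x. \<forall>e'\<in>fibre E x. h e e' = sesq H (snd \<tau> e) (snd \<tau> e'))"
    using assms(1,2) unfolding herm_inner_on_def by (auto simp: case_prod_unfold)
  then obtain H' where H': "\<forall>i j. H' $ j $ i = cnj (H' $ i $ j)" "\<forall>v. v \<noteq> 0 \<longrightarrow> Re (sesq H' v v) > 0"
    and he: "\<And>e e'. e \<in> fibre E x \<Longrightarrow> e' \<in> fibre E x \<Longrightarrow> h e e' = sesq H' (snd \<tau> e) (snd \<tau> e')" by blast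
  have hf: "hform (sesq H')" by (rule hform_sesq[OF H'])
  have "frame E \<tau> x i = vec_of \<tau> x (axis i 1)" for i by (simp add: frame_def vec_of_def)
  then have "H = (\<chi> i j. sesq H' (axis i 1) (axis j 1))"
    unfolding H_def using he[OF vec_of_fibre[OF assms(1,2)] vec_of_fibre[OF assms(1,2)]] triv_vec_of[OF assms(1,2)] by simp
  then have "sesq H = sesq H'" using hform_eq_sesq[OF hf] by simp
  then show "hform (sesq H)" "e \<in> fibre E x \<Longrightarrow> e' \<in> fibre E x \<Longrightarrow> h e e' = sesq H (snd \<tau> e) (snd \<tau> e')"
    using hf he by simp_all
qed

lemma inj_a: assumes "s \<in> {0..1}" shows "inj (\<lambda>i. a i s)"
proof (rule injI, rule ccontr)
  fix i j assume e: "a i s = a j s" and "i \<noteq> j"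
  then have "i < j \<or> j < i" by auto
  then show False using order assms e by fastforce
qed

lemma path_cont: "continuous_on {0..1} \<gamma>"
  using C1 by (simp add: C1_path_def path_def)

abbreviation vel where "vel c s \<equiv> velocity c (p \<circ> \<gamma>) s"

lemma velocity:
  assumes "c \<in> charts E" "s \<in> {0..1}" "p (\<gamma> s) \<in> fst c"
  shows "((\<lambda>s. snd c (p (\<gamma> s))) has_vector_derivative vel c s) (at s within {0..1})"
proof -
  have "(\<lambda>s. snd c (p (\<gamma> s))) differentiable (at s within {0..1})"
    using C1 assms unfolding C1_path_def Let_def by blast
  then show ?thesis by (simp add: vector_derivative_works velocity_def)
qed

lemma velocity_cont:
  assumes "c \<in> charts E" "I \<subseteq> {0..1}" "\<And>s. s \<in> I \<Longrightarrow> p (\<gamma> s) \<in> fst c"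
  shows "continuous_on I (vel c)"
proof -
  have "continuous_on {s \<in> {0..1}. p (\<gamma> s) \<in> fst c} (vel c)"
    using C1 assms(1) unfolding C1_path_def Let_def by blast
  then show ?thesis by (rule continuous_on_subset) (use assms in auto)
qed

lemma path_eventually:
  assumes "s \<in> {0..1}" "open W" "\<gamma> s \<in> W"
  obtains d where "d > 0" "\<And>s'. s' \<in> {0..1} \<Longrightarrow> dist s' s < d \<Longrightarrow> \<gamma> s' \<in> W"
proof -
  obtain T where T: "open T" "T \<inter> {0..1} = \<gamma> -` W \<inter> {0..1}"
    using path_cont[unfolded continuous_on_open_invariant, rule_format, OF assms(2)] by blast
  then have "s \<in> T" using assms by blast
  then obtain d where d: "d > 0" "\<And>s'. dist s' s < d \<Longrightarrow> s' \<in> T" using T(1) unfolding open_dist by blast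
  have "\<gamma> s' \<in> W" if "s' \<in> {0..1}" "dist s' s < d" for s' using d(2)[OF that(2)] T(2) that(1) by blast
  then show thesis using that d(1) by blast
qed

lemma velocity_change:
  assumes c: "c \<in> charts E" "c' \<in> charts E" and s: "s \<in> {0..1}" and x: "p (\<gamma> s) \<in> fst c" "p (\<gamma> s) \<in> fst c'"
  shows "vel c s = cderiv c' (snd c) (p (\<gamma> s)) * vel c' s"
proof -
  have "((snd c \<circ> inv_into (fst c') (snd c')) has_field_derivative cderiv c' (snd c) (p (\<gamma> s))) (at (snd c' (p (\<gamma> s))))"
    by (rule holo_fun_derivative[OF chart_holo[OF c(1)] c(2) chart_open[OF c(1)] x(2,1)])
  from field_vector_diff_chain_within[OF velocity[OF c(2) s x(2)] has_field_derivative_at_within[OF this]]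
  have 1: "((snd c \<circ> inv_into (fst c') (snd c') \<circ> (\<lambda>s. snd c' (p (\<gamma> s)))) has_vector_derivative
    vel c' s * cderiv c' (snd c) (p (\<gamma> s))) (at s within {0..1})" .
  have "open (p -` fst c')" by (intro open_vimage p_cont chart_open c)
  then obtain d where d: "d > 0" "\<And>s'. s' \<in> {0..1} \<Longrightarrow> dist s' s < d \<Longrightarrow> \<gamma> s' \<in> p -` fst c'"
    using path_eventually[OF s, of "p -` fst c'"] x by auto
  have "((\<lambda>s. snd c (p (\<gamma> s))) has_vector_derivative vel c' s * cderiv c' (snd c) (p (\<gamma> s))) (at s within {0..1})"
    by (rule has_vector_derivative_transform_within[OF 1 d(1) s]) (use d(2) in \<open>simp add: chart_inv[OF c(2)]\<close>)
  from vector_derivative_unique_within[OF _ velocity[OF c(1) s x(1)] this]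
  show ?thesis using s by (simp add: mult.commute trivial_limit_within)
qed

text \<open>The matrix of the pulled back Higgs field with respect to \<open>ds\<close>. Velocity
  and \<open>\<Phi>\<close> transform inversely under a change of chart, so only the trivialization
  matters.\<close>

definition N where "N c \<tau> s = (\<chi> i j. vel c s * \<Phi> c \<tau> (p (\<gamma> s)) $ i $ j)"

lemma N_intertwine:
  assumes c: "c \<in> charts E" "c' \<in> charts E" "\<tau> \<in> trivs E" "\<tau>' \<in> trivs E" and s: "s \<in> {0..1}"
    and x: "p (\<gamma> s) \<in> fst c" "p (\<gamma> s) \<in> fst c'" "p (\<gamma> s) \<in> fst \<tau>" "p (\<gamma> s) \<in> fst \<tau>'"
  defines "g \<equiv> trans_fun E \<tau> \<tau>' (p (\<gamma> s))"
  shows "N c' \<tau>' s ** g = g ** N c \<tau> s"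
proof -
  have sc: "(\<chi> i j. k * M $ i $ j) ** M' = (\<chi> i j. k * (M ** M') $ i $ j)"
    "M' ** (\<chi> i j. k * M $ i $ j) = (\<chi> i j. k * (M' ** M) $ i $ j)" for k and M M' :: "(complex, 'r) vec ^ 'r::{finite,linorder}"
    by (simp_all add: matrix_matrix_mult_def vec_eq_iff sum_distrib_left mult_ac)
  have "(\<Phi> c' \<tau>' (p (\<gamma> s)) ** g) $ i $ j = cderiv c' (snd c) (p (\<gamma> s)) * (g ** \<Phi> c \<tau> (p (\<gamma> s))) $ i $ j" for i j
    using higgs c x unfolding higgs_field_def g_def by blast
  then show ?thesis
    unfolding N_def sc velocity_change[OF c(1,2) s x(1,2)] by (simp add: vec_eq_iff)
qed

lemma N_charpoly:
  assumes c: "c \<in> charts E" "\<tau> \<in> trivs E" and s: "s \<in> {0..1}" and x: "p (\<gamma> s) \<in> fst c" "p (\<gamma> s) \<in> fst \<tau>"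
  shows "charpoly_fun (N c \<tau> s) l = (\<Prod>i\<in>UNIV. l - a i s)"
proof -
  obtain W \<phi> d where W: "open W" "p (\<gamma> s) \<in> W" "eigenforms E \<Phi> W \<phi>" "d > 0"
    and d: "\<forall>s'\<in>{0..1}. \<bar>s' - s\<bar> < d \<longrightarrow> p (\<gamma> s') \<in> W \<and>
           (\<forall>c\<in>charts E. p (\<gamma> s') \<in> fst c \<longrightarrow> (\<forall>i. a i s' = \<phi> i c (p (\<gamma> s')) * vel c s'))"
    using bspec[OF pull[unfolded pullback_eigenforms_def] s] by (elim exE conjE) (rule that)
  have "a i s = vel c s * \<phi> i c (p (\<gamma> s))" for i using d s W(4) c(1) x(1) by (simp add: mult.commute)
  moreover have "charpoly_fun (\<Phi> c \<tau> (p (\<gamma> s))) l = (\<Prod>i\<in>UNIV. l - \<phi> i c (p (\<gamma> s)))" for l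
    using W c x unfolding eigenforms_def by blast
  ultimately show ?thesis unfolding N_def using charpoly_scale[of "\<Phi> c \<tau> (p (\<gamma> s))" "\<lambda>i. \<phi> i c (p (\<gamma> s))"] by simp
qed

section \<open>Spectral components along the path and their uniform growth estimate\<close>

definition Pr where "Pr c \<tau> s j = spectral_proj (N c \<tau> s) (\<lambda>i. a i s) j"

definition some_chart where "some_chart x = (SOME c. c \<in> charts E \<and> x \<in> fst c)"

lemma some_chart: "some_chart x \<in> charts E" "x \<in> fst (some_chart x)"
proof -
  have "\<exists>c. c \<in> charts E \<and> x \<in> fst c" using chart_at[of x] by blast
  from someI_ex[OF this] show "some_chart x \<in> charts E" "x \<in> fst (some_chart x)"
    unfolding some_chart_def by blast+
qed

text \<open>The spectral component of a vector of the fibre, formed in an arbitrarily chosen chart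
  and trivialization; the lemma \<open>comp\<close> shows that any other choice computes it.\<close>

definition comp where
  "comp s j e = (let x = p (\<gamma> s); \<tau> = flat.some_triv x in vec_of \<tau> x (Pr (some_chart x) \<tau> s j *v snd \<tau> e))"

definition f where "f s j e = Re (h (comp s j e) (comp s j e))"

lemma comp:
  assumes c: "c \<in> charts E" "\<tau> \<in> trivs E" and s: "s \<in> {0..1}" and x: "p (\<gamma> s) \<in> fst c" "p (\<gamma> s) \<in> fst \<tau>"
    and e: "e \<in> fibre E (p (\<gamma> s))"
  shows "comp s j e \<in> fibre E (p (\<gamma> s))" "snd \<tau> (comp s j e) = Pr c \<tau> s j *v snd \<tau> e"
proof -
  define \<tau>' where "\<tau>' = flat.some_triv (p (\<gamma> s))"
  define c' where "c' = some_chart (p (\<gamma> s))"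
  have t': "\<tau>' \<in> trivs E" "p (\<gamma> s) \<in> fst \<tau>'" unfolding \<tau>'_def by (rule flat.some_triv)+
  have c': "c' \<in> charts E" "p (\<gamma> s) \<in> fst c'" unfolding c'_def by (rule some_chart)+
  have ce: "comp s j e = vec_of \<tau>' (p (\<gamma> s)) (Pr c' \<tau>' s j *v snd \<tau>' e)"
    by (simp add: comp_def \<tau>'_def c'_def Let_def)
  show ef: "comp s j e \<in> fibre E (p (\<gamma> s))" unfolding ce by (rule vec_of_fibre[OF t'])
  let ?g = "trans_fun E \<tau>' \<tau> (p (\<gamma> s))"
  have xx: "p (\<gamma> s) \<in> fst \<tau>' \<inter> fst \<tau>" using t' x by blast
  have "snd \<tau> (comp s j e) = ?g *v (Pr c' \<tau>' s j *v snd \<tau>' e)"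
    using trans_apply[OF t'(1) c(2) xx ef] by (simp add: ce triv_vec_of[OF t'])
  also have "\<dots> = (Pr c \<tau> s j ** ?g) *v snd \<tau>' e"
    unfolding Pr_def spectral_proj_intertwine[OF N_intertwine[OF c'(1) c(1) t'(1) c(2) s c'(2) x(1) t'(2) x(2)]]
    by (simp add: matrix_vector_mul_assoc)
  also have "\<dots> = Pr c \<tau> s j *v snd \<tau> e"
    using trans_apply[OF t'(1) c(2) xx e] by (simp flip: matrix_vector_mul_assoc)
  finally show "snd \<tau> (comp s j e) = Pr c \<tau> s j *v snd \<tau> e" .
qed

lemma path_ode:
  assumes \<sigma>: "flat.flat_on t UNIV \<sigma>" and c: "c \<in> charts E" "\<tau> \<in> trivs E" and s: "s \<in> {0..1}"
    and x: "p (\<gamma> s) \<in> fst c" "p (\<gamma> s) \<in> fst \<tau>"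
  shows "((\<lambda>s. snd \<tau> (\<sigma> (\<gamma> s)) $ i) has_vector_derivative
    ((t *\<^sub>R N c \<tau> s - (\<chi> i j. vel c s * B c \<tau> (p (\<gamma> s)) $ i $ j)) *v snd \<tau> (\<sigma> (\<gamma> s))) $ i) (at s within {0..1})"
proof -
  obtain M \<rho> where M: "\<rho> > 0" "open M" "\<gamma> s \<in> M" "M \<subseteq> UNIV" "inj_on p M" "p ` M \<subseteq> fst c \<inter> fst \<tau>"
    and im: "(snd c \<circ> p) ` M = ball (snd c (p (\<gamma> s))) \<rho>"
    using coordinate_ball[OF c(1) open_UNIV UNIV_I x(1) triv_open[OF c(2)] x(2)] by metis
  let ?q = "inv_into M (snd c \<circ> p)"
  have "flat.flat_deriv t c \<tau> M \<sigma> (\<gamma> s)" by (rule flat.flat_on_deriv[OF \<sigma> c M(2,5,6,4,3)])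
  then have "((\<lambda>w. snd \<tau> (\<sigma> (?q w)) $ i) has_field_derivative (A t c \<tau> (p (\<gamma> s)) *v snd \<tau> (\<sigma> (\<gamma> s))) $ i) (at (snd c (p (\<gamma> s))))"
    unfolding flat.flat_deriv_def by blast
  from field_vector_diff_chain_within[OF velocity[OF c(1) s x(1)] has_field_derivative_at_within[OF this]]
  have 1: "(((\<lambda>w. snd \<tau> (\<sigma> (?q w)) $ i) \<circ> (\<lambda>s. snd c (p (\<gamma> s)))) has_vector_derivative
      vel c s * (A t c \<tau> (p (\<gamma> s)) *v snd \<tau> (\<sigma> (\<gamma> s))) $ i) (at s within {0..1})" .
  obtain d where d: "d > 0" "\<And>s'. s' \<in> {0..1} \<Longrightarrow> dist s' s < d \<Longrightarrow> \<gamma> s' \<in> M"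
    using path_eventually[OF s M(2,3)] by blast
  have pM: "p ` M \<subseteq> fst c" using M by auto
  have "((\<lambda>s. snd \<tau> (\<sigma> (\<gamma> s)) $ i) has_vector_derivative vel c s * (A t c \<tau> (p (\<gamma> s)) *v snd \<tau> (\<sigma> (\<gamma> s))) $ i) (at s within {0..1})"
  proof (rule has_vector_derivative_transform_within[OF 1 d(1) s])
    fix s' assume "s' \<in> {0..1}" "dist s' s < d"
    then have "\<gamma> s' \<in> M" by (rule d(2))
    then show "((\<lambda>w. snd \<tau> (\<sigma> (?q w)) $ i) \<circ> (\<lambda>s. snd c (p (\<gamma> s)))) s' = snd \<tau> (\<sigma> (\<gamma> s')) $ i"
      using inv_into_f_f[OF coord_inj[OF c(1) M(2,5) pM], of "\<gamma> s'"] by simp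
  qed
  also have "vel c s * (A t c \<tau> (p (\<gamma> s)) *v snd \<tau> (\<sigma> (\<gamma> s))) $ i =
     ((t *\<^sub>R N c \<tau> s - (\<chi> i j. vel c s * B c \<tau> (p (\<gamma> s)) $ i $ j)) *v snd \<tau> (\<sigma> (\<gamma> s))) $ i"
    by (simp add: A_def N_def matrix_vector_mult_def sum_distrib_left scaleR_conv_of_real[where 'a = complex] algebra_simps)
  finally show ?thesis .
qed

text \<open>The form of \<open>wkb_local_estimate\<close> at one parameter, free of charts and
  trivializations, so that constants from different pieces of the path can be combined; a single
  \<open>M\<close> serves all t.\<close>

definition estimate where
  "estimate M s \<longleftrightarrow> (\<forall>e\<in>fibre E (p (\<gamma> s)). (\<Sum>j\<in>UNIV. f s j e) \<le> M * Re (h e e) \<and> Re (h e e) \<le> M * (\<Sum>j\<in>UNIV. f s j e)) \<and>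
     (\<forall>t \<sigma> j. flat.flat_on t UNIV \<sigma> \<longrightarrow> (\<exists>D. ((\<lambda>s. f s j (\<sigma> (\<gamma> s))) has_real_derivative D) (at s within {0..1}) \<and>
        \<bar>D - 2 * t * Re (a j s) * f s j (\<sigma> (\<gamma> s))\<bar> \<le> M * (\<Sum>j\<in>UNIV. f s j (\<sigma> (\<gamma> s)))))"

text \<open>Around \<open>s0\<close> one chart, one trivialization and one family of local
  eigenforms suffice. Continuity of \<open>a i\<close> is recorded along the way, for the uniform
  gap and the integrals.\<close>

lemma local_estimate:
  assumes s0: "s0 \<in> {0..1}"
  shows "\<exists>d>0. (\<forall>i. continuous_on ({0..1} \<inter> {s0 - d..s0 + d}) (a i)) \<and> (\<exists>M. \<forall>s\<in>{0..1}. \<bar>s - s0\<bar> < d \<longrightarrow> estimate M s)"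
proof -
  obtain W \<phi> d1 where W: "open W" "p (\<gamma> s0) \<in> W" "eigenforms E \<Phi> W \<phi>" "d1 > 0"
    and d1: "\<forall>s\<in>{0..1}. \<bar>s - s0\<bar> < d1 \<longrightarrow> p (\<gamma> s) \<in> W \<and>
           (\<forall>c\<in>charts E. p (\<gamma> s) \<in> fst c \<longrightarrow> (\<forall>i. a i s = \<phi> i c (p (\<gamma> s)) * vel c s))"
    using bspec[OF pull[unfolded pullback_eigenforms_def] s0] by (elim exE conjE) (rule that)
  obtain c where c: "c \<in> charts E" "p (\<gamma> s0) \<in> fst c" by (rule chart_at)
  obtain \<tau> where t: "\<tau> \<in> trivs E" "p (\<gamma> s0) \<in> fst \<tau>" by (rule triv_at)
  have "open (p -` (fst c \<inter> fst \<tau>))" by (intro open_vimage p_cont open_Int chart_open triv_open c t)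
  moreover have "\<gamma> s0 \<in> p -` (fst c \<inter> fst \<tau>)" using c t by auto
  ultimately obtain d2 where d2: "d2 > 0" "\<And>s. s \<in> {0..1} \<Longrightarrow> dist s s0 < d2 \<Longrightarrow> \<gamma> s \<in> p -` (fst c \<inter> fst \<tau>)"
    using path_eventually[OF s0] by metis
  \<comment> \<open>The closed interval \<open>I\<close> has radius \<open>d\<close>, while the
    local data are available within \<open>2 * d\<close>; the margin is used for derivatives within
    \<open>{0..1}\<close> at the ends of \<open>I\<close>.\<close>
  define d where "d = min d1 d2 / 2"
  define I where "I = {0..1} \<inter> {s0 - d..s0 + d}"
  define near where "near s \<longleftrightarrow> s \<in> {0..1} \<and> \<bar>s - s0\<bar> < 2 * d" for s
  have d: "d > 0" using W(4) d2(1) by (simp add: d_def)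
  have I: "compact I" "I \<subseteq> {0..1}" by (auto simp: I_def)
  have nI: "near s" if "s \<in> I" for s using that d unfolding I_def near_def by (auto simp: abs_less_iff)
  have x: "p (\<gamma> s) \<in> W" "p (\<gamma> s) \<in> fst c" "p (\<gamma> s) \<in> fst \<tau>" if "near s" for s
    using d1 d2(2)[of s] that by (auto simp: near_def d_def dist_real_def)
  have a: "a i s = vel c s * \<phi> i c (p (\<gamma> s))" if "near s" for i s
    using d1 that c(1) x(2)[OF that] by (auto simp: near_def d_def mult.commute)
  define \<zeta> where "\<zeta> s = snd c (p (\<gamma> s))" for s
  have vc: "continuous_on I (vel c)" by (rule velocity_cont[OF c(1) I(2) x(2)[OF nI]])
  have \<zeta>1: "C1_on I \<zeta>"
    unfolding C1_on_def \<zeta>_def using velocity[OF c(1) _ x(2)[OF nI]] I(2) by (intro exI[of _ "vel c"] conjI vc) auto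
  have inv\<zeta>: "inv_into (fst c) (snd c) (\<zeta> s) = p (\<gamma> s)" if "near s" for s using x(2)[OF that] by (simp add: \<zeta>_def chart_inv[OF c(1)])
  have near_ball: "near s'" if "s \<in> I" "s' \<in> {0..1}" "dist s' s < d" for s s'
    using that unfolding I_def near_def dist_real_def by (auto simp: abs_less_iff)
  have C1_cong: "C1_on I g" if g': "C1_on I g'" and eq: "\<And>s. near s \<Longrightarrow> g' s = g s" for g g'
  proof -
    obtain g1 where g1: "continuous_on I g1" "\<And>s. s \<in> I \<Longrightarrow> (g' has_vector_derivative g1 s) (at s within {0..1})"
      using g' unfolding C1_on_def by blast
    have "(g has_vector_derivative g1 s) (at s within {0..1})" if "s \<in> I" for s
      by (rule has_vector_derivative_transform_within[OF g1(2)[OF that] d]) (use that I near_ball eq in auto)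
    then show ?thesis using g1(1) unfolding C1_on_def by blast
  qed
  have holo: "C1_on I (\<lambda>s. g (p (\<gamma> s)))"
    if g: "holo_fun (charts E) V g" and V: "open V" "\<And>s. near s \<Longrightarrow> p (\<gamma> s) \<in> V" for g V
  proof (rule C1_cong)
    show "C1_on I (\<lambda>s. (g \<circ> inv_into (fst c) (snd c)) (\<zeta> s))"
      by (rule C1_on_holomorphic[OF holo_fun_chart[OF g c(1)] chart_image_Int_open[OF c(1) V(1)] \<zeta>1 _ I(2)])
         (use V(2) x nI in \<open>auto simp: \<zeta>_def\<close>)
  qed (simp add: inv\<zeta>)
  define H where "H s = (\<chi> i j. h (frame E \<tau> (p (\<gamma> s)) i) (frame E \<tau> (p (\<gamma> s)) j))" for s
  define k where "k s = qf (sesq (H s))" for s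
  have hH: "hform (sesq (H s))" if "near s" for s unfolding H_def by (rule metric_matrix(1)[OF t(1) x(3)[OF that]])
  have H1: "C1_on I (\<lambda>s. H s $ i $ j)" for i j
  proof (rule C1_cong)
    let ?g = "(\<lambda>x. h (frame E \<tau> x i) (frame E \<tau> x j)) \<circ> inv_into (fst c) (snd c)"
    have "\<forall>c\<in>charts E. case c of (U, z) \<Rightarrow> \<forall>\<tau>\<in>trivs E. \<forall>i j k. C_k k (z ` (U \<inter> fst \<tau>))
          ((\<lambda>x. h (frame E \<tau> x i) (frame E \<tau> x j)) \<circ> inv_into U z)"
      using herm unfolding hermitian_metric_def by (rule conjunct2)
    from bspec[OF this c(1)] have "C_k (Suc 0) (snd c ` (fst c \<inter> fst \<tau>)) ?g" using t(1) unfolding case_prod_unfold by blast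
    then show "C1_on I (\<lambda>s. ?g (\<zeta> s))"
      by (rule C1_on_C_k[OF _ \<zeta>1 _ I(2)]) (use x nI in \<open>auto simp: \<zeta>_def\<close>)
  qed (simp add: inv\<zeta> H_def)
  have \<phi>1: "C1_on I (\<lambda>s. \<phi> i c (p (\<gamma> s)))" for i
  proof (rule holo)
    show "holo_fun (charts E) (W \<inter> fst c) (\<phi> i c)" using W(3) c(1) unfolding eigenforms_def holo_form_def by blast
  qed (use W(1) chart_open[OF c(1)] x in auto)
  have \<Phi>1: "C1_on I (\<lambda>s. \<Phi> c \<tau> (p (\<gamma> s)) $ i $ j)" for i j
    by (rule holo[OF holo_entries(1)[OF c(1) t(1)]]) (use x in \<open>auto intro: chart_open triv_open c t\<close>)
  have B1: "C1_on I (\<lambda>s. B c \<tau> (p (\<gamma> s)) $ i $ j)" for i j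
    by (rule holo[OF holo_entries(2)[OF c(1) t(1)]]) (use x in \<open>auto intro: chart_open triv_open c t\<close>)
  have inj\<phi>: "inj (\<lambda>i. \<phi> i c (p (\<gamma> s)))" if "near s" for s
    using inj_a[of s] that unfolding inj_def a[OF that] near_def by metis
  \<comment> \<open>\<open>N c \<tau> s\<close> and \<open>\<Phi>\<close> differ by the scalar
    velocity and thus have the same projections; differentiability along the path is obtained from
    \<open>\<Phi>\<close>.\<close>
  have P1: "C1_on I (\<lambda>s. Pr c \<tau> s j $ i $ l)" for i j l
  proof (rule C1_cong)
    show "C1_on I (\<lambda>s. spectral_proj (\<Phi> c \<tau> (p (\<gamma> s))) (\<lambda>i. \<phi> i c (p (\<gamma> s))) j $ i $ l)"
      by (rule C1_on_spectral_proj[OF \<Phi>1 \<phi>1 I(2) inj\<phi>[OF nI]])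
    fix s assume s: "near s"
    show "spectral_proj (\<Phi> c \<tau> (p (\<gamma> s))) (\<lambda>i. \<phi> i c (p (\<gamma> s))) j $ i $ l = Pr c \<tau> s j $ i $ l"
    proof (cases "vel c s = 0")
      case False
      then show ?thesis by (simp add: Pr_def N_def a[OF s] spectral_proj_scale)
    next
      \<comment> \<open>With zero velocity all \<open>a i s\<close> coincide, so by
        \<open>inj_a\<close> there is only one index and both projections are empty
        products.\<close>
      case True
      have "i = j" for i using inj_a[of s] a[OF s] s True unfolding near_def inj_def by simp
      then have e: "UNIV - {j} = {}" by auto
      show ?thesis unfolding Pr_def spectral_proj_def e by simp
    qed
  qed
  have ca: "continuous_on I (a i)" for i
  proof -
    have "continuous_on I (\<lambda>s. vel c s * \<phi> i c (p (\<gamma> s)))"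
      by (intro continuous_on_mult vc C1_on_continuous[OF \<phi>1 I(2)])
    then show ?thesis by (rule continuous_on_eq) (simp add: a nI)
  qed
  have s01: "s \<in> {0..1}" if "s \<in> I" for s using I(2) that by blast
  note sr = spectral_resolution[OF inj_a[OF s01] N_charpoly[OF c(1) t(1) s01 x(2)[OF nI] x(3)[OF nI]], folded Pr_def]
  have Bc: "continuous_on I (\<lambda>s. (\<chi> i j. vel c s * B c \<tau> (p (\<gamma> s)) $ i $ j) $ i $ j)" for i j
    by (simp, intro continuous_on_mult vc C1_on_continuous[OF B1 I(2)])
  obtain M where M1: "\<And>s v. s \<in> I \<Longrightarrow> (\<Sum>j\<in>UNIV. k s (Pr c \<tau> s j *v v)) \<le> M * k s v"
    and M2: "\<And>s v. s \<in> I \<Longrightarrow> k s v \<le> M * (\<Sum>j\<in>UNIV. k s (Pr c \<tau> s j *v v))"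
    and M3: "\<And>s t y j. s \<in> I \<Longrightarrow>
      (\<And>i. ((\<lambda>s. y s $ i) has_vector_derivative ((t *\<^sub>R N c \<tau> s - (\<chi> i j. vel c s * B c \<tau> (p (\<gamma> s)) $ i $ j)) *v y s) $ i) (at s within {0..1})) \<Longrightarrow>
      \<exists>D. ((\<lambda>s. k s (Pr c \<tau> s j *v y s)) has_real_derivative D) (at s within {0..1}) \<and>
        \<bar>D - 2 * t * Re (a j s) * k s (Pr c \<tau> s j *v y s)\<bar> \<le> M * (\<Sum>j\<in>UNIV. k s (Pr c \<tau> s j *v y s))"
    unfolding k_def
    by (rule wkb_local_estimate[where Pm = "\<lambda>j s. Pr c \<tau> s j" and N = "N c \<tau>" and al = a and H = H and I = I,
          OF I H1 hH[OF nI] P1 Bc sr(2) sr(1)]) blast+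
  have he: "Re (h e e) = k s (snd \<tau> e)" if "near s" "e \<in> fibre E (p (\<gamma> s))" for s e
    unfolding k_def qf_def H_def metric_matrix(2)[OF t(1) x(3)[OF that(1)] that(2,2)] ..
  have fe: "f s j e = k s (Pr c \<tau> s j *v snd \<tau> e)" if "near s" "e \<in> fibre E (p (\<gamma> s))" for s j e
  proof -
    have s: "s \<in> {0..1}" using that(1) by (simp add: near_def)
    show ?thesis
      unfolding f_def he[OF that(1) comp(1)[OF c(1) t(1) s x(2)[OF that(1)] x(3)[OF that(1)] that(2)]]
        comp(2)[OF c(1) t(1) s x(2)[OF that(1)] x(3)[OF that(1)] that(2)] ..
  qed
  have "estimate M s" if s: "s \<in> {0..1}" "\<bar>s - s0\<bar> < d" for s
  proof -
    have sI: "s \<in> I" using s by (auto simp: I_def abs_less_iff)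
    note ns = nI[OF sI]
    show ?thesis
      unfolding estimate_def
    proof (intro conjI ballI allI impI)
      fix e assume e: "e \<in> fibre E (p (\<gamma> s))"
      show "(\<Sum>j\<in>UNIV. f s j e) \<le> M * Re (h e e)" "Re (h e e) \<le> M * (\<Sum>j\<in>UNIV. f s j e)"
        unfolding fe[OF ns e] he[OF ns e] using M1[OF sI] M2[OF sI] by blast+
    next
      fix t' \<sigma> j assume \<sigma>: "flat.flat_on t' UNIV \<sigma>"
      have \<sigma>f: "\<sigma> (\<gamma> s) \<in> fibre E (p (\<gamma> s))" for s by (rule flat.flat_onD[OF \<sigma> UNIV_I])
      obtain D where D: "((\<lambda>s. k s (Pr c \<tau> s j *v snd \<tau> (\<sigma> (\<gamma> s)))) has_real_derivative D) (at s within {0..1})"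
        and D': "\<bar>D - 2 * t' * Re (a j s) * k s (Pr c \<tau> s j *v snd \<tau> (\<sigma> (\<gamma> s)))\<bar> \<le> M * (\<Sum>j\<in>UNIV. k s (Pr c \<tau> s j *v snd \<tau> (\<sigma> (\<gamma> s))))"
        using M3[OF sI path_ode[OF \<sigma> c(1) t(1) s(1) x(2)[OF ns] x(3)[OF ns]]] by blast
      have "((\<lambda>s. f s j (\<sigma> (\<gamma> s))) has_real_derivative D) (at s within {0..1})"
        by (rule has_field_derivative_transform_within[OF D d s(1)]) (use near_ball[OF sI] fe \<sigma>f in auto)
      then show "\<exists>D. ((\<lambda>s. f s j (\<sigma> (\<gamma> s))) has_real_derivative D) (at s within {0..1}) \<and>
        \<bar>D - 2 * t' * Re (a j s) * f s j (\<sigma> (\<gamma> s))\<bar> \<le> M * (\<Sum>j\<in>UNIV. f s j (\<sigma> (\<gamma> s)))"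
        using D' unfolding fe[OF ns \<sigma>f] by blast
    qed
  qed
  then show ?thesis using d ca unfolding I_def by blast
qed

lemma f_nonneg: "s \<in> {0..1} \<Longrightarrow> e \<in> fibre E (p (\<gamma> s)) \<Longrightarrow> f s j e \<ge> 0"
proof -
  assume s: "s \<in> {0..1}" and e: "e \<in> fibre E (p (\<gamma> s))"
  note t = flat.some_triv[of "p (\<gamma> s)"] and c = some_chart[of "p (\<gamma> s)"]
  have "comp s j e \<in> fibre E (p (\<gamma> s))" by (rule comp(1)[OF c(1) t(1) s c(2) t(2) e])
  then show ?thesis
    unfolding f_def metric_matrix(2)[OF t \<open>comp s j e \<in> _\<close> \<open>comp s j e \<in> _\<close>]
    using qf_nonneg[OF metric_matrix(1)[OF t]] by (simp add: qf_def)
qed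

lemma h_nonneg: "e \<in> fibre E x \<Longrightarrow> Re (h e e) \<ge> 0"
  unfolding metric_matrix(2)[OF flat.some_triv[of x]]
  using qf_nonneg[OF metric_matrix(1)[OF flat.some_triv]] by (simp add: qf_def)

lemma uniform_estimate: obtains M where "M \<ge> 1" "\<And>s. s \<in> {0..1} \<Longrightarrow> estimate M s"
proof -
  \<comment> \<open>Membership in \<open>{0..1}\<close> is part of the predicate because enlarging
    \<open>M\<close> uses \<open>f_nonneg\<close>, which is available there.\<close>
  have mono: "estimate M' s" if "s \<in> {0..1} \<and> estimate M s" "M \<le> M'" for M M' s
    unfolding estimate_def
  proof (intro conjI ballI allI impI)
    have s: "s \<in> {0..1}" and est: "estimate M s" using that by auto
    fix e assume e: "e \<in> fibre E (p (\<gamma> s))"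
    have "M * Re (h e e) \<le> M' * Re (h e e)" using h_nonneg[OF e] that(2) by (rule mult_right_mono[rotated])
    then show "(\<Sum>j\<in>UNIV. f s j e) \<le> M' * Re (h e e)" using est e unfolding estimate_def by fastforce
    have "M * (\<Sum>j\<in>UNIV. f s j e) \<le> M' * (\<Sum>j\<in>UNIV. f s j e)"
      using that(2) by (intro mult_right_mono sum_nonneg f_nonneg s e)
    then show "Re (h e e) \<le> M' * (\<Sum>j\<in>UNIV. f s j e)" using est e unfolding estimate_def by fastforce
  next
    have s: "s \<in> {0..1}" and est: "estimate M s" using that by auto
    fix t \<sigma> j assume \<sigma>: "flat.flat_on t UNIV \<sigma>"
    then obtain D where D: "((\<lambda>s. f s j (\<sigma> (\<gamma> s))) has_real_derivative D) (at s within {0..1})"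
        "\<bar>D - 2 * t * Re (a j s) * f s j (\<sigma> (\<gamma> s))\<bar> \<le> M * (\<Sum>j\<in>UNIV. f s j (\<sigma> (\<gamma> s)))"
      using est unfolding estimate_def by blast
    have "M * (\<Sum>j\<in>UNIV. f s j (\<sigma> (\<gamma> s))) \<le> M' * (\<Sum>j\<in>UNIV. f s j (\<sigma> (\<gamma> s)))"
      using that(2) by (intro mult_right_mono sum_nonneg f_nonneg s flat.flat_onD[OF \<sigma> UNIV_I])
    with D show "\<exists>D. ((\<lambda>s. f s j (\<sigma> (\<gamma> s))) has_real_derivative D) (at s within {0..1}) \<and>
        \<bar>D - 2 * t * Re (a j s) * f s j (\<sigma> (\<gamma> s))\<bar> \<le> M' * (\<Sum>j\<in>UNIV. f s j (\<sigma> (\<gamma> s)))"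
      by (intro exI[of _ D]) auto
  qed
  obtain M where M: "\<And>s. s \<in> {0..1} \<Longrightarrow> s \<in> {0..1} \<and> estimate M s"
  proof (rule uniform_constant[of "\<lambda>M s. s \<in> {0..1} \<and> estimate M s"])
    fix x :: real assume "x \<in> {0..1}"
    from local_estimate[OF this] show "\<exists>d>0. \<exists>K. \<forall>s\<in>{0..1}. \<bar>s - x\<bar> < d \<longrightarrow> s \<in> {0..1} \<and> estimate K s" by meson
  qed (use mono in auto)
  have "estimate (max 1 M) s" if "s \<in> {0..1}" for s by (rule mono[OF M[OF that]]) simp
  then show thesis by (intro that[of "max 1 M"]) auto
qed

lemma a_continuous: "continuous_on {0..1} (a i)"
  unfolding continuous_on_eq_continuous_within
proof
  fix s0 :: real assume s0: "s0 \<in> {0..1}"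
  from local_estimate[OF this] obtain d where d: "d > 0" "continuous_on ({0..1} \<inter> {s0 - d..s0 + d}) (a i)" by blast
  then have "continuous (at s0 within {0..1} \<inter> {s0 - d..s0 + d}) (a i)"
    using s0 by (simp add: continuous_on_eq_continuous_within)
  moreover have "at s0 within {0..1} \<inter> {s0 - d..s0 + d} = at s0 within {0..1}"
    by (rule at_within_nhd[of _ "{s0 - d<..<s0 + d}"]) (use d in auto)
  ultimately show "continuous (at s0 within {0..1}) (a i)" by simp
qed

text \<open>Each difference of rates attains a positive minimum on the compact interval, and there
  are finitely many pairs of indices.\<close>

lemma gap: obtains \<delta> where "\<delta> > 0" "\<And>s i j. s \<in> {0..1} \<Longrightarrow> i < j \<Longrightarrow> Re (a j s) + \<delta> \<le> Re (a i s)"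
proof -
  have "\<exists>\<delta>>0. \<forall>s\<in>{0..1}. i < j \<longrightarrow> Re (a j s) + \<delta> \<le> Re (a i s)" for i j
  proof (cases "i < j")
    case True
    have "continuous_on {0..1} (\<lambda>s. Re (a i s) - Re (a j s))"
      by (intro continuous_intros a_continuous)
    from continuous_attains_inf[OF _ _ this] obtain s0 where s0: "s0 \<in> {0..1}"
      "\<forall>s\<in>{0..1}. Re (a i s0) - Re (a j s0) \<le> Re (a i s) - Re (a j s)" by auto
    have "Re (a i s0) - Re (a j s0) > 0" using order s0(1) True by simp
    then show ?thesis using s0(2) by (intro exI[of _ "Re (a i s0) - Re (a j s0)"]) fastforce
  qed (auto intro: exI[of _ 1])
  then obtain \<delta> where \<delta>: "\<And>i j. \<delta> i j > 0" "\<And>i j s. s \<in> {0..1} \<Longrightarrow> i < j \<Longrightarrow> Re (a j s) + \<delta> i j \<le> Re (a i s)" by metis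
  define \<delta>0 where "\<delta>0 = Min (range (\<lambda>q. \<delta> (fst q) (snd q)))"
  have "\<delta>0 > 0" unfolding \<delta>0_def using \<delta>(1) by (subst Min_gr_iff) auto
  moreover have "\<delta>0 \<le> \<delta> i j" for i j unfolding \<delta>0_def by (rule Min_le) (auto intro: range_eqI[of _ _ "(i, j)"])
  ultimately show thesis using that[of \<delta>0] \<delta>(2) by (smt (verit))
qed

end

section \<open>Sorting real vectors\<close>

lemma sorting_permutation:
  fixes v :: "real ^ 'n::{finite,linorder}"
  obtains \<sigma> :: "'n \<Rightarrow> 'n" where "bij \<sigma>" "decreasing (\<chi> i. v $ \<sigma> i)"
proof -
  define es where "es = sorted_list_of_set (UNIV :: 'n set)"
  \<comment> \<open>Sorting by negated entries gives decreasing order; \<open>pos\<close> sends an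
    index to its place in the ordered enumeration, and \<open>\<sigma>\<close> reads off the entry
    of \<open>ss\<close> at that place.\<close>
  define ss where "ss = sort_key (\<lambda>i. - v $ i) es"
  define pos where "pos = inv_into {..<length es} (nth es)"
  define \<sigma> where "\<sigma> i = ss ! pos i" for i
  have es: "distinct es" "set es = UNIV" "sorted es" by (auto simp: es_def)
  have ss: "distinct ss" "set ss = UNIV" "length ss = length es" "sorted (map (\<lambda>i. - v $ i) ss)"
    using es by (auto simp: ss_def)
  have b: "bij_betw (nth es) {..<length es} UNIV" using es by (intro bij_betw_nth) auto
  have bp: "bij_betw pos UNIV {..<length es}" unfolding pos_def by (rule bij_betw_inv_into[OF b])
  have "bij_betw (nth ss) {..<length es} UNIV" using ss by (intro bij_betw_nth) auto
  from bij_betw_trans[OF bp this] have "bij \<sigma>" by (simp add: o_def \<sigma>_def[abs_def])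
  moreover have "v $ \<sigma> j \<le> v $ \<sigma> i" if "i \<le> j" for i j
  proof -
    have p: "pos i < length es" "pos j < length es" using bp by (auto simp: bij_betw_def)
    have e: "es ! pos i = i" for i using bij_betw_inv_into_right[OF b, of i] by (simp add: pos_def)
    have "pos i \<le> pos j"
    proof (rule ccontr)
      assume "\<not> pos i \<le> pos j"
      then have "j \<le> i" using sorted_nth_mono[OF es(3), of "pos j" "pos i"] p e by simp
      then show False using that \<open>\<not> pos i \<le> pos j\<close> by simp
    qed
    then show ?thesis using sorted_nth_mono[OF ss(4), of "pos i" "pos j"] p ss(3) by (simp add: \<sigma>_def)
  qed
  ultimately show thesis using that[of \<sigma>] by (simp add: decreasing_def)
qed

text \<open>Pigeonhole: if the \<open>i\<close>-th entry of \<open>w'\<close> exceeded that of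
  \<open>w\<close>, then \<open>\<tau>\<close> would map the indices up to \<open>i\<close>
  injectively into those strictly below \<open>i\<close>.\<close>

lemma decreasing_rearrangement_le:
  fixes w w' :: "real ^ 'n::{finite,linorder}"
  assumes "decreasing w" "decreasing w'" "bij \<tau>" "\<And>i. w' $ i = w $ \<tau> i"
  shows "w' $ i \<le> w $ i"
proof (rule ccontr)
  assume c: "\<not> w' $ i \<le> w $ i"
  have "\<tau> j < i" if "j \<le> i" for j
  proof (rule ccontr)
    assume "\<not> \<tau> j < i"
    then have "w $ \<tau> j \<le> w $ i" using assms(1) by (simp add: decreasing_def)
    moreover have "w' $ i \<le> w' $ j" using assms(2) that by (simp add: decreasing_def)
    ultimately show False using c assms(4) by simp
  qed
  then have "\<tau> ` {..i} \<subseteq> {..<i}" by auto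
  then have "card {..i} \<le> card {..<i}"
    using assms(3) by (intro card_inj_on_le[of \<tau>]) (auto simp: bij_def intro: inj_on_subset)
  moreover have "card {..<i} < card {..i}" by (rule psubset_card_mono) auto
  ultimately show False by simp
qed

text \<open>Two decreasing rearrangements of a vector bound each other from both sides, which
  justifies the definite description in \<open>sort_desc\<close>.\<close>

lemma sort_desc_eqI:
  fixes v w :: "real ^ 'n::{finite,linorder}" and \<sigma> :: "'n \<Rightarrow> 'n"
  assumes "decreasing w" "bij \<sigma>" "w = (\<chi> i. v $ \<sigma> i)"
  shows "sort_desc v = w"
  unfolding sort_desc_def
proof (rule the_equality)
  show "decreasing w \<and> (\<exists>\<sigma>. bij \<sigma> \<and> w = (\<chi> i. v $ \<sigma> i))" using assms by blast
  fix w' :: "real ^ 'n::{finite,linorder}"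
  assume "decreasing w' \<and> (\<exists>\<sigma>. bij \<sigma> \<and> w' = (\<chi> i. v $ \<sigma> i))"
  then obtain \<sigma>' where w': "decreasing w'" "bij \<sigma>'" "w' = (\<chi> i. v $ \<sigma>' i)" by blast
  have 1: "w' $ i = w $ (inv \<sigma> \<circ> \<sigma>') i" for i
    using assms(2,3) w'(3) by (simp add: bij_is_surj surj_f_inv_f)
  have 2: "w $ i = w' $ (inv \<sigma>' \<circ> \<sigma>) i" for i
    using assms(3) w'(2,3) by (simp add: bij_is_surj surj_f_inv_f)
  have b: "bij (inv \<sigma> \<circ> \<sigma>')" "bij (inv \<sigma>' \<circ> \<sigma>)"
    using assms(2) w'(2) by (simp_all add: bij_comp bij_imp_bij_inv)
  show "w' = w"
    using decreasing_rearrangement_le[OF assms(1) w'(1) b(1) 1] decreasing_rearrangement_le[OF w'(1) assms(1) b(2) 2]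
    by (simp add: vec_eq_iff antisym)
qed

lemma sort_desc:
  fixes v :: "real ^ 'n::{finite,linorder}"
  obtains \<sigma> :: "'n \<Rightarrow> 'n" where "bij \<sigma>" "decreasing (sort_desc v)" "sort_desc v = (\<chi> i. v $ \<sigma> i)"
proof -
  obtain \<sigma> :: "'n \<Rightarrow> 'n" where \<sigma>: "bij \<sigma>" "decreasing (\<chi> i. v $ \<sigma> i)" by (rule sorting_permutation)
  from sort_desc_eqI[OF \<sigma>(2,1) refl] \<sigma> that show thesis by simp
qed

lemma sort_desc_scale:
  fixes v :: "real ^ 'n::{finite,linorder}"
  assumes "t \<ge> 0" shows "sort_desc (t *\<^sub>R v) = t *\<^sub>R sort_desc v"
proof -
  obtain \<sigma> :: "'n \<Rightarrow> 'n" where \<sigma>: "bij \<sigma>" "decreasing (sort_desc v)" "sort_desc v = (\<chi> i. v $ \<sigma> i)" by (rule sort_desc)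
  show ?thesis
    by (rule sort_desc_eqI[OF _ \<sigma>(1)]) (use \<sigma> assms in \<open>auto simp: decreasing_def mult_left_mono vec_eq_iff\<close>)
qed

section \<open>Metrics on a fibre\<close>

definition hmat :: "(complex ^ 'n \<Rightarrow> complex ^ 'n \<Rightarrow> complex) \<Rightarrow> complex ^ 'n::finite ^ 'n" where
  "hmat K = (\<chi> i j. K (axis i 1) (axis j 1))"

text \<open>The Gram matrix factors as the transpose of \<open>cmat b\<close>, times
  \<open>hmat K\<close>, times the conjugate of \<open>cmat b\<close>.\<close>

lemma gram_det:
  fixes b :: "'n::finite \<Rightarrow> complex ^ 'n"
  assumes "hform K"
  shows "det (\<chi> i j. K (b i) (b j)) = det (hmat K) * of_real ((cmod (det (cmat b)))\<^sup>2)"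
proof -
  define C where "C = (\<chi> i j. cnj (cmat b $ i $ j))"
  define M where "M = hmat K"
  have K: "K = sesq M" unfolding M_def hmat_def by (rule hform_eq_sesq[OF assms])
  have "K (b i) (b j) = (transpose (cmat b) ** M ** C) $ i $ j" for i j
  proof -
    have "(transpose (cmat b) ** M ** C) $ i $ j = (\<Sum>m\<in>UNIV. \<Sum>l\<in>UNIV. M $ l $ m * b i $ l * cnj (b j $ m))"
      by (simp add: matrix_matrix_mult_def transpose_def C_def cmat_def sum_distrib_right sum_distrib_left mult_ac)
    also have "\<dots> = K (b i) (b j)" unfolding K sesq_def by (rule sum.swap)
    finally show ?thesis ..
  qed
  then have "(\<chi> i j. K (b i) (b j)) = transpose (cmat b) ** hmat K ** C" by (simp add: vec_eq_iff M_def)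
  then have "det (\<chi> i j. K (b i) (b j)) = det (cmat b) * det (hmat K) * det C"
    by (simp add: det_mul det_transpose)
  also have "det C = cnj (det (cmat b))" by (simp add: C_def det_def)
  finally show ?thesis by (simp add: mult_ac complex_norm_square del: of_real_power)
qed

text \<open>In a common orthogonal basis both determinants are products of the diagonal values, up
  to the same positive factor.\<close>

lemma gram_det_comparison:
  fixes H K :: "complex ^ 'n::finite \<Rightarrow> complex ^ 'n \<Rightarrow> complex"
  assumes "hform H" "hform K" "\<And>v. qf K v \<le> c * qf H v" and c: "c > 0"
  shows "Re (det (hmat K)) \<le> c ^ CARD('n) * Re (det (hmat H))" "det (hmat H) = of_real (Re (det (hmat H)))" "Re (det (hmat H)) > 0"
proof -
  obtain b :: "'n \<Rightarrow> complex ^ 'n" where b: "\<And>i. b i \<noteq> 0" "\<And>i j. i \<noteq> j \<Longrightarrow> H (b i) (b j) = 0" "\<And>i j. i \<noteq> j \<Longrightarrow> K (b i) (b j) = 0"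
    by (rule simultaneous_diagonalization[OF assms(1,2)]) blast
  have diag: "det (\<chi> i j. M (b i) (b j)) = of_real (\<Prod>i\<in>UNIV. qf M (b i))"
    if "hform M" "\<And>i j. i \<noteq> j \<Longrightarrow> M (b i) (b j) = 0" for M
    using det_diagonal[of "\<chi> i j. M (b i) (b j)"] that by (simp add: hform_diag[symmetric])
  define q where "q = (cmod (det (cmat b)))\<^sup>2"
  have q: "q > 0" using orthogonal_det_nz[of H b, OF assms(1) b(2,1)] by (simp add: q_def)
  have e: "det (hmat M) = of_real ((\<Prod>i\<in>UNIV. qf M (b i)) / q)"
    if "hform M" "\<And>i j. i \<noteq> j \<Longrightarrow> M (b i) (b j) = 0" for M
    using diag[OF that] gram_det[OF that(1), of b] q unfolding q_def[symmetric]
    by (simp add: eq_divide_eq del: of_real_prod)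
  have eH: "det (hmat H) = of_real ((\<Prod>i\<in>UNIV. qf H (b i)) / q)" by (rule e[OF assms(1) b(2)])
  have eK: "det (hmat K) = of_real ((\<Prod>i\<in>UNIV. qf K (b i)) / q)" by (rule e[OF assms(2) b(3)])
  have "(\<Prod>i\<in>UNIV. qf K (b i)) \<le> (\<Prod>i\<in>UNIV. c * qf H (b i))"
    by (intro prod_mono conjI assms(3) qf_nonneg assms(2))
  also have "\<dots> = c ^ CARD('n) * (\<Prod>i\<in>UNIV. qf H (b i))" by (simp add: prod.distrib)
  finally show "Re (det (hmat K)) \<le> c ^ CARD('n) * Re (det (hmat H))"
    unfolding eH eK Re_complex_of_real using q by (simp add: divide_right_mono)
  show "det (hmat H) = of_real (Re (det (hmat H)))" unfolding eH Re_complex_of_real ..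
  show "Re (det (hmat H)) > 0"
    unfolding eH Re_complex_of_real by (intro divide_pos_pos prod_pos q hform_pos[OF assms(1) b(1)])
qed

locale fibre_metrics = covered_bundle E p
  for E :: "('x::t2_space, 'e, 'r::{finite,linorder}) vbundle" and p :: "'u::t2_space \<Rightarrow> 'x" +
  fixes x :: 'x and \<tau> :: "('x, 'e, 'r) triv"
  assumes \<tau>: "\<tau> \<in> trivs E" "x \<in> fst \<tau>" and detE: "det_trivialized E"
begin

abbreviation vec where "vec \<equiv> vec_of \<tau> x"

definition F where "F k v w = k (vec v) (vec w)"

text \<open>Inverse to \<open>F\<close> on forms supported on the fibre; together they identify
  metrics on the fibre with Hermitian forms on coordinate vectors in the fixed
  trivialization.\<close>

definition mk where "mk K = restrict_form (fibre E x) (\<lambda>e e'. K (snd \<tau> e) (snd \<tau> e'))"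

lemma F_mk: "F (mk K) = K"
  by (intro ext) (simp add: F_def mk_def restrict_form_def vec_of_fibre[OF \<tau>] triv_vec_of[OF \<tau>])

lemma F_apply: "e \<in> fibre E x \<Longrightarrow> e' \<in> fibre E x \<Longrightarrow> k e e' = F k (snd \<tau> e) (snd \<tau> e')"
  by (simp add: F_def vec_of_triv[OF \<tau>])

lemma F_restrict: "F (restrict_form (fibre E x) k) = F k"
  by (intro ext) (simp add: F_def restrict_form_def vec_of_fibre[OF \<tau>])

lemma change_triv:
  assumes "\<tau>' \<in> trivs E" "x \<in> fst \<tau>'"
  obtains g where "det g \<noteq> 0" "\<And>e. e \<in> fibre E x \<Longrightarrow> snd \<tau> e = g *v snd \<tau>' e"
proof -
  have g: "snd \<tau> e = trans_fun E \<tau>' \<tau> x *v snd \<tau>' e" if "e \<in> fibre E x" for e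
    using trans_apply[OF assms(1) \<tau>(1)] assms \<tau> that by blast
  have g': "snd \<tau>' e = trans_fun E \<tau> \<tau>' x *v snd \<tau> e" if "e \<in> fibre E x" for e
    using trans_apply[OF \<tau>(1) assms(1)] assms \<tau> that by blast
  have "det (trans_fun E \<tau>' \<tau> x) \<noteq> 0"
  proof (rule det_nzI)
    fix v assume "trans_fun E \<tau>' \<tau> x *v v = 0"
    then have "snd \<tau> (vec_of \<tau>' x v) = 0" using g[OF vec_of_fibre[OF assms]] by (simp add: triv_vec_of[OF assms])
    then show "v = 0" using g'[OF vec_of_fibre[OF assms, of v]] by (simp add: triv_vec_of[OF assms])
  qed
  then show thesis by (rule that[OF _ g])
qed

text \<open>The defining condition ranges over all trivializations at \<open>x\<close>; one suffices
  because they differ by invertible matrices.\<close>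

lemma herm_inner_on_iff: "herm_inner_on E x k \<longleftrightarrow> hform (F k)"
proof
  assume "herm_inner_on E x k"
  then have "\<exists>H. (\<forall>i j. H $ j $ i = cnj (H $ i $ j)) \<and> (\<forall>v. v \<noteq> 0 \<longrightarrow> Re (sesq H v v) > 0) \<and>
             (\<forall>e\<in>fibre E x. \<forall>e'\<in>fibre E x. k e e' = sesq H (snd \<tau> e) (snd \<tau> e'))"
    using \<tau> unfolding herm_inner_on_def by (auto simp: case_prod_unfold)
  then obtain H where H: "\<forall>i j. H $ j $ i = cnj (H $ i $ j)" "\<forall>v. v \<noteq> 0 \<longrightarrow> Re (sesq H v v) > 0"
    and k: "\<And>e e'. e \<in> fibre E x \<Longrightarrow> e' \<in> fibre E x \<Longrightarrow> k e e' = sesq H (snd \<tau> e) (snd \<tau> e')" by blast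
  have "F k = sesq H"
    by (intro ext) (simp add: F_def k vec_of_fibre[OF \<tau>] triv_vec_of[OF \<tau>])
  then show "hform (F k)" using hform_sesq[OF H] by simp
next
  assume hf: "hform (F k)"
  show "herm_inner_on E x k"
    unfolding herm_inner_on_def case_prod_unfold
  proof (intro ballI impI)
    fix \<tau>' assume t': "\<tau>' \<in> trivs E" "x \<in> fst \<tau>'"
    obtain g where g: "det g \<noteq> 0" "\<And>e. e \<in> fibre E x \<Longrightarrow> snd \<tau> e = g *v snd \<tau>' e" by (rule change_triv[OF t']) blast
    define K where "K v w = F k (g *v v) (g *v w)" for v w
    have hK: "hform K" unfolding K_def[abs_def] using det_nz_ker[OF g(1)] by (intro hform_compose hf) auto
    have s: "sesq (hmat K) = K" unfolding hmat_def by (rule hform_eq_sesq[OF hK, symmetric])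
    show "\<exists>H. (\<forall>i j. H $ j $ i = cnj (H $ i $ j)) \<and> (\<forall>v. v \<noteq> 0 \<longrightarrow> Re (sesq H v v) > 0) \<and>
             (\<forall>e\<in>fibre E x. \<forall>e'\<in>fibre E x. k e e' = sesq H (snd \<tau>' e) (snd \<tau>' e'))"
    proof (intro exI[of _ "hmat K"] conjI, unfold s)
      show "\<forall>i j. hmat K $ j $ i = cnj (hmat K $ i $ j)"
        unfolding hmat_def vec_lambda_beta by (intro allI hform_cnj[OF hK])
      show "\<forall>v. v \<noteq> 0 \<longrightarrow> Re (K v v) > 0" using hform_pos[OF hK] by (simp add: qf_def)
      show "\<forall>e\<in>fibre E x. \<forall>e'\<in>fibre E x. k e e' = K (snd \<tau>' e) (snd \<tau>' e')"
        by (simp add: K_def F_apply g(2))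
    qed
  qed
qed

definition volume_factor where
  "volume_factor = (SOME d. d \<noteq> 0 \<and> (\<forall>e. range e \<subseteq> fibre E x \<longrightarrow> vol E e = d * det (cmat (\<lambda>i. snd \<tau> (e i)))))"

lemma volume: "volume_factor \<noteq> 0" "range e \<subseteq> fibre E x \<Longrightarrow> vol E e = volume_factor * det (cmat (\<lambda>i. snd \<tau> (e i)))"
proof -
  have "\<exists>d. d \<noteq> 0 \<and> (\<forall>e. range e \<subseteq> fibre E x \<longrightarrow> vol E e = d * det (cmat (\<lambda>i. snd \<tau> (e i))))"
    using bspec[OF detE[unfolded det_trivialized_def] \<tau>(1)] \<tau>(2) unfolding case_prod_unfold cmat_def by blast
  from someI_ex[OF this] show "volume_factor \<noteq> 0" "range e \<subseteq> fibre E x \<Longrightarrow> vol E e = volume_factor * det (cmat (\<lambda>i. snd \<tau> (e i)))"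
    unfolding volume_factor_def by blast+
qed

text \<open>Both sides of the determinant condition scale by the same factor under a change of
  basis, so it amounts to a single equation, tested on the coordinate frame.\<close>

lemma standard_det_on_iff:
  assumes "hform (F k)"
  shows "standard_det_on E x k \<longleftrightarrow> det (hmat (F k)) = of_real ((cmod volume_factor)\<^sup>2)"
proof -
  have g: "det (\<chi> i j. k (e i) (e j)) = det (hmat (F k)) * of_real ((cmod (det (cmat (\<lambda>i. snd \<tau> (e i)))))\<^sup>2)"
    if "range e \<subseteq> fibre E x" for e
  proof -
    have "(\<chi> i j. k (e i) (e j)) = (\<chi> i j. F k (snd \<tau> (e i)) (snd \<tau> (e j)))"
      using that by (simp add: vec_eq_iff F_apply[symmetric] range_subsetD)
    then show ?thesis using gram_det[OF assms] by simp
  qed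
  show ?thesis
  proof
    assume s: "standard_det_on E x k"
    define e where "e i = vec (axis i 1)" for i
    have e: "range e \<subseteq> fibre E x" by (auto simp: e_def vec_of_fibre[OF \<tau>])
    have "cmat (\<lambda>i. snd \<tau> (e i)) = mat 1" by (simp add: e_def triv_vec_of[OF \<tau>] cmat_def mat_def axis_def vec_eq_iff)
    then show "det (hmat (F k)) = of_real ((cmod volume_factor)\<^sup>2)"
      using s g[OF e] volume(2)[OF e] e unfolding standard_det_on_def by simp
  next
    assume "det (hmat (F k)) = of_real ((cmod volume_factor)\<^sup>2)"
    then show "standard_det_on E x k"
      unfolding standard_det_on_def using g volume(2) by (simp add: norm_mult power_mult_distrib)
  qed
qed

lemma Met_iff: "k \<in> Met E x \<longleftrightarrow> hform (F k) \<and> det (hmat (F k)) = of_real ((cmod volume_factor)\<^sup>2) \<and> mk (F k) = k"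
proof -
  have "mk (F k) = restrict_form (fibre E x) k"
    by (intro ext) (simp add: mk_def restrict_form_def F_apply)
  then show ?thesis unfolding Met_def using herm_inner_on_iff[of k] standard_det_on_iff[of k] by auto
qed

lemma fibre_basis_iff:
  "fibre_basis E x e \<longleftrightarrow> range e \<subseteq> fibre E x \<and> det (cmat (\<lambda>i. snd \<tau> (e i))) \<noteq> 0"
proof
  assume "fibre_basis E x e"
  then have "range e \<subseteq> fibre E x" "vec.span (range (\<lambda>i. snd \<tau> (e i))) = UNIV"
    using \<tau> unfolding fibre_basis_def by (auto simp: case_prod_unfold)
  then show "range e \<subseteq> fibre E x \<and> det (cmat (\<lambda>i. snd \<tau> (e i))) \<noteq> 0" using det_cmat_nz_iff_span by blast
next
  assume e: "range e \<subseteq> fibre E x \<and> det (cmat (\<lambda>i. snd \<tau> (e i))) \<noteq> 0"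
  show "fibre_basis E x e"
    unfolding fibre_basis_def case_prod_unfold
  proof (intro conjI ballI impI)
    fix \<tau>' assume t': "\<tau>' \<in> trivs E" "x \<in> fst \<tau>'"
    obtain g where g: "det g \<noteq> 0" "\<And>e. e \<in> fibre E x \<Longrightarrow> snd \<tau> e = g *v snd \<tau>' e" by (rule change_triv[OF t']) blast
    have "cmat (\<lambda>i. snd \<tau> (e i)) = g ** cmat (\<lambda>i. snd \<tau>' (e i))"
      using e g(2) by (auto simp: cmat_def vec_eq_iff matrix_matrix_mult_def matrix_vector_mult_def range_subsetD)
    then have "det (cmat (\<lambda>i. snd \<tau>' (e i))) \<noteq> 0" using e by (auto simp: det_mul)
    then show "vec.span (range (\<lambda>i. snd \<tau>' (e i))) = UNIV" by (simp add: det_cmat_nz_iff_span)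
  qed (use e in blast)
qed

section \<open>Vector distance and distance between metrics on a fibre\<close>

lemma form_norm_eq: "e \<in> fibre E x \<Longrightarrow> form_norm k e = sqrt (qf (F k) (snd \<tau> e))"
  by (simp add: form_norm_def qf_def F_apply)

text \<open>The exponents of \<open>met_vdist\<close> with a basis realizing them, in coordinates;
  the factor 2 converts norms to squared norms.\<close>

definition vdist_witness ::
  "('e \<Rightarrow> 'e \<Rightarrow> complex) \<Rightarrow> ('e \<Rightarrow> 'e \<Rightarrow> complex) \<Rightarrow> (real, 'r) vec \<Rightarrow> ('r \<Rightarrow> (complex, 'r) vec) \<Rightarrow> bool" where
  "vdist_witness k l a b \<longleftrightarrow> decreasing a \<and> (\<forall>i. b i \<noteq> 0) \<and> (\<forall>i j. i \<noteq> j \<longrightarrow> F k (b i) (b j) = 0 \<and> F l (b i) (b j) = 0) \<and>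
     (\<forall>i. qf (F l) (b i) = exp (2 * a $ i) * qf (F k) (b i))"

text \<open>The minimax comparison in logarithmic form. With zero errors it gives uniqueness of the
  vector distance, with small ones its stability and hence the independence of apartments in the
  cone.\<close>

lemma vdist_witness_le:
  assumes f: "hform (F k)" "hform (F l)" "hform (F k')" "hform (F l')"
    and w: "vdist_witness k l a b" "vdist_witness k' l' a' b'"
    and c: "\<And>v. qf (F l) v \<le> exp (2 * c) * qf (F l') v" "\<And>v. qf (F k') v \<le> exp (2 * d) * qf (F k) v"
  shows "a $ i \<le> a' $ i + c + d"
proof -
  have "exp (2 * a $ i) \<le> exp (2 * c) * exp (2 * d) * exp (2 * a' $ i)"
    by (rule minimax_comparison[of "F k" "F l" "F k'" "F l'" b b' "\<lambda>i. exp (2 * a $ i)" "\<lambda>i. exp (2 * a' $ i)"])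
       (use f w c in \<open>auto simp: vdist_witness_def decreasing_def\<close>)
  then have "exp (2 * a $ i) \<le> exp (2 * (a' $ i + c + d))" by (simp add: exp_add[symmetric] algebra_simps)
  then show ?thesis by simp
qed

lemma met_vdist_eqI:
  assumes f: "hform (F k)" "hform (F l)" and w: "vdist_witness k l a b"
  shows "met_vdist E x k l = a"
  unfolding met_vdist_def
proof (rule the_equality)
  define e where "e i = vec (b i)" for i
  have te: "snd \<tau> (e i) = b i" "e i \<in> fibre E x" for i by (simp_all add: e_def triv_vec_of[OF \<tau>] vec_of_fibre[OF \<tau>])
  have "det (cmat b) \<noteq> 0" using w by (intro orthogonal_det_nz[OF f(1)]) (auto simp: vdist_witness_def)
  then have "fibre_basis E x e" unfolding fibre_basis_iff using te by auto
  moreover have "form_norm l (e i) = exp (a $ i) * form_norm k (e i)" for i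
    using w by (simp add: form_norm_eq te vdist_witness_def real_sqrt_mult exp_double)
  ultimately show "decreasing a \<and> (\<exists>e. fibre_basis E x e \<and> (\<forall>i j. i \<noteq> j \<longrightarrow> k (e i) (e j) = 0 \<and> l (e i) (e j) = 0) \<and>
          (\<forall>i. form_norm l (e i) = exp (a $ i) * form_norm k (e i)))"
    using w by (auto simp: vdist_witness_def F_apply te intro!: exI[of _ e])
next
  fix a' assume "decreasing a' \<and> (\<exists>e. fibre_basis E x e \<and> (\<forall>i j. i \<noteq> j \<longrightarrow> k (e i) (e j) = 0 \<and> l (e i) (e j) = 0) \<and>
          (\<forall>i. form_norm l (e i) = exp (a' $ i) * form_norm k (e i)))"
  then obtain e where a': "decreasing a'" and e: "fibre_basis E x e" "\<And>i j. i \<noteq> j \<Longrightarrow> k (e i) (e j) = 0 \<and> l (e i) (e j) = 0"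
    "\<And>i. form_norm l (e i) = exp (a' $ i) * form_norm k (e i)" by blast
  define b' where "b' i = snd \<tau> (e i)" for i
  have ef: "e i \<in> fibre E x" for i using e(1) unfolding fibre_basis_iff by blast
  have "b' i \<noteq> 0" for i
  proof
    assume "b' i = 0"
    then have "cmat b' *v axis i 1 = 0" by (simp add: cmat_mult axis_def if_distrib[of "\<lambda>c. c *s _"] cong: if_cong)
    moreover have "det (cmat b') \<noteq> 0" using e(1) unfolding fibre_basis_iff b'_def[symmetric] by blast
    ultimately have "axis i (1 :: complex) = 0" using det_nz_ker by blast
    then show False by (simp add: axis_eq_0_iff)
  qed
  moreover have "qf (F l) (b' i) = exp (2 * a' $ i) * qf (F k) (b' i)" for i
  proof -
    have "(sqrt (qf (F l) (b' i)))\<^sup>2 = (exp (a' $ i) * sqrt (qf (F k) (b' i)))\<^sup>2"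
      using e(3)[of i] by (simp add: form_norm_eq[OF ef] b'_def)
    then show ?thesis using f by (simp add: power_mult_distrib exp_double qf_nonneg)
  qed
  ultimately have w': "vdist_witness k l a' b'"
    using a' e(2) by (simp add: vdist_witness_def b'_def F_apply[symmetric] ef)
  have "a' $ i \<le> a $ i" "a $ i \<le> a' $ i" for i
    using vdist_witness_le[OF f f w' w, of 0 0 i] vdist_witness_le[OF f f w w', of 0 0 i] by simp_all
  then show "a' = a" by (simp add: vec_eq_iff antisym)
qed

lemma met_vdist_witness:
  assumes f: "hform (F k)" "hform (F l)"
  obtains b where "vdist_witness k l (met_vdist E x k l) b"
proof -
  obtain b :: "'r \<Rightarrow> (complex, 'r) vec" where b: "\<And>i. b i \<noteq> 0" "\<And>i j. i \<noteq> j \<Longrightarrow> F k (b i) (b j) = 0" "\<And>i j. i \<noteq> j \<Longrightarrow> F l (b i) (b j) = 0"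
    by (rule simultaneous_diagonalization[OF f]) blast
  define v :: "(real, 'r) vec" where "v = (\<chi> i. ln (qf (F l) (b i) / qf (F k) (b i)) / 2)"
  obtain \<sigma> :: "'r \<Rightarrow> 'r" where \<sigma>: "bij \<sigma>" "decreasing (\<chi> i. v $ \<sigma> i)" by (rule sorting_permutation)
  have "exp (2 * v $ i) * qf (F k) (b i) = qf (F l) (b i)" for i
    using hform_pos[OF f(1) b(1)[of i]] hform_pos[OF f(2) b(1)[of i]] by (simp add: v_def)
  moreover have "\<sigma> i \<noteq> \<sigma> j" if "i \<noteq> j" for i j using \<sigma>(1) that by (simp add: bij_def inj_eq)
  ultimately have w: "vdist_witness k l (\<chi> i. v $ \<sigma> i) (\<lambda>i. b (\<sigma> i))"
    using b \<sigma>(2) by (simp add: vdist_witness_def)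
  show thesis by (rule that) (unfold met_vdist_eqI[OF f w], rule w)
qed

lemma met_vdist_le:
  assumes f: "hform (F k)" "hform (F l)" "hform (F k')" "hform (F l')"
    and c: "\<And>v. qf (F l) v \<le> exp (2 * c) * qf (F l') v" "\<And>v. qf (F k') v \<le> exp (2 * d) * qf (F k) v"
  shows "met_vdist E x k l $ i \<le> met_vdist E x k' l' $ i + c + d"
proof -
  obtain b where "vdist_witness k l (met_vdist E x k l) b" by (rule met_vdist_witness[OF f(1,2)])
  moreover obtain b' where "vdist_witness k' l' (met_vdist E x k' l') b'" by (rule met_vdist_witness[OF f(3,4)])
  ultimately show ?thesis using vdist_witness_le[OF f _ _ c] by blast
qed

lemma met_vdist_self: assumes "hform (F k)" shows "met_vdist E x k k = 0"
proof -
  obtain b where "vdist_witness k k (met_vdist E x k k) b" by (rule met_vdist_witness[OF assms assms])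
  then have "qf (F k) (b i) = exp (2 * met_vdist E x k k $ i) * qf (F k) (b i)" "b i \<noteq> 0" for i
    by (simp_all add: vdist_witness_def)
  then have "exp (2 * met_vdist E x k k $ i) = 1" for i
    using hform_pos[OF assms] by (metis less_irrefl mult_cancel_right1)
  then show ?thesis by (simp add: vec_eq_iff)
qed

lemma met_dist_comparison:
  assumes f: "hform (F k)" "hform (F l)"
  shows "qf (F l) v \<le> exp (2 * met_dist E x k l) * qf (F k) v" "qf (F k) v \<le> exp (2 * met_dist E x k l) * qf (F l) v"
proof -
  let ?a = "met_vdist E x k l"
  obtain b where b: "vdist_witness k l ?a b" by (rule met_vdist_witness[OF f])
  have "det (cmat b) \<noteq> 0" using b by (intro orthogonal_det_nz[OF f(1)]) (auto simp: vdist_witness_def)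
  then obtain y where y: "cmat b *v y = v" by (rule det_nz_solve)
  have k: "qf (F k) v = (\<Sum>j\<in>UNIV. (cmod (y $ j))\<^sup>2 * qf (F k) (b j))"
    unfolding y[symmetric] using b by (intro qf_orthogonal_sum(1) f) (auto simp: vdist_witness_def)
  have l: "qf (F l) v = (\<Sum>j\<in>UNIV. (cmod (y $ j))\<^sup>2 * qf (F l) (b j))"
    unfolding y[symmetric] using b by (intro qf_orthogonal_sum(1) f) (auto simp: vdist_witness_def)
  have "\<bar>?a $ i\<bar> \<le> met_dist E x k l" for i
    unfolding met_dist_def using component_le_norm_cart[of ?a i] by simp
  then have a: "?a $ i \<le> met_dist E x k l" "- ?a $ i \<le> met_dist E x k l" for i by (simp_all add: abs_le_iff)
  show "qf (F l) v \<le> exp (2 * met_dist E x k l) * qf (F k) v"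
    unfolding k l sum_distrib_left
  proof (intro sum_mono)
    fix j
    have "qf (F l) (b j) \<le> exp (2 * met_dist E x k l) * qf (F k) (b j)"
      using b a[of j] qf_nonneg[OF f(1)] by (simp add: vdist_witness_def mult_right_mono)
    then show "(cmod (y $ j))\<^sup>2 * qf (F l) (b j) \<le> exp (2 * met_dist E x k l) * ((cmod (y $ j))\<^sup>2 * qf (F k) (b j))"
      using mult_left_mono[of _ _ "(cmod (y $ j))\<^sup>2"] by (fastforce simp: mult_ac)
  qed
  show "qf (F k) v \<le> exp (2 * met_dist E x k l) * qf (F l) v"
    unfolding k l sum_distrib_left
  proof (intro sum_mono)
    fix j
    have "1 * qf (F k) (b j) \<le> exp (2 * met_dist E x k l + 2 * ?a $ j) * qf (F k) (b j)"
      using a[of j] qf_nonneg[OF f(1)] by (intro mult_right_mono) auto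
    then have "qf (F k) (b j) \<le> exp (2 * met_dist E x k l) * qf (F l) (b j)"
      using b by (simp add: vdist_witness_def exp_add)
    then show "(cmod (y $ j))\<^sup>2 * qf (F k) (b j) \<le> exp (2 * met_dist E x k l) * ((cmod (y $ j))\<^sup>2 * qf (F l) (b j))"
      using mult_left_mono[of _ _ "(cmod (y $ j))\<^sup>2"] by (fastforce simp: mult_ac)
  qed
qed

text \<open>The factor \<open>CARD('r)\<close> comes from bounding the Euclidean norm of the vector
  distance by the sum of its absolute coordinates.\<close>

lemma met_dist_le:
  fixes c :: real
  assumes f: "hform (F k)" "hform (F l)"
    and c: "\<And>v. qf (F l) v \<le> exp (2 * c) * qf (F k) v" "\<And>v. qf (F k) v \<le> exp (2 * c) * qf (F l) v"
  shows "met_dist E x k l \<le> CARD('r) * c"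
proof -
  have "\<bar>met_vdist E x k l $ i\<bar> \<le> c" for i
    using met_vdist_le[OF f f(1) f(1), of c 0 i] met_vdist_le[OF f(1) f(1) f, of c 0 i] c met_vdist_self[OF f(1)]
    by (simp add: abs_le_iff)
  then have "(\<Sum>i\<in>UNIV. \<bar>met_vdist E x k l $ i\<bar>) \<le> (\<Sum>i\<in>(UNIV :: 'r set). c)" by (intro sum_mono)
  then show ?thesis
    using norm_le_l1_cart[of "met_vdist E x k l"] by (simp add: met_dist_def)
qed

text \<open>A triangle inequality up to the rank, obtained by chaining comparisons of the forms. It
  suffices for the cone, where rescaled distances enter only through boundedness and through
  convergence to zero.\<close>

lemma met_dist_triangle:
  assumes f: "hform (F k)" "hform (F l)" "hform (F m)"
  shows "met_dist E x k m \<le> CARD('r) * (met_dist E x k l + met_dist E x l m)"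
proof (rule met_dist_le[OF f(1,3)])
  fix v
  have "qf (F m) v \<le> exp (2 * met_dist E x l m) * qf (F l) v" by (rule met_dist_comparison[OF f(2,3)])
  also have "\<dots> \<le> exp (2 * met_dist E x l m) * (exp (2 * met_dist E x k l) * qf (F k) v)"
    by (intro mult_left_mono met_dist_comparison[OF f(1,2)]) simp
  also have "\<dots> = exp (2 * (met_dist E x k l + met_dist E x l m)) * qf (F k) v"
    by (simp add: distrib_left exp_add mult_ac)
  finally show "qf (F m) v \<le> exp (2 * (met_dist E x k l + met_dist E x l m)) * qf (F k) v" .
  have "qf (F k) v \<le> exp (2 * met_dist E x k l) * qf (F l) v" by (rule met_dist_comparison[OF f(1,2)])
  also have "\<dots> \<le> exp (2 * met_dist E x k l) * (exp (2 * met_dist E x l m) * qf (F m) v)"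
    by (intro mult_left_mono met_dist_comparison[OF f(2,3)]) simp
  also have "\<dots> = exp (2 * (met_dist E x k l + met_dist E x l m)) * qf (F m) v"
    by (simp add: distrib_left exp_add mult_ac)
  finally show "qf (F k) v \<le> exp (2 * (met_dist E x k l + met_dist E x l m)) * qf (F m) v" .
qed

lemma met_dist_sym_le:
  assumes f: "hform (F k)" "hform (F l)"
  shows "met_dist E x l k \<le> CARD('r) * met_dist E x k l"
  by (rule met_dist_le[OF f(2,1)]) (rule met_dist_comparison[OF f])+

lemma met_dist_nonneg: "met_dist E x k l \<ge> 0"
  by (simp add: met_dist_def)

lemma met_dist_self: "hform (F k) \<Longrightarrow> met_dist E x k k = 0"
  by (simp add: met_dist_def met_vdist_self)

section \<open>Maximal flats and their charts\<close>

lemma flat_chart: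
  assumes e: "unimodular_basis E x e" and v: "v \<in> model_apartment"
  defines "b \<equiv> \<lambda>i. snd \<tau> (e i)"
  shows flat_chart_Met: "flat_chart E x e v \<in> Met E x"
    and flat_chart_orthogonal: "i \<noteq> j \<Longrightarrow> F (flat_chart E x e v) (b i) (b j) = 0"
    and flat_chart_qf: "qf (F (flat_chart E x e v)) (cmat b *v y) = (\<Sum>i\<in>UNIV. (cmod (y $ i))\<^sup>2 * exp (2 * v $ i))"
    and flat_chart_qf_basis: "qf (F (flat_chart E x e v)) (b i) = exp (2 * v $ i)"
    and unimodular_nz: "det (cmat b) \<noteq> 0" "b i \<noteq> 0"
proof -
  have eb: "range e \<subseteq> fibre E x" "det (cmat b) \<noteq> 0" "cmod (vol E e) = 1"
    using e unfolding unimodular_basis_def fibre_basis_iff b_def by auto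
  show "det (cmat b) \<noteq> 0" by (rule eb)
  have ef: "e i \<in> fibre E x" for i using eb(1) by blast
  have "invertible (cmat b)" using eb(2) invertible_det_nz by blast
  then obtain V where V: "cmat b ** V = mat 1" "V ** cmat b = mat 1" unfolding invertible_def by blast
  have ax: "cmat b *v axis i 1 = b i" for i
    by (simp add: cmat_mult axis_def if_distrib[of "\<lambda>c. c *s _"] cong: if_cong)
  have Vb: "V *v b i = axis i 1" for i
  proof -
    have "V *v (cmat b *v axis i 1) = axis i 1" by (simp only: matrix_vector_mul_assoc V matrix_vector_mul_lid)
    then show ?thesis by (simp only: ax)
  qed
  \<comment> \<open>The candidate metric is the diagonal form with weights
    \<open>exp (2 * v $ i)\<close> in the coordinates with respect to \<open>b\<close>, which
    \<open>V\<close> computes.\<close>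
  define Dm :: "(complex, 'r) vec \<Rightarrow> (complex, 'r) vec \<Rightarrow> complex"
    where "Dm u w = (\<Sum>i\<in>UNIV. of_real (exp (2 * v $ i)) * (u $ i * cnj (w $ i)))" for u w
  have Dqf: "qf Dm u = (\<Sum>i\<in>UNIV. (cmod (u $ i))\<^sup>2 * exp (2 * v $ i))" for u
    by (simp add: qf_def Dm_def complex_norm_square[symmetric] mult.commute del: of_real_power)
  have hD: "hform Dm"
    unfolding hform_def
  proof (intro conjI allI impI)
    fix u :: "(complex, 'r) vec" assume "u \<noteq> 0"
    then obtain i where "u $ i \<noteq> 0" by (auto simp: vec_eq_iff)
    then have "(\<Sum>i\<in>UNIV. (cmod (u $ i))\<^sup>2 * exp (2 * v $ i)) > 0" by (intro sum_pos2[of _ i]) auto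
    then show "Re (Dm u u) > 0" using Dqf[of u] by (simp add: qf_def)
  qed (simp_all add: Dm_def algebra_simps sum.distrib sum_distrib_left)
  define K where "K u w = Dm (V *v u) (V *v w)" for u w
  have Vnz: "V *v u \<noteq> 0" if "u \<noteq> 0" for u
    using that V(1) by (metis matrix_vector_mul_assoc matrix_vector_mul_lid matrix_vector_mult_0_right)
  have hK: "hform K" unfolding K_def[abs_def] by (intro hform_compose hD Vnz)
  have Kb: "K (b i) (b j) = (if i = j then of_real (exp (2 * v $ i)) else 0)" for i j
    by (simp add: K_def Dm_def Vb axis_def if_distrib[of "\<lambda>c. _ * c"] if_distrib[of cnj] cong: if_cong)
  \<comment> \<open>The Gram determinant is 1 because the coordinates of \<open>v\<close> sum to
    zero; with unit volume of the basis this is the standard determinant condition.\<close>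
  have "det (\<chi> i j. K (b i) (b j)) = (\<Prod>i\<in>UNIV. of_real (exp (2 * v $ i)))"
    using det_diagonal[of "\<chi> i j. K (b i) (b j)"] by (simp add: Kb)
  also have "\<dots> = of_real (exp (2 * (\<Sum>i\<in>UNIV. v $ i)))" by (simp add: exp_sum sum_distrib_left flip: of_real_prod)
  also have "\<dots> = 1" using v by (simp add: model_apartment_def)
  finally have 1: "det (hmat K) * of_real ((cmod (det (cmat b)))\<^sup>2) = 1" using gram_det[OF hK, of b] by simp
  have "(cmod volume_factor)\<^sup>2 * (cmod (det (cmat b)))\<^sup>2 = 1"
    using volume(2)[OF eb(1)] eb(3) by (simp add: b_def norm_mult flip: power_mult_distrib)
  then have "of_real ((cmod volume_factor)\<^sup>2) * of_real ((cmod (det (cmat b)))\<^sup>2) = (1 :: complex)"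
    by (metis of_real_1 of_real_mult)
  with 1 have "det (hmat K) = of_real ((cmod volume_factor)\<^sup>2)"
    using eb(2) by (metis mult_right_cancel mult_zero_right zero_neq_one)
  then have KM: "mk K \<in> Met E x" unfolding Met_iff F_mk using hK by simp
  have "flat_chart E x e v = mk K"
    unfolding flat_chart_def
  proof (rule the_equality)
    show "mk K \<in> Met E x \<and> (\<forall>i j. mk K (e i) (e j) = (if i = j then of_real (exp (2 * v $ i)) else 0))"
      using KM by (simp add: F_apply[OF ef ef] F_mk Kb[unfolded b_def])
    fix k assume k: "k \<in> Met E x \<and> (\<forall>i j. k (e i) (e j) = (if i = j then of_real (exp (2 * v $ i)) else 0))"
    then have hk: "hform (F k)" and mk: "mk (F k) = k" unfolding Met_iff by auto
    have kb: "F k (b i) (b j) = K (b i) (b j)" for i j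
      using k by (simp add: F_apply[OF ef ef, symmetric] b_def Kb[unfolded b_def])
    \<comment> \<open>A Hermitian form is determined by its values on a basis, which gives
      uniqueness in the definition of \<open>flat_chart\<close>.\<close>
    have "F k u w = K u w" for u w
    proof -
      obtain y z where "cmat b *v y = u" "cmat b *v z = w" using det_nz_solve[OF eb(2)] by metis
      then show ?thesis
        by (auto simp: cmat_mult hform_sum_left hform_sum_right hform_scale_left hform_scale_right hk hK kb)
    qed
    then have "F k = K" by (intro ext)
    then show "k = mk K" using mk by simp
  qed
  then show "flat_chart E x e v \<in> Met E x" and "i \<noteq> j \<Longrightarrow> F (flat_chart E x e v) (b i) (b j) = 0"
    and "qf (F (flat_chart E x e v)) (cmat b *v y) = (\<Sum>i\<in>UNIV. (cmod (y $ i))\<^sup>2 * exp (2 * v $ i))"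
    and "qf (F (flat_chart E x e v)) (b i) = exp (2 * v $ i)"
  proof -
    assume fc: "flat_chart E x e v = mk K"
    show "flat_chart E x e v \<in> Met E x" using KM fc by simp
    show "i \<noteq> j \<Longrightarrow> F (flat_chart E x e v) (b i) (b j) = 0" by (simp add: fc F_mk Kb)
    show "qf (F (flat_chart E x e v)) (b i) = exp (2 * v $ i)" by (simp add: fc F_mk Kb qf_def)
    have "qf K (cmat b *v y) = qf Dm (V *v (cmat b *v y))" by (simp add: qf_def K_def)
    then show "qf (F (flat_chart E x e v)) (cmat b *v y) = (\<Sum>i\<in>UNIV. (cmod (y $ i))\<^sup>2 * exp (2 * v $ i))"
      by (simp add: fc F_mk matrix_vector_mul_assoc V Dqf)
  qed
  show "b i \<noteq> 0"
    using hform_pos[OF hK] Kb[of i i] hK by (auto simp: hform_zero_left)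
qed

lemma flat_chart_hform: "unimodular_basis E x e \<Longrightarrow> v \<in> model_apartment \<Longrightarrow> hform (F (flat_chart E x e v))"
  using flat_chart_Met Met_iff by blast

text \<open>The basis of the flat, permuted so as to sort the exponents, is itself a witness for the
  vector distance.\<close>

lemma flat_chart_vdist:
  assumes e: "unimodular_basis E x e" and v: "v \<in> model_apartment" "w \<in> model_apartment"
  shows "met_vdist E x (flat_chart E x e v) (flat_chart E x e w) = sort_desc (w - v)"
proof -
  obtain \<sigma> :: "'r \<Rightarrow> 'r" where \<sigma>: "bij \<sigma>" "decreasing (sort_desc (w - v))" "sort_desc (w - v) = (\<chi> i. (w - v) $ \<sigma> i)" by (rule sort_desc)
  have \<sigma>i: "\<sigma> i \<noteq> \<sigma> j" if "i \<noteq> j" for i j using \<sigma>(1) that by (simp add: bij_def inj_eq)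
  have "vdist_witness (flat_chart E x e v) (flat_chart E x e w) (sort_desc (w - v)) (\<lambda>i. snd \<tau> (e (\<sigma> i)))"
    unfolding vdist_witness_def
    using \<sigma> flat_chart_orthogonal[OF e v(1)] flat_chart_orthogonal[OF e v(2)] flat_chart_qf_basis[OF e v(1)]
      flat_chart_qf_basis[OF e v(2)] unimodular_nz(2)[OF e v(1)] \<sigma>i
    by (simp flip: exp_add)
  then show ?thesis by (intro met_vdist_eqI flat_chart_hform e v)
qed

end

section \<open>Points and apartments of the asymptotic cone\<close>

context fibre_metrics
begin

lemma cone_families_hform: "z \<in> cone_families E x h \<omega> \<Longrightarrow> hform (F (z t))"
  unfolding cone_families_def using Met_iff by blast

lemma cone_class_subset:
  assumes y: "\<And>t. hform (F (y t))" "\<And>t. hform (F (y' t))"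
    and lim: "((\<lambda>t. met_dist E x (y' t) (y t) / t) \<longlongrightarrow> 0) \<omega>" and pos: "eventually (\<lambda>t. t > 0) \<omega>"
  shows "cone_class E x h \<omega> y \<subseteq> cone_class E x h \<omega> y'"
proof
  fix z assume "z \<in> cone_class E x h \<omega> y"
  then have z: "z \<in> cone_families E x h \<omega>" and zl: "((\<lambda>t. met_dist E x (y t) (z t) / t) \<longlongrightarrow> 0) \<omega>"
    unfolding cone_class_def by auto
  have "((\<lambda>t. CARD('r) * (met_dist E x (y' t) (y t) / t + met_dist E x (y t) (z t) / t)) \<longlongrightarrow> real CARD('r) * (0 + 0)) \<omega>"
    by (intro tendsto_intros lim zl)
  then have ub: "((\<lambda>t. CARD('r) * (met_dist E x (y' t) (y t) / t + met_dist E x (y t) (z t) / t)) \<longlongrightarrow> 0) \<omega>" by simp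
  have "((\<lambda>t. met_dist E x (y' t) (z t) / t) \<longlongrightarrow> 0) \<omega>"
  proof (rule tendsto_sandwich[OF _ _ tendsto_const ub])
    show "\<forall>\<^sub>F t in \<omega>. 0 \<le> met_dist E x (y' t) (z t) / t"
      using pos by eventually_elim (simp add: met_dist_nonneg)
    show "\<forall>\<^sub>F t in \<omega>. met_dist E x (y' t) (z t) / t \<le> CARD('r) * (met_dist E x (y' t) (y t) / t + met_dist E x (y t) (z t) / t)"
      using pos
    proof eventually_elim
      case (elim t)
      show ?case
        using divide_right_mono[OF met_dist_triangle[OF y(2)[of t] y(1)[of t] cone_families_hform[OF z, of t]], of t] elim
        by (simp flip: add_divide_distrib)
    qed
  qed
  then show "z \<in> cone_class E x h \<omega> y'" using z unfolding cone_class_def by simp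
qed

lemma cone_class_eqI:
  assumes y: "\<And>t. hform (F (y t))" "\<And>t. hform (F (y' t))"
    and lim: "((\<lambda>t. met_dist E x (y t) (y' t) / t) \<longlongrightarrow> 0) \<omega>" and pos: "eventually (\<lambda>t. t > 0) \<omega>"
  shows "cone_class E x h \<omega> y = cone_class E x h \<omega> y'"
proof
  have ub: "((\<lambda>t. CARD('r) * (met_dist E x (y t) (y' t) / t)) \<longlongrightarrow> 0) \<omega>"
    using tendsto_mult[OF tendsto_const lim, of "CARD('r)"] by simp
  have "((\<lambda>t. met_dist E x (y' t) (y t) / t) \<longlongrightarrow> 0) \<omega>"
  proof (rule tendsto_sandwich[OF _ _ tendsto_const ub])
    show "\<forall>\<^sub>F t in \<omega>. 0 \<le> met_dist E x (y' t) (y t) / t"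
      using pos by eventually_elim (simp add: met_dist_nonneg)
    show "\<forall>\<^sub>F t in \<omega>. met_dist E x (y' t) (y t) / t \<le> CARD('r) * (met_dist E x (y t) (y' t) / t)"
      using pos
    proof eventually_elim
      case (elim t)
      show ?case using divide_right_mono[OF met_dist_sym_le[OF y(1)[of t] y(2)[of t]], of t] elim by simp
    qed
  qed
  then show "cone_class E x h \<omega> y \<subseteq> cone_class E x h \<omega> y'" by (intro cone_class_subset y pos)
  show "cone_class E x h \<omega> y' \<subseteq> cone_class E x h \<omega> y" by (intro cone_class_subset y pos lim)
qed

lemma cone_class_self:
  assumes "y \<in> cone_families E x h \<omega>" shows "y \<in> cone_class E x h \<omega> y"
  using assms cone_families_hform[OF assms] by (simp add: cone_class_def met_dist_self)

lemma model_zero: "0 \<in> model_apartment" and model_scale: "v \<in> model_apartment \<Longrightarrow> t *\<^sub>R v \<in> model_apartment"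
  by (simp_all add: model_apartment_def flip: sum_distrib_left)

text \<open>Within a flat, moving from the origin to \<open>t *\<^sub>R v\<close> costs a distance
  of at most a multiple of t, so every model point defines a family of the cone as soon as the
  origin does.\<close>

lemma flat_family:
  assumes hh: "hform (F h)" and e: "\<And>t. unimodular_basis E x (e t)"
    and bd: "(\<lambda>t. flat_chart E x (e t) 0) \<in> cone_families E x h \<omega>"
    and v: "v \<in> model_apartment" and pos: "eventually (\<lambda>t. t > 0) \<omega>"
  shows "(\<lambda>t. flat_chart E x (e t) (t *\<^sub>R v)) \<in> cone_families E x h \<omega>"
proof -
  let ?h = "restrict_form (fibre E x) h" and ?r = "real CARD('r)"
  have hx: "hform (F ?h)" using hh by (simp add: F_restrict)
  obtain C where C: "eventually (\<lambda>t. met_dist E x (flat_chart E x (e t) 0) ?h / t \<le> C) \<omega>"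
    using bd unfolding cone_families_def by blast
  have d: "met_dist E x (flat_chart E x (e t) (t *\<^sub>R v)) (flat_chart E x (e t) 0) \<le> ?r * (t * norm v)" if t: "t > 0" for t
  proof (rule met_dist_le[OF flat_chart_hform[OF e model_scale[OF v]] flat_chart_hform[OF e model_zero]])
    fix w
    obtain y where y: "cmat (\<lambda>i. snd \<tau> (e t i)) *v y = w" using det_nz_solve[OF unimodular_nz(1)[OF e model_zero]] .
    have b: "t * v $ i \<le> t * norm v" "- (t * v $ i) \<le> t * norm v" for i
      using component_le_norm_cart[of v i] mult_left_mono[of "v $ i" "norm v" t] mult_left_mono[of "- v $ i" "norm v" t] t
      by (auto simp: abs_le_iff)
    show "qf (F (flat_chart E x (e t) 0)) w \<le> exp (2 * (t * norm v)) * qf (F (flat_chart E x (e t) (t *\<^sub>R v))) w"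
      unfolding y[symmetric] flat_chart_qf[OF e model_zero] flat_chart_qf[OF e model_scale[OF v]] sum_distrib_left
    proof (intro sum_mono)
      fix i
      have "(cmod (y $ i))\<^sup>2 * 1 \<le> (cmod (y $ i))\<^sup>2 * exp (2 * (t * norm v) + 2 * (t *\<^sub>R v) $ i)"
        using b(2)[of i] by (intro mult_left_mono) auto
      then show "(cmod (y $ i))\<^sup>2 * exp (2 * 0 $ i) \<le> exp (2 * (t * norm v)) * ((cmod (y $ i))\<^sup>2 * exp (2 * (t *\<^sub>R v) $ i))"
        by (simp add: exp_add mult_ac)
    qed
    show "qf (F (flat_chart E x (e t) (t *\<^sub>R v))) w \<le> exp (2 * (t * norm v)) * qf (F (flat_chart E x (e t) 0)) w"
      unfolding y[symmetric] flat_chart_qf[OF e model_zero] flat_chart_qf[OF e model_scale[OF v]] sum_distrib_left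
    proof (intro sum_mono)
      fix i
      have "(cmod (y $ i))\<^sup>2 * exp (2 * (t *\<^sub>R v) $ i) \<le> (cmod (y $ i))\<^sup>2 * exp (2 * (t * norm v))"
        using b(1)[of i] by (intro mult_left_mono) auto
      then show "(cmod (y $ i))\<^sup>2 * exp (2 * (t *\<^sub>R v) $ i) \<le> exp (2 * (t * norm v)) * ((cmod (y $ i))\<^sup>2 * exp (2 * 0 $ i))"
        by (simp add: mult_ac)
    qed
  qed
  have "eventually (\<lambda>t. met_dist E x (flat_chart E x (e t) (t *\<^sub>R v)) ?h / t \<le> ?r * (?r * norm v + C)) \<omega>"
    using pos C
  proof eventually_elim
    case (elim t)
    have "met_dist E x (flat_chart E x (e t) (t *\<^sub>R v)) ?h \<le>
        ?r * (met_dist E x (flat_chart E x (e t) (t *\<^sub>R v)) (flat_chart E x (e t) 0) + met_dist E x (flat_chart E x (e t) 0) ?h)"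
      by (rule met_dist_triangle[OF flat_chart_hform[OF e model_scale[OF v]] flat_chart_hform[OF e model_zero] hx])
    also have "\<dots> \<le> ?r * (?r * (t * norm v) + C * t)"
      using d[OF elim(1)] elim by (intro mult_left_mono add_mono) (auto simp: field_simps)
    finally show ?case using elim(1) by (simp add: field_simps)
  qed
  then show ?thesis
    unfolding cone_families_def using flat_chart_Met[OF e model_scale[OF v]] by blast
qed

text \<open>In \<open>Met\<close> the vector distance of the representatives is exactly t times the
  sorted difference, for either family of flats. Equality of the classes makes corresponding
  representatives sublinearly close, so by \<open>met_vdist_le\<close> the error vanishes in the
  limit after division by t.\<close>

lemma sort_desc_le:
  assumes hh: "hform (F h)" and e: "\<And>t. unimodular_basis E x (e t)" "\<And>t. unimodular_basis E x (e' t)"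
    and bd: "(\<lambda>t. flat_chart E x (e t) 0) \<in> cone_families E x h \<omega>"
    and m: "a \<in> model_apartment" "b \<in> model_apartment" "a' \<in> model_apartment" "b' \<in> model_apartment"
    and \<omega>: "eventually (\<lambda>t. t > 0) \<omega>" "\<omega> \<noteq> bot"
    and eq: "cone_class E x h \<omega> (\<lambda>t. flat_chart E x (e t) (t *\<^sub>R a)) = cone_class E x h \<omega> (\<lambda>t. flat_chart E x (e' t) (t *\<^sub>R a'))"
      "cone_class E x h \<omega> (\<lambda>t. flat_chart E x (e t) (t *\<^sub>R b)) = cone_class E x h \<omega> (\<lambda>t. flat_chart E x (e' t) (t *\<^sub>R b'))"
  shows "sort_desc (b - a) $ i \<le> sort_desc (b' - a') $ i"
proof -
  define y where "y v t = flat_chart E x (e t) (t *\<^sub>R v)" for v t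
  define y' where "y' v t = flat_chart E x (e' t) (t *\<^sub>R v)" for v t
  have hy: "hform (F (y v t))" "hform (F (y' v t))" if "v \<in> model_apartment" for v t
    unfolding y_def y'_def by (intro flat_chart_hform e model_scale that)+
  have lim: "((\<lambda>t. met_dist E x (y' v' t) (y v t) / t) \<longlongrightarrow> 0) \<omega>"
    if "v \<in> model_apartment" "cone_class E x h \<omega> (y v) = cone_class E x h \<omega> (y' v')" for v v'
  proof -
    \<comment> \<open>Once \<open>y v\<close> belongs to the families of the cone it is a member of
      its own class, and through the equality of classes its distance to \<open>y' v'\<close> is
      sublinear.\<close>
    have "y v \<in> cone_families E x h \<omega>" unfolding y_def by (rule flat_family[OF hh e(1) bd that(1) \<omega>(1)])
    then have "y v \<in> cone_class E x h \<omega> (y' v')" using cone_class_self that(2) by blast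
    then show ?thesis unfolding cone_class_def by simp
  qed
  have l1: "((\<lambda>t. met_dist E x (y' a' t) (y a t) / t) \<longlongrightarrow> 0) \<omega>" using eq(1) by (intro lim m) (simp add: y_def[abs_def] y'_def[abs_def])
  have l2: "((\<lambda>t. met_dist E x (y' b' t) (y b t) / t) \<longlongrightarrow> 0) \<omega>" using eq(2) by (intro lim m) (simp add: y_def[abs_def] y'_def[abs_def])
  have "((\<lambda>t. sort_desc (b' - a') $ i + met_dist E x (y' b' t) (y b t) / t + met_dist E x (y' a' t) (y a t) / t)
      \<longlongrightarrow> sort_desc (b' - a') $ i + 0 + 0) \<omega>"
    by (intro tendsto_intros l1 l2)
  moreover have "eventually (\<lambda>t. sort_desc (b - a) $ i \<le> sort_desc (b' - a') $ i + met_dist E x (y' b' t) (y b t) / t + met_dist E x (y' a' t) (y a t) / t) \<omega>"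
    using \<omega>(1)
  proof eventually_elim
    case (elim t)
    have 1: "met_vdist E x (y a t) (y b t) = t *\<^sub>R sort_desc (b - a)"
      unfolding y_def flat_chart_vdist[OF e(1) model_scale[OF m(1)] model_scale[OF m(2)]]
      using sort_desc_scale[of t "b - a"] elim by (simp add: scaleR_diff_right)
    have 2: "met_vdist E x (y' a' t) (y' b' t) = t *\<^sub>R sort_desc (b' - a')"
      unfolding y'_def flat_chart_vdist[OF e(2) model_scale[OF m(3)] model_scale[OF m(4)]]
      using sort_desc_scale[of t "b' - a'"] elim by (simp add: scaleR_diff_right)
    have "met_vdist E x (y a t) (y b t) $ i \<le> met_vdist E x (y' a' t) (y' b' t) $ i + met_dist E x (y' b' t) (y b t) + met_dist E x (y' a' t) (y a t)"
      by (rule met_vdist_le[OF hy(1)[OF m(1)] hy(1)[OF m(2)] hy(2)[OF m(3)] hy(2)[OF m(4)]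
          met_dist_comparison(1)[OF hy(2)[OF m(4)] hy(1)[OF m(2)]] met_dist_comparison(2)[OF hy(2)[OF m(3)] hy(1)[OF m(1)]]])
    then show ?case unfolding 1 2 using elim by (simp add: field_simps)
  qed
  ultimately show ?thesis using tendsto_lowerbound \<omega>(2) by fastforce
qed

text \<open>By \<open>sort_desc_le\<close> in both directions all apartment coordinates of the two
  points give the same vector, which justifies the definite description in
  \<open>cone_vdist\<close>.\<close>

lemma cone_vdist_eq:
  assumes hh: "hform (F h)" and \<omega>: "eventually (\<lambda>t. t > 0) \<omega>" "\<omega> \<noteq> bot"
    and f: "apartment_chart E x h \<omega> f" and m: "a \<in> model_apartment" "b \<in> model_apartment"
  shows "cone_vdist E x h \<omega> (f a) (f b) = sort_desc (b - a)"
  unfolding cone_vdist_def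
proof (rule the_equality)
  show "\<exists>f'. apartment_chart E x h \<omega> f' \<and> (\<exists>a'\<in>model_apartment. \<exists>b'\<in>model_apartment. f' a' = f a \<and> f' b' = f b \<and> sort_desc (b - a) = sort_desc (b' - a'))"
    using f m by blast
  fix v assume "\<exists>f'. apartment_chart E x h \<omega> f' \<and> (\<exists>a'\<in>model_apartment. \<exists>b'\<in>model_apartment. f' a' = f a \<and> f' b' = f b \<and> v = sort_desc (b' - a'))"
  then obtain f' a' b' where f': "apartment_chart E x h \<omega> f'" and m': "a' \<in> model_apartment" "b' \<in> model_apartment"
    and eq: "f' a' = f a" "f' b' = f b" and v: "v = sort_desc (b' - a')" by blast
  obtain e where e: "\<And>t. unimodular_basis E x (e t)" "(\<lambda>t. flat_chart E x (e t) 0) \<in> cone_families E x h \<omega>"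
    "f = (\<lambda>v. cone_class E x h \<omega> (\<lambda>t. flat_chart E x (e t) (t *\<^sub>R v)))" using f unfolding apartment_chart_def by blast
  obtain e' where e': "\<And>t. unimodular_basis E x (e' t)" "(\<lambda>t. flat_chart E x (e' t) 0) \<in> cone_families E x h \<omega>"
    "f' = (\<lambda>v. cone_class E x h \<omega> (\<lambda>t. flat_chart E x (e' t) (t *\<^sub>R v)))" using f' unfolding apartment_chart_def by blast
  have "sort_desc (b - a) $ i \<le> sort_desc (b' - a') $ i" for i
    by (rule sort_desc_le[where e = e and e' = e', OF hh e(1) e'(1) e(2) m m' \<omega>]) (use eq e(3) e'(3) in simp_all)
  moreover have "sort_desc (b' - a') $ i \<le> sort_desc (b - a) $ i" for i
    by (rule sort_desc_le[where e = e' and e' = e, OF hh e'(1) e(1) e'(2) m' m \<omega>]) (use eq e(3) e'(3) in simp_all)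
  ultimately show "v = sort_desc (b - a)" unfolding v by (simp add: vec_eq_iff antisym)
qed

end

section \<open>The limiting map along a noncritical path\<close>

lemma qf_identity: "qf (sesq (mat 1)) v = (\<Sum>i\<in>UNIV. (cmod (v $ i))\<^sup>2)" for v :: "complex ^ 'n::finite"
proof -
  have "sesq (mat 1) v v = (\<Sum>i\<in>UNIV. v $ i * cnj (v $ i))"
    by (simp add: sesq_def mat_def if_distrib[of "\<lambda>c. c * _"] cong: if_cong)
  then show ?thesis by (simp add: qf_def complex_norm_square[symmetric] flip: of_real_power)
qed

lemma hform_identity: "hform (sesq (mat 1 :: complex ^ 'n::finite ^ 'n))"
proof (rule hform_sesq)
  show "\<forall>v::complex ^ 'n. v \<noteq> 0 \<longrightarrow> Re (sesq (mat 1) v v) > 0"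
  proof (intro allI impI)
    fix v :: "complex ^ 'n" assume "v \<noteq> 0"
    then obtain i where "v $ i \<noteq> 0" by (auto simp: vec_eq_iff)
    then have "(\<Sum>i\<in>UNIV. (cmod (v $ i))\<^sup>2) > 0" by (intro sum_pos2[of _ i]) auto
    then show "Re (sesq (mat 1) v v) > 0" using qf_identity[of v] by (simp add: qf_def)
  qed
qed (simp add: mat_def)

lemma hform_comparable:
  fixes H K :: "complex ^ 'n::finite \<Rightarrow> complex ^ 'n \<Rightarrow> complex"
  assumes "hform H" "hform K"
  obtains c where "c \<ge> 1" "\<And>v. qf K v \<le> c * qf H v"
proof -
  obtain b :: "'n \<Rightarrow> complex ^ 'n" where b: "\<And>i. b i \<noteq> 0" "\<And>i j. i \<noteq> j \<Longrightarrow> H (b i) (b j) = 0" "\<And>i j. i \<noteq> j \<Longrightarrow> K (b i) (b j) = 0"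
    by (rule simultaneous_diagonalization[OF assms]) blast
  define c where "c = 1 + (\<Sum>i\<in>UNIV. qf K (b i) / qf H (b i))"
  have Hp: "qf H (b i) > 0" and Kp: "qf K (b i) > 0" for i using hform_pos assms b(1) by blast+
  then have nn: "qf K (b i) / qf H (b i) \<ge> 0" for i by (simp add: less_imp_le)
  have le: "qf K (b i) \<le> c * qf H (b i)" for i
  proof -
    have "qf K (b i) / qf H (b i) \<le> (\<Sum>i\<in>UNIV. qf K (b i) / qf H (b i))" by (rule member_le_sum) (use nn in auto)
    then have "qf K (b i) / qf H (b i) \<le> c" by (simp add: c_def)
    then show ?thesis using Hp[of i] by (simp add: field_simps)
  qed
  have "qf K v \<le> c * qf H v" for v
  proof -
    have "det (cmat b) \<noteq> 0" using b by (intro orthogonal_det_nz[OF assms(1)]) auto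
    then obtain x where x: "cmat b *v x = v" by (rule det_nz_solve)
    have "(cmod (x $ i))\<^sup>2 * qf K (b i) \<le> (cmod (x $ i))\<^sup>2 * (c * qf H (b i))" for i by (intro mult_left_mono le) simp
    then have "(\<Sum>i\<in>UNIV. (cmod (x $ i))\<^sup>2 * qf K (b i)) \<le> (\<Sum>i\<in>UNIV. (cmod (x $ i))\<^sup>2 * (c * qf H (b i)))" by (intro sum_mono)
    also have "\<dots> = c * (\<Sum>i\<in>UNIV. (cmod (x $ i))\<^sup>2 * qf H (b i))" by (simp add: sum_distrib_left mult_ac)
    finally show ?thesis
      unfolding x[symmetric] using qf_orthogonal_sum(1)[of H b x, OF assms(1) b(2)] qf_orthogonal_sum(1)[of K b x, OF assms(2) b(3)] by simp
  qed
  moreover have "c \<ge> 1" unfolding c_def using sum_nonneg[of UNIV "\<lambda>i. qf K (b i) / qf H (b i)"] nn by simp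
  ultimately show thesis using that by blast
qed

lemma det_nz_inverse:
  fixes V :: "complex ^ 'n::finite ^ 'n"
  assumes "det V \<noteq> 0" obtains V' where "V ** V' = mat 1" "V' ** V = mat 1"
  using assms invertible_det_nz[of V] unfolding invertible_def by blast

text \<open>Turns the vanishing trace of the Higgs field into a vanishing sum of eigenforms, which
  places \<open>\<alpha>v\<close> in the model apartment.\<close>

lemma trace_eigenvalues:
  fixes A :: "complex ^ 'n::{finite,linorder} ^ 'n::{finite,linorder}" and l :: "'n \<Rightarrow> complex"
  assumes "inj l" "\<And>z. charpoly_fun A z = (\<Prod>i\<in>UNIV. z - l i)"
  shows "trace A = (\<Sum>i\<in>UNIV. l i)"
proof -
  obtain W where W: "det (cmat W) \<noteq> 0" "\<And>i. A *v W i = l i *s W i" by (rule eigenbasis[OF assms]) blast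
  define D :: "complex ^ 'n::{finite,linorder} ^ 'n::{finite,linorder}" where "D = (\<chi> i j. if i = j then l j else 0)"
  obtain V' where V': "cmat W ** V' = mat 1" "V' ** cmat W = mat 1" by (rule det_nz_inverse[OF W(1)])
  have "(A *v W j) $ k = l j * W j $ k" for j k by (simp add: W(2))
  then have e: "A ** cmat W = cmat W ** D"
    by (simp add: vec_eq_iff matrix_matrix_mult_def matrix_vector_mult_def cmat_def D_def if_distrib[of "\<lambda>c. _ * c"] mult.commute cong: if_cong)
  have "trace A = trace (A ** (cmat W ** V'))" by (simp add: V')
  also have "\<dots> = trace ((cmat W ** D) ** V')" by (simp add: matrix_mul_assoc e)
  also have "\<dots> = trace (V' ** (cmat W ** D))" by (rule trace_mul_sym)
  also have "\<dots> = trace D" by (simp add: matrix_mul_assoc V')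
  finally show ?thesis by (simp add: trace_def D_def)
qed

section \<open>Pulled back metrics expressed by flat sections\<close>

locale wkb_cone = wkb_path E p \<Phi> B h \<gamma> a + fibre_metrics E p "p x0" \<tau>0
  for E :: "('x::t2_space, 'e, 'r::{finite,linorder}) vbundle" and p :: "'u::t2_space \<Rightarrow> 'x"
    and \<Phi> B :: "('x, 'e, 'r) local_form" and h :: "'e \<Rightarrow> 'e \<Rightarrow> complex" and \<gamma> :: "real \<Rightarrow> 'u" and a :: "'r \<Rightarrow> real \<Rightarrow> complex"
    and x0 :: 'u and \<tau>0 :: "('x, 'e, 'r) triv" +
  assumes tr0: "trace_zero E \<Phi>" and detB: "trivial_det_connection E B" and std: "\<And>x. standard_det_on E x h"
begin

abbreviation hp where "hp \<equiv> h_pull E \<Phi> B p x0 h"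

text \<open>Uniqueness of global flat sections turns the definite description into evaluation of a
  section.\<close>

lemma transport_eq:
  assumes s: "flat.flat_on t UNIV s" shows "transport E \<Phi> B p x0 t Q (s x0) = s Q"
  unfolding transport_def flat_section_iff
proof (rule the_equality)
  show "\<exists>s'. flat.flat_on t UNIV s' \<and> s' x0 = s x0 \<and> s' Q = s Q" using s by blast
  fix e' assume "\<exists>s'. flat.flat_on t UNIV s' \<and> s' x0 = s x0 \<and> s' Q = e'"
  then obtain s' where s': "flat.flat_on t UNIV s'" "s' x0 = s x0" "s' Q = e'" by blast
  have "s' = s" by (rule flat.flat_section_unique[OF s'(1) s s'(2)])
  then show "e' = s Q" using s' by simp
qed

definition S where "S t v = (SOME s. flat.flat_on t UNIV s \<and> s x0 = vec v)"

lemma S: "flat.flat_on t UNIV (S t v)" "S t v x0 = vec v"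
proof -
  obtain s where "flat.flat_on t UNIV s" "s x0 = vec v"
    by (rule flat.global_flat_section[OF vec_of_fibre[OF \<tau>]])
  then have "\<exists>s. flat.flat_on t UNIV s \<and> s x0 = vec v" by blast
  from someI_ex[OF this] show "flat.flat_on t UNIV (S t v)" "S t v x0 = vec v" unfolding S_def by blast+
qed

lemma S_fibre: "S t v Q \<in> fibre E (p Q)"
  by (rule flat.flat_onD[OF S(1) UNIV_I])

lemma F_hp: "F (hp t Q) v w = h (S t v Q) (S t w Q)"
  using transport_eq[OF S(1)[of t v], of Q] transport_eq[OF S(1)[of t w], of Q]
  by (simp add: h_pull_def F_restrict) (simp add: F_def S(2))

lemma qf_hp: "qf (F (hp t Q)) v = Re (h (S t v Q) (S t v Q))"
  by (simp add: qf_def F_hp)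

lemma S_matrix:
  assumes t': "\<tau>' \<in> trivs E" "p Q \<in> fst \<tau>'"
  obtains G where "det G \<noteq> 0" "\<And>v. snd \<tau>' (S t v Q) = G *v v"
proof -
  obtain G where G: "det G \<noteq> 0" "\<And>s. flat.flat_on t UNIV s \<Longrightarrow> snd \<tau>' (s Q) = G *v snd \<tau>0 (s x0)"
    by (rule flat.transport_matrix[where t = t, OF \<tau> t']) blast
  then show thesis using that[of G] S triv_vec_of[OF \<tau>] by simp
qed

lemma hp_hform: "hform (F (hp t Q))"
proof -
  note st = flat.some_triv[of "p Q"]
  obtain G where G: "det G \<noteq> 0" "\<And>v. snd (flat.some_triv (p Q)) (S t v Q) = G *v v" by (rule S_matrix[where t = t, OF st]) blast
  have F: "F (hp t Q) = (\<lambda>v w. sesq (\<chi> i j. h (frame E (flat.some_triv (p Q)) (p Q) i) (frame E (flat.some_triv (p Q)) (p Q) j)) (G *v v) (G *v w))"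
    by (intro ext) (simp only: F_hp metric_matrix(2)[OF st S_fibre S_fibre] G)
  have "G *v v \<noteq> 0" if "v \<noteq> 0" for v using det_nz_ker[OF G(1)] that by blast
  then show ?thesis unfolding F by (intro hform_compose metric_matrix(1)[OF st])
qed

lemma h_hform: "hform (F h)"
  using herm herm_inner_on_iff[of h] unfolding hermitian_metric_def by blast

lemma volume_flat:
  assumes "\<And>i. flat.flat_on t UNIV (s i)" shows "vol E (\<lambda>i. s i u) = vol E (\<lambda>i. s i u')"
proof (rule flat.volume_constant[OF detE _ assms])
  fix c \<tau>' x assume c: "c \<in> charts E" "\<tau>' \<in> trivs E" "x \<in> fst c \<inter> fst \<tau>'"
  have "trace (\<Phi> c \<tau>' x) = 0" using tr0 c by (simp add: trace_zero_def)
  then have "trace (A t c \<tau>' x) = - trace (B c \<tau>' x)"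
    by (simp add: A_def trace_def sum_subtractf flip: scaleR_sum_right)
  then show "cderiv c (\<lambda>y. vol E (frame E \<tau>' y)) x = - trace (A t c \<tau>' x) * vol E (frame E \<tau>' x)"
    using detB c by (simp add: trivial_det_connection_def)
qed

text \<open>Transport conserves the volume form and \<open>h\<close> induces the standard
  determinant metric at \<open>p Q\<close>, so the pulled back metric induces it at
  \<open>p x0\<close>.\<close>

lemma hp_Met: "hp t Q \<in> Met E (p x0)"
proof -
  have "det (\<chi> i j. hp t Q (e i) (e j)) = of_real ((cmod (vol E e))\<^sup>2)" if e: "range e \<subseteq> fibre E (p x0)" for e :: "'r \<Rightarrow> 'e"
  proof -
    define s where "s i = S t (snd \<tau>0 (e i))" for i
    have ef: "e i \<in> fibre E (p x0)" for i using e by blast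
    have s: "flat.flat_on t UNIV (s i)" "s i x0 = e i" for i
      unfolding s_def using S vec_of_triv[OF \<tau> ef] by simp_all
    have "hp t Q (e i) (e j) = h (s i Q) (s j Q)" for i j
      unfolding F_apply[OF ef ef] F_hp s_def ..
    then have "det (\<chi> i j. hp t Q (e i) (e j)) = det (\<chi> i j. h (s i Q) (s j Q))" by simp
    also have "\<dots> = of_real ((cmod (vol E (\<lambda>i. s i Q)))\<^sup>2)"
      using std[of "p Q", unfolded standard_det_on_def, rule_format, of "\<lambda>i. s i Q"] flat.flat_onD[OF s(1) UNIV_I] by blast
    also have "vol E (\<lambda>i. s i Q) = vol E (\<lambda>i. s i x0)" by (rule volume_flat[OF s(1)])
    finally show ?thesis by (simp add: s(2))
  qed
  then have "standard_det_on E (p x0) (hp t Q)" unfolding standard_det_on_def by blast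
  moreover have "restrict_form (fibre E (p x0)) (hp t Q) = hp t Q"
    by (intro ext) (simp add: h_pull_def restrict_form_def)
  ultimately show ?thesis unfolding Met_def using herm_inner_on_iff hp_hform by blast
qed

section \<open>Exponential a priori bounds on transport\<close>

definition bounded_transport where
  "bounded_transport u u' \<longleftrightarrow> (\<exists>C. \<forall>t\<ge>1. \<forall>s. flat.flat_on t UNIV s \<longrightarrow>
     Re (h (s u') (s u')) \<le> exp (C * t) * Re (h (s u) (s u)) \<and> Re (h (s u) (s u)) \<le> exp (C * t) * Re (h (s u') (s u')))"

lemma norm_comparison:
  assumes "\<tau>' \<in> trivs E" "x \<in> fst \<tau>'"
  obtains c where "c \<ge> 1" "\<And>e. e \<in> fibre E x \<Longrightarrow> Re (h e e) \<le> c * (norm (snd \<tau>' e))\<^sup>2"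
    "\<And>e. e \<in> fibre E x \<Longrightarrow> (norm (snd \<tau>' e))\<^sup>2 \<le> c * Re (h e e)"
proof -
  define H where "H = sesq (\<chi> i j. h (frame E \<tau>' x i) (frame E \<tau>' x j))"
  have hH: "hform H" unfolding H_def by (rule metric_matrix(1)[OF assms])
  have he: "Re (h e e) = qf H (snd \<tau>' e)" if "e \<in> fibre E x" for e
    unfolding H_def qf_def metric_matrix(2)[OF assms that that] ..
  have n: "(norm v)\<^sup>2 = qf (sesq (mat 1)) v" for v :: "(complex, 'r) vec"
    by (simp add: qf_identity norm_vec_def L2_set_def sum_nonneg)
  obtain c1 where c1: "c1 \<ge> 1" "\<And>v. qf H v \<le> c1 * qf (sesq (mat 1)) v" by (rule hform_comparable[OF hform_identity hH]) blast
  obtain c2 where c2: "c2 \<ge> 1" "\<And>v. qf (sesq (mat 1)) v \<le> c2 * qf H v" by (rule hform_comparable[OF hH hform_identity]) blast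
  show thesis
  proof (rule that[of "max c1 c2"])
    show "max c1 c2 \<ge> 1" using c1 by simp
    fix e assume e: "e \<in> fibre E x"
    have "c1 * (norm (snd \<tau>' e))\<^sup>2 \<le> max c1 c2 * (norm (snd \<tau>' e))\<^sup>2" by (rule mult_right_mono) auto
    then show "Re (h e e) \<le> max c1 c2 * (norm (snd \<tau>' e))\<^sup>2" using c1(2)[of "snd \<tau>' e"] by (simp add: he[OF e] n)
    have "c2 * qf H (snd \<tau>' e) \<le> max c1 c2 * qf H (snd \<tau>' e)" using qf_nonneg[OF hH] by (intro mult_right_mono) auto
    then show "(norm (snd \<tau>' e))\<^sup>2 \<le> max c1 c2 * Re (h e e)" using c2(2)[of "snd \<tau>' e"] by (simp add: he[OF e] n)
  qed
qed

text \<open>The relation is symmetric and transitive and holds between nearby points, hence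
  everywhere on the connected cover. Locally the coefficients are affine in t, so bounded by a
  multiple of t, and \<open>ball_growth\<close> gives an exponent linear in t.\<close>

lemma bounded_transport: "bounded_transport u u'"
proof (rule connected_equivalence_relation[OF flat.connected_cover UNIV_I UNIV_I, of bounded_transport])
  fix u u' u'' assume "bounded_transport u u'"
  then show "bounded_transport u' u" unfolding bounded_transport_def by blast
next
  fix u u' u'' assume "bounded_transport u u'" "bounded_transport u' u''"
  then obtain C C' where C: "\<And>t s. t \<ge> 1 \<Longrightarrow> flat.flat_on t UNIV s \<Longrightarrow>
     Re (h (s u') (s u')) \<le> exp (C * t) * Re (h (s u) (s u)) \<and> Re (h (s u) (s u)) \<le> exp (C * t) * Re (h (s u') (s u'))"
    and C': "\<And>t s. t \<ge> 1 \<Longrightarrow> flat.flat_on t UNIV s \<Longrightarrow>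
     Re (h (s u'') (s u'')) \<le> exp (C' * t) * Re (h (s u') (s u')) \<and> Re (h (s u') (s u')) \<le> exp (C' * t) * Re (h (s u'') (s u''))"
    unfolding bounded_transport_def by meson
  have "Re (h (s u'') (s u'')) \<le> exp ((C + C') * t) * Re (h (s u) (s u)) \<and> Re (h (s u) (s u)) \<le> exp ((C + C') * t) * Re (h (s u'') (s u''))"
    if "t \<ge> 1" "flat.flat_on t UNIV s" for t s
  proof -
    have e: "exp ((C + C') * t) = exp (C * t) * exp (C' * t)" by (simp add: distrib_right exp_add)
    have "exp (C' * t) * Re (h (s u') (s u')) \<le> exp (C' * t) * (exp (C * t) * Re (h (s u) (s u)))"
      "exp (C * t) * Re (h (s u') (s u')) \<le> exp (C * t) * (exp (C' * t) * Re (h (s u'') (s u'')))"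
      using C[OF that] C'[OF that] by (auto intro!: mult_left_mono)
    then show ?thesis using C[OF that] C'[OF that] unfolding e by (simp only: mult_ac) linarith
  qed
  then show "bounded_transport u u''" unfolding bounded_transport_def by blast
next
  fix u0
  obtain c where c: "c \<in> charts E" "p u0 \<in> fst c" by (rule chart_at)
  obtain \<tau>' where t: "\<tau>' \<in> trivs E" "p u0 \<in> fst \<tau>'" by (rule triv_at)
  obtain R0 m0 where R0: "R0 > 0"
    and m0: "\<And>w i j. w \<in> ball (snd c (p u0)) R0 \<Longrightarrow> cmod (A 0 c \<tau>' (inv_into (fst c) (snd c) w) $ i $ j) \<le> m0"
    using flat.coefficient_bound[OF c(1) t(1) c(2) t(2), where t = 0] by metis
  obtain R1 m1 where R1: "R1 > 0"
    and m1: "\<And>w i j. w \<in> ball (snd c (p u0)) R1 \<Longrightarrow> cmod (A 1 c \<tau>' (inv_into (fst c) (snd c) w) $ i $ j) \<le> m1"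
    using flat.coefficient_bound[OF c(1) t(1) c(2) t(2), where t = 1] by metis
  define R where "R = min R0 R1"
  have R: "R > 0" using R0 R1 by (simp add: R_def)
  have m0': "m0 \<ge> 0" using m0[of "snd c (p u0)"] R0 by (meson centre_in_ball norm_ge_zero order_trans)
  define \<Omega> where "\<Omega> = p -` fst c \<inter> (snd c \<circ> p) -` ball (snd c (p u0)) R"
  have o: "open \<Omega>" unfolding \<Omega>_def
    by (intro continuous_open_preimage continuous_on_compose p_cont open_vimage chart_open c open_ball
        continuous_on_subset[OF chart_cont[OF c(1)]]) auto
  have u0: "u0 \<in> \<Omega>" using c R by (simp add: \<Omega>_def)
  obtain N \<rho> where N: "\<rho> > 0" "open N" "u0 \<in> N" "N \<subseteq> \<Omega>" "inj_on p N" "p ` N \<subseteq> fst c \<inter> fst \<tau>'"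
    and im: "(snd c \<circ> p) ` N = ball (snd c (p u0)) \<rho>"
    using coordinate_ball[OF c(1) o u0 c(2) triv_open[OF t(1)] t(2)] by metis
  have sub: "ball (snd c (p u0)) \<rho> \<subseteq> ball (snd c (p u0)) R"
    unfolding im[symmetric] using N(4) by (auto simp: \<Omega>_def)
  have m: "cmod (A t c \<tau>' (inv_into (fst c) (snd c) w) $ i $ j) \<le> t * (m0 + m1)"
    if t: "t \<ge> 1" and w: "w \<in> ball (snd c (p u0)) \<rho>" for t w i j
  proof -
    let ?y = "inv_into (fst c) (snd c) w"
    have w: "w \<in> ball (snd c (p u0)) R0" "w \<in> ball (snd c (p u0)) R1" using w sub by (auto simp: R_def)
    \<comment> \<open>The affine dependence on t, recovered from the values at 0 and 1.\<close>
    have "A t c \<tau>' ?y $ i $ j = of_real t * A 1 c \<tau>' ?y $ i $ j + of_real (1 - t) * A 0 c \<tau>' ?y $ i $ j"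
      by (simp add: A_def scaleR_conv_of_real[where 'a = complex] algebra_simps)
    also have "cmod \<dots> \<le> t * cmod (A 1 c \<tau>' ?y $ i $ j) + (t - 1) * cmod (A 0 c \<tau>' ?y $ i $ j)"
      using norm_triangle_ineq[of "of_real t * A 1 c \<tau>' ?y $ i $ j" "of_real (1 - t) * A 0 c \<tau>' ?y $ i $ j"] t
      by (simp add: norm_mult del: of_real_diff)
    also have "\<dots> \<le> t * m1 + (t - 1) * m0" using t by (intro add_mono mult_left_mono m0 m1 w) auto
    finally show ?thesis using m0' by (simp add: algebra_simps)
  qed
  have "bounded_transport u0 u" if u: "u \<in> N" for u
  proof -
    have tu: "p u \<in> fst \<tau>'" using N u by auto
    obtain c0 where c0: "c0 \<ge> 1" "\<And>e. e \<in> fibre E (p u0) \<Longrightarrow> Re (h e e) \<le> c0 * (norm (snd \<tau>' e))\<^sup>2"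
      "\<And>e. e \<in> fibre E (p u0) \<Longrightarrow> (norm (snd \<tau>' e))\<^sup>2 \<le> c0 * Re (h e e)" by (rule norm_comparison[OF t]) blast
    obtain c1 where c1: "c1 \<ge> 1" "\<And>e. e \<in> fibre E (p u) \<Longrightarrow> Re (h e e) \<le> c1 * (norm (snd \<tau>' e))\<^sup>2"
      "\<And>e. e \<in> fibre E (p u) \<Longrightarrow> (norm (snd \<tau>' e))\<^sup>2 \<le> c1 * Re (h e e)" by (rule norm_comparison[OF t(1) tu]) blast
    define d where "d = norm (snd c (p u) - snd c (p u0)) * (CARD('r) * (CARD('r) * (m0 + m1)))"
    \<comment> \<open>The logarithm absorbs the constants comparing \<open>h\<close> with the
      coordinate norms at both points, which is possible since t is at least 1; \<open>2 * d\<close>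
      appears because norms are squared.\<close>
    define C where "C = ln (c0 * c1) + 2 * d"
    have cc: "c0 * c1 \<ge> 1" using mult_mono[OF c0(1) c1(1)] c0 by simp
    have K: "c0 * c1 * (exp (d * t))\<^sup>2 \<le> exp (C * t)" if "t \<ge> 1" for t
    proof -
      have "ln (c0 * c1) * 1 \<le> ln (c0 * c1) * t" using cc that by (intro mult_left_mono) auto
      then have "exp (ln (c0 * c1) + 2 * (d * t)) \<le> exp (C * t)" by (simp add: C_def algebra_simps)
      then show ?thesis using cc by (simp add: exp_add exp_double)
    qed
    have "Re (h (s u) (s u)) \<le> exp (C * t) * Re (h (s u0) (s u0)) \<and> Re (h (s u0) (s u0)) \<le> exp (C * t) * Re (h (s u) (s u))"
      if t1: "t \<ge> 1" and s: "flat.flat_on t UNIV s" for t s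
    proof -
      have sN: "flat.flat_on t N s" by (rule flat.flat_on_subset[OF s subset_UNIV])
      have f: "s u \<in> fibre E (p u)" for u by (rule flat.flat_onD[OF s UNIV_I])
      have e: "norm (snd c (p u) - snd c (p u0)) * (CARD('r) * (CARD('r) * (t * (m0 + m1)))) = d * t"
        "norm (snd c (p u0) - snd c (p u)) * (CARD('r) * (CARD('r) * (t * (m0 + m1)))) = d * t"
        by (simp_all add: d_def norm_minus_commute mult_ac)
      have bg: "norm (snd \<tau>' (s v')) \<le> exp (norm (snd c (p v') - snd c (p v)) * (CARD('r) * (CARD('r) * (t * (m0 + m1))))) * norm (snd \<tau>' (s v))"
        if "v \<in> N" "v' \<in> N" for v v'
        by (rule flat.ball_growth[OF c(1) t(1) N(2,5,6) im _ sN that]) (rule m[OF t1])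
      have 1: "norm (snd \<tau>' (s u)) \<le> exp (d * t) * norm (snd \<tau>' (s u0))" using bg[OF N(3) u] unfolding e .
      have 2: "norm (snd \<tau>' (s u0)) \<le> exp (d * t) * norm (snd \<tau>' (s u))" using bg[OF u N(3)] unfolding e .
      have 3: "y \<le> exp (C * t) * y'" if "y \<le> k * z\<^sup>2" "z \<le> exp (d * t) * z'" "z'\<^sup>2 \<le> k' * y'" "z \<ge> 0" "k \<ge> 1" "k' \<ge> 1" "k * k' = c0 * c1" "y' \<ge> 0"
        for y y' z z' k k' :: real
      proof -
        have "z\<^sup>2 \<le> (exp (d * t))\<^sup>2 * z'\<^sup>2" using power_mono[OF that(2,4), of 2] by (simp add: power_mult_distrib)
        also have "\<dots> \<le> (exp (d * t))\<^sup>2 * (k' * y')" using that by (intro mult_left_mono) auto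
        finally have "k * z\<^sup>2 \<le> k * ((exp (d * t))\<^sup>2 * (k' * y'))" using that by (intro mult_left_mono) auto
        also have "\<dots> = c0 * c1 * (exp (d * t))\<^sup>2 * y'" using that(7) by (simp add: mult_ac flip: that(7))
        also have "\<dots> \<le> exp (C * t) * y'" by (intro mult_right_mono K t1 that)
        finally show ?thesis using that(1) by simp
      qed
      show ?thesis
        using 3[OF c1(2)[OF f] 1 c0(3)[OF f] norm_ge_zero c1(1) c0(1) mult.commute h_nonneg[OF f]]
          3[OF c0(2)[OF f] 2 c1(3)[OF f] norm_ge_zero c0(1) c1(1) refl h_nonneg[OF f]] by blast
    qed
    then show ?thesis unfolding bounded_transport_def by blast
  qed
  then show "\<exists>T. openin (top_of_set UNIV) T \<and> u0 \<in> T \<and> (\<forall>u\<in>T. bounded_transport u0 u)"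
    using N by (intro exI[of _ N]) simp
qed

text \<open>Keeps the pulled back metric at any point within a multiple of t of the base metric,
  although the path may not pass through the base point.\<close>

lemma hp_bounded:
  obtains C where "\<And>t. t \<ge> 1 \<Longrightarrow> met_dist E (p x0) (hp t Q) (restrict_form (fibre E (p x0)) h) \<le> C * t"
proof -
  obtain C where C: "\<And>t s. t \<ge> 1 \<Longrightarrow> flat.flat_on t UNIV s \<Longrightarrow>
     Re (h (s Q) (s Q)) \<le> exp (C * t) * Re (h (s x0) (s x0)) \<and> Re (h (s x0) (s x0)) \<le> exp (C * t) * Re (h (s Q) (s Q))"
    using bounded_transport[of x0 Q] unfolding bounded_transport_def by meson
  have "met_dist E (p x0) (hp t Q) (restrict_form (fibre E (p x0)) h) \<le> CARD('r) * (C * t / 2)" if "t \<ge> 1" for t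
  proof (rule met_dist_le)
    show "hform (F (hp t Q))" "hform (F (restrict_form (fibre E (p x0)) h))" by (simp_all add: hp_hform h_hform F_restrict)
    fix v
    have "qf (F h) v = Re (h (S t v x0) (S t v x0))" by (simp add: qf_def F_def S(2))
    then show "qf (F (restrict_form (fibre E (p x0)) h)) v \<le> exp (2 * (C * t / 2)) * qf (F (hp t Q)) v"
      "qf (F (hp t Q)) v \<le> exp (2 * (C * t / 2)) * qf (F (restrict_form (fibre E (p x0)) h)) v"
      using C[OF that S(1)[of t v]] by (simp_all add: F_restrict qf_hp)
  qed
  then show thesis by (intro that[of "CARD('r) * (C / 2)"]) (simp add: mult_ac)
qed

end

text \<open>Determinant comparison of the form in the coordinates of \<open>b\<close> with the
  identity form; it bounds the volume of the adapted basis from both sides.\<close>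

lemma hform_congruence_det:
  fixes K :: "complex ^ 'n::finite \<Rightarrow> complex ^ 'n \<Rightarrow> complex" and b :: "'n \<Rightarrow> complex ^ 'n"
  assumes hK: "hform K" and b: "det (cmat b) \<noteq> 0" and c: "c > 0"
    and le: "\<And>x. qf K (cmat b *v x) \<le> c * (\<Sum>i\<in>UNIV. (cmod (x $ i))\<^sup>2)"
      "\<And>x. (\<Sum>i\<in>UNIV. (cmod (x $ i))\<^sup>2) \<le> c * qf K (cmat b *v x)"
  defines "D \<equiv> Re (det (hmat K)) * (cmod (det (cmat b)))\<^sup>2"
  shows "D \<le> c ^ CARD('n)" "1 \<le> c ^ CARD('n) * D"
proof -
  define K' where "K' u w = K (cmat b *v u) (cmat b *v w)" for u w
  have "cmat b *v u \<noteq> 0" if "u \<noteq> 0" for u using det_nz_ker[OF b] that by blast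
  then have hK': "hform K'" unfolding K'_def[abs_def] by (rule hform_compose[OF hK])
  have "cmat b *v axis i 1 = b i" for i
    by (simp add: vec_eq_iff cmat_def matrix_vector_mult_def axis_def if_distrib[of "\<lambda>c. _ * c"] cong: if_cong)
  then have "hmat K' = (\<chi> i j. K (b i) (b j))" by (simp add: hmat_def K'_def)
  then have D: "Re (det (hmat K')) = D"
    using gram_det[OF hK, of b] by (simp add: D_def)
  have I: "det (hmat (sesq (mat 1 :: complex ^ 'n ^ 'n))) = 1"
  proof -
    have "hmat (sesq (mat 1 :: complex ^ 'n ^ 'n)) = mat 1"
      by (simp add: hmat_def sesq_def vec_eq_iff mat_def axis_def if_distrib[of "\<lambda>c. c * _"] if_distrib[of cnj] if_distrib[of "\<lambda>c. _ * c"] cong: if_cong)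
    then show ?thesis by simp
  qed
  have q: "qf K' x = qf K (cmat b *v x)" for x by (simp add: K'_def qf_def)
  show "D \<le> c ^ CARD('n)"
    using gram_det_comparison(1)[OF hform_identity hK' _ c] le(1) by (simp add: q qf_identity I D)
  show "1 \<le> c ^ CARD('n) * D"
    using gram_det_comparison(1)[OF hK' hform_identity _ c] le(2) by (simp add: q qf_identity I D)
qed

section \<open>The flat close to the path and the limiting apartment\<close>

context wkb_cone
begin

definition \<alpha>v :: "real \<Rightarrow> (real, 'r) vec" where
  "\<alpha>v s = (\<chi> i. integral {0..s} (\<lambda>s. Re (a i s)))"

lemma Re_a_continuous: "continuous_on {0..1} (\<lambda>s. Re (a i s))"
  by (intro continuous_intros a_continuous)

lemma sum_a:
  assumes s: "s \<in> {0..1}" shows "(\<Sum>i\<in>UNIV. a i s) = 0"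
proof -
  let ?x = "p (\<gamma> s)"
  note c = some_chart[of ?x] and t = flat.some_triv[of ?x]
  have "trace (N (some_chart ?x) (flat.some_triv ?x) s) = (\<Sum>i\<in>UNIV. a i s)"
    by (rule trace_eigenvalues[OF inj_a[OF s] N_charpoly[OF c(1) t(1) s c(2) t(2)]])
  moreover have "trace (N (some_chart ?x) (flat.some_triv ?x) s) = vel (some_chart ?x) s * trace (\<Phi> (some_chart ?x) (flat.some_triv ?x) ?x)"
    by (simp add: N_def trace_def sum_distrib_left)
  moreover have "trace (\<Phi> (some_chart ?x) (flat.some_triv ?x) ?x) = 0" using tr0 c t by (simp add: trace_zero_def)
  ultimately show ?thesis by simp
qed

lemma \<alpha>v_model: assumes s: "s \<in> {0..1}" shows "\<alpha>v s \<in> model_apartment"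
proof -
  have "(\<lambda>s. Re (a i s)) integrable_on {0..s}" for i
    by (rule integrable_continuous_real[OF continuous_on_subset[OF Re_a_continuous]]) (use s in auto)
  then have "(\<Sum>i\<in>UNIV. integral {0..s} (\<lambda>s. Re (a i s))) = integral {0..s} (\<lambda>s. \<Sum>i\<in>UNIV. Re (a i s))"
    by (intro integral_sum[symmetric]) auto
  also have "\<dots> = integral {0..s} (\<lambda>s. 0)"
  proof (rule integral_cong)
    fix s' assume "s' \<in> {0..s}"
    then show "(\<Sum>i\<in>UNIV. Re (a i s')) = 0" using sum_a[of s'] s by (simp flip: Re_sum)
  qed
  finally show ?thesis by (simp add: model_apartment_def \<alpha>v_def)
qed

text \<open>Writes \<open>f\<close> on transported vectors as a positive form composed with linear
  maps: this gives the seminorm properties at every \<open>s\<close>, and the kernel condition of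
  \<open>adapted_basis\<close> on the path.\<close>

lemma f_form:
  obtains K :: "(complex, 'r) vec \<Rightarrow> (complex, 'r) vec \<Rightarrow> complex" and P G :: "((complex, 'r) vec, 'r) vec"
  where "hform K" "det G \<noteq> 0" "\<And>v. f s j (S t v (\<gamma> s)) = qf K (P *v (G *v v))"
    "s \<in> {0..1} \<Longrightarrow> \<exists>L :: (complex, 'r) vec. \<forall>v. (\<Sum>k\<in>UNIV. L $ k * v $ k) = 0 \<longrightarrow> P *v v = 0"
proof -
  let ?x = "p (\<gamma> s)"
  note c = some_chart[of ?x] and t = flat.some_triv[of ?x]
  define P where "P = Pr (some_chart ?x) (flat.some_triv ?x) s j"
  define K where "K = sesq (\<chi> i j. h (frame E (flat.some_triv ?x) ?x i) (frame E (flat.some_triv ?x) ?x j))"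
  obtain G where G: "det G \<noteq> 0" "\<And>v. snd (flat.some_triv ?x) (S t v (\<gamma> s)) = G *v v" by (rule S_matrix[where t = t, OF t]) blast
  have cf: "comp s j (S t v (\<gamma> s)) = vec_of (flat.some_triv ?x) ?x (P *v (G *v v))" for v
    by (simp add: comp_def P_def Let_def G)
  have ff: "f s j (S t v (\<gamma> s)) = qf K (P *v (G *v v))" for v
    unfolding f_def cf K_def qf_def metric_matrix(2)[OF t vec_of_fibre[OF t] vec_of_fibre[OF t]] triv_vec_of[OF t] ..
  have hK: "hform K" unfolding K_def by (rule metric_matrix(1)[OF t])
  have ker: "\<exists>L :: (complex, 'r) vec. \<forall>v. (\<Sum>k\<in>UNIV. L $ k * v $ k) = 0 \<longrightarrow> P *v v = 0" if s: "s \<in> {0..1}"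
    unfolding P_def Pr_def by (rule spectral_resolution(3)[OF inj_a[OF s] N_charpoly[OF c(1) t(1) s c(2) t(2)]])
  show thesis by (rule that[OF hK G(1) ff ker])
qed

text \<open>Combines \<open>adapted_basis_comparison\<close> with \<open>estimate\<close>; the
  latter passes from the components to the metric and contributes the extra factor
  \<open>M\<close>.\<close>

lemma adapted_flat:
  assumes M: "M \<ge> 1" "\<And>s. s \<in> {0..1} \<Longrightarrow> estimate M s"
    and g: "growth_system (\<lambda>i s. Re (a i s)) (\<lambda>i s. \<alpha>v s $ i) t M \<delta> \<epsilon>"
    and small: "2 * sqrt \<epsilon> * CARD('r) \<le> 1 / 2"
  obtains b :: "'r \<Rightarrow> (complex, 'r) vec" where
    "\<And>s x. s \<in> {0..1} \<Longrightarrow> qf (F (hp t (\<gamma> s))) (cmat b *v x) \<le>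
      M * (4 * (real CARD('r))\<^sup>2 * exp (2 * M)) * (\<Sum>i\<in>UNIV. (cmod (x $ i))\<^sup>2 * exp (2 * t * \<alpha>v s $ i))"
    "\<And>s x. s \<in> {0..1} \<Longrightarrow> (\<Sum>i\<in>UNIV. (cmod (x $ i))\<^sup>2 * exp (2 * t * \<alpha>v s $ i)) \<le>
      M * (4 * (real CARD('r))\<^sup>2 * exp (2 * M)) * qf (F (hp t (\<gamma> s))) (cmat b *v x)"
proof -
  interpret g: growth_system "\<lambda>i s. Re (a i s)" "\<lambda>i s. \<alpha>v s $ i" t M \<delta> \<epsilon> by (rule g)
  define n where "n s j v = sqrt (f s j (S t v (\<gamma> s)))" for s j v
  have f0: "f s j (S t v (\<gamma> s)) \<ge> 0" for s j v
  proof -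
    obtain K :: "(complex, 'r) vec \<Rightarrow> (complex, 'r) vec \<Rightarrow> complex" and P G :: "((complex, 'r) vec, 'r) vec" where "hform K" "\<And>v. f s j (S t v (\<gamma> s)) = qf K (P *v (G *v v))" by (rule f_form[of s j t]) blast
    then show ?thesis by (simp add: qf_nonneg)
  qed
  have n2: "(n s j v)\<^sup>2 = f s j (S t v (\<gamma> s))" for s j v by (simp add: n_def f0)
  have nn: "n s j v \<ge> 0" for s j v by (simp add: n_def f0)
  have hom: "n s j (c *s v) = cmod c * n s j v" and tri: "n s j (v + w) \<le> n s j v + n s j w" for s j c v w
  proof -
    obtain K :: "(complex, 'r) vec \<Rightarrow> (complex, 'r) vec \<Rightarrow> complex" and P G :: "((complex, 'r) vec, 'r) vec" where K: "hform K" "\<And>v. f s j (S t v (\<gamma> s)) = qf K (P *v (G *v v))" by (rule f_form[of s j t]) blast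
    show "n s j (c *s v) = cmod c * n s j v"
      by (simp add: n_def K vector_scalar_commute qf_scale real_sqrt_mult)
    show "n s j (v + w) \<le> n s j v + n s j w"
      by (simp add: n_def K matrix_vector_right_distrib sqrt_qf_triangle)
  qed
  have est: "(\<Sum>j\<in>UNIV. f s j (S t v (\<gamma> s))) \<le> M * qf (F (hp t (\<gamma> s))) v"
    "qf (F (hp t (\<gamma> s))) v \<le> M * (\<Sum>j\<in>UNIV. f s j (S t v (\<gamma> s)))" if "s \<in> {0..1}" for s v
    using M(2)[OF that, unfolded estimate_def, THEN conjunct1, THEN bspec, OF S_fibre[of t v]] by (simp_all add: qf_hp)
  have der: "\<exists>D. ((\<lambda>s. f s j (S t v (\<gamma> s))) has_real_derivative D) (at s within {0..1}) \<and>
        \<bar>D - 2 * t * Re (a j s) * f s j (S t v (\<gamma> s))\<bar> \<le> M * (\<Sum>j\<in>UNIV. f s j (S t v (\<gamma> s)))"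
    if "s \<in> {0..1}" for s j v
    using M(2)[OF that, unfolded estimate_def, THEN conjunct2, rule_format, OF S(1)[of t v], of j] .
  obtain b where "\<And>i. n 0 i (b i) = 1" and off: "\<And>i j s. s \<in> {0..1} \<Longrightarrow> j \<noteq> i \<Longrightarrow> n s j (b i) \<le> 2 * sqrt \<epsilon> * n s i (b i)"
    and ub: "\<And>i s. s \<in> {0..1} \<Longrightarrow> n s i (b i) \<le> exp (t * \<alpha>v s $ i + M)"
    and lb: "\<And>i s. s \<in> {0..1} \<Longrightarrow> exp (t * \<alpha>v s $ i - M) \<le> n s i (b i)"
  proof (rule g.adapted_basis[of n, OF nn hom])
    fix s j v assume "s \<in> {0..1::real}"
    from der[OF this, of j v]
    show "\<exists>D. ((\<lambda>s. (n s j v)\<^sup>2) has_real_derivative D) (at s within {0..1}) \<and>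
      \<bar>D - 2 * t * Re (a j s) * (n s j v)\<^sup>2\<bar> \<le> M * (\<Sum>k\<in>UNIV. (n s k v)\<^sup>2)" unfolding n2 .
  next
    fix s and v :: "(complex, 'r) vec" assume s: "s \<in> {0..1::real}" and v: "v \<noteq> 0"
    have "0 < M * (\<Sum>j\<in>UNIV. f s j (S t v (\<gamma> s)))"
      using hform_pos[OF hp_hform v, of t "\<gamma> s"] est(2)[OF s, of v] by linarith
    then show "(\<Sum>k\<in>UNIV. (n s k v)\<^sup>2) > 0" unfolding n2 using M(1) by (simp add: zero_less_mult_iff)
  next
    fix s :: real and j assume "s \<in> {0, 1}"
    then have s: "s \<in> {0..1}" by auto
    obtain K :: "(complex, 'r) vec \<Rightarrow> (complex, 'r) vec \<Rightarrow> complex" and P G :: "((complex, 'r) vec, 'r) vec" where K: "hform K"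
      and fK: "\<And>v. f s j (S t v (\<gamma> s)) = qf K (P *v (G *v v))"
      and ker: "s \<in> {0..1} \<Longrightarrow> \<exists>L :: (complex, 'r) vec. \<forall>v. (\<Sum>k\<in>UNIV. L $ k * v $ k) = 0 \<longrightarrow> P *v v = 0" by (rule f_form[of s j t]) blast
    from ker[OF s] obtain L :: "(complex, 'r) vec" where L: "\<And>v. (\<Sum>k\<in>UNIV. L $ k * v $ k) = 0 \<Longrightarrow> P *v v = 0" by blast
    \<comment> \<open>The functional \<open>L\<close> lives in the fibre over the path point and is
      pulled back to the base fibre along the transport matrix \<open>G\<close>.\<close>
    have "n s j v = 0" if v: "(\<Sum>k\<in>UNIV. (\<Sum>m\<in>UNIV. L $ m * G $ m $ k) * v $ k) = 0" for v
    proof -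
      have "(\<Sum>k\<in>UNIV. (\<Sum>m\<in>UNIV. L $ m * G $ m $ k) * v $ k) = (\<Sum>m\<in>UNIV. L $ m * (G *v v) $ m)"
        unfolding matrix_vector_mult_def sum_distrib_right vec_lambda_beta sum_distrib_left mult.assoc by (rule sum.swap)
      then have "P *v (G *v v) = 0" using L v by simp
      then show ?thesis using K by (simp add: n_def fK qf_def)
    qed
    then show "\<exists>l :: (complex, 'r) vec. \<forall>v. (\<Sum>k\<in>UNIV. l $ k * v $ k) = 0 \<longrightarrow> n s j v = 0"
      by (intro exI[of _ "\<chi> k. \<Sum>m\<in>UNIV. L $ m * G $ m $ k"]) simp
  qed blast
  let ?C = "4 * (real CARD('r))\<^sup>2 * exp (2 * M)"
  show thesis
  proof (rule that[of b])
    fix s x assume s: "s \<in> {0..1::real}"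
    note cmp = g.adapted_basis_comparison[where n = "n s" and b = b and s = s and x = x, OF nn hom tri off[OF s] ub[OF s] lb[OF s] small, unfolded n2]
    have "qf (F (hp t (\<gamma> s))) (cmat b *v x) \<le> M * (\<Sum>j\<in>UNIV. f s j (S t (cmat b *v x) (\<gamma> s)))" by (rule est(2)[OF s])
    also have "\<dots> \<le> M * (?C * (\<Sum>i\<in>UNIV. (cmod (x $ i))\<^sup>2 * exp (2 * t * \<alpha>v s $ i)))"
      using M(1) by (intro mult_left_mono cmp(1)) auto
    finally show "qf (F (hp t (\<gamma> s))) (cmat b *v x) \<le> M * ?C * (\<Sum>i\<in>UNIV. (cmod (x $ i))\<^sup>2 * exp (2 * t * \<alpha>v s $ i))"
      by (simp only: mult.assoc)
    have "(\<Sum>i\<in>UNIV. (cmod (x $ i))\<^sup>2 * exp (2 * t * \<alpha>v s $ i)) \<le> ?C * (\<Sum>j\<in>UNIV. f s j (S t (cmat b *v x) (\<gamma> s)))" by (rule cmp(2))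
    also have "\<dots> \<le> ?C * (M * qf (F (hp t (\<gamma> s))) (cmat b *v x))" by (intro mult_left_mono est(1)[OF s]) simp
    finally show "(\<Sum>i\<in>UNIV. (cmod (x $ i))\<^sup>2 * exp (2 * t * \<alpha>v s $ i)) \<le> M * ?C * qf (F (hp t (\<gamma> s))) (cmat b *v x)"
      by (simp only: mult_ac)
  qed
qed

lemma \<alpha>v_0: "\<alpha>v 0 = 0"
  by (simp add: \<alpha>v_def vec_eq_iff)

text \<open>The adapted basis has no prescribed volume, while charts of flats ask for volume one.
  Since the pulled back metric at \<open>\<gamma> 0\<close> has standard determinant, the bounds at
  \<open>s = 0\<close>, where \<open>\<alpha>v\<close> vanishes, confine the volume. Rescaling costs
  at most another factor \<open>C\<close>, whence \<open>C * C = exp (2 * ln C)\<close>.\<close>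

lemma unimodular_adapted:
  fixes b :: "'r \<Rightarrow> (complex, 'r) vec"
  assumes C: "C \<ge> 1"
    and ub: "\<And>s x. s \<in> {0..1} \<Longrightarrow> qf (F (hp t (\<gamma> s))) (cmat b *v x) \<le> C * (\<Sum>i\<in>UNIV. (cmod (x $ i))\<^sup>2 * exp (2 * t * \<alpha>v s $ i))"
    and lb: "\<And>s x. s \<in> {0..1} \<Longrightarrow> (\<Sum>i\<in>UNIV. (cmod (x $ i))\<^sup>2 * exp (2 * t * \<alpha>v s $ i)) \<le> C * qf (F (hp t (\<gamma> s))) (cmat b *v x)"
  obtains e where "unimodular_basis E (p x0) e"
    "\<And>s. s \<in> {0..1} \<Longrightarrow> met_dist E (p x0) (hp t (\<gamma> s)) (flat_chart E (p x0) e (t *\<^sub>R \<alpha>v s)) \<le> CARD('r) * ln C"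
proof -
  let ?r = "CARD('r)"
  have r: "?r > 0" by simp
  have ub0: "qf (F (hp t (\<gamma> 0))) (cmat b *v x) \<le> C * (\<Sum>i\<in>UNIV. (cmod (x $ i))\<^sup>2)"
    and lb0: "(\<Sum>i\<in>UNIV. (cmod (x $ i))\<^sup>2) \<le> C * qf (F (hp t (\<gamma> 0))) (cmat b *v x)" for x
    using ub[of 0 x] lb[of 0 x] by (simp_all add: \<alpha>v_0)
  have det: "det (cmat b) \<noteq> 0"
  proof (rule det_nzI)
    fix x assume "cmat b *v x = 0"
    then have "(\<Sum>i\<in>UNIV. (cmod (x $ i))\<^sup>2) \<le> 0" using lb0[of x] hp_hform[of t "\<gamma> 0"] by (simp add: qf_def)
    then have "(\<Sum>i\<in>UNIV. (cmod (x $ i))\<^sup>2) = 0" by (intro antisym sum_nonneg) auto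
    then show "x = 0" by (subst (asm) sum_nonneg_eq_0_iff) (auto simp: vec_eq_iff)
  qed
  define D where "D = cmod volume_factor * cmod (det (cmat b))"
  have D: "D > 0" using det volume(1) by (simp add: D_def)
  have "Re (det (hmat (F (hp t (\<gamma> 0))))) = (cmod volume_factor)\<^sup>2" using hp_Met[of t "\<gamma> 0"] unfolding Met_iff by simp
  then have D2: "D\<^sup>2 \<le> C ^ ?r" "1 \<le> C ^ ?r * D\<^sup>2"
    using hform_congruence_det[OF hp_hform det _ ub0 lb0] C by (simp_all add: D_def power_mult_distrib)
  \<comment> \<open>Scaling by this root brings the volume \<open>D\<close> to 1; \<open>D2\<close>
    puts the square of \<open>\<mu>\<close> between \<open>1 / C\<close> and
    \<open>C\<close>.\<close>
  define \<mu> where "\<mu> = root ?r (1 / D)"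
  have \<mu>: "\<mu> > 0" "\<mu> ^ ?r = 1 / D" using D r by (simp_all add: \<mu>_def)
  have \<mu>D: "(\<mu>\<^sup>2) ^ ?r * D\<^sup>2 = 1" using D by (simp add: power_mult[symmetric] mult.commute[of 2] power_mult \<mu>(2) power_divide)
  have \<mu>C: "\<mu>\<^sup>2 \<le> C"
  proof (rule power_le_imp_le_base)
    have "(\<mu>\<^sup>2) ^ ?r * 1 \<le> (\<mu>\<^sup>2) ^ ?r * (C ^ ?r * D\<^sup>2)" by (intro mult_left_mono D2) simp
    also have "\<dots> = C ^ ?r" using \<mu>D by (simp add: mult_ac flip: \<mu>D)
    finally show "(\<mu>\<^sup>2) ^ Suc (?r - 1) \<le> C ^ Suc (?r - 1)" by simp
  qed (use C in simp)
  have \<mu>C': "1 \<le> C * \<mu>\<^sup>2"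
  proof (rule power_le_imp_le_base)
    have "1 \<le> (\<mu>\<^sup>2) ^ ?r * C ^ ?r"
      using mult_left_mono[OF D2(1), of "(\<mu>\<^sup>2) ^ ?r"] by (simp only: \<mu>D) simp
    then show "1 ^ Suc (?r - 1) \<le> (C * \<mu>\<^sup>2) ^ Suc (?r - 1)" by (simp add: power_mult_distrib mult.commute)
  qed (use C in simp)
  define e where "e i = vec (of_real \<mu> *s b i)" for i
  have te: "snd \<tau>0 (e i) = of_real \<mu> *s b i" for i by (simp add: e_def triv_vec_of[OF \<tau>])
  have ef: "range e \<subseteq> fibre E (p x0)" by (auto simp: e_def vec_of_fibre[OF \<tau>])
  have ce: "cmat (\<lambda>i. snd \<tau>0 (e i)) = (\<chi> i j. of_real \<mu> * cmat b $ i $ j)" by (simp add: te cmat_def vec_eq_iff)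
  have de: "det (cmat (\<lambda>i. snd \<tau>0 (e i))) = of_real \<mu> ^ ?r * det (cmat b)" unfolding ce by (rule det_scale)
  have "cmod (vol E e) = \<mu> ^ ?r * D"
    unfolding volume(2)[OF ef] de using \<mu>(1) by (simp add: D_def norm_mult norm_power)
  then have u: "unimodular_basis E (p x0) e"
    unfolding unimodular_basis_def fibre_basis_iff de using ef det \<mu> D by simp
  have "met_dist E (p x0) (hp t (\<gamma> s)) (flat_chart E (p x0) e (t *\<^sub>R \<alpha>v s)) \<le> CARD('r) * ln C" if s: "s \<in> {0..1}" for s
  proof (rule met_dist_le[OF hp_hform flat_chart_hform[OF u model_scale[OF \<alpha>v_model[OF s]]]])
    fix w :: "(complex, 'r) vec"
    obtain y where y: "cmat (\<lambda>i. snd \<tau>0 (e i)) *v y = w"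
      by (rule det_nz_solve[OF unimodular_nz(1)[OF u model_zero]])
    \<comment> \<open>\<open>y\<close> holds the coordinates in the rescaled basis, \<open>x\<close>
      those in \<open>b\<close>.\<close>
    define x where "x = of_real \<mu> *s y"
    have w: "cmat b *v x = w"
      unfolding y[symmetric] ce by (simp add: x_def vec_eq_iff matrix_vector_mult_def mult_ac)
    define W where "W = (\<Sum>i\<in>UNIV. (cmod (x $ i))\<^sup>2 * exp (2 * t * \<alpha>v s $ i))"
    define Z where "Z = qf (F (flat_chart E (p x0) e (t *\<^sub>R \<alpha>v s))) w"
    define q where "q = qf (F (hp t (\<gamma> s))) w"
    have Z: "Z = (\<Sum>i\<in>UNIV. (cmod (y $ i))\<^sup>2 * exp (2 * (t *\<^sub>R \<alpha>v s) $ i))"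
      unfolding Z_def y[symmetric] by (rule flat_chart_qf[OF u model_scale[OF \<alpha>v_model[OF s]]])
    have WZ: "W = \<mu>\<^sup>2 * Z"
      using \<mu>(1) by (simp add: W_def Z x_def norm_mult power_mult_distrib sum_distrib_left mult_ac)
    have Z0: "Z \<ge> 0" unfolding Z by (intro sum_nonneg) simp
    have qW: "q \<le> C * W" "W \<le> C * q" using ub[OF s, of x] lb[OF s, of x] by (simp_all add: q_def W_def w)
    have e: "exp (2 * ln C) = C * C" using C by (simp add: exp_double power2_eq_square)
    have "C * W \<le> C * (C * Z)" unfolding WZ using C Z0 \<mu>C by (intro mult_left_mono mult_right_mono) auto
    then show "qf (F (hp t (\<gamma> s))) w \<le> exp (2 * ln C) * qf (F (flat_chart E (p x0) e (t *\<^sub>R \<alpha>v s))) w"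
      unfolding e q_def[symmetric] Z_def[symmetric] using qW(1) by (simp add: mult_ac)
    have "1 * Z \<le> C * \<mu>\<^sup>2 * Z" by (intro mult_right_mono \<mu>C' Z0)
    also have "\<dots> = C * W" by (simp add: WZ mult_ac)
    also have "\<dots> \<le> C * (C * q)" using C qW(2) by (intro mult_left_mono) auto
    finally show "qf (F (flat_chart E (p x0) e (t *\<^sub>R \<alpha>v s))) w \<le> exp (2 * ln C) * qf (F (hp t (\<gamma> s))) w"
      unfolding e q_def[symmetric] Z_def[symmetric] by (simp add: mult_ac)
  qed
  then show thesis using that u by blast
qed

lemma asymptotic_flat:
  obtains T C e where "T \<ge> 1" "\<And>t. unimodular_basis E (p x0) (e t)"
    "\<And>t s. t \<ge> T \<Longrightarrow> s \<in> {0..1} \<Longrightarrow> met_dist E (p x0) (hp t (\<gamma> s)) (flat_chart E (p x0) (e t) (t *\<^sub>R \<alpha>v s)) \<le> C"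
proof -
  let ?r = "real CARD('r)"
  have r: "?r \<ge> 1" using zero_less_card_finite[where 'a = 'r] by linarith
  obtain M where M: "M \<ge> 1" "\<And>s. s \<in> {0..1} \<Longrightarrow> estimate M s" by (rule uniform_estimate) blast
  obtain \<delta> where \<delta>: "\<delta> > 0" "\<And>s i j. s \<in> {0..1} \<Longrightarrow> i < j \<Longrightarrow> Re (a j s) + \<delta> \<le> Re (a i s)" by (rule gap) blast
  \<comment> \<open>Chosen so that \<open>2 * sqrt \<epsilon> * CARD('r)\<close> is exactly
    \<open>1 / 2\<close>; it also respects the bound \<open>1 / 4\<close> of the growth
    system.\<close>
  define \<epsilon> where "\<epsilon> = (1 / (4 * ?r))\<^sup>2"
  have s\<epsilon>: "sqrt \<epsilon> = 1 / (4 * ?r)" unfolding \<epsilon>_def by (rule real_sqrt_unique) auto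
  have "2 * 1 \<le> 4 * ?r" using r by linarith
  then have "1 / (4 * ?r) \<le> 1 / 2" by (intro frac_le) auto
  then have "(1 / (4 * ?r))\<^sup>2 \<le> (1 / 2)\<^sup>2" by (intro power_mono) auto
  then have \<epsilon>: "0 < \<epsilon>" "\<epsilon> \<le> 1 / 4" using r by (simp_all add: \<epsilon>_def power_divide)
  have small: "2 * sqrt \<epsilon> * CARD('r) \<le> 1 / 2" using r by (simp add: s\<epsilon>)
  \<comment> \<open>The threshold solves the condition \<open>large\<close> of the growth system for
    t, with \<open>M\<close> as error constant.\<close>
  define T where "T = max 1 (M * ?r * (1 + \<epsilon>)\<^sup>2 / (2 * \<delta> * \<epsilon>))"
  define C where "C = M * (4 * ?r\<^sup>2 * exp (2 * M))"
  have C: "C \<ge> 1"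
  proof -
    have "1 * (1 * 1) \<le> M * (4 * ?r\<^sup>2 * exp (2 * M))"
    proof (intro mult_mono)
      show "1 \<le> 4 * ?r\<^sup>2" using one_le_power[OF r, of 2] by linarith
    qed (use M(1) in auto)
    then show ?thesis by (simp add: C_def)
  qed
  have "\<exists>e. unimodular_basis E (p x0) e \<and> (\<forall>s\<in>{0..1}. met_dist E (p x0) (hp t (\<gamma> s)) (flat_chart E (p x0) e (t *\<^sub>R \<alpha>v s)) \<le> CARD('r) * ln C)"
    if t: "t \<ge> T" for t
  proof -
    have g: "growth_system (\<lambda>i s. Re (a i s)) (\<lambda>i s. \<alpha>v s $ i) t M \<delta> \<epsilon>"
    proof
      fix s i assume "s \<in> {0..1::real}"
      from integral_has_real_derivative[OF Re_a_continuous this]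
      show "((\<lambda>s. \<alpha>v s $ i) has_real_derivative Re (a i s)) (at s within {0..1})" by (simp add: \<alpha>v_def)
    next
      have "M * ?r * (1 + \<epsilon>)\<^sup>2 / (2 * \<delta> * \<epsilon>) \<le> t" using t by (simp add: T_def)
      then show "M * ?r * (1 + \<epsilon>)\<^sup>2 \<le> 2 * t * \<delta> * \<epsilon>" using \<delta>(1) \<epsilon>(1) by (simp add: pos_divide_le_eq mult_ac)
    qed (use \<delta> \<epsilon> M t in \<open>auto simp: \<alpha>v_0 T_def\<close>)
    obtain b :: "'r \<Rightarrow> (complex, 'r) vec" where
      "\<And>s x. s \<in> {0..1} \<Longrightarrow> qf (F (hp t (\<gamma> s))) (cmat b *v x) \<le> C * (\<Sum>i\<in>UNIV. (cmod (x $ i))\<^sup>2 * exp (2 * t * \<alpha>v s $ i))"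
      "\<And>s x. s \<in> {0..1} \<Longrightarrow> (\<Sum>i\<in>UNIV. (cmod (x $ i))\<^sup>2 * exp (2 * t * \<alpha>v s $ i)) \<le> C * qf (F (hp t (\<gamma> s))) (cmat b *v x)"
      unfolding C_def by (rule adapted_flat[OF M(1) _ g small]) (rule M(2), assumption, blast)
    from unimodular_adapted[OF C this] show ?thesis by (metis (no_types, lifting))
  qed
  then obtain e where e: "\<And>t. t \<ge> T \<Longrightarrow> unimodular_basis E (p x0) (e t)"
    "\<And>t s. t \<ge> T \<Longrightarrow> s \<in> {0..1} \<Longrightarrow> met_dist E (p x0) (hp t (\<gamma> s)) (flat_chart E (p x0) (e t) (t *\<^sub>R \<alpha>v s)) \<le> CARD('r) * ln C"
    by metis
  \<comment> \<open>For t below the threshold the basis at \<open>T\<close> is reused, because a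
    chart of an apartment asks for a unimodular basis at every t.\<close>
  show thesis
    by (rule that[of T "\<lambda>t. e (max t T)" "CARD('r) * ln C"]) (use e in \<open>auto simp: T_def[symmetric] max_absorb1\<close>, simp add: T_def)
qed

text \<open>The distance from the pulled back metrics to the flat is bounded by a constant, which
  vanishes after division by t; so both define the same classes in the cone.\<close>

lemma cone_limit:
  assumes \<omega>: "cone_ultrafilter \<omega>"
  obtains f where "apartment_chart E (p x0) h \<omega> f" "\<And>s. s \<in> {0..1} \<Longrightarrow> h_lim E \<Phi> B p x0 h \<omega> (\<gamma> s) = f (\<alpha>v s)"
proof -
  let ?x = "p x0" and ?r = "real CARD('r)"
  let ?h = "restrict_form (fibre E ?x) h"
  have large: "eventually (\<lambda>t. t > T) \<omega>" for T using \<omega> by (simp add: cone_ultrafilter_def)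
  obtain T C and e :: "real \<Rightarrow> 'r \<Rightarrow> 'e" where T: "T \<ge> 1" and e: "\<And>t. unimodular_basis E ?x (e t)"
    and d: "\<And>t s. t \<ge> T \<Longrightarrow> s \<in> {0..1} \<Longrightarrow> met_dist E ?x (hp t (\<gamma> s)) (flat_chart E ?x (e t) (t *\<^sub>R \<alpha>v s)) \<le> C"
    by (rule asymptotic_flat) blast
  obtain C' where C': "\<And>t. t \<ge> 1 \<Longrightarrow> met_dist E ?x (hp t (\<gamma> 0)) ?h \<le> C' * t" by (rule hp_bounded[of "\<gamma> 0"]) blast
  have C0: "C \<ge> 0" using d[of T 0] met_dist_nonneg[of "hp T (\<gamma> 0)"] by (meson atLeastAtMost_iff order_refl order_trans zero_le_one)
  \<comment> \<open>As \<open>\<alpha>v 0 = 0\<close>, the origin of the flat is within a constant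
    of the pulled back metric at \<open>\<gamma> 0\<close>, which is within a multiple of t of the
    base point.\<close>
  have bd: "eventually (\<lambda>t. met_dist E ?x (flat_chart E ?x (e t) 0) ?h / t \<le> ?r * (?r * C + C')) \<omega>"
    using large[of T]
  proof eventually_elim
    case (elim t)
    have t: "t \<ge> 1" "t \<ge> T" using elim T by auto
    have hf: "hform (F (flat_chart E ?x (e t) 0))" by (rule flat_chart_hform[OF e model_zero])
    have "met_dist E ?x (flat_chart E ?x (e t) 0) ?h \<le>
        ?r * (met_dist E ?x (flat_chart E ?x (e t) 0) (hp t (\<gamma> 0)) + met_dist E ?x (hp t (\<gamma> 0)) ?h)"
      by (rule met_dist_triangle[OF hf hp_hform]) (simp add: F_restrict h_hform)
    also have "\<dots> \<le> ?r * (?r * C + C' * t)"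
    proof (intro mult_left_mono add_mono C' t)
      have "met_dist E ?x (flat_chart E ?x (e t) 0) (hp t (\<gamma> 0)) \<le> ?r * met_dist E ?x (hp t (\<gamma> 0)) (flat_chart E ?x (e t) 0)"
        by (rule met_dist_sym_le[OF hp_hform hf])
      also have "\<dots> \<le> ?r * C" using d[OF t(2), of 0] by (intro mult_left_mono) (auto simp: \<alpha>v_0)
      finally show "met_dist E ?x (flat_chart E ?x (e t) 0) (hp t (\<gamma> 0)) \<le> ?r * C" .
    qed simp
    also have "\<dots> \<le> ?r * (?r * C * t + C' * t)"
      using mult_left_mono[OF t(1), of "?r * C"] C0 by (intro mult_left_mono add_right_mono) auto
    also have "\<dots> = ?r * (?r * C + C') * t" by (simp add: algebra_simps)
    finally show ?case using t(1) by (simp add: pos_divide_le_eq)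
  qed
  then have cf: "(\<lambda>t. flat_chart E ?x (e t) 0) \<in> cone_families E ?x h \<omega>"
    unfolding cone_families_def using flat_chart_Met[OF e model_zero] by blast
  define f where "f = (\<lambda>v. cone_class E ?x h \<omega> (\<lambda>t. flat_chart E ?x (e t) (t *\<^sub>R v)))"
  have "apartment_chart E ?x h \<omega> f" unfolding apartment_chart_def f_def using e cf by blast
  moreover have "h_lim E \<Phi> B p x0 h \<omega> (\<gamma> s) = f (\<alpha>v s)" if s: "s \<in> {0..1}" for s
    unfolding h_lim_def f_def
  proof (rule cone_class_eqI[OF hp_hform flat_chart_hform[OF e model_scale[OF \<alpha>v_model[OF s]]] _ large[of 0]])
    have "filterlim (\<lambda>t. t) at_top \<omega>"
      unfolding filterlim_at_top using eventually_mono[OF large] by (meson less_imp_le)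
    then have lim: "((\<lambda>t. C / t) \<longlongrightarrow> 0) \<omega>" by (intro tendsto_divide_0[OF tendsto_const] filterlim_at_top_imp_at_infinity)
    show "((\<lambda>t. met_dist E ?x (hp t (\<gamma> s)) (flat_chart E ?x (e t) (t *\<^sub>R \<alpha>v s)) / t) \<longlongrightarrow> 0) \<omega>"
    proof (rule tendsto_sandwich[OF _ _ tendsto_const lim])
      show "\<forall>\<^sub>F t in \<omega>. 0 \<le> met_dist E ?x (hp t (\<gamma> s)) (flat_chart E ?x (e t) (t *\<^sub>R \<alpha>v s)) / t"
        using large[of 0] by eventually_elim (simp add: met_dist_nonneg)
      show "\<forall>\<^sub>F t in \<omega>. met_dist E ?x (hp t (\<gamma> s)) (flat_chart E ?x (e t) (t *\<^sub>R \<alpha>v s)) / t \<le> C / t"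
        using large[of T] by eventually_elim (use d s T in \<open>auto intro!: divide_right_mono\<close>)
    qed
  qed
  ultimately show thesis using that by blast
qed

lemma \<alpha>v_sorted: "sort_desc (\<alpha>v 1) = \<alpha>v 1"
proof (rule sort_desc_eqI[OF _ bij_id])
  have i: "(\<lambda>s. Re (a i s)) integrable_on {0..1}" for i by (rule integrable_continuous_real[OF Re_a_continuous])
  have "\<alpha>v 1 $ j \<le> \<alpha>v 1 $ i" if "i \<le> j" for i j
  proof (cases "i = j")
    case False
    then have "i < j" using that by simp
    then show ?thesis using order by (simp add: \<alpha>v_def) (intro integral_le i, auto intro: less_imp_le)
  qed simp
  then show "decreasing (\<alpha>v 1)" by (simp add: decreasing_def)
qed (simp add: vec_eq_iff)

end

theorem corollary1p9:
  fixes E :: "('x::t2_space, 'e, 'r::{finite,linorder}) vbundle"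
    and \<Phi> B :: "('x, 'e, 'r) local_form"
    and p :: "'u::t2_space \<Rightarrow> 'x"
    and x0 :: 'u
    and h :: "'e \<Rightarrow> 'e \<Rightarrow> complex"
    and \<omega> :: "real filter"
    and \<gamma> :: "real \<Rightarrow> 'u"
    and a :: "'r \<Rightarrow> real \<Rightarrow> complex"
  assumes "holomorphic_bundle E" and "det_trivialized E"
    and "higgs_field E \<Phi>" and "trace_zero E \<Phi>" and "reduced_spectral_curve E \<Phi>"
    and "holo_connection E B" and "trivial_det_connection E B"
    and "universal_cover p"
    and "hermitian_metric E h" and "\<forall>x. standard_det_on E x h"
    and "cone_ultrafilter \<omega>"
    and "C1_path (charts E) p \<gamma>" and "\<gamma> ` {0..1} \<subseteq> cover_star E \<Phi> p"
    and "pullback_eigenforms E \<Phi> p \<gamma> a"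
    and "noncritical a"
    and "\<forall>s\<in>{0..1}. \<forall>i j. i < j \<longrightarrow> Re (a i s) > Re (a j s)"
  shows "(\<exists>F\<in>apartments E (p x0) h \<omega>. \<forall>s\<in>{0..1}. h_lim E \<Phi> B p x0 h \<omega> (\<gamma> s) \<in> F) \<and>
         cone_vdist E (p x0) h \<omega> (h_lim E \<Phi> B p x0 h \<omega> (\<gamma> 0)) (h_lim E \<Phi> B p x0 h \<omega> (\<gamma> 1))
           = (\<chi> i. integral {0..1} (\<lambda>s. Re (a i s)))"
proof -
  interpret covered_bundle E p by unfold_locales (rule assms)+
  \<comment> \<open>An auxiliary trivialization at the base point, in which metrics become Hermitian
    forms on coordinate vectors.\<close>
  obtain \<tau>0 where \<tau>0: "\<tau>0 \<in> trivs E" "p x0 \<in> fst \<tau>0" by (rule triv_at)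
  interpret wkb_cone E p \<Phi> B h \<gamma> a x0 \<tau>0
    by unfold_locales (use assms \<tau>0 in auto)
  obtain f where f: "apartment_chart E (p x0) h \<omega> f" and fs: "\<And>s. s \<in> {0..1} \<Longrightarrow> h_lim E \<Phi> B p x0 h \<omega> (\<gamma> s) = f (\<alpha>v s)"
    by (rule cone_limit[OF \<open>cone_ultrafilter \<omega>\<close>]) blast
  have \<omega>: "eventually (\<lambda>t. t > 0) \<omega>" "\<omega> \<noteq> bot" using \<open>cone_ultrafilter \<omega>\<close> by (simp_all add: cone_ultrafilter_def)
  have "f ` model_apartment \<in> apartments E (p x0) h \<omega>" unfolding apartments_def using f by blast
  moreover have "h_lim E \<Phi> B p x0 h \<omega> (\<gamma> s) \<in> f ` model_apartment" if "s \<in> {0..1}" for s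
    unfolding fs[OF that] by (intro imageI \<alpha>v_model that)
  \<comment> \<open>The path starts at coordinate zero, and by the numbering of the eigenforms the
    coordinates of its endpoint are already in decreasing order.\<close>
  moreover have "cone_vdist E (p x0) h \<omega> (h_lim E \<Phi> B p x0 h \<omega> (\<gamma> 0)) (h_lim E \<Phi> B p x0 h \<omega> (\<gamma> 1)) = \<alpha>v 1"
    using cone_vdist_eq[OF h_hform \<omega> f \<alpha>v_model[of 0] \<alpha>v_model[of 1]] by (simp add: fs \<alpha>v_0 \<alpha>v_sorted)
  ultimately show ?thesis unfolding \<alpha>v_def by blast
qed

end
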